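(* Let $\mathcal{S}$ be a straight-line program (SLP) of size $n$ representing a string $S$ of length $N$. One can solve the longest common extension problem on $S$ using $O(n)$ space and $O(\log N + \log^2 \ell)$ query time, where $\ell$ is the length of the longest common extension returned by the query.
   Context: A straight-line program (SLP) is a context-free grammar in which every rule has exactly one variable on the left-hand side and on the right-hand side either exactly two variables or exactly one terminal symbol; it is acyclic and each variable derives exactly one string. Its size $n$ is the number of rules, and $S$ is the string derived by the start variable. The longest common extension problem asks to support queries $\mathsf{lce}(i,j)$: given positions $i,j$ of $S$, return the length of the longest common prefix of the suffixes $S[i,N]$ and $S[j,N]$. Space is measured in machine words (word-RAM model). *)

theory Defs
  imports Complex_Main "HOL-Library.Sublist"
begin

section \<open>Straight-line programs\<close>

text \<open>In the right-hand side of a rule, \<open>Inl\<close> marks variables and \<open>Inr\<close> marks terminals.\<close>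

record ('v, 'a) cfg =
  rules :: "('v \<times> ('v + 'a) list) set"
  start :: 'v

inductive derive_step :: "('v, 'a) cfg \<Rightarrow> ('v + 'a) list \<Rightarrow> ('v + 'a) list \<Rightarrow> bool"
  for G where
  "(X, rhs) \<in> rules G \<Longrightarrow> derive_step G (us @ [Inl X] @ vs) (us @ rhs @ vs)"

definition derives :: "('v, 'a) cfg \<Rightarrow> 'v \<Rightarrow> 'a list \<Rightarrow> bool" where
  "derives G X s \<longleftrightarrow> (derive_step G)\<^sup>*\<^sup>* [Inl X] (map Inr s)"

definition variables :: "('v, 'a) cfg \<Rightarrow> 'v set" where
  "variables G = {start G} \<union> fst ` rules G \<union> {Y. \<exists>(X, rhs) \<in> rules G. Inl Y \<in> set rhs}"

definition uses :: "('v, 'a) cfg \<Rightarrow> ('v \<times> 'v) set" where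
  "uses G = {(X, Y). \<exists>rhs. (X, rhs) \<in> rules G \<and> Inl Y \<in> set rhs}"

definition is_slp :: "('v, 'a) cfg \<Rightarrow> bool" where
  "is_slp G \<longleftrightarrow>
     finite (rules G) \<and>
     (\<forall>(X, rhs) \<in> rules G. (\<exists>Y Z. rhs = [Inl Y, Inl Z]) \<or> (\<exists>a. rhs = [Inr a])) \<and>
     acyclic (uses G) \<and>
     (\<forall>X \<in> variables G. \<exists>!s. derives G X s)"

definition slp_size :: "('v, 'a) cfg \<Rightarrow> nat" where
  "slp_size G = card (rules G)"

definition slp_represents :: "('v, 'a) cfg \<Rightarrow> 'a list \<Rightarrow> bool" where
  "slp_represents G S \<longleftrightarrow> is_slp G \<and> derives G (start G) S"


section \<open>Longest common extensions\<close>

text \<open>Positions are counted from 1, so that \<open>drop (i - 1) S\<close> is the suffix \<open>S[i, N]\<close>.\<close>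

definition lce :: "'a list \<Rightarrow> nat \<Rightarrow> nat \<Rightarrow> nat" where
  "lce S i j = length (longest_common_prefix (drop (i - 1) S) (drop (j - 1) S))"


section \<open>The word RAM\<close>

text \<open>
  A unit-cost RAM with words of \<open>w\<close> bits, represented by the natural numbers below \<open>2 ^ w\<close>.
  The word length is a parameter of the semantics and not a type, since one program has to work
  for all word lengths. Programs are while-programs over registers; as a program mentions only
  finitely many registers, the registers account for a constant number of words. The memory is a
  list of words, and its length is the space that is used. An access outside of this list is an
  error: \<open>exec\<close> relates such a run to no final state.
\<close>

type_synonym reg = nat

datatype binop = Add | Sub | Mult | Div | Mod | And | Or | Xor | ShiftL | ShiftR

datatype cmp = Less reg reg | LessEq reg reg | Equal reg reg | NotEqual reg reg

datatype prog =
    Skip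
  | Const reg nat
  | Op binop reg reg reg
  | Load reg reg
  | Store reg reg
  | Seq prog prog
  | Cond cmp prog prog
  | While cmp prog

type_synonym state = "(reg \<Rightarrow> nat) \<times> nat list"

fun binop_val :: "nat \<Rightarrow> binop \<Rightarrow> nat \<Rightarrow> nat \<Rightarrow> nat" where
  "binop_val w Add x y = (x + y) mod 2 ^ w"
| "binop_val w Sub x y = (x + (2 ^ w - y)) mod 2 ^ w"
| "binop_val w Mult x y = (x * y) mod 2 ^ w"
| "binop_val w Div x y = x div y"
| "binop_val w Mod x y = x mod y"
| "binop_val w And x y = and x y"
| "binop_val w Or x y = or x y"
| "binop_val w Xor x y = xor x y"
| "binop_val w ShiftL x y = push_bit y x mod 2 ^ w"
| "binop_val w ShiftR x y = drop_bit y x"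

fun cmp_val :: "cmp \<Rightarrow> (reg \<Rightarrow> nat) \<Rightarrow> bool" where
  "cmp_val (Less a b) r \<longleftrightarrow> r a < r b"
| "cmp_val (LessEq a b) r \<longleftrightarrow> r a \<le> r b"
| "cmp_val (Equal a b) r \<longleftrightarrow> r a = r b"
| "cmp_val (NotEqual a b) r \<longleftrightarrow> r a \<noteq> r b"

text \<open>\<open>exec w p s t s'\<close>: on words of \<open>w\<close> bits, \<open>p\<close> started in \<open>s\<close> terminates in \<open>s'\<close>
  after exactly \<open>t\<close> instructions, where each evaluation of a test counts as an instruction.\<close>

inductive exec :: "nat \<Rightarrow> prog \<Rightarrow> state \<Rightarrow> nat \<Rightarrow> state \<Rightarrow> bool" for w where
  Skip: "exec w Skip s 0 s"
| Const: "exec w (Const a k) (r, m) 1 (r(a := k mod 2 ^ w), m)"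
| Op: "exec w (Op f a b c) (r, m) 1 (r(a := binop_val w f (r b) (r c)), m)"
| Load: "r b < length m \<Longrightarrow> exec w (Load a b) (r, m) 1 (r(a := m ! r b), m)"
| Store: "r a < length m \<Longrightarrow> exec w (Store a b) (r, m) 1 (r, m[r a := r b])"
| Seq: "exec w p s t s' \<Longrightarrow> exec w q s' t' s'' \<Longrightarrow> exec w (Seq p q) s (t + t') s''"
| CondTrue: "cmp_val c (fst s) \<Longrightarrow> exec w p s t s' \<Longrightarrow> exec w (Cond c p q) s (Suc t) s'"
| CondFalse: "\<not> cmp_val c (fst s) \<Longrightarrow> exec w q s t s' \<Longrightarrow> exec w (Cond c p q) s (Suc t) s'"
| WhileFalse: "\<not> cmp_val c (fst s) \<Longrightarrow> exec w (While c p) s 1 s"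
| WhileTrue: "cmp_val c (fst s) \<Longrightarrow> exec w p s t s' \<Longrightarrow> exec w (While c p) s' t' s'' \<Longrightarrow>
    exec w (While c p) s (Suc (t + t')) s''"

inductive_cases exec_elims:
  "exec w Skip s t s'"
  "exec w (Const a k) s t s'"
  "exec w (Op f a b c) s t s'"
  "exec w (Load a b) s t s'"
  "exec w (Store a b) s t s'"
  "exec w (Seq p q) s t s'"
  "exec w (Cond c p q) s t s'"

inductive_cases exec_WhileE: "exec w (While c p) s t s'"

lemma exec_deterministic:
  "exec w p s t s' \<Longrightarrow> exec w p s u s'' \<Longrightarrow> u = t \<and> s'' = s'"
proof (induction arbitrary: u s'' rule: exec.induct)
  case (Seq p s t s' q t' s'')
  from Seq.prems show ?case
    by (rule exec_elims(6)) (use Seq.IH in blast)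
next
  case (CondTrue c s p t s' q)
  from CondTrue.prems show ?case
    by (rule exec_elims(7)) (use CondTrue.hyps CondTrue.IH in blast)+
next
  case (CondFalse c s q t s' p)
  from CondFalse.prems show ?case
    by (rule exec_elims(7)) (use CondFalse.hyps CondFalse.IH in blast)+
next
  case (WhileFalse c s p)
  from WhileFalse.prems show ?case
    by (rule exec_WhileE) (use WhileFalse.hyps in auto)
next
  case (WhileTrue c s p t s' t' s'')
  from WhileTrue.prems show ?case
    by (rule exec_WhileE) (use WhileTrue.hyps WhileTrue.IH in blast)+
qed (erule exec_elims; simp)+


section \<open>Data structures for longest common extension queries\<close>

text \<open>
  A query finds the positions in registers 0 and 1 and leaves its answer in register 0. It may
  write to memory; \<open>D\<close> collects the memory contents that can be met between two queries, so an
  arbitrarily long sequence of queries is answered. The working space of a query is part of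
  \<open>space\<close>. The time bound depends on the answer.
\<close>

definition query_regs :: "nat \<Rightarrow> nat \<Rightarrow> reg \<Rightarrow> nat" where
  "query_regs i j = (\<lambda>_. 0)(0 := i, 1 := j)"

definition solves_lce ::
  "nat \<Rightarrow> prog \<Rightarrow> 'a list \<Rightarrow> real \<Rightarrow> (nat \<Rightarrow> real) \<Rightarrow> bool" where
  "solves_lce w p S space time \<longleftrightarrow>
     (\<exists>D. D \<noteq> {} \<and>
       (\<forall>m \<in> D. real (length m) \<le> space \<and> (\<forall>x \<in> set m. x < 2 ^ w)) \<and>
       (\<forall>m \<in> D. \<forall>i \<in> {1..length S}. \<forall>j \<in> {1..length S}.
          \<exists>t r m'. exec w p (query_regs i j, m) t (r, m') \<and>
            r 0 = lce S i j \<and> m' \<in> D \<and> real t \<le> time (lce S i j)))"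

end

theory Submission
  imports Defs "HOL-Computational_Algebra.Computational_Algebra"
begin

text \<open>
  The SLP is first balanced locally: there is a family \<open>F\<close> of \<open>O(n)\<close> strings, closed under taking
  the two halves of a fixed factorization, in which every string \<open>s\<close> has a derivation tree of height
  \<open>O(log (length s))\<close>. To get it, decompose the SLP along heavy paths. The light siblings on either side of a
  heavy path form a word of a trie (words are stored with the heavy end at the root), and it suffices to build
  the words of a trie with weighted letters. A word is split where its prefix weight passes a multiple
  of a large power of two; nodes whose depth lies in a sparse residue class modulo \<open>2 ^ k\<close>
  store the pieces belonging to level \<open>k\<close>, which costs \<open>O(k / 2 ^ k)\<close> per node of the trie.

  Every string of \<open>F\<close> carries its Karp-Rabin hash modulo a prime \<open>P\<close> of \<open>O(log N)\<close> bits for which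
  no two distinct substrings of equal length of \<open>S\<close> collide.

  A query runs in phases with a guess \<open>D\<close> for the answer. A phase collects \<open>O(log N)\<close> strings of \<open>F\<close>
  of length at most \<open>D\<close> whose concatenation is the window of length \<open>D\<close> at each of the two positions,
  together with the hashes of all prefixes of the concatenation. After that, two prefixes of the
  windows are compared in time \<open>O(log D)\<close>, by a binary search for the item and a descent of
  its tree. If the windows agree, \<open>D\<close> is squared, and otherwise a binary search for the answer takes
  \<open>O((log D)\<^sup>2)\<close>. The first guess has \<open>(log D)\<^sup>2\<close> of order \<open>log N\<close>, which pays
  for the collecting, and the costs \<open>(log D)\<^sup>2\<close> of the later phases form a geometric series.
\<close>

section \<open>Words of a trie\<close>

text \<open>Splitting words by weight alone gives height logarithmic in \<open>N\<close>. The
  obstacle is to get locality and linear size together: a short suffix may lie in a huge cell, and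
  keeping every cell at every node costs a logarithmic factor. A piece missing at a node is taken
  from a nearby prefix in the sparse class, and the fewer than \<open>2 ^ k\<close> letters in
  between are covered by a hop, a path as in a skip list with O(k) extra words. Short pieces of huge
  cells stay cheap: until the first split each step only doubles the spacing, and soon one hop
  covers the piece; the first split confines it to small cells. Linear space also needs log N =
  O(n), for the stack and the item lists. Since the word length is bounded below only in terms of
  \<open>N\<close>, the family must have size O(N) as well, so that addresses fit into words. The
  prime comes from comparing two bounds for lcm(1..y^2). It has a constant number of digits, so a
  modular product takes constant time. Residues are kept as positive numbers: reducing a positive
  number below 3P ends in {1..P}, a canonical form reached without any comparison.\<close>

definition bl :: "nat \<Rightarrow> nat" where "bl n = (LEAST b. n < 2 ^ b)"

lemma bl_bound: "n < 2 ^ bl n"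
  unfolding bl_def by (rule LeastI[of _ n]) simp

lemma bl_le_iff: "bl n \<le> b \<longleftrightarrow> n < 2 ^ b"
proof
  assume "bl n \<le> b"
  then have "(2::nat) ^ bl n \<le> 2 ^ b" by simp
  then show "n < 2 ^ b" using bl_bound[of n] by linarith
qed (simp add: bl_def Least_le)

lemma bl_less_iff: "b < bl n \<longleftrightarrow> 2 ^ b \<le> n"
  using bl_le_iff[of n b] by linarith

lemma bl_mono: "m \<le> n \<Longrightarrow> bl m \<le> bl n"
  using bl_bound[of n] by (simp add: bl_le_iff)

lemma bl_pos: "0 < n \<Longrightarrow> 0 < bl n"
  by (simp add: bl_less_iff)

lemma bl_0 [simp]: "bl 0 = 0"
  using bl_le_iff[of 0 0] by simp

definition lastn :: "nat \<Rightarrow> 'b list \<Rightarrow> 'b list" where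
  "lastn L z = drop (length z - L) z"

lemma length_lastn [simp]: "length (lastn L z) = min L (length z)"
  by (simp add: lastn_def)

lemma lastn_all: "length z \<le> L \<Longrightarrow> lastn L z = z"
  by (simp add: lastn_def)

lemma lastn_drop: "s \<le> length z \<Longrightarrow> drop s z = lastn (length z - s) z"
  by (simp add: lastn_def)

lemma set_lastn: "set (lastn L z) \<subseteq> set z"
  by (simp add: lastn_def set_drop_subset)

lemma lastn_split:
  assumes "M \<le> L" "L \<le> length z"
  shows "lastn L z = lastn (L - M) (take (length z - M) z) @ lastn M z"
proof -
  have "lastn L z = drop (length z - L) (take (length z - M) z @ drop (length z - M) z)"
    by (simp add: lastn_def)
  also have "\<dots> = drop (length z - L) (take (length z - M) z) @ lastn M z"
    using assms unfolding drop_append by (simp add: lastn_def)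
  finally show ?thesis using assms by (simp add: lastn_def)
qed

section \<open>Derivation trees inside a set of words\<close>

text \<open>\<open>bt F g u h\<close>: the word \<open>u\<close> has a binary derivation tree with all nodes in \<open>F\<close> and height at most \<open>h\<close>,
  where a leaf \<open>x\<close> counts with height \<open>g x\<close>.\<close>

inductive bt :: "'b list set \<Rightarrow> ('b \<Rightarrow> nat) \<Rightarrow> 'b list \<Rightarrow> nat \<Rightarrow> bool" for F g where
  leaf: "[x] \<in> F \<Longrightarrow> g x \<le> h \<Longrightarrow> bt F g [x] h"
| node: "bt F g u h \<Longrightarrow> bt F g v h \<Longrightarrow> u @ v \<in> F \<Longrightarrow> Suc h \<le> h' \<Longrightarrow> bt F g (u @ v) h'"

lemma bt_mono: "bt F g u h \<Longrightarrow> h \<le> h' \<Longrightarrow> bt F g u h'"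
  by (erule bt.cases) (auto intro: bt.intros)

lemma bt_mono': "bt F g u h \<Longrightarrow> u = u' \<Longrightarrow> h \<le> h' \<Longrightarrow> bt F g u' h'"
  using bt_mono by blast

lemma bt_subset: "bt F g u h \<Longrightarrow> F \<subseteq> F' \<Longrightarrow> bt F' g u h"
  by (induction rule: bt.induct) (auto intro: bt.intros)

lemma bt_nonempty: "bt F g u h \<Longrightarrow> u \<noteq> []"
  by (induction rule: bt.induct) auto

lemma bt_in: "bt F g u h \<Longrightarrow> u \<in> F"
  by (induction rule: bt.induct) auto

lemma bt_append:
  assumes "u \<noteq> [] \<Longrightarrow> bt F g u h" "v \<noteq> [] \<Longrightarrow> bt F g v h" "u @ v \<in> F" "u @ v \<noteq> []"
  shows "bt F g (u @ v) (Suc h)"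
proof (cases "u = [] \<or> v = []")
  case True
  then show ?thesis using assms by (auto intro: bt_mono)
next
  case False
  then show ?thesis using assms by (auto intro: bt.node)
qed

text \<open>The slope \<open>c\<close> counts tree levels per doubling of the length: 1 for blocks,
  2 for words that first climb the levels and then descend; \<open>c - 1\<close> is the node on top
  of the climb. Quantifying over all letter heights \<open>g\<close> keeps the notion independent of
  the trees that later replace the letters.\<close>

definition hop_bound :: "nat \<Rightarrow> 'b list set \<Rightarrow> 'b list \<Rightarrow> bool" where
  "hop_bound c F u \<longleftrightarrow>
     (\<forall>g h j. (\<forall>x \<in> set u. g x \<le> h) \<longrightarrow> length u \<le> 2 ^ j \<longrightarrow> bt F g u (h + c * j + (c - 1)))"

lemma hop_boundD:
  "hop_bound c F u \<Longrightarrow> (\<And>x. x \<in> set u \<Longrightarrow> g x \<le> h) \<Longrightarrow> length u \<le> 2 ^ j \<Longrightarrow>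
    bt F g u (h + c * j + (c - 1))"
  unfolding hop_bound_def by blast

lemma hop_bound_subset: "hop_bound c F u \<Longrightarrow> F \<subseteq> F' \<Longrightarrow> hop_bound c F' u"
  unfolding hop_bound_def by (blast intro: bt_subset)

lemma hop_bound_12:
  assumes "hop_bound 1 F u" shows "hop_bound 2 F u"
  unfolding hop_bound_def
proof (intro allI impI)
  fix g :: "'a \<Rightarrow> nat" and h j
  assume "\<forall>x\<in>set u. g x \<le> h" "length u \<le> 2 ^ j"
  then have "bt F g u (h + 1 * j + (1 - 1))" using assms by (intro hop_boundD) auto
  then show "bt F g u (h + 2 * j + (2 - 1))" by (rule bt_mono) simp
qed

section \<open>Sparse residue classes of trie nodes\<close>

text \<open>A trie node is identified with the word that leads to it, so prefixes are ancestors.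
  Positive weights make prefix weights strictly increasing and bound lengths by weights.\<close>

locale trie =
  fixes P :: "'b list set" and wt :: "'b \<Rightarrow> nat"
  assumes finite_P: "finite P" and Nil_P: "[] \<in> P"
    and prefix_P: "v @ [x] \<in> P \<Longrightarrow> v \<in> P"
    and wt_pos: "0 < wt x"
begin

lemma take_P: "v \<in> P \<Longrightarrow> take i v \<in> P"
proof (induction v rule: rev_induct)
  case (snoc x v)
  then show ?case using prefix_P[OF snoc.prems] by (cases "i \<le> length v") auto
qed simp

text \<open>The residues are chosen greedily, the rarer extension to the next bit each time, so that
  \<open>A k\<close> below has at most \<open>card P / 2 ^ k\<close> elements.\<close>

primrec res :: "nat \<Rightarrow> nat" where
  "res 0 = 0"
| "res (Suc k) =
    (if 2 * card {v \<in> P. length v mod 2 ^ Suc k = res k} \<le> card {v \<in> P. length v mod 2 ^ k = res k}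
     then res k else res k + 2 ^ k)"

definition A :: "nat \<Rightarrow> 'b list set" where "A k = {v \<in> P. length v mod 2 ^ k = res k}"

lemma A_0 [simp]: "A 0 = P"
  by (simp add: A_def)

lemma res_less: "res k < 2 ^ k"
  by (induction k) auto

lemma eq_halves:
  "x < m \<Longrightarrow> r < m \<Longrightarrow> y = x \<or> y = x + m \<Longrightarrow> x = r \<longleftrightarrow> (y = r \<or> y = r + m)" for x y r m :: nat
  by auto

lemma mod_halves: "n mod 2 ^ k = r \<longleftrightarrow> (n mod 2 ^ Suc k = r \<or> n mod 2 ^ Suc k = r + 2 ^ k)"
  if "r < 2 ^ k" for n r :: nat
proof -
  have *: "(2::nat) ^ Suc k = 2 ^ k * 2" by simp
  have "n mod 2 ^ Suc k = 2 ^ k * (n div 2 ^ k mod 2) + n mod 2 ^ k"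
    unfolding * by (rule mod_mult2_eq)
  moreover have "n div 2 ^ k mod 2 = 0 \<or> n div 2 ^ k mod 2 = 1" by linarith
  ultimately have "n mod 2 ^ Suc k = n mod 2 ^ k \<or> n mod 2 ^ Suc k = n mod 2 ^ k + 2 ^ k"
    by (elim disjE) (simp_all only: mult_0_right mult_1_right add_0 add.commute, blast+)
  then show ?thesis using that by (intro eq_halves) auto
qed

lemma A_Suc_subset: "A (Suc k) \<subseteq> A k"
proof
  fix v assume "v \<in> A (Suc k)"
  moreover have "res (Suc k) = res k \<or> res (Suc k) = res k + 2 ^ k" by simp
  ultimately show "v \<in> A k"
    using mod_halves[OF res_less, of "length v" k] unfolding A_def by auto
qed

lemma A_antimono: "i \<le> j \<Longrightarrow> A j \<subseteq> A i"
  using A_Suc_subset by (rule lift_Suc_antimono_le)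

lemma A_subset_P: "A k \<subseteq> P"
  by (auto simp: A_def)

lemma finite_A: "finite (A k)"
  using finite_P by (simp add: A_def)

lemma card_A_Suc: "2 * card (A (Suc k)) \<le> card (A k)"
proof -
  let ?X = "{v \<in> P. length v mod 2 ^ Suc k = res k}"
  let ?Y = "{v \<in> P. length v mod 2 ^ Suc k = res k + 2 ^ k}"
  have "A k = ?X \<union> ?Y"
    unfolding A_def using mod_halves[OF res_less] by blast
  moreover have "?X \<inter> ?Y = {}" by auto
  ultimately have c: "card (A k) = card ?X + card ?Y"
    using finite_P by (simp add: card_Un_disjoint)
  show ?thesis
  proof (cases "2 * card ?X \<le> card (A k)")
    case True
    then have "A (Suc k) = ?X" by (simp add: A_def)
    with True show ?thesis by simp
  next
    case False
    then have "A (Suc k) = ?Y" by (simp add: A_def)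
    with False c show ?thesis by simp
  qed
qed

lemma card_A: "card (A k) * 2 ^ k \<le> card P"
proof (induction k)
  case (Suc k)
  have "card (A (Suc k)) * 2 ^ Suc k = (2 * card (A (Suc k))) * 2 ^ k" by simp
  also have "\<dots> \<le> card (A k) * 2 ^ k" using card_A_Suc by (intro mult_right_mono) auto
  finally show ?case using Suc by linarith
qed simp

text \<open>Turns the union over all levels in \<open>F\<close> into a finite one.\<close>

lemma A_empty: "card P \<le> k \<Longrightarrow> A k = {}"
proof (rule ccontr)
  assume *: "card P \<le> k" "A k \<noteq> {}"
  then have "1 \<le> card (A k)" using finite_A by (simp add: Suc_leI card_gt_0_iff)
  then have "1 * 2 ^ k \<le> card P" using card_A[of k] by (meson le_trans mult_le_mono1)
  moreover have "k < 2 ^ k" by simp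
  ultimately show False using * by linarith
qed

text \<open>Among \<open>2 ^ k\<close> consecutive prefix lengths every residue modulo
  \<open>2 ^ k\<close> occurs.\<close>

lemma A_near:
  assumes "z \<in> P" "2 ^ k \<le> length z"
  shows "\<exists>L < 2 ^ k. take (length z - L) z \<in> A k"
proof -
  let ?n = "length z" and ?m = "2 ^ k :: nat"
  define L where "L = (?n + (?m - res k)) mod ?m"
  have L: "L < ?m" by (simp add: L_def)
  have "(?n - L) mod ?m = res k"
  proof -
    have "(?n + (?m - res k)) mod ?m = L mod ?m" by (simp add: L_def)
    then have "int (?n + (?m - res k)) mod int ?m = int L mod int ?m" by (metis zmod_int)
    then have "(int ?n + (int ?m - int (res k))) mod int ?m = int L mod int ?m"
      using res_less[of k] by (simp add: of_nat_diff add_diff_eq)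
    then have "int ?m dvd (int ?n + (int ?m - int (res k))) - int L" by (simp add: mod_eq_dvd_iff)
    then have "int ?m dvd (int ?n - int L) - int (res k) + int ?m" by (simp add: algebra_simps)
    then have "int ?m dvd (int ?n - int L) - int (res k)" by (simp only: dvd_add_triv_right_iff)
    then have "(int ?n - int L) mod int ?m = int (res k) mod int ?m" by (simp add: mod_eq_dvd_iff)
    then have "int ((?n - L) mod ?m) = int (res k mod ?m)"
      using L assms(2) by (simp add: zmod_int of_nat_diff)
    then show ?thesis using res_less[of k] by simp
  qed
  then show ?thesis using L assms(1) take_P by (intro exI[of _ L]) (auto simp: A_def)
qed

lemma A_step: "z \<in> A k \<Longrightarrow> 2 ^ k \<le> length z \<Longrightarrow> take (length z - 2 ^ k) z \<in> A k"
  by (auto simp: A_def take_P le_mod_geq)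

text \<open>Going up by \<open>2 ^ k\<close> changes the length by half of the modulus
  \<open>2 ^ Suc k\<close>, which exchanges the two residues extending \<open>res k\<close>.\<close>

lemma A_step_Suc:
  assumes z: "z \<in> A k" "z \<notin> A (Suc k)" "2 ^ k \<le> length z"
  shows "take (length z - 2 ^ k) z \<in> A (Suc k)"
proof -
  let ?m = "2 ^ k :: nat" and ?n = "length z"
  have z1: "z \<in> P" "?n mod ?m = res k" using z by (auto simp: A_def)
  have "(?n - ?m) mod ?m = res k" using z1 z(3) by (simp add: le_mod_geq)
  then have d: "(?n - ?m) mod 2 ^ Suc k = res k \<or> (?n - ?m) mod 2 ^ Suc k = res k + ?m"
    using mod_halves[OF res_less] by blast
  have d2: "?n mod 2 ^ Suc k = res k \<or> ?n mod 2 ^ Suc k = res k + ?m"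
    using mod_halves[OF res_less] z1 by blast
  have ne: "?n mod 2 ^ Suc k \<noteq> (?n - ?m) mod 2 ^ Suc k"
  proof
    assume "?n mod 2 ^ Suc k = (?n - ?m) mod 2 ^ Suc k"
    then have "2 ^ Suc k dvd ?n - (?n - ?m)" by (metis diff_le_self mod_eq_dvd_iff_nat)
    then have "2 ^ Suc k dvd ?m" using z(3) by simp
    then have "(2::nat) ^ Suc k \<le> 2 ^ k" by (rule dvd_imp_le) simp
    then show False by simp
  qed
  have r: "res (Suc k) = res k \<or> res (Suc k) = res k + ?m" by simp
  have "?n mod 2 ^ Suc k \<noteq> res (Suc k)" using z(2) z1 by (simp add: A_def)
  then have "(?n - ?m) mod 2 ^ Suc k = res (Suc k)" using d d2 ne r by metis
  then show ?thesis using z1 take_P by (simp add: A_def)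
qed

section \<open>Blocks and hops between levels\<close>

text \<open>Near the root \<open>lastn\<close> truncates, so a block of level \<open>i\<close> may
  be shorter than \<open>2 ^ i\<close>.\<close>

definition Blk :: "'b list set" where "Blk = {lastn (2 ^ i) z | i z. z \<in> A i \<and> z \<noteq> []}"

lemma BlkI: "z \<in> A i \<Longrightarrow> z \<noteq> [] \<Longrightarrow> lastn (2 ^ i) z \<in> Blk"
  by (auto simp: Blk_def)

text \<open>The block of level \<open>i + 1\<close> at \<open>z\<close> is the block of level
  \<open>i\<close> at the ancestor \<open>2 ^ i\<close> letters up, followed by that at
  \<open>z\<close>; both nodes lie in \<open>A i\<close>. The parameter \<open>j\<close> measures
  the actual length, so truncated blocks get no height for missing letters.\<close>

lemma bt_block:
  assumes "z \<in> A i" "z \<noteq> []" "\<And>x. x \<in> set z \<Longrightarrow> g x \<le> h" "min (2 ^ i) (length z) \<le> 2 ^ j"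
  shows "bt Blk g (lastn (2 ^ i) z) (h + j)"
  using assms
proof (induction i arbitrary: z j)
  case 0
  then obtain y x where z: "z = y @ [x]" by (metis rev_exhaust)
  have "lastn (2 ^ 0) z = [x]" by (simp add: z lastn_def)
  moreover have "lastn (2 ^ 0) z \<in> Blk" using 0(1,2) unfolding Blk_def by blast
  moreover have "g x \<le> h + j" using 0(3)[of x] by (simp add: z)
  ultimately show ?case using bt.leaf[of x Blk g] by simp
next
  case (Suc i)
  have zi: "z \<in> A i" using Suc.prems A_Suc_subset by blast
  have inB: "lastn (2 ^ Suc i) z \<in> Blk" using Suc.prems unfolding Blk_def by blast
  show ?case
  proof (cases "length z \<le> 2 ^ i")
    case True
    then have "lastn (2 ^ Suc i) z = lastn (2 ^ i) z" by (simp add: lastn_all)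
    moreover have "bt Blk g (lastn (2 ^ i) z) (h + j)"
      using Suc.prems True zi by (intro Suc.IH) auto
    ultimately show ?thesis by simp
  next
    case False
    have ij: "Suc i \<le> j"
    proof (rule ccontr)
      assume "\<not> Suc i \<le> j"
      then have "(2::nat) ^ j \<le> 2 ^ i" by simp
      moreover have "2 ^ i < min (2 ^ Suc i) (length z)" using False by simp
      ultimately show False using Suc.prems(4) by linarith
    qed
    define y where "y = take (length z - 2 ^ i) z"
    have y: "y \<in> A i" "y \<noteq> []" using A_step[OF zi] False by (auto simp: y_def)
    have b1: "bt Blk g (lastn (2 ^ i) y) (h + i)"
      using y Suc.prems(3) by (intro Suc.IH) (auto simp: y_def dest: in_set_takeD)
    have b2: "bt Blk g (lastn (2 ^ i) z) (h + i)"
      using zi Suc.prems by (intro Suc.IH) auto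
    have e: "lastn (2 ^ Suc i) z = lastn (2 ^ i) y @ lastn (2 ^ i) z"
    proof (cases "2 ^ Suc i \<le> length z")
      case True
      then show ?thesis using lastn_split[of "2 ^ i" "2 ^ Suc i" z] by (simp add: y_def mult_2)
    next
      case F: False
      have "lastn (2 ^ Suc i) z = z" "lastn (2 ^ i) y = y" using F by (auto simp: lastn_all y_def)
      then show ?thesis by (simp add: y_def lastn_def)
    qed
    show ?thesis
      using bt.node[OF b1 b2, of "h + j"] e inB ij by simp
  qed
qed

lemma hop_bound_block: "u \<in> Blk \<Longrightarrow> hop_bound 1 Blk u"
  unfolding hop_bound_def
proof (intro allI impI)
  fix g :: "'b \<Rightarrow> nat" and h j
  assume u: "u \<in> Blk" "\<forall>x\<in>set u. g x \<le> h" "length u \<le> 2 ^ j"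
  then obtain i z where z: "z \<in> A i" "z \<noteq> []" "u = lastn (2 ^ i) z" unfolding Blk_def by blast
  \<comment> \<open>\<open>bt_block\<close> needs a bound on all letters of \<open>z\<close>,
    whereas only those of the suffix \<open>u\<close> are bounded; the others are given height
    0.\<close>
  define g' where "g' = (\<lambda>x. if x \<in> set u then g x else 0)"
  have "bt Blk g' (lastn (2 ^ i) z) (h + j)"
    by (rule bt_block[OF z(1,2)]) (use z u in \<open>auto simp: g'_def\<close>)
  then have "bt Blk g' u (h + j)" by (simp add: z)
  moreover have "bt Blk g' v k \<Longrightarrow> set v \<subseteq> set u \<Longrightarrow> bt Blk g v k" for v k
    by (induction rule: bt.induct) (auto intro: bt.intros simp: g'_def)
  ultimately show "bt Blk g u (h + 1 * j + (1 - 1))" by simp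
qed

text \<open>Binary expansion of \<open>L\<close>: if \<open>L\<close> exceeds half of the level's
  length, one block is split off and the rest continues at the ancestor, which is again in the
  class. Each level contributes at most one new word.\<close>

lemma hop_aligned:
  assumes "z \<in> A i" "0 < L" "L \<le> 2 ^ i" "L \<le> length z"
  shows "\<exists>E. finite E \<and> card E \<le> i \<and> lastn L z \<in> Blk \<union> E \<and> (\<forall>u \<in> E. hop_bound 1 (Blk \<union> E) u)"
  using assms
proof (induction i arbitrary: z L)
  case 0
  then have "L = 2 ^ 0" "z \<noteq> []" by auto
  then have "lastn L z \<in> Blk" using 0(1) unfolding Blk_def by blast
  then show ?case by (intro exI[of _ "{}"]) auto
next
  case (Suc i)
  have zi: "z \<in> A i" using Suc.prems A_Suc_subset by blast
  show ?case
  proof (cases "L \<le> 2 ^ i")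
    case True
    from Suc.IH[OF zi Suc.prems(2) True Suc.prems(4)] show ?thesis by (meson le_SucI)
  next
    case False
    define y where "y = take (length z - 2 ^ i) z"
    have y: "y \<in> A i" using A_step[OF zi] False Suc.prems by (auto simp: y_def)
    obtain E where E: "finite E" "card E \<le> i" "lastn (L - 2 ^ i) y \<in> Blk \<union> E"
      "\<forall>u \<in> E. hop_bound 1 (Blk \<union> E) u"
    proof -
      have "0 < L - 2 ^ i" "L - 2 ^ i \<le> 2 ^ i" "L - 2 ^ i \<le> length y"
        using False Suc.prems by (auto simp: y_def)
      from Suc.IH[OF y this] show ?thesis using that by blast
    qed
    let ?E = "insert (lastn L z) E"
    have e: "lastn L z = lastn (L - 2 ^ i) y @ lastn (2 ^ i) z"
      unfolding y_def using False Suc.prems by (intro lastn_split) auto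
    have zB: "lastn (2 ^ i) z \<in> Blk" using zi False Suc.prems by (intro BlkI) auto
    have sub: "Blk \<union> E \<subseteq> Blk \<union> ?E" "Blk \<subseteq> Blk \<union> ?E" by auto
    have h1: "hop_bound 1 (Blk \<union> ?E) (lastn (L - 2 ^ i) y)"
      using E(3,4) hop_bound_subset[OF _ sub(1)] hop_bound_subset[OF hop_bound_block sub(2)] by blast
    have h2: "hop_bound 1 (Blk \<union> ?E) (lastn (2 ^ i) z)"
      using hop_bound_subset[OF hop_bound_block[OF zB] sub(2)] .
    have "hop_bound 1 (Blk \<union> ?E) (lastn L z)" unfolding hop_bound_def
    proof (intro allI impI)
      fix g :: "'b \<Rightarrow> nat" and h j
      assume u: "\<forall>x\<in>set (lastn L z). g x \<le> h" "length (lastn L z) \<le> 2 ^ j"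
      have ij: "Suc i \<le> j"
      proof (rule ccontr)
        assume "\<not> Suc i \<le> j"
        then have "(2::nat) ^ j \<le> 2 ^ i" by simp
        moreover have "L \<le> 2 ^ j" using Suc.prems u(2) by simp
        ultimately show False using False by linarith
      qed
      have "bt (Blk \<union> ?E) g (lastn (L - 2 ^ i) y) (h + 1 * i + (1 - 1))"
        using Suc.prems u e by (intro hop_boundD[OF h1]) auto
      moreover have "bt (Blk \<union> ?E) g (lastn (2 ^ i) z) (h + 1 * i + (1 - 1))"
        using u e by (intro hop_boundD[OF h2]) auto
      ultimately have "bt (Blk \<union> ?E) g (lastn (L - 2 ^ i) y @ lastn (2 ^ i) z) (h + j)"
        by (rule bt.node) (use e ij in auto)
      then show "bt (Blk \<union> ?E) g (lastn L z) (h + 1 * j + (1 - 1))" using e by simp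
    qed
    moreover have "card ?E \<le> Suc i" using E(1,2) by (simp add: card_insert_if)
    ultimately show ?thesis using E hop_bound_subset[OF _ sub(1)] by (intro exI[of _ ?E]) auto
  qed
qed

text \<open>The ascent in a skip list. If \<open>p\<close> is not in \<open>A (Suc i)\<close>, one
  block of length \<open>2 ^ i\<close> leads to an ancestor that is. One new word per level on the
  way up and one per level in the final \<open>hop_aligned\<close> make \<open>2 * k - i\<close>.
  The height bound with \<open>j - i\<close> is the form that survives the induction.\<close>

lemma hop_from_level:
  assumes "p \<in> A i" "0 < L" "L \<le> length p" "L \<le> 2 ^ k" "i \<le> k"
  shows "\<exists>E. finite E \<and> card E \<le> 2 * k - i \<and> lastn L p \<in> Blk \<union> E \<and>
    (\<forall>u \<in> E. hop_bound 2 (Blk \<union> E) u) \<and>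
    (\<forall>g h j. (\<forall>x \<in> set (lastn L p). g x \<le> h) \<longrightarrow> L \<le> 2 ^ j \<longrightarrow>
       bt (Blk \<union> E) g (lastn L p) (h + j + (j - i) + 1))"
  using assms
proof (induction "k - i" arbitrary: i p L)
  case 0
  then have ik: "i = k" by simp
  obtain E where E: "finite E" "card E \<le> i" "lastn L p \<in> Blk \<union> E" "\<forall>u \<in> E. hop_bound 1 (Blk \<union> E) u"
    using hop_aligned[OF 0(2)] 0 ik by blast
  have h: "hop_bound 1 (Blk \<union> E) (lastn L p)"
    using E hop_bound_block hop_bound_subset[of 1 Blk _ "Blk \<union> E"] by auto
  have "bt (Blk \<union> E) g (lastn L p) (h + j + (j - i) + 1)"
    if "\<forall>x \<in> set (lastn L p). g x \<le> h" "L \<le> 2 ^ j" for g h j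
    by (rule bt_mono[OF hop_boundD[OF h, where h = h and j = j]]) (use that in auto)
  moreover have "\<forall>u \<in> E. hop_bound 2 (Blk \<union> E) u" using E(4) hop_bound_12 by blast
  ultimately show ?case using E(1-3) ik by (intro exI[of _ E]) auto
next
  case (Suc n)
  show ?case
  proof (cases "L \<le> 2 ^ i")
    case True
    obtain E where E: "finite E" "card E \<le> i" "lastn L p \<in> Blk \<union> E" "\<forall>u \<in> E. hop_bound 1 (Blk \<union> E) u"
      using hop_aligned[OF Suc.prems(1,2) True Suc.prems(3)] by blast
    have h: "hop_bound 1 (Blk \<union> E) (lastn L p)"
      using E hop_bound_block hop_bound_subset[of 1 Blk _ "Blk \<union> E"] by auto
    have "bt (Blk \<union> E) g (lastn L p) (h + j + (j - i) + 1)"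
      if "\<forall>x \<in> set (lastn L p). g x \<le> h" "L \<le> 2 ^ j" for g h j
      by (rule bt_mono[OF hop_boundD[OF h, where h = h and j = j]]) (use that in auto)
    moreover have "\<forall>u \<in> E. hop_bound 2 (Blk \<union> E) u" using E(4) hop_bound_12 by blast
    ultimately show ?thesis using E(1-3) Suc.prems by (intro exI[of _ E]) auto
  next
    case False
    show ?thesis
    proof (cases "p \<in> A (Suc i)")
      case True
      have "n = k - Suc i" "Suc i \<le> k" using Suc.hyps(2) by auto
      from Suc.hyps(1)[OF this(1) True Suc.prems(2-4) this(2)]
      obtain E where E: "finite E" "card E \<le> 2 * k - Suc i" "lastn L p \<in> Blk \<union> E"
        "\<forall>u \<in> E. hop_bound 2 (Blk \<union> E) u"
        "\<forall>g h j. (\<forall>x \<in> set (lastn L p). g x \<le> h) \<longrightarrow> L \<le> 2 ^ j \<longrightarrow>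
          bt (Blk \<union> E) g (lastn L p) (h + j + (j - Suc i) + 1)" by blast
      have "bt (Blk \<union> E) g (lastn L p) (h + j + (j - i) + 1)"
        if "\<forall>x \<in> set (lastn L p). g x \<le> h" "L \<le> 2 ^ j" for g h j
        by (rule bt_mono[OF E(5)[rule_format]]) (use that in auto)
      then show ?thesis using E by (intro exI[of _ E]) auto
    next
      case F: False
      define y where "y = take (length p - 2 ^ i) p"
      have y: "y \<in> A (Suc i)" unfolding y_def
        using A_step_Suc[OF Suc.prems(1) F] False Suc.prems by simp
      have n: "n = k - Suc i" "Suc i \<le> k" using Suc.hyps(2) by auto
      have l: "0 < L - 2 ^ i" "L - 2 ^ i \<le> length y" "L - 2 ^ i \<le> 2 ^ k"
        using False Suc.prems by (auto simp: y_def)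
      from Suc.hyps(1)[OF n(1) y l n(2)] obtain E where E: "finite E" "card E \<le> 2 * k - Suc i" "lastn (L - 2 ^ i) y \<in> Blk \<union> E"
        "\<forall>u \<in> E. hop_bound 2 (Blk \<union> E) u"
        "\<forall>g h j. (\<forall>x \<in> set (lastn (L - 2 ^ i) y). g x \<le> h) \<longrightarrow> L - 2 ^ i \<le> 2 ^ j \<longrightarrow>
          bt (Blk \<union> E) g (lastn (L - 2 ^ i) y) (h + j + (j - Suc i) + 1)"
        by blast
      let ?E = "insert (lastn L p) E"
      have e: "lastn L p = lastn (L - 2 ^ i) y @ lastn (2 ^ i) p"
        unfolding y_def using False Suc.prems by (intro lastn_split) auto
      have pB: "lastn (2 ^ i) p \<in> Blk" using Suc.prems by (intro BlkI) auto
      have sub: "Blk \<union> E \<subseteq> Blk \<union> ?E" "Blk \<subseteq> Blk \<union> ?E" by auto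
      have *: "bt (Blk \<union> ?E) g (lastn L p) (h + j + (j - i) + 1)"
        if u: "\<forall>x \<in> set (lastn L p). g x \<le> h" "L \<le> 2 ^ j" for g h j
      proof -
        have ij: "Suc i \<le> j"
        proof (rule ccontr)
          assume "\<not> Suc i \<le> j"
          then have "(2::nat) ^ j \<le> 2 ^ i" by simp
          then show False using False u(2) by linarith
        qed
        have "bt (Blk \<union> E) g (lastn (L - 2 ^ i) y) (h + j + (j - Suc i) + 1)"
          using u e by (intro E(5)[rule_format]) auto
        then have b1: "bt (Blk \<union> ?E) g (lastn (L - 2 ^ i) y) (h + j + (j - Suc i) + 1)"
          using sub(1) by (rule bt_subset)
        have "bt Blk g (lastn (2 ^ i) p) (h + 1 * i + (1 - 1))"
          using u e by (intro hop_boundD[OF hop_bound_block[OF pB]]) auto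
        from bt_subset[OF this sub(2)]
        have b2: "bt (Blk \<union> ?E) g (lastn (2 ^ i) p) (h + j + (j - Suc i) + 1)"
          by (rule bt_mono) (use ij in simp)
        show ?thesis using bt.node[OF b1 b2] e ij by auto
      qed
      have "hop_bound 2 (Blk \<union> ?E) (lastn L p)" unfolding hop_bound_def
      proof (intro allI impI)
        fix g :: "'b \<Rightarrow> nat" and h j
        assume "\<forall>x\<in>set (lastn L p). g x \<le> h" "length (lastn L p) \<le> 2 ^ j"
        then show "bt (Blk \<union> ?E) g (lastn L p) (h + 2 * j + (2 - 1))"
          using Suc.prems by (intro bt_mono[OF *]) auto
      qed
      moreover have "card ?E \<le> Suc (card E)" using E(1) by (simp add: card_insert_if)
      then have "card ?E \<le> 2 * k - i" using E(2) Suc.hyps(2) by arith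
      ultimately show ?thesis using E(1,4) * hop_bound_subset[OF _ sub(1)] by (intro exI[of _ ?E]) auto
    qed
  qed
qed

text \<open>One witness is fixed for every triple, so that the extra words can be stored and
  counted; the default \<open>{}\<close> makes finiteness and the size bound unconditional.\<close>

definition hopset :: "'b list \<Rightarrow> nat \<Rightarrow> nat \<Rightarrow> 'b list set" where
  "hopset p L k = (if p \<in> P \<and> 0 < L \<and> L \<le> length p \<and> L \<le> 2 ^ k then
     (SOME E. finite E \<and> card E \<le> 2 * k \<and> lastn L p \<in> Blk \<union> E \<and> (\<forall>u \<in> E. hop_bound 2 (Blk \<union> E) u))
     else {})"

lemma hopset:
  shows "finite (hopset p L k)" "card (hopset p L k) \<le> 2 * k"
    "p \<in> P \<Longrightarrow> 0 < L \<Longrightarrow> L \<le> length p \<Longrightarrow> L \<le> 2 ^ k \<Longrightarrow> lastn L p \<in> Blk \<union> hopset p L k"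
    "u \<in> hopset p L k \<Longrightarrow> hop_bound 2 (Blk \<union> hopset p L k) u"
proof -
  have "finite (hopset p L k) \<and> card (hopset p L k) \<le> 2 * k \<and>
    (p \<in> P \<and> 0 < L \<and> L \<le> length p \<and> L \<le> 2 ^ k \<longrightarrow> lastn L p \<in> Blk \<union> hopset p L k) \<and>
    (\<forall>u \<in> hopset p L k. hop_bound 2 (Blk \<union> hopset p L k) u)"
  proof (cases "p \<in> P \<and> 0 < L \<and> L \<le> length p \<and> L \<le> 2 ^ k")
    case True
    then have "\<exists>E. finite E \<and> card E \<le> 2 * k \<and> lastn L p \<in> Blk \<union> E \<and> (\<forall>u \<in> E. hop_bound 2 (Blk \<union> E) u)"
      using hop_from_level[of p 0 L k] by auto
    from someI_ex[OF this] show ?thesis using True by (simp add: hopset_def)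
  next
    case False
    then have "hopset p L k = {}" unfolding hopset_def by (rule if_not_P)
    with False show ?thesis by auto
  qed
  then show "finite (hopset p L k)" "card (hopset p L k) \<le> 2 * k"
    "p \<in> P \<Longrightarrow> 0 < L \<Longrightarrow> L \<le> length p \<Longrightarrow> L \<le> 2 ^ k \<Longrightarrow> lastn L p \<in> Blk \<union> hopset p L k"
    "u \<in> hopset p L k \<Longrightarrow> hop_bound 2 (Blk \<union> hopset p L k) u" by blast+
qed

section \<open>Cells of prefix weights\<close>

definition W :: "'b list \<Rightarrow> nat" where "W u = sum_list (map wt u)"

lemma W_Nil [simp]: "W [] = 0" and W_append [simp]: "W (u @ v) = W u + W v"
  and W_Cons [simp]: "W (x # v) = wt x + W v"
  by (simp_all add: W_def)

lemma length_le_W: "length u \<le> W u"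
proof (induction u)
  case (Cons x u)
  then show ?case using wt_pos[of x] by simp
qed simp

lemma W_eq_0 [simp]: "W u = 0 \<longleftrightarrow> u = []"
  using length_le_W[of u] by (cases u) (use wt_pos in auto)

lemma wt_le_W: "x \<in> set u \<Longrightarrow> wt x \<le> W u"
  by (simp add: W_def member_le_sum_list)

lemma W_take_drop: "W (take i v) + W (drop i v) = W v"
  by (metis W_append append_take_drop_id)

lemma W_take_mono: "i \<le> j \<Longrightarrow> W (take i v) \<le> W (take j v)"
  using W_take_drop[of i "take j v"] by (simp add: min_def split: if_splits)

lemma W_take_le: "W (take i v) \<le> W v"
  using W_take_drop[of i v] by linarith

lemma W_take_less: "i < length v \<Longrightarrow> W (take i v) < W v"
  using W_take_drop[of i v] W_eq_0[of "drop i v"] by (simp del: W_eq_0)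

definition R :: "'b list \<Rightarrow> nat" where "R v = bl (W v)"

text \<open>\<open>I r v\<close> is the part of \<open>v\<close> within the last of the cells of length \<open>2 ^ r\<close> into which the
  prefix weights are divided.\<close>

definition start :: "nat \<Rightarrow> 'b list \<Rightarrow> nat" where
  "start r v = (LEAST i. W (take i v) div 2 ^ r = W v div 2 ^ r)"

definition I :: "nat \<Rightarrow> 'b list \<Rightarrow> 'b list" where "I r v = drop (start r v) v"

lemma start_eq: "W (take (start r v) v) div 2 ^ r = W v div 2 ^ r"
  unfolding start_def by (rule LeastI[of _ "length v"]) simp

lemma start_le: "start r v \<le> length v"
  unfolding start_def by (rule Least_le) simp

lemma start_same: "start r v \<le> i \<Longrightarrow> W (take i v) div 2 ^ r = W v div 2 ^ r"
  using div_le_mono[OF W_take_mono[of "start r v" i v], of "2 ^ r"]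
    div_le_mono[OF W_take_le[of i v], of "2 ^ r"] start_eq[of r v] by simp

lemma start_differ: "i < start r v \<Longrightarrow> W (take i v) div 2 ^ r < W v div 2 ^ r"
  using not_less_Least[of i "\<lambda>i. W (take i v) div 2 ^ r = W v div 2 ^ r"]
    div_le_mono[OF W_take_le[of i v], of "2 ^ r"] unfolding start_def by fastforce

lemma start_equality:
  assumes "W (take s v) div 2 ^ r = W v div 2 ^ r" "\<And>i. i < s \<Longrightarrow> W (take i v) div 2 ^ r \<noteq> W v div 2 ^ r"
  shows "start r v = s"
  unfolding start_def using assms by (intro Least_equality) (auto simp: not_less[symmetric])

lemma start_take:
  assumes "start r v \<le> i" "i \<le> length v"
  shows "start r (take i v) = start r v"
proof (rule start_equality)
  show "W (take (start r v) (take i v)) div 2 ^ r = W (take i v) div 2 ^ r"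
    using assms start_same[OF assms(1)] start_eq[of r v] by (simp add: min_def)
next
  fix j assume "j < start r v"
  then show "W (take j (take i v)) div 2 ^ r \<noteq> W (take i v) div 2 ^ r"
    using assms start_same[OF assms(1)] start_differ[of j r v] by (simp add: min_def)
qed

lemma I_take:
  assumes "start r v \<le> i" "i \<le> length v"
  shows "I r v = I r (take i v) @ drop i v"
  using assms start_take[OF assms] unfolding I_def
  by (metis (no_types, lifting) append_take_drop_id drop_append length_take min.absorb2
      diff_is_0_eq drop0)

lemma div_pow_trans: "x div 2 ^ r = y div 2 ^ r \<Longrightarrow> r \<le> t \<Longrightarrow> x div 2 ^ t = y div (2 ^ t :: nat)"
  by (metis div_mult2_eq le_add_diff_inverse power_add)

lemma start_antimono: "r \<le> t \<Longrightarrow> start t v \<le> start r v"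
  unfolding start_def[of t] by (rule Least_le) (rule div_pow_trans[OF start_eq])

lemma start_full: "W v < 2 ^ r \<Longrightarrow> start r v = 0"
  by (rule start_equality) auto

lemma I_full: "W v < 2 ^ r \<Longrightarrow> I r v = v"
  by (simp add: I_def start_full)

lemma I_R: "R v \<le> r \<Longrightarrow> I r v = v"
  by (rule I_full) (simp add: R_def bl_le_iff)

lemma I_0 [simp]: "I 0 v = []"
proof -
  have "\<not> start 0 v < length v"
    using start_eq[of 0 v] W_take_less[of "start 0 v" v] by auto
  then show ?thesis by (simp add: I_def)
qed

lemma same_div_less: "x div m = y div m \<Longrightarrow> y < x + m" if "0 < m" for x y m :: nat
proof -
  assume e: "x div m = y div m"
  have "y < y div m * m + m" using mod_less_divisor[OF that, of y] div_mult_mod_eq[of y m] by linarith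
  moreover have "y div m * m \<le> x" unfolding e[symmetric] by simp
  ultimately show "y < x + m" by linarith
qed

lemma W_I_less: "W (I r v) < 2 ^ r"
  using same_div_less[OF _ start_eq[of r v]] W_take_drop[of "start r v" v] unfolding I_def by simp

lemma wt_I_less: "x \<in> set (I r v) \<Longrightarrow> wt x < 2 ^ r"
  using wt_le_W[of x "I r v"] W_I_less[of r v] by linarith

lemma set_I: "set (I r v) \<subseteq> set v"
  by (simp add: I_def set_drop_subset)

text \<open>A cell of length \<open>2 ^ Suc r\<close> has one interior multiple of
  \<open>2 ^ r\<close>. If it separates the piece, exactly one letter starts before it and ends at
  or beyond it. What precedes this letter is the last cell of a shorter prefix, hence again of the
  form \<open>I r _\<close>.\<close>

lemma I_split:
  assumes "start (Suc r) v < start r v"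
  defines "i \<equiv> start r v - 1"
  shows "start r (take i v) = start (Suc r) v"
    "I (Suc r) v = I r (take i v) @ [v ! i] @ I r v"
    "i < length v" "Suc i = start r v"
    "W (take i v) < W v div 2 ^ r * 2 ^ r" "W v div 2 ^ r * 2 ^ r \<le> W (take (Suc i) v)"
proof -
  let ?b = "W v div 2 ^ r" and ?s = "start (Suc r) v"
  show Si: "Suc i = start r v" using assms by simp
  show il: "i < length v" using Si start_le[of r v] by simp
  have dd: "x div 2 ^ Suc r = x div 2 ^ r div 2" for x :: nat
    by (metis div_mult2_eq power_Suc2)
  have same: "W (take j v) div 2 ^ r = ?b - 1" if "?s \<le> j" "j < start r v" for j
  proof -
    have "W (take j v) div 2 ^ r < ?b" using start_differ that by blast
    moreover have "W (take j v) div 2 ^ r div 2 = ?b div 2" using start_same[OF that(1)] unfolding dd .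
    ultimately show ?thesis by linarith
  qed
  show st: "start r (take i v) = ?s"
  proof (rule start_equality)
    show "W (take ?s (take i v)) div 2 ^ r = W (take i v) div 2 ^ r"
      using same[of ?s] same[of i] assms(1) Si by (simp add: min_def)
  next
    fix j assume j: "j < ?s"
    then have "W (take j v) div 2 ^ Suc r \<noteq> W (take i v) div 2 ^ Suc r"
      using start_differ[OF j] start_same[of "Suc r" v i] Si assms(1) by simp
    then show "W (take j (take i v)) div 2 ^ r \<noteq> W (take i v) div 2 ^ r"
      using j Si assms(1) unfolding dd by (auto simp: min_def)
  qed
  have "v = take i v @ [v ! i] @ drop (Suc i) v" using id_take_nth_drop[OF il] by simp
  then have "drop ?s v = drop ?s (take i v @ [v ! i] @ drop (Suc i) v)" by simp
  also have "\<dots> = drop ?s (take i v) @ [v ! i] @ drop (Suc i) v"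
    using Si assms(1) il by simp
  finally show "I (Suc r) v = I r (take i v) @ [v ! i] @ I r v"
    unfolding I_def st Si by simp
  have "W (take i v) div 2 ^ r < ?b" using start_differ Si by simp
  then show "W (take i v) < ?b * 2 ^ r" by (simp add: div_less_iff_less_mult)
  have "W (take (Suc i) v) div 2 ^ r = ?b" using start_same[of r v "Suc i"] Si by simp
  then show "?b * 2 ^ r \<le> W (take (Suc i) v)" by (metis div_times_less_eq_dividend)
qed

lemma I_no_split: "\<not> start (Suc r) v < start r v \<Longrightarrow> I (Suc r) v = I r v"
  using start_antimono[of r "Suc r" v] by (simp add: I_def)

section \<open>The stored words and their number\<close>

definition pre :: "nat \<Rightarrow> 'b list \<Rightarrow> 'b list" where "pre r v = take (start r v - 1) v"

text \<open>The part of \<open>z\<close> left to a hop: all of the piece if it is short, otherwise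
  what lies beyond some prefix in \<open>A k\<close>, fewer than \<open>2 ^ k\<close>
  letters.\<close>

definition hoplen :: "nat \<Rightarrow> nat \<Rightarrow> 'b list \<Rightarrow> nat" where
  "hoplen r k z = (if length (I r z) \<le> 2 ^ k then length (I r z)
     else (SOME L. L < 2 ^ k \<and> take (length z - L) z \<in> A k))"

text \<open>For \<open>k = 0\<close> the stored cell is the whole word \<open>v\<close>; cells
  smaller by the factor \<open>2 ^ k\<close> are kept only at nodes of \<open>A k\<close>. The hop
  sets use level \<open>Suc k\<close>, because the halves of the cell are continued from nodes of
  \<open>A (Suc k)\<close>.\<close>

definition E :: "nat \<Rightarrow> 'b list \<Rightarrow> 'b list set" where
  "E k v = insert (lastn (2 ^ k) v) (if k < R v then
     (let r = R v - Suc k; p = pre r v in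
       {I (Suc r) v, I r p, I r p @ [v ! (start r v - 1)], I r v} \<union>
       (hopset p (hoplen r (Suc k) p) (Suc k) \<union> hopset v (hoplen r (Suc k) v) (Suc k))) else {})"

definition F :: "'b list set" where "F = (\<Union>k. \<Union>v \<in> A k. E k v) - {[]}"

lemma finite_E: "finite (E k v)"
  by (simp add: E_def Let_def hopset)

lemma card_E: "card (E k v) \<le> 4 * k + 12"
proof (cases "k < R v")
  case True
  define r where "r = R v - Suc k"
  define p where "p = pre r v"
  let ?X = "{lastn (2 ^ k) v, I (Suc r) v, I r p, I r p @ [v ! (start r v - 1)], I r v}"
  let ?Y = "hopset p (hoplen r (Suc k) p) (Suc k)" and ?Z = "hopset v (hoplen r (Suc k) v) (Suc k)"
  have e: "E k v = ?X \<union> (?Y \<union> ?Z)" using True by (auto simp: E_def Let_def r_def p_def)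
  have "card (E k v) \<le> card ?X + (card ?Y + card ?Z)"
    unfolding e using card_Un_le[of ?X "?Y \<union> ?Z"] card_Un_le[of ?Y ?Z] by linarith
  moreover have "card ?X \<le> 5" by (simp add: card_insert_if)
  moreover have "card ?Y \<le> 2 * Suc k" "card ?Z \<le> 2 * Suc k" by (rule hopset)+
  ultimately show ?thesis by simp
qed (simp add: E_def)

text \<open>The full series has the value 32, the constant of \<open>card_F\<close>.\<close>

lemma sum_geometric: "(\<Sum>k<K. (4 * real k + 12) / 2 ^ k) = 32 - (8 * real K + 32) / 2 ^ K"
proof (induction K)
  case (Suc K)
  have "(\<Sum>k<Suc K. (4 * real k + 12) / 2 ^ k) = 32 - (8 * real K + 32) / 2 ^ K + (4 * real K + 12) / 2 ^ K"
    by (simp add: Suc)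
  also have "\<dots> = 32 - (8 * real (Suc K) + 32) / 2 ^ Suc K" by (simp add: field_simps)
  finally show ?case .
qed simp

lemma finite_F: "finite F" and card_F: "card F \<le> 32 * card P"
proof -
  have eq: "(\<Union>k. \<Union>v \<in> A k. E k v) = (\<Union>k<card P. \<Union>v \<in> A k. E k v)"
  proof -
    have "k < card P" if "v \<in> A k" for k v using A_empty[of k] that by (cases "k < card P") auto
    then show ?thesis by blast
  qed
  have fin: "finite (\<Union>k<card P. \<Union>v \<in> A k. E k v)" by (simp add: finite_A finite_E)
  then show "finite F" by (simp add: F_def eq)
  have "card F \<le> card (\<Union>k<card P. \<Union>v \<in> A k. E k v)"
    unfolding F_def eq using fin by (intro card_mono) auto
  also have "\<dots> \<le> (\<Sum>k<card P. card (\<Union>v \<in> A k. E k v))" by (rule card_UN_le) simp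
  also have "\<dots> \<le> (\<Sum>k<card P. card (A k) * (4 * k + 12))"
  proof (rule sum_mono)
    fix k
    have "card (\<Union>v \<in> A k. E k v) \<le> (\<Sum>v\<in>A k. card (E k v))" by (rule card_UN_le[OF finite_A])
    also have "\<dots> \<le> card (A k) * (4 * k + 12)"
      using sum_bounded_above[of "A k" "\<lambda>v. card (E k v)" "4 * k + 12"] card_E by simp
    finally show "card (\<Union>v \<in> A k. E k v) \<le> card (A k) * (4 * k + 12)" .
  qed
  finally have "real (card F) \<le> real (\<Sum>k<card P. card (A k) * (4 * k + 12))" by (rule of_nat_mono)
  also have "\<dots> = (\<Sum>k<card P. real (card (A k)) * real (4 * k + 12))" by simp
  also have "\<dots> \<le> (\<Sum>k<card P. real (card P) * ((4 * real k + 12) / 2 ^ k))"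
  proof (rule sum_mono)
    fix k
    have "real (card (A k) * 2 ^ k) \<le> real (card P)" using card_A by (rule of_nat_mono)
    then have "real (card (A k)) \<le> real (card P) / 2 ^ k" by (simp add: field_simps)
    then have "real (card (A k)) * real (4 * k + 12) \<le> real (card P) / 2 ^ k * real (4 * k + 12)"
      by (rule mult_right_mono) simp
    then show "real (card (A k)) * real (4 * k + 12) \<le> real (card P) * ((4 * real k + 12) / 2 ^ k)"
      by simp
  qed
  also have "\<dots> = real (card P) * (32 - (8 * real (card P) + 32) / 2 ^ card P)"
    by (simp only: sum_distrib_left[symmetric] sum_geometric)
  also have "\<dots> \<le> real (card P) * 32" by (intro mult_left_mono) auto
  finally show "card F \<le> 32 * card P" by linarith
qed

lemma Blk_subset_F: "Blk \<subseteq> F"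
proof
  fix u assume "u \<in> Blk"
  then obtain i z where z: "z \<in> A i" "z \<noteq> []" "u = lastn (2 ^ i) z" unfolding Blk_def by blast
  then have "u \<in> E i z" by (simp add: E_def)
  moreover have "length u \<noteq> 0" using z by simp
  ultimately show "u \<in> F" using z(1) unfolding F_def by auto
qed

lemma in_F: "v \<in> A k \<Longrightarrow> u \<in> E k v \<Longrightarrow> u \<noteq> [] \<Longrightarrow> u \<in> F"
  unfolding F_def by auto

lemma letter_F: "v \<in> P \<Longrightarrow> x \<in> set v \<Longrightarrow> [x] \<in> F"
proof -
  assume v: "v \<in> P" "x \<in> set v"
  then obtain i where i: "i < length v" "v ! i = x" by (auto simp: in_set_conv_nth)
  have "lastn (2 ^ 0) (take (Suc i) v) = [x]" using i by (simp add: lastn_def take_Suc_conv_app_nth)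
  moreover have "take (Suc i) v \<in> A 0" "take (Suc i) v \<noteq> []" using v i take_P by auto
  ultimately have "[x] \<in> Blk" using BlkI by metis
  then show ?thesis using Blk_subset_F by blast
qed

lemma hopset_F:
  assumes "hopset p L k \<subseteq> F" "u \<in> Blk \<union> hopset p L k"
  shows "hop_bound 2 F u"
proof -
  have "hop_bound 2 (Blk \<union> hopset p L k) u"
    using assms(2) hopset(4) hop_bound_subset[OF hop_bound_12[OF hop_bound_block]] by blast
  then show ?thesis using assms(1) Blk_subset_F by (elim hop_bound_subset) auto
qed

lemma hopset_nonempty: "u \<in> hopset p L k \<Longrightarrow> u \<noteq> []"
proof -
  assume "u \<in> hopset p L k"
  then have "hop_bound 2 (Blk \<union> hopset p L k) u" by (rule hopset)
  from hop_boundD[OF this, of "\<lambda>_. 0" 0 "length u"] show "u \<noteq> []"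
    using bt_nonempty by (metis less_imp_le_nat less_exp zero_order(1))
qed

section \<open>Height bounds for the stored words\<close>

text \<open>A piece is cut at a prefix in \<open>A k\<close> of the same cell: the front is the
  piece \<open>I r\<close> of that prefix, handled by the hypothesis \<open>q\<close>, and the rest
  is one hop. This costs a single tree level.\<close>

lemma piece:
  assumes z: "z \<in> P" "I r z \<noteq> []" "I r z \<in> F" "hopset z (hoplen r k z) k \<subseteq> F"
    and g: "\<And>x. x \<in> set (I r z) \<Longrightarrow> g x \<le> h"
    and j: "2 ^ k \<le> (2::nat) ^ j \<or> length (I r z) \<le> 2 ^ j" "h + 2 * j + 1 \<le> X"
    and q: "\<And>i. take i z \<in> A k \<Longrightarrow> start r z < i \<Longrightarrow> i \<le> length z \<Longrightarrow> 2 ^ k < length (I r z) \<Longrightarrow>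
      bt F g (I r (take i z)) X"
  shows "bt F g (I r z) (Suc X)"
proof -
  have hop: "bt F g (lastn L z) X"
    if "L = hoplen r k z" "0 < L" "L \<le> length (I r z)" "L \<le> 2 ^ k" for L
  proof -
    have Lz: "L \<le> length z" using that(3) by (simp add: I_def)
    have "lastn L z \<in> Blk \<union> hopset z L k" using hopset(3)[OF z(1) that(2) Lz that(4)] .
    then have hb: "hop_bound 2 F (lastn L z)" using hopset_F z(4) that(1) by blast
    have Lj: "L \<le> 2 ^ j" using j(1) that(3,4) by linarith
    have "lastn L z = lastn L (I r z)" using that(3) start_le[of r z]
      by (simp add: lastn_def I_def)
    then have "bt F g (lastn L z) (h + 2 * j + (2 - 1))"
      using g set_lastn[of L "I r z"] Lj by (intro hop_boundD[OF hb]) auto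
    then show ?thesis using j(2) by (elim bt_mono) simp
  qed
  show ?thesis
  proof (cases "length (I r z) \<le> 2 ^ k")
    case True
    then have hl: "hoplen r k z = length (I r z)" by (simp add: hoplen_def)
    have "I r z = lastn (length (I r z)) z" using lastn_drop[OF start_le[of r z]] by (simp add: I_def)
    then have "bt F g (I r z) X" using hop[of "length (I r z)"] hl True z(2) by simp
    then show ?thesis by (rule bt_mono) simp
  next
    case False
    define L where "L = hoplen r k z"
    have "\<exists>L. L < 2 ^ k \<and> take (length z - L) z \<in> A k"
      using A_near[OF z(1), of k] False by (auto simp: I_def)
    from someI_ex[OF this] have L: "L < 2 ^ k" "take (length z - L) z \<in> A k"
      using False by (auto simp: L_def hoplen_def)
    have i: "start r z < length z - L" using L(1) False by (simp add: I_def)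
    have "I r z = I r (take (length z - L) z) @ lastn L z"
      using I_take[of r z "length z - L"] i by (simp add: lastn_def)
    moreover have "bt F g (I r (take (length z - L) z)) X" using q[OF L(2) i] False by simp
    moreover have "bt F g (lastn L z) X" if "lastn L z \<noteq> []"
      using that L(1) False i by (intro hop) (auto simp: L_def[symmetric] lastn_def)
    ultimately show ?thesis using bt_append z(2,3) by metis
  qed
qed

lemma stored:
  assumes "v \<in> A k" "R v = Suc r + k"
  shows "I (Suc r) v \<noteq> [] \<Longrightarrow> I (Suc r) v \<in> F" "I r v \<noteq> [] \<Longrightarrow> I r v \<in> F"
    "I r (pre r v) \<noteq> [] \<Longrightarrow> I r (pre r v) \<in> F" "I r (pre r v) @ [v ! (start r v - 1)] \<in> F"
    "hopset v (hoplen r (Suc k) v) (Suc k) \<subseteq> F"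
    "hopset (pre r v) (hoplen r (Suc k) (pre r v)) (Suc k) \<subseteq> F"
proof -
  have r: "R v - Suc k = r" "k < R v" using assms(2) by auto
  show "I (Suc r) v \<noteq> [] \<Longrightarrow> I (Suc r) v \<in> F" "I r v \<noteq> [] \<Longrightarrow> I r v \<in> F"
    "I r (pre r v) \<noteq> [] \<Longrightarrow> I r (pre r v) \<in> F" "I r (pre r v) @ [v ! (start r v - 1)] \<in> F"
    using r by (intro in_F[OF assms(1)]; simp add: E_def Let_def)+
  show "hopset v (hoplen r (Suc k) v) (Suc k) \<subseteq> F"
    "hopset (pre r v) (hoplen r (Suc k) (pre r v)) (Suc k) \<subseteq> F"
    using r hopset_nonempty by (intro subsetI in_F[OF assms(1)]; force simp: E_def Let_def)+
qed

lemma R_take: "R (take i v) \<le> R v"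
  by (simp add: R_def bl_mono W_take_le)

text \<open>\<open>R v = r + k\<close> matches the cell size with the sparseness. Halving the cell
  costs three levels, one for the cut in \<open>piece\<close> and two for joining the three parts of
  a split, hence \<open>3 * r\<close>. The summand \<open>2 * R v\<close> dominates the hops, and a
  letter in a cell of length \<open>2 ^ s\<close> has \<open>bl (wt x) \<le> s\<close>.\<close>

lemma biased_bound:
  assumes "v \<in> A k" "R v = r + k" "I r v \<noteq> []" "\<And>x. x \<in> set v \<Longrightarrow> g x \<le> 5 * bl (wt x) + M"
  shows "bt F g (I r v) (3 * r + 2 * R v + M + 2)"
  using assms
proof (induction r arbitrary: v k rule: less_induct)
  case (less r)
  show ?case
  proof (cases r)
    case 0
    then show ?thesis using less.prems by simp
  next
    case (Suc s)
    have Rv: "R v = Suc s + k" using less.prems Suc by simp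
    note st = stored[OF less.prems(1) Rv]
    have vP: "v \<in> P" using less.prems A_subset_P by blast
    let ?X = "3 * s + 2 * R v + M + 2"
    have pc: "bt F g (I s (take i v)) (Suc ?X)"
      if nz: "I s (take i v) \<noteq> []" "I s (take i v) \<in> F"
        "hopset (take i v) (hoplen s (Suc k) (take i v)) (Suc k) \<subseteq> F" for i
    proof (rule piece[where k = "Suc k" and j = "Suc k" and h = "5 * s + M"])
      show "take i v \<in> P" using vP by (rule take_P)
      show "5 * s + M + 2 * Suc k + 1 \<le> ?X" using Rv by simp
      fix x assume x: "x \<in> set (I s (take i v))"
      then have "bl (wt x) \<le> s" using wt_I_less by (simp add: bl_le_iff)
      moreover have "x \<in> set v" using x set_I by (metis in_set_takeD subsetD)
      ultimately show "g x \<le> 5 * s + M" using less.prems(4)[of x] by linarith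
    next
      fix j assume j: "take j (take i v) \<in> A (Suc k)" "start s (take i v) < j" "j \<le> length (take i v)"
      let ?q = "take j (take i v)"
      have nq: "I s ?q \<noteq> []" using j start_take[of s "take i v" j] by (simp add: I_def)
      have gq: "\<And>x. x \<in> set ?q \<Longrightarrow> g x \<le> 5 * bl (wt x) + M" using less.prems(4) by (metis in_set_takeD)
      have Rq: "R ?q \<le> R v" using R_take le_trans by metis
      show "bt F g (I s ?q) ?X"
      proof (cases "R ?q \<le> s")
        case True
        \<comment> \<open>Such a prefix is so light that its cell is the whole word; it is treated
          at its own rank, where membership in \<open>A 0\<close> is enough.\<close>
        then have "I s ?q = I (R ?q) ?q" using I_R by simp
        moreover have "bt F g (I (R ?q) ?q) (3 * R ?q + 2 * R ?q + M + 2)"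
          using j(1) A_subset_P True Suc nq calculation gq by (intro less.IH[of _ _ 0]) auto
        ultimately show ?thesis by (elim bt_mono') (use True Rq in auto)
      next
        case False
        have "R ?q - s \<le> Suc k" using Rq Rv by linarith
        then have "?q \<in> A (R ?q - s)" using A_antimono j(1) by blast
        then have "bt F g (I s ?q) (3 * s + 2 * R ?q + M + 2)"
          using False Suc nq gq by (intro less.IH[of _ _ "R ?q - s"]) auto
        then show ?thesis by (rule bt_mono) (use Rq in simp)
      qed
    qed (use that in auto)
    show ?thesis
    proof (cases "start (Suc s) v < start s v")
      case False
      then have e: "I r v = I s v" using I_no_split Suc by simp
      have "bt F g (I s (take (length v) v)) (Suc ?X)" using less.prems(3) e st by (intro pc) auto
      then show ?thesis by (rule bt_mono') (use e Suc in simp_all)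
    next
      case True
      note sp = I_split[OF True]
      let ?p = "pre s v" and ?e = "v ! (start s v - 1)"
      have e: "I r v = (I s ?p @ [?e]) @ I s v" using sp(2) Suc by (simp add: pre_def)
      have bv: "bt F g (I s v) (Suc (Suc ?X))" if "I s v \<noteq> []"
        by (rule bt_mono'[OF pc[of "length v"]]) (use that st(2,5) in auto)
      have bp: "bt F g (I s ?p) (Suc ?X)" if "I s ?p \<noteq> []"
        by (rule bt_mono'[OF pc[of "start s v - 1"]]) (use that st(3,6) in \<open>auto simp: pre_def\<close>)
      have ev: "?e \<in> set v" using sp(3) by simp
      have "?e \<in> set (I r v)" using e by simp
      then have "bl (wt ?e) \<le> Suc s" using wt_I_less[of ?e r v] Suc by (simp add: bl_le_iff)
      then have "g ?e \<le> Suc ?X" using less.prems(4)[OF ev] Rv by linarith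
      then have be: "bt F g [?e] (Suc ?X)" using letter_F[OF vP ev] by (auto intro: bt.leaf)
      have "bt F g (I s ?p @ [?e]) (Suc (Suc ?X))" using bp be st(4) by (intro bt_append) auto
      then have "bt F g ((I s ?p @ [?e]) @ I s v) (Suc (Suc (Suc ?X)))"
        by (rule bt_append[OF _ bv]) (use st(1) less.prems(3) e Suc in simp_all)
      then show ?thesis by (rule bt_mono') (use e Suc in simp_all)
    qed
  qed
qed

text \<open>\<open>2 ^ (R v - 1)\<close> is a multiple of \<open>2 ^ r\<close> and at most
  \<open>W v\<close>, so the entire cell of \<open>v\<close> lies at or above it, and with it
  \<open>W q\<close>.\<close>

lemma same_R:
  assumes "W q \<le> W v" "W q div 2 ^ r = W v div 2 ^ r" "r < R v"
  shows "R q = R v"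
proof -
  have 1: "2 ^ (R v - 1) \<le> W v" using assms(3) unfolding R_def by (subst bl_less_iff[symmetric]) simp
  have 2: "(2::nat) ^ (R v - 1) = 2 ^ (R v - 1 - r) * 2 ^ r"
    using assms(3) by (simp flip: power_add)
  then have "2 ^ (R v - 1 - r) \<le> W v div 2 ^ r" using 1 by (simp add: less_eq_div_iff_mult_less_eq)
  then have "2 ^ (R v - 1) \<le> W q div 2 ^ r * 2 ^ r" unfolding 2 assms(2) by simp
  also have "\<dots> \<le> W q" by simp
  finally have "R v - 1 < R q" unfolding R_def by (simp add: bl_less_iff)
  moreover have "R q \<le> R v" using assms(1) by (simp add: R_def bl_mono)
  ultimately show ?thesis by linarith
qed

lemma W_I: "W (take (start r v) v) + W (I r v) = W v"
  by (simp add: I_def W_take_drop)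

text \<open>For \<open>k = 0\<close> the cell begins at 0 and its midpoint \<open>2 ^ s\<close> is
  at most \<open>W v\<close>, which forces a split.\<close>

lemma k_pos:
  assumes "\<not> start (Suc s) v < start s v" "R v = Suc s + k" shows "0 < k"
proof (rule ccontr)
  assume "\<not> 0 < k"
  then have R: "R v = Suc s" using assms by simp
  then have "start (Suc s) v = 0" using start_full[of v "Suc s"] bl_bound[of "W v"] by (simp add: R_def)
  then have "start s v = 0" using assms(1) by simp
  then have "W v div 2 ^ s = 0" using start_eq[of s v] by simp
  then have "W v < 2 ^ s" by (simp add: div_eq_0_iff)
  then have "R v \<le> s" by (simp add: R_def bl_le_iff)
  then show False using R by simp
qed

lemma start_less_length: "I r v \<noteq> [] \<longleftrightarrow> start r v < length v"
  by (auto simp: I_def not_le)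

text \<open>A piece inside one cell of length \<open>2 ^ b\<close> is split only at levels below
  \<open>b\<close>, which gives \<open>3 * min r b\<close>. A step without a split raises
  \<open>k\<close> and is paid by \<open>b - k\<close>; once \<open>Suc k\<close> reaches
  \<open>b\<close>, a single hop covers the piece.\<close>

lemma aligned_local_bound:
  assumes "v \<in> A k" "R v = r + k" "I r v \<noteq> []" "W (I r v) < 2 ^ b" "start b v \<le> start r v"
    and "\<And>x. x \<in> set (I r v) \<Longrightarrow> g x \<le> h"
  shows "bt F g (I r v) (3 * min r b + (b - k) + h + 2 * b + 1)"
  using assms
proof (induction r arbitrary: v k rule: less_induct)
  case (less r)
  show ?case
  proof (cases r)
    case 0
    then show ?thesis using less.prems by simp
  next
    case (Suc s)
    have Rv: "R v = Suc s + k" using less.prems Suc by simp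
    note st = stored[OF less.prems(1) Rv]
    have vP: "v \<in> P" using less.prems A_subset_P by blast
    have b: "0 < b" using less.prems(3,4) by (cases b) auto
    show ?thesis
    proof (cases "start (Suc s) v < start s v")
      case False
      then have e: "I r v = I s v" using I_no_split Suc by simp
      have se: "start s v = start (Suc s) v" using False start_antimono[of s "Suc s" v] by simp
      have k: "0 < k" using k_pos[OF False Rv] .
      have len: "length (I s v) < 2 ^ b" using length_le_W[of "I s v"] less.prems(4) e by simp
      show ?thesis
      proof (cases "2 ^ Suc k < length (I s v)")
        case True
        then have "(2::nat) ^ Suc k < 2 ^ b" using len by linarith
        then have kb: "Suc k < b" by (simp del: power_Suc)
        let ?X = "3 * min s b + (b - Suc k) + h + 2 * b + 1"
        have "bt F g (I s v) (Suc ?X)"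
        proof (rule piece[where k = "Suc k" and j = b and h = h])
          show "2 ^ Suc k \<le> (2::nat) ^ b \<or> length (I s v) \<le> 2 ^ b" using len by simp
          fix j assume j: "take j v \<in> A (Suc k)" "start s v < j" "j \<le> length v"
          let ?q = "take j v"
          have sq: "start s ?q = start s v" using start_take j by simp
          have It: "I s v = I s ?q @ drop j v" using I_take j by simp
          have "R ?q = R v" using Rv k j se start_same[of "Suc s" v j]
            by (intro same_R[of _ _ "Suc s"]) (auto simp: W_take_le)
          moreover have "start b ?q = start b v"
            using less.prems(5) j se Suc by (intro start_take) auto
          ultimately show "bt F g (I s ?q) ?X"
            using less.prems(4-6) e It j sq Suc se Rv
            by (intro less.IH) (auto simp: start_less_length)
        qed (use vP less.prems e st in auto)
        moreover have "Suc ?X \<le> 3 * min r b + (b - k) + h + 2 * b + 1"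
        proof -
          have "min s b \<le> min r b" "Suc (b - Suc k) \<le> b - k" using Suc kb by auto
          then show ?thesis by linarith
        qed
        ultimately show ?thesis unfolding e by (rule bt_mono)
      next
        case F: False
        have "bt F g (I s v) (Suc (h + 2 * b + 1))"
        proof (rule piece[where k = "Suc k" and j = b and h = h])
          show "2 ^ Suc k \<le> (2::nat) ^ b \<or> length (I s v) \<le> 2 ^ b" using len by simp
        qed (use F vP less.prems e st in auto)
        moreover have "1 \<le> min r b" using Suc b by simp
        then have "Suc (h + 2 * b + 1) \<le> 3 * min r b + (b - k) + h + 2 * b + 1" by linarith
        ultimately show ?thesis unfolding e by (rule bt_mono)
      qed
    next
      case True
      note sp = I_split[OF True]
      have sb: "s < b"
      proof (rule ccontr)
        assume "\<not> s < b"
        then have "start s v \<le> start b v" by (intro start_antimono) simp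
        then show False using True less.prems(5) Suc by simp
      qed
      let ?p = "pre s v" and ?e = "v ! (start s v - 1)"
      have e: "I r v = (I s ?p @ [?e]) @ I s v" using sp(2) Suc by (simp add: pre_def)
      let ?X = "3 * s + (b - k) + h + 2 * b + 1"
      have pc: "bt F g (I s (take i v)) (Suc ?X)"
        if nz: "I s (take i v) \<noteq> []" "I s (take i v) \<in> F"
          "hopset (take i v) (hoplen s (Suc k) (take i v)) (Suc k) \<subseteq> F"
          and W: "W (I s (take i v)) < 2 ^ b" and sub: "set (I s (take i v)) \<subseteq> set (I r v)"
          and si: "start (Suc s) v \<le> start s (take i v)" for i
      proof (rule piece[where k = "Suc k" and j = b and h = h])
        show "take i v \<in> P" using vP by (rule take_P)
        show "2 ^ Suc k \<le> (2::nat) ^ b \<or> length (I s (take i v)) \<le> 2 ^ b"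
          using W length_le_W[of "I s (take i v)"] by simp
        fix j assume j: "take j (take i v) \<in> A (Suc k)" "start s (take i v) < j" "j \<le> length (take i v)"
        let ?q = "take j (take i v)"
        have sq: "start s ?q = start s (take i v)" by (rule start_take) (use j in auto)
        have It: "I s (take i v) = I s ?q @ drop j (take i v)" by (rule I_take) (use j in auto)
        have nq: "I s ?q \<noteq> []" using j sq by (simp add: start_less_length)
        have Wq: "W (I s ?q) < 2 ^ b" using W It by simp
        have gq: "\<And>x. x \<in> set (I s ?q) \<Longrightarrow> g x \<le> h" using less.prems(6) sub It by auto
        have Rq: "R ?q \<le> R v" using R_take le_trans by metis
        have qv: "?q = take j v" using j(3) by (simp add: min_absorb1)
        have RR: "R ?q = R v" if "0 < k"
          unfolding qv using Rv that si j start_same[of "Suc s" v j]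
          by (intro same_R[of _ _ "Suc s"]) (auto simp: W_take_le)
        show "bt F g (I s ?q) ?X"
        proof (cases "R ?q \<le> s")
          case True
          then have k0: "k = 0" using RR Rv by (cases k) auto
          have eq: "I s ?q = I (R ?q) ?q" using I_R True by simp
          have "bt F g (I (R ?q) ?q) (3 * min (R ?q) b + (b - 0) + h + 2 * b + 1)"
          proof (rule less.IH)
            show "start b ?q \<le> start (R ?q) ?q" using True sb by (intro start_antimono) simp
          qed (use j(1) A_subset_P True Suc nq Wq gq eq in auto)
          then show ?thesis by (rule bt_mono') (use eq True k0 in auto)
        next
          case False
          have "R ?q - s \<le> Suc k" using Rq Rv by linarith
          then have qA: "?q \<in> A (R ?q - s)" using A_antimono j(1) by blast
          have "bt F g (I s ?q) (3 * min s b + (b - (R ?q - s)) + h + 2 * b + 1)"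
          proof (rule less.IH)
            show "start b ?q \<le> start s ?q" using sb by (intro start_antimono) simp
          qed (use qA False Suc nq Wq gq in auto)
          moreover have "b - (R ?q - s) \<le> b - k" using RR Rv by (cases k) auto
          ultimately show ?thesis by (elim bt_mono) simp
        qed
      qed (use that less.prems(6) in auto)
      have WI: "W (I r v) = W (I s ?p) + wt ?e + W (I s v)" by (simp add: e)
      have bv: "bt F g (I s v) (Suc (Suc ?X))" if "I s v \<noteq> []"
        by (rule bt_mono'[OF pc[of "length v"]])
          (use that st(2,5) less.prems(4) WI e start_antimono[of s "Suc s" v] in auto)
      have bp: "bt F g (I s ?p) (Suc ?X)" if "I s ?p \<noteq> []"
        by (rule bt_mono'[OF pc[of "start s v - 1"]])
          (use that st(3,6) less.prems(4) WI e sp(1) in \<open>auto simp: pre_def\<close>)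
      have "g ?e \<le> Suc ?X" using less.prems(6)[of ?e] e by simp
      then have be: "bt F g [?e] (Suc ?X)" using letter_F[OF vP, of ?e] sp(3) by (auto intro: bt.leaf)
      have "bt F g (I s ?p @ [?e]) (Suc (Suc ?X))" using bp be st(4) by (intro bt_append) auto
      then have "bt F g ((I s ?p @ [?e]) @ I s v) (Suc (Suc (Suc ?X)))"
        by (rule bt_append[OF _ bv]) (use st(1) less.prems(3) e Suc in simp_all)
      then show ?thesis by (rule bt_mono') (use e Suc sb in simp_all)
    qed
  qed
qed

lemma start_mono_cell: "W (take i v) div 2 ^ b = W v div 2 ^ b \<Longrightarrow> start b v \<le> i"
  unfolding start_def by (rule Least_le)

lemma same_cell:
  assumes "X = m * 2 ^ s" "b \<le> s" "X \<le> x" "x < X + 2 ^ b" "X \<le> y" "y < X + 2 ^ b"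
  shows "x div 2 ^ b = y div (2 ^ b :: nat)"
proof -
  have X: "X = (m * 2 ^ (s - b)) * 2 ^ b"
    using assms(1,2) by (simp flip: power_add add: mult.assoc)
  have "x div 2 ^ b = m * 2 ^ (s - b)" if "X \<le> x" "x < X + 2 ^ b" for x
    using that X by (intro div_nat_eqI) (simp_all add: algebra_simps)
  then show ?thesis using assms(3-6) by metis
qed

text \<open>The positions on either side of a multiple of a large power of two stay on that side, so a word
  of weight below \<open>2 ^ b\<close> is confined to one cell of length \<open>2 ^ b\<close> after its first split.\<close>

lemma confined_after_split:
  assumes sp: "start (Suc s) v < start s v" and W: "W (I (Suc s) v) < 2 ^ b"
  shows "start b v \<le> start s v" "start b (pre s v) \<le> start s (pre s v)"
proof -
  note sp' = I_split[OF sp]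
  let ?i = "start s v - 1" and ?s0 = "start (Suc s) v"
  let ?X = "W v div 2 ^ s * 2 ^ s"
  have p: "pre s v = take ?i v" by (simp add: pre_def)
  have WI: "W (take ?s0 v) + W (I (Suc s) v) = W v" by (rule W_I)
  have tk: "take (start s v) v = take (Suc ?i) v" using sp'(4) by simp
  have le: "W (take ?s0 v) \<le> W (take ?i v)" using sp'(4) sp by (intro W_take_mono) simp
  show "start b v \<le> start s v"
  proof (cases "s \<le> b")
    case True then show ?thesis by (rule start_antimono)
  next
    case False
    show ?thesis
    proof (rule start_mono_cell, rule same_cell[OF refl])
      show "b \<le> s" using False by simp
      show "?X \<le> W (take (start s v) v)" using sp'(6) tk by simp
      show "?X \<le> W v" by simp
      show "W v < ?X + 2 ^ b" using WI W le sp'(5) by linarith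
      then show "W (take (start s v) v) < ?X + 2 ^ b" using W_take_le[of "start s v" v] by linarith
    qed
  qed
  show "start b (pre s v) \<le> start s (pre s v)"
  proof (cases "s \<le> b")
    case True then show ?thesis by (rule start_antimono)
  next
    case False
    have s0: "start s (pre s v) = ?s0" using sp'(1) p by simp
    have tk0: "take ?s0 (take ?i v) = take ?s0 v" proof -
      have "?s0 \<le> ?i" using sp by linarith
      then show ?thesis by (simp add: min_absorb1)
    qed
    define m where "m = W v div 2 ^ s"
    have m0: "0 < m" using sp'(5) unfolding m_def by (cases "W v div 2 ^ s") auto
    \<comment> \<open>Start of the last cell of length \<open>2 ^ b\<close> before the split
      point.\<close>
    define Y where "Y = (m * 2 ^ (s - b) - 1) * 2 ^ b"
    have XY: "?X = Y + 2 ^ b"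
    proof -
      have "?X = (m * 2 ^ (s - b)) * 2 ^ b" using False by (simp flip: power_add add: m_def mult.assoc)
      moreover have "0 < m * 2 ^ (s - b)" using m0 by simp
      ultimately show ?thesis unfolding Y_def by (cases "m * 2 ^ (s - b)") (auto simp: algebra_simps)
    qed
    have "W v < W (take ?s0 v) + 2 ^ b" using WI W by linarith
    moreover have "?X \<le> W v" by simp
    ultimately have lo: "Y \<le> W (take ?s0 v)" using XY by linarith
    have hi: "W (take ?i v) < Y + 2 ^ b" using sp'(5) XY by simp
    have "W (take ?s0 v) div 2 ^ b = W (take ?i v) div 2 ^ b"
      by (rule same_cell[OF Y_def, of b]) (use lo hi le in linarith)+
    then have "W (take ?s0 (pre s v)) div 2 ^ b = W (pre s v) div 2 ^ b" using tk0 p by simp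
    then show ?thesis unfolding s0 by (rule start_mono_cell)
  qed
qed

text \<open>Steps before the first split are paid by \<open>b - k\<close> as in the aligned case.
  The first split accounts for the additional 3, and then both sides satisfy the hypothesis of
  \<open>aligned_local_bound\<close>.\<close>

lemma local_bound:
  assumes "v \<in> A k" "R v = r + k" "I r v \<noteq> []" "W (I r v) < 2 ^ b"
    and "\<And>x. x \<in> set (I r v) \<Longrightarrow> g x \<le> h"
  shows "bt F g (I r v) (3 * b + 3 + (b - k) + h + 2 * b + 1)"
  using assms
proof (induction r arbitrary: v k rule: less_induct)
  case (less r)
  show ?case
  proof (cases r)
    case 0
    then show ?thesis using less.prems by simp
  next
    case (Suc s)
    have Rv: "R v = Suc s + k" using less.prems Suc by simp
    note st = stored[OF less.prems(1) Rv]
    have vP: "v \<in> P" using less.prems A_subset_P by blast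
    show ?thesis
    proof (cases "start (Suc s) v < start s v")
      case False
      then have e: "I r v = I s v" using I_no_split Suc by simp
      have se: "start s v = start (Suc s) v" using False start_antimono[of s "Suc s" v] by simp
      have k: "0 < k" using k_pos[OF False Rv] .
      have len: "length (I s v) < 2 ^ b" using length_le_W[of "I s v"] less.prems(4) e by simp
      show ?thesis
      proof (cases "2 ^ Suc k < length (I s v)")
        case True
        then have "(2::nat) ^ Suc k < 2 ^ b" using len by linarith
        then have kb: "Suc k < b" by (simp del: power_Suc)
        let ?X = "3 * b + 3 + (b - Suc k) + h + 2 * b + 1"
        have "bt F g (I s v) (Suc ?X)"
        proof (rule piece[where k = "Suc k" and j = b and h = h])
          show "2 ^ Suc k \<le> (2::nat) ^ b \<or> length (I s v) \<le> 2 ^ b" using len by simp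
          fix j assume j: "take j v \<in> A (Suc k)" "start s v < j" "j \<le> length v"
          let ?q = "take j v"
          have sq: "start s ?q = start s v" using start_take j by simp
          have It: "I s v = I s ?q @ drop j v" using I_take j by simp
          have "R ?q = R v" using Rv k j se start_same[of "Suc s" v j]
            by (intro same_R[of _ _ "Suc s"]) (auto simp: W_take_le)
          then show "bt F g (I s ?q) ?X"
            using less.prems(4-5) e It j sq Suc se Rv
            by (intro less.IH) (auto simp: start_less_length)
        qed (use vP less.prems e st in auto)
        then show ?thesis by (rule bt_mono') (use e Suc kb in auto)
      next
        case F: False
        have "bt F g (I s v) (Suc (h + 2 * b + 1))"
        proof (rule piece[where k = "Suc k" and j = b and h = h])
          show "2 ^ Suc k \<le> (2::nat) ^ b \<or> length (I s v) \<le> 2 ^ b" using len by simp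
        qed (use F vP less.prems e st in auto)
        then show ?thesis by (rule bt_mono') (use e Suc in auto)
      qed
    next
      case True
      note sp = I_split[OF True]
      let ?p = "pre s v" and ?e = "v ! (start s v - 1)"
      have e: "I r v = (I s ?p @ [?e]) @ I s v" using sp(2) Suc by (simp add: pre_def)
      have conf: "start b v \<le> start s v" "start b ?p \<le> start s ?p"
        using confined_after_split[OF True, of b] less.prems(4) Suc by auto
      let ?X = "3 * b + (b - k) + h + 2 * b + 1"
      have pc: "bt F g (I s (take i v)) (Suc ?X)"
        if nz: "I s (take i v) \<noteq> []" "I s (take i v) \<in> F"
          "hopset (take i v) (hoplen s (Suc k) (take i v)) (Suc k) \<subseteq> F"
          and W: "W (I s (take i v)) < 2 ^ b" and sub: "set (I s (take i v)) \<subseteq> set (I r v)"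
          and si: "start (Suc s) v \<le> start s (take i v)"
          and cf: "start b (take i v) \<le> start s (take i v)" for i
      proof (rule piece[where k = "Suc k" and j = b and h = h])
        show "take i v \<in> P" using vP by (rule take_P)
        show "2 ^ Suc k \<le> (2::nat) ^ b \<or> length (I s (take i v)) \<le> 2 ^ b"
          using W length_le_W[of "I s (take i v)"] by simp
        fix j assume j: "take j (take i v) \<in> A (Suc k)" "start s (take i v) < j" "j \<le> length (take i v)"
        let ?q = "take j (take i v)"
        have sq: "start s ?q = start s (take i v)" by (rule start_take) (use j in auto)
        have cq: "start b ?q \<le> start s ?q" using start_take[of b "take i v" j] cf j sq by simp
        have It: "I s (take i v) = I s ?q @ drop j (take i v)" by (rule I_take) (use j in auto)
        have nq: "I s ?q \<noteq> []" using j sq by (simp add: start_less_length)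
        have Wq: "W (I s ?q) < 2 ^ b" using W It by simp
        have gq: "\<And>x. x \<in> set (I s ?q) \<Longrightarrow> g x \<le> h" using less.prems(5) sub It by auto
        have Rq: "R ?q \<le> R v" using R_take le_trans by metis
        have qv: "?q = take j v" using j(3) by (simp add: min_absorb1)
        have RR: "R ?q = R v" if "0 < k"
          unfolding qv using Rv that si j start_same[of "Suc s" v j]
          by (intro same_R[of _ _ "Suc s"]) (auto simp: W_take_le)
        show "bt F g (I s ?q) ?X"
        proof (cases "R ?q \<le> s")
          case True
          then have k0: "k = 0" using RR Rv by (cases k) auto
          have eq: "I s ?q = I (R ?q) ?q" using I_R True by simp
          have s0: "start (R ?q) ?q = start s ?q"
            using start_full[of ?q] bl_bound[of "W ?q"] bl_le_iff[of "W ?q" s] True by (simp add: R_def)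
          have "bt F g (I (R ?q) ?q) (3 * min (R ?q) b + (b - 0) + h + 2 * b + 1)"
            by (rule aligned_local_bound) (use j(1) A_subset_P nq Wq gq eq cq s0 in auto)
          then show ?thesis by (rule bt_mono') (use eq True k0 in auto)
        next
          case False
          have "R ?q - s \<le> Suc k" using Rq Rv by linarith
          then have qA: "?q \<in> A (R ?q - s)" using A_antimono j(1) by blast
          have "bt F g (I s ?q) (3 * min s b + (b - (R ?q - s)) + h + 2 * b + 1)"
            by (rule aligned_local_bound) (use qA False nq Wq gq cq in auto)
          moreover have "b - (R ?q - s) \<le> b - k" using RR Rv by (cases k) auto
          ultimately show ?thesis by (elim bt_mono) simp
        qed
      qed (use that less.prems(5) in auto)
      have WI: "W (I r v) = W (I s ?p) + wt ?e + W (I s v)" by (simp add: e)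
      have bv: "bt F g (I s v) (Suc (Suc ?X))" if "I s v \<noteq> []"
        by (rule bt_mono'[OF pc[of "length v"]])
          (use that st(2,5) less.prems(4) WI e start_antimono[of s "Suc s" v] conf in auto)
      have bp: "bt F g (I s ?p) (Suc ?X)" if "I s ?p \<noteq> []"
        by (rule bt_mono'[OF pc[of "start s v - 1"]])
          (use that st(3,6) less.prems(4) WI e sp(1) conf in \<open>auto simp: pre_def\<close>)
      have "g ?e \<le> Suc ?X" using less.prems(5)[of ?e] e by simp
      then have be: "bt F g [?e] (Suc ?X)" using letter_F[OF vP, of ?e] sp(3) by (auto intro: bt.leaf)
      have "bt F g (I s ?p @ [?e]) (Suc (Suc ?X))" using bp be st(4) by (intro bt_append) auto
      then have "bt F g ((I s ?p @ [?e]) @ I s v) (Suc (Suc (Suc ?X)))"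
        by (rule bt_append[OF _ bv]) (use st(1) less.prems(3) e Suc in simp_all)
      then show ?thesis by (rule bt_mono') (use e Suc in simp_all)
    qed
  qed
qed

text \<open>Blocks and hop words are balanced by \<open>hop_bound\<close>. Any other stored word is
  a cell piece, or such a piece and one letter; at most one application of \<open>piece\<close>
  reduces it to pieces that \<open>local_bound\<close> controls.\<close>

lemma local_bound_F:
  assumes "u \<in> F" "W u < 2 ^ b" and g: "\<And>x. x \<in> set u \<Longrightarrow> g x \<le> h"
  shows "bt F g u (h + 6 * b + 6)"
proof -
  obtain k v where kv: "v \<in> A k" "u \<in> E k v" "u \<noteq> []" using assms(1) unfolding F_def by auto
  have vP: "v \<in> P" using kv A_subset_P by blast
  have len: "length u \<le> 2 ^ b" using assms(2) length_le_W[of u] by simp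
  have hop: ?thesis if "hop_bound 2 F u"
    by (rule bt_mono[OF hop_boundD[OF that, of g h b]]) (use g len in auto)
  show ?thesis
  proof (cases "u = lastn (2 ^ k) v")
    case True
    then have "v \<noteq> []" using kv(3) by (auto simp: lastn_def)
    then have "u \<in> Blk" using True BlkI kv(1) by simp
    then show ?thesis using hop hop_bound_subset[OF hop_bound_12[OF hop_bound_block] Blk_subset_F] by blast
  next
    case False
    then have k: "k < R v" using kv(2) by (auto simp: E_def split: if_splits)
    define s where "s = R v - Suc k"
    have Rv: "R v = Suc s + k" using k by (simp add: s_def)
    note st = stored[OF kv(1) Rv]
    let ?p = "pre s v" and ?e = "v ! (start s v - 1)" and ?X = "h + 6 * b + 4"
    have v0: "v \<noteq> []" using k by (auto simp: R_def)
    have ev: "?e \<in> set v" using v0 start_le[of s v] by (cases "start s v") auto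
    have pc: "bt F g (I s (take i v)) (Suc ?X)"
      if nz: "I s (take i v) \<noteq> []" "I s (take i v) \<in> F"
        "hopset (take i v) (hoplen s (Suc k) (take i v)) (Suc k) \<subseteq> F"
        and W: "W (I s (take i v)) < 2 ^ b" and sub: "set (I s (take i v)) \<subseteq> set u" for i
    proof (rule piece[where k = "Suc k" and j = b and h = h])
      show "take i v \<in> P" using vP by (rule take_P)
      show "2 ^ Suc k \<le> (2::nat) ^ b \<or> length (I s (take i v)) \<le> 2 ^ b"
        using W length_le_W[of "I s (take i v)"] by simp
      fix j assume j: "take j (take i v) \<in> A (Suc k)" "start s (take i v) < j" "j \<le> length (take i v)"
      let ?q = "take j (take i v)"
      have sq: "start s ?q = start s (take i v)" by (rule start_take) (use j in auto)
      have It: "I s (take i v) = I s ?q @ drop j (take i v)" by (rule I_take) (use j in auto)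
      have nq: "I s ?q \<noteq> []" using j sq by (simp add: start_less_length)
      have Wq: "W (I s ?q) < 2 ^ b" using W It by simp
      have gq: "\<And>x. x \<in> set (I s ?q) \<Longrightarrow> g x \<le> h" using g sub It by auto
      have Rq: "R ?q \<le> R v" using R_take le_trans by metis
      show "bt F g (I s ?q) ?X"
      proof (cases "R ?q \<le> s")
        case True
        have eq: "I s ?q = I (R ?q) ?q" using I_R True by simp
        have "bt F g (I (R ?q) ?q) (3 * b + 3 + (b - 0) + h + 2 * b + 1)"
          by (rule local_bound) (use j(1) A_subset_P nq Wq gq eq in auto)
        then show ?thesis by (rule bt_mono') (use eq True in auto)
      next
        case False
        have "R ?q - s \<le> Suc k" using Rq Rv by linarith
        then have qA: "?q \<in> A (R ?q - s)" using A_antimono j(1) by blast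
        have "bt F g (I s ?q) (3 * b + 3 + (b - (R ?q - s)) + h + 2 * b + 1)"
          by (rule local_bound) (use qA False nq Wq gq in auto)
        then show ?thesis by (rule bt_mono) simp
      qed
    qed (use that g in auto)
    have be: "bt F g [?e] (Suc ?X)" if "?e \<in> set u"
      using letter_F[OF vP ev] g[OF that] by (auto intro: bt.leaf)
    consider "u = I (Suc s) v" | "u = I s ?p" | "u = I s v" | "u = I s ?p @ [?e]"
      | "u \<in> hopset v (hoplen s (Suc k) v) (Suc k)" | "u \<in> hopset ?p (hoplen s (Suc k) ?p) (Suc k)"
      using kv(2) False k by (auto simp: E_def Let_def s_def)
    then show ?thesis
    proof cases
      case 1
      have "bt F g (I (Suc s) v) (3 * b + 3 + (b - k) + h + 2 * b + 1)"
        by (rule local_bound) (use kv Rv 1 assms in auto)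
      then show ?thesis by (rule bt_mono') (use 1 in auto)
    next
      case 2
      show ?thesis
        by (rule bt_mono'[OF pc[of "start s v - 1"]])
          (use 2 kv(3) st(3,6) assms(2) in \<open>auto simp: pre_def\<close>)
    next
      case 3
      show ?thesis
        by (rule bt_mono'[OF pc[of "length v"]]) (use 3 kv(3) st(2,5) assms(2) in auto)
    next
      case 4
      have "bt F g (I s ?p) (Suc ?X)" if "I s ?p \<noteq> []"
        by (rule bt_mono'[OF pc[of "start s v - 1"]])
          (use 4 that st(3,6) assms(2) in \<open>auto simp: pre_def\<close>)
      then have "bt F g (I s ?p @ [?e]) (Suc (Suc ?X))" using be 4 st(4) by (intro bt_append) auto
      then show ?thesis by (rule bt_mono') (use 4 in auto)
    next
      case 5
      then show ?thesis using hop hopset_F[OF st(5)] by blast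
    next
      case 6
      then show ?thesis using hop hopset_F[OF st(6)] by blast
    qed
  qed
qed

text \<open>A whole word is its own cell for \<open>r = R v\<close> and \<open>k = 0\<close>; the
  factors 3 and 2 of \<open>biased_bound\<close> add up to the 5 of the hypothesis on letters, so
  that the bounds telescope from one heavy path to the next.\<close>

lemma main_bound:
  assumes "v \<in> P" "v \<noteq> []" "\<And>x. x \<in> set v \<Longrightarrow> g x \<le> 5 * bl (wt x) + M"
  shows "bt F g v (5 * bl (W v) + M + 2)"
proof -
  have e: "I (R v) v = v" by (rule I_R) simp
  have "bt F g (I (R v) v) (3 * R v + 2 * R v + M + 2)"
    by (rule biased_bound[of _ 0]) (use assms e in auto)
  then show ?thesis by (rule bt_mono') (use e in \<open>auto simp: R_def\<close>)
qed

end

section \<open>Locally balanced families\<close>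

lemma bt_restrict: "bt F g u h \<Longrightarrow> set u \<subseteq> X \<Longrightarrow> bt {y \<in> F. set y \<subseteq> X} g u h"
proof (induction rule: bt.induct)
  case (node u h v h')
  then have "bt {y \<in> F. set y \<subseteq> X} g u h" "bt {y \<in> F. set y \<subseteq> X} g v h" by auto
  then show ?case by (rule bt.node) (use node in auto)
qed (auto intro: bt.leaf)

text \<open>Substitution of trees for leaves; the leaf heights \<open>g\<close> exist for this
  composition.\<close>

lemma bt_concat:
  assumes "bt F g u h" "\<And>y. y \<in> F \<Longrightarrow> concat y \<in> Fs" "\<And>x. x \<in> set u \<Longrightarrow> bt Fs g' x (g x)"
  shows "bt Fs g' (concat u) h"
  using assms
proof (induction rule: bt.induct)
  case (leaf x h)
  have "bt Fs g' x (g x)" by (rule leaf.prems) simp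
  then show ?case using leaf(2) by (simp add: bt_mono)
next
  case (node u h v h')
  then have "bt Fs g' (concat u) h" "bt Fs g' (concat v) h" by auto
  moreover have "concat u @ concat v \<in> Fs" using node.prems(1)[OF node.hyps(3)] by simp
  ultimately show ?case using bt.node[OF _ _ _ node.hyps(4)] by simp
qed

lemma bt_concat_rev:
  assumes "bt F g u h" "\<And>y. y \<in> F \<Longrightarrow> concat (rev y) \<in> Fs" "\<And>x. x \<in> set u \<Longrightarrow> bt Fs g' x (g x)"
  shows "bt Fs g' (concat (rev u)) h"
  using assms
proof (induction rule: bt.induct)
  case (leaf x h)
  have "bt Fs g' x (g x)" by (rule leaf.prems) simp
  then show ?case using leaf(2) by (simp add: bt_mono)
next
  case (node u h v h')
  then have "bt Fs g' (concat (rev u)) h" "bt Fs g' (concat (rev v)) h" by auto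
  moreover have "concat (rev v) @ concat (rev u) \<in> Fs" using node.prems(1)[OF node.hyps(3)] by simp
  ultimately show ?case using bt.node[OF _ _ _ node.hyps(4)] by simp
qed

text \<open>The maximum with 1 makes every weight positive, as \<open>trie\<close> demands; on the
  nonempty strings that occur it is the length.\<close>

definition wlen :: "'a list \<Rightarrow> nat" where "wlen x = max 1 (length x)"

lemma wlen_pos: "0 < wlen x" and wlen_nonempty: "x \<noteq> [] \<Longrightarrow> wlen x = length x"
  by (auto simp: wlen_def max_def Suc_le_eq)

text \<open>An SLP reduced to the strings it derives: variables with equal values become one
  element.\<close>

definition closed_family :: "'a list set \<Rightarrow> bool" where
  "closed_family V \<longleftrightarrow> [] \<notin> V \<and> (\<forall>s \<in> V. length s = 1 \<or> (\<exists>u \<in> V. \<exists>v \<in> V. s = u @ v))"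

locale family =
  fixes V :: "'a list set"
  assumes finite_V: "finite V" and closed_V: "closed_family V"
begin

lemma V_nonempty: "s \<in> V \<Longrightarrow> s \<noteq> []"
  using closed_V by (auto simp: closed_family_def)

definition cut :: "'a list \<Rightarrow> 'a list \<times> 'a list" where
  "cut s = (SOME p. fst p \<in> V \<and> snd p \<in> V \<and> s = fst p @ snd p)"

definition sl :: "'a list \<Rightarrow> 'a list" where "sl s = fst (cut s)"
definition sr :: "'a list \<Rightarrow> 'a list" where "sr s = snd (cut s)"

lemma cut:
  assumes "s \<in> V" "length s \<noteq> 1"
  shows "sl s \<in> V" "sr s \<in> V" "s = sl s @ sr s" "length (sl s) < length s" "length (sr s) < length s"
proof -
  have "\<exists>p. fst p \<in> V \<and> snd p \<in> V \<and> s = fst p @ snd p"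
    using assms closed_V by (auto simp: closed_family_def)
  from someI_ex[OF this] show *: "sl s \<in> V" "sr s \<in> V" "s = sl s @ sr s"
    unfolding sl_def sr_def cut_def by blast+
  have "sl s \<noteq> []" "sr s \<noteq> []" using * V_nonempty by auto
  then show "length (sl s) < length s" "length (sr s) < length s"
    using arg_cong[OF *(3), of length] by auto
qed

section \<open>Heavy paths of a closed family\<close>

text \<open>Both words list the siblings from the end of the path upwards, so that each recursive
  step appends one letter. The left siblings thereby appear in reverse, which
  \<open>concat (rev _)\<close> undoes.\<close>

function heavy_path :: "'a list \<Rightarrow> 'a list list \<times> 'a list \<times> 'a list list" where
  "heavy_path s = (if s \<in> V \<and> length s \<noteq> 1 then
     (if length (sr s) \<le> length (sl s)
      then (case heavy_path (sl s) of (l, a, r) \<Rightarrow> (l, a, r @ [sr s]))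
      else (case heavy_path (sr s) of (l, a, r) \<Rightarrow> (l @ [sl s], a, r))) else ([], s, []))"
  by auto
termination by (relation "measure length") (auto simp: cut)

declare heavy_path.simps [simp del]

definition lw where "lw s = fst (heavy_path s)"
definition mid where "mid s = fst (snd (heavy_path s))"
definition rw where "rw s = snd (snd (heavy_path s))"

lemma heavy_path_leaf: "length s = 1 \<Longrightarrow> lw s = [] \<and> mid s = s \<and> rw s = []"
  by (simp add: lw_def mid_def rw_def heavy_path.simps[of s])

lemma heavy_path_left:
  "s \<in> V \<Longrightarrow> length s \<noteq> 1 \<Longrightarrow> length (sr s) \<le> length (sl s) \<Longrightarrow>
    lw s = lw (sl s) \<and> mid s = mid (sl s) \<and> rw s = rw (sl s) @ [sr s]"
  by (simp add: lw_def mid_def rw_def heavy_path.simps[of s] split: prod.split)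

lemma heavy_path_right:
  "s \<in> V \<Longrightarrow> length s \<noteq> 1 \<Longrightarrow> \<not> length (sr s) \<le> length (sl s) \<Longrightarrow>
    lw s = lw (sr s) @ [sl s] \<and> mid s = mid (sr s) \<and> rw s = rw (sr s)"
  by (simp add: lw_def mid_def rw_def heavy_path.simps[of s] split: prod.split)

lemma heavy_induct [consumes 1, case_names leaf left right]:
  assumes "s \<in> V" "\<And>s. s \<in> V \<Longrightarrow> length s = 1 \<Longrightarrow> Q s"
    "\<And>s. s \<in> V \<Longrightarrow> length s \<noteq> 1 \<Longrightarrow> length (sr s) \<le> length (sl s) \<Longrightarrow> Q (sl s) \<Longrightarrow> Q s"
    "\<And>s. s \<in> V \<Longrightarrow> length s \<noteq> 1 \<Longrightarrow> \<not> length (sr s) \<le> length (sl s) \<Longrightarrow> Q (sr s) \<Longrightarrow> Q s"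
  shows "Q s"
  using assms(1)
proof (induction "length s" arbitrary: s rule: less_induct)
  case less
  show ?case
  proof (cases "length s = 1")
    case False
    note c = cut[OF less.prems False]
    show ?thesis
      using assms(3)[OF less.prems False] assms(4)[OF less.prems False] less.hyps c by blast
  qed (use assms(2) less in blast)
qed

lemma heavy_path_props:
  assumes "s \<in> V"
  shows "s = concat (rev (lw s)) @ mid s @ concat (rw s) \<and> length (mid s) = 1 \<and> mid s \<in> V \<and>
    (\<forall>x \<in> set (lw s) \<union> set (rw s). x \<in> V \<and> 2 * length x \<le> length s)"
  using assms
proof (induction rule: heavy_induct)
  case (leaf s)
  then show ?case using heavy_path_leaf[of s] by simp
next
  case (left s)
  note c = cut[OF left.hyps(1,2)]
  have l: "length s = length (sl s) + length (sr s)" using c(3) by (metis length_append)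
  show ?case
  proof (intro conjI ballI)
    show "s = concat (rev (lw s)) @ mid s @ concat (rw s)"
      using heavy_path_left[OF left.hyps(1-3)] left.IH c(3) by (metis append.assoc concat.simps concat_append append_Nil2)
    show "length (mid s) = 1" "mid s \<in> V" using heavy_path_left[OF left.hyps(1-3)] left.IH by auto
    fix x assume "x \<in> set (lw s) \<union> set (rw s)"
    then have "x = sr s \<or> x \<in> set (lw (sl s)) \<union> set (rw (sl s))" using heavy_path_left[OF left.hyps(1-3)] by auto
    then consider "x = sr s" | "x \<in> V" "2 * length x \<le> length (sl s)" using left.IH by blast
    then show "x \<in> V" "2 * length x \<le> length s" by (cases; use c l left.hyps(3) in simp)+
  qed
next
  case (right s)
  note c = cut[OF right.hyps(1,2)]
  have l: "length s = length (sl s) + length (sr s)" using c(3) by (metis length_append)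
  show ?case
  proof (intro conjI ballI)
    show "s = concat (rev (lw s)) @ mid s @ concat (rw s)"
    proof -
      have "concat (rev (lw s)) = sl s @ concat (rev (lw (sr s)))" using heavy_path_right[OF right.hyps(1-3)] by simp
      then show ?thesis using heavy_path_right[OF right.hyps(1-3)] right.IH c(3) by (metis append.assoc)
    qed
    show "length (mid s) = 1" "mid s \<in> V" using heavy_path_right[OF right.hyps(1-3)] right.IH by auto
    fix x assume "x \<in> set (lw s) \<union> set (rw s)"
    then have "x = sl s \<or> x \<in> set (lw (sr s)) \<union> set (rw (sr s))" using heavy_path_right[OF right.hyps(1-3)] by auto
    then consider "x = sl s" | "x \<in> V" "2 * length x \<le> length (sr s)" using right.IH by blast
    then show "x \<in> V" "2 * length x \<le> length s" by (cases; use c l right.hyps(3) in simp)+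
  qed
qed

text \<open>The last letter is the topmost sibling on this side; without it the word belongs to a
  node further down the same heavy path.\<close>

lemma rw_prefix: "s \<in> V \<Longrightarrow> rw s = v @ [x] \<Longrightarrow> v \<in> insert [] (rw ` V)"
proof (induction rule: heavy_induct)
  case (leaf s)
  then show ?case using heavy_path_leaf[of s] by simp
next
  case (left s)
  then show ?case using heavy_path_left[OF left.hyps(1-3)] cut[OF left.hyps(1,2)] by auto
next
  case (right s)
  then show ?case using heavy_path_right[OF right.hyps(1-3)] by auto
qed

lemma lw_prefix: "s \<in> V \<Longrightarrow> lw s = v @ [x] \<Longrightarrow> v \<in> insert [] (lw ` V)"
proof (induction rule: heavy_induct)
  case (leaf s)
  then show ?case using heavy_path_leaf[of s] by simp
next
  case (left s)
  then show ?case using heavy_path_left[OF left.hyps(1-3)] by auto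
next
  case (right s)
  then show ?case using heavy_path_right[OF right.hyps(1-3)] cut[OF right.hyps(1,2)] by auto
qed

sublocale right: trie "insert [] (rw ` V)" wlen
proof
  fix v x assume "v @ [x] \<in> insert [] (rw ` V)"
  then obtain s where "s \<in> V" "rw s = v @ [x]" by auto
  then show "v \<in> insert [] (rw ` V)" by (rule rw_prefix)
qed (use finite_V wlen_pos in auto)

sublocale left: trie "insert [] (lw ` V)" wlen
proof
  fix v x assume "v @ [x] \<in> insert [] (lw ` V)"
  then obtain s where "s \<in> V" "lw s = v @ [x]" by auto
  then show "v \<in> insert [] (lw ` V)" by (rule lw_prefix)
qed (use finite_V wlen_pos in auto)

lemma length_concat_V:
  assumes "set u \<subseteq> V" shows "right.W u = length (concat u)" "left.W u = length (concat (rev u))"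
proof -
  have "(\<Sum>x\<leftarrow>u. wlen x) = (\<Sum>x\<leftarrow>u. length x)"
    using assms V_nonempty wlen_nonempty by (intro arg_cong[of _ _ sum_list] map_cong) auto
  then show "right.W u = length (concat u)" "left.W u = length (concat (rev u))"
    by (simp_all add: right.W_def left.W_def length_concat rev_map[symmetric] sum_list_rev)
qed

text \<open>The choice of \<open>hopset\<close> says nothing about the letters involved, so letters
  outside \<open>V\<close> are excluded explicitly.\<close>

definition FR where "FR = {y \<in> right.F. set y \<subseteq> V}"
definition FL where "FL = {y \<in> left.F. set y \<subseteq> V}"

text \<open>The last set contains the nodes that join the end of a heavy path with its right
  siblings before the left siblings are put in front.\<close>

definition bal :: "'a list set" where
  "bal = V \<union> concat ` FR \<union> (\<lambda>y. concat (rev y)) ` FL \<union> (\<lambda>s. mid s @ concat (rw s)) ` V"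

lemma FR_bal: "y \<in> FR \<Longrightarrow> concat y \<in> bal" and FL_bal: "y \<in> FL \<Longrightarrow> concat (rev y) \<in> bal"
  by (auto simp: bal_def)

lemma finite_bal: "finite bal"
  using finite_V right.finite_F left.finite_F by (simp add: bal_def FR_def FL_def)

text \<open>Each trie has at most \<open>2 * card V\<close> nodes and so yields at most
  \<open>64 * card V\<close> words; \<open>V\<close> and the joining nodes contribute
  \<open>card V\<close> each.\<close>

lemma card_bal:
  assumes "V \<noteq> {}" shows "card bal \<le> 130 * card V"
proof -
  have V: "1 \<le> card V" using assms finite_V by (simp add: Suc_leI card_gt_0_iff)
  have c: "card (insert [] (f ` V)) \<le> 2 * card V" for f :: "'a list \<Rightarrow> 'a list list"
    using card_insert_le_m1 card_image_le[OF finite_V, of f] V finite_V by (simp add: card_insert_if)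
  have "card (concat ` FR) \<le> card right.F"
    using card_image_le[of FR concat] card_mono[OF right.finite_F, of FR] right.finite_F
    by (fastforce simp: FR_def)
  then have 1: "card (concat ` FR) \<le> 64 * card V" using right.card_F c[of rw] by linarith
  have "card ((\<lambda>y. concat (rev y)) ` FL) \<le> card left.F"
    using card_image_le[of FL "\<lambda>y. concat (rev y)"] card_mono[OF left.finite_F, of FL] left.finite_F
    by (fastforce simp: FL_def)
  then have 2: "card ((\<lambda>y. concat (rev y)) ` FL) \<le> 64 * card V" using left.card_F c[of lw] by linarith
  have 3: "card ((\<lambda>s. mid s @ concat (rw s)) ` V) \<le> card V" by (rule card_image_le[OF finite_V])
  have "card bal \<le> card (V \<union> concat ` FR \<union> (\<lambda>y. concat (rev y)) ` FL) + card ((\<lambda>s. mid s @ concat (rw s)) ` V)"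
    unfolding bal_def by (rule card_Un_le)
  moreover have "card (V \<union> concat ` FR \<union> (\<lambda>y. concat (rev y)) ` FL) \<le>
      card (V \<union> concat ` FR) + card ((\<lambda>y. concat (rev y)) ` FL)" by (rule card_Un_le)
  moreover have "card (V \<union> concat ` FR) \<le> card V + card (concat ` FR)" by (rule card_Un_le)
  ultimately show ?thesis using 1 2 3 by linarith
qed

lemma bl_half: "0 < x \<Longrightarrow> 2 * x \<le> n \<Longrightarrow> Suc (bl x) \<le> bl n"
proof -
  assume x: "0 < x" "2 * x \<le> n"
  have "bl x - 1 < bl x" using bl_pos[OF x(1)] by simp
  then have "2 ^ (bl x - 1) \<le> x" by (simp add: bl_less_iff)
  then have "2 * 2 ^ (bl x - 1) \<le> n" using x(2) by linarith
  then have "2 ^ bl x \<le> n" using bl_pos[OF x(1)] by (simp flip: power_Suc)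
  then show ?thesis by (simp add: Suc_le_eq bl_less_iff)
qed

text \<open>A sibling of a heavy path has at most half the length, hence one bit less. Of its 9
  levels per bit, 5 have the form that \<open>main_bound\<close> telescopes and 4 go into
  \<open>M = 4 * (b - 1)\<close>. The missing 4 pay for the additive 2 of \<open>main_bound\<close>
  and the two nodes on top.\<close>

lemma bt_V: "s \<in> V \<Longrightarrow> bt bal (\<lambda>_. 0) s (9 * bl (length s))"
proof (induction "length s" arbitrary: s rule: less_induct)
  case less
  note hp = heavy_path_props[OF less.prems]
  let ?b = "bl (length s)"
  have b: "0 < ?b" using V_nonempty[OF less.prems] by (intro bl_pos) simp
  define g where "g = (\<lambda>x::'a list. 9 * bl (length x))"
  define M where "M = 4 * (?b - 1)"
  have letters: "x \<in> V" "length x < length s" "g x \<le> 5 * bl (wlen x) + M" "bt bal (\<lambda>_. 0) x (g x)"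
    if "x \<in> set (lw s) \<union> set (rw s)" for x
  proof -
    show x: "x \<in> V" using that hp by blast
    then have x0: "0 < length x" using V_nonempty by auto
    moreover have x2: "2 * length x \<le> length s" using that hp by blast
    ultimately show xs: "length x < length s" by linarith
    have "Suc (bl (length x)) \<le> ?b" using bl_half[OF x0 x2] .
    moreover have "wlen x = length x" using x0 wlen_nonempty by auto
    ultimately show "g x \<le> 5 * bl (wlen x) + M" by (simp add: g_def M_def)
    show "bt bal (\<lambda>_. 0) x (g x)" unfolding g_def by (rule less.hyps[OF xs x])
  qed
  have lV: "set (lw s) \<subseteq> V" "set (rw s) \<subseteq> V" using letters(1) by auto
  let ?X = "5 * ?b + M + 2"
  have "length (concat (rw s)) \<le> length s" "length (concat (rev (lw s))) \<le> length s"
    using arg_cong[OF conjunct1[OF hp], of length] by auto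
  then have W: "bl (right.W (rw s)) \<le> ?b" "bl (left.W (lw s)) \<le> ?b"
    using length_concat_V lV by (auto intro: bl_mono)
  have r: "bt bal (\<lambda>_. 0) (concat (rw s)) ?X" if "rw s \<noteq> []"
  proof -
    have "bt right.F g (rw s) (5 * bl (right.W (rw s)) + M + 2)"
      by (rule right.main_bound) (use that letters less.prems in auto)
    then have "bt FR g (rw s) (5 * bl (right.W (rw s)) + M + 2)"
      unfolding FR_def by (rule bt_restrict[OF _ lV(2)])
    then have "bt bal (\<lambda>_. 0) (concat (rw s)) (5 * bl (right.W (rw s)) + M + 2)"
      by (rule bt_concat) (use FR_bal letters in auto)
    then show ?thesis by (rule bt_mono) (use W in simp)
  qed
  have l: "bt bal (\<lambda>_. 0) (concat (rev (lw s))) ?X" if "lw s \<noteq> []"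
  proof -
    have "bt left.F g (lw s) (5 * bl (left.W (lw s)) + M + 2)"
      by (rule left.main_bound) (use that letters less.prems in auto)
    then have "bt FL g (lw s) (5 * bl (left.W (lw s)) + M + 2)"
      unfolding FL_def by (rule bt_restrict[OF _ lV(1)])
    then have "bt bal (\<lambda>_. 0) (concat (rev (lw s))) (5 * bl (left.W (lw s)) + M + 2)"
      by (rule bt_concat_rev) (use FL_bal letters in auto)
    then show ?thesis by (rule bt_mono) (use W in simp)
  qed
  have m: "bt bal (\<lambda>_. 0) (mid s) ?X"
  proof -
    obtain a where a: "mid s = [a]" using hp by (metis One_nat_def length_0_conv length_Suc_conv)
    have "mid s \<in> bal" using hp by (simp add: bal_def)
    then show ?thesis unfolding a by (intro bt.leaf) auto
  qed
  have mr: "bt bal (\<lambda>_. 0) (mid s @ concat (rw s)) (Suc ?X)"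
  proof (rule bt_append[OF m])
    show "concat (rw s) \<noteq> [] \<Longrightarrow> bt bal (\<lambda>_. 0) (concat (rw s)) ?X" using r by (cases "rw s = []") auto
    show "mid s @ concat (rw s) \<in> bal" using less.prems by (simp add: bal_def)
  qed (use hp in auto)
  have sb: "s \<in> bal" using less.prems by (simp add: bal_def)
  have "bt bal (\<lambda>_. 0) (concat (rev (lw s)) @ mid s @ concat (rw s)) (Suc (Suc ?X))"
  proof (rule bt_append)
    show "concat (rev (lw s)) \<noteq> [] \<Longrightarrow> bt bal (\<lambda>_. 0) (concat (rev (lw s))) (Suc ?X)"
      using l by (cases "lw s = []") (auto intro: bt_mono)
    show "bt bal (\<lambda>_. 0) (mid s @ concat (rw s)) (Suc ?X)" by (rule mr)
    show "concat (rev (lw s)) @ mid s @ concat (rw s) \<in> bal" using conjunct1[OF hp] sb by simp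
    show "concat (rev (lw s)) @ mid s @ concat (rw s) \<noteq> []" using hp by auto
  qed
  then have "bt bal (\<lambda>_. 0) s (Suc (Suc ?X))" using conjunct1[OF hp] by simp
  then show ?case by (rule bt_mono) (use b in \<open>simp add: M_def\<close>)
qed

text \<open>With \<open>b\<close> the bit length, letters have height at most \<open>9 * b\<close>
  and the word over them adds \<open>6 * b + 6\<close>, together at most \<open>21 * b\<close> as
  \<open>b\<close> is positive; one more level serves the joining nodes.\<close>

lemma bt_bal: "s \<in> bal \<Longrightarrow> bt bal (\<lambda>_. 0) s (22 * bl (length s))"
proof -
  assume s: "s \<in> bal"
  define g where "g = (\<lambda>x::'a list. 9 * bl (length x))"
  have gx: "bt bal (\<lambda>_. 0) x (g x)" if "x \<in> V" for x using bt_V[OF that] by (simp add: g_def)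
  have R: "bt bal (\<lambda>_. 0) (concat y) (21 * bl (length (concat y)))" if "y \<in> FR" for y
  proof -
    have y: "y \<in> right.F" "set y \<subseteq> V" using that by (auto simp: FR_def)
    let ?b = "bl (length (concat y))"
    have "y \<noteq> []" using y by (auto simp: right.F_def)
    then have b: "0 < ?b" using y V_nonempty by (intro bl_pos) (cases y, auto)
    have "bt right.F g y (9 * ?b + 6 * ?b + 6)"
    proof (rule right.local_bound_F[OF y(1)])
      show "right.W y < 2 ^ ?b" using length_concat_V[OF y(2)] bl_bound by simp
      fix x assume "x \<in> set y"
      then have "length x \<le> length (concat y)" by (simp add: length_concat member_le_sum_list)
      then show "g x \<le> 9 * ?b" by (simp add: g_def bl_mono)
    qed
    then have "bt FR g y (9 * ?b + 6 * ?b + 6)" unfolding FR_def by (rule bt_restrict[OF _ y(2)])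
    then have "bt bal (\<lambda>_. 0) (concat y) (9 * ?b + 6 * ?b + 6)"
      by (rule bt_concat) (use FR_bal gx y in auto)
    then show ?thesis by (rule bt_mono) (use b in simp)
  qed
  have L: "bt bal (\<lambda>_. 0) (concat (rev y)) (21 * bl (length (concat (rev y))))" if "y \<in> FL" for y
  proof -
    have y: "y \<in> left.F" "set y \<subseteq> V" using that by (auto simp: FL_def)
    let ?b = "bl (length (concat (rev y)))"
    have "y \<noteq> []" using y by (auto simp: left.F_def)
    then have b: "0 < ?b" using y V_nonempty by (intro bl_pos) (cases y, auto)
    have "bt left.F g y (9 * ?b + 6 * ?b + 6)"
    proof (rule left.local_bound_F[OF y(1)])
      show "left.W y < 2 ^ ?b" using length_concat_V[OF y(2)] bl_bound by simp
      fix x assume "x \<in> set y"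
      then have "length x \<le> length (concat (rev y))" by (simp add: length_concat member_le_sum_list)
      then show "g x \<le> 9 * ?b" by (simp add: g_def bl_mono)
    qed
    then have "bt FL g y (9 * ?b + 6 * ?b + 6)" unfolding FL_def by (rule bt_restrict[OF _ y(2)])
    then have "bt bal (\<lambda>_. 0) (concat (rev y)) (9 * ?b + 6 * ?b + 6)"
      by (rule bt_concat_rev) (use FL_bal gx y in auto)
    then show ?thesis by (rule bt_mono) (use b in simp)
  qed
  consider "s \<in> V" | y where "s = concat y" "y \<in> FR" | y where "s = concat (rev y)" "y \<in> FL"
    | t where "t \<in> V" "s = mid t @ concat (rw t)"
    using s by (auto simp: bal_def)
  then show ?thesis
  proof cases
    case 1
    from bt_V[OF this] show ?thesis by (rule bt_mono) simp
  next
    case 2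
    from R[OF 2(2)] show ?thesis by (rule bt_mono') (use 2 in auto)
  next
    case 3
    from L[OF 3(2)] show ?thesis by (rule bt_mono') (use 3 in auto)
  next
    case 4
    note hp = heavy_path_props[OF 4(1)]
    have ls: "length s = Suc (length (concat (rw t)))" using hp 4 by simp
    have b: "0 < bl (length s)" by (rule bl_pos) (simp add: ls)
    obtain a where a: "mid t = [a]" using hp by (metis One_nat_def length_0_conv length_Suc_conv)
    have m: "bt bal (\<lambda>_. 0) (mid t) (21 * bl (length s))"
    proof -
      have "mid t \<in> bal" using hp by (simp add: bal_def)
      then show ?thesis unfolding a by (intro bt.leaf) auto
    qed
    have r: "bt bal (\<lambda>_. 0) (concat (rw t)) (21 * bl (length s))" if "concat (rw t) \<noteq> []"
    proof -
      have rP: "rw t \<in> insert [] (rw ` V)" "rw t \<noteq> []" using 4(1) that by auto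
      have tV: "set (rw t) \<subseteq> V" using hp by blast
      have "bt right.F (\<lambda>_. 0) (rw t) (5 * bl (right.W (rw t)) + 0 + 2)"
        by (rule right.main_bound) (use rP in auto)
      then have "rw t \<in> right.F" by (rule bt_in)
      then have "rw t \<in> FR" using tV by (simp add: FR_def)
      from R[OF this] show ?thesis by (rule bt_mono) (simp add: ls bl_mono)
    qed
    have "bt bal (\<lambda>_. 0) (mid t @ concat (rw t)) (Suc (21 * bl (length s)))"
      by (rule bt_append[OF m r]) (use 4 a s in auto)
    then show ?thesis by (rule bt_mono') (use 4 b in auto)
  qed
qed

end

theorem balanced_family:
  assumes "finite V" "closed_family V" "V \<noteq> {}"
  obtains F where "finite F" "V \<subseteq> F" "card F \<le> 130 * card V"
    "\<And>s. s \<in> F \<Longrightarrow> bt F (\<lambda>_. 0) s (22 * bl (length s))"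
proof -
  interpret family V using assms by unfold_locales
  show thesis using that[of bal] finite_bal card_bal[OF assms(3)] bt_bal by (auto simp: bal_def)
qed

section \<open>Sizes of closed families, and the family of an SLP\<close>

text \<open>Keeps the nodes of one derivation tree of \<open>s\<close>. A bound in terms of the
  string length is needed because the word length is only known to be large relative to
  \<open>length S\<close>.\<close>

lemma closed_family_small:
  assumes "closed_family V" "s \<in> V"
  shows "\<exists>V' \<subseteq> V. closed_family V' \<and> s \<in> V' \<and> finite V' \<and> card V' \<le> 2 * length s - 1"
  using assms(2)
proof (induction "length s" arbitrary: s rule: less_induct)
  case less
  have s0: "s \<noteq> []" using less.prems assms(1) by (auto simp: closed_family_def)
  show ?case
  proof (cases "length s = 1")
    case True
    then show ?thesis using less.prems s0 by (intro exI[of _ "{s}"]) (auto simp: closed_family_def)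
  next
    case False
    then obtain u v where uv: "u \<in> V" "v \<in> V" "s = u @ v"
      using less.prems assms(1) by (auto simp: closed_family_def)
    have ne: "u \<noteq> []" "v \<noteq> []" using uv assms(1) by (auto simp: closed_family_def)
    obtain U where U: "U \<subseteq> V" "closed_family U" "u \<in> U" "finite U" "card U \<le> 2 * length u - 1"
      using less.hyps[of u] uv ne by auto
    obtain T where T: "T \<subseteq> V" "closed_family T" "v \<in> T" "finite T" "card T \<le> 2 * length v - 1"
      using less.hyps[of v] uv ne by auto
    have "closed_family (insert s (U \<union> T))"
      unfolding closed_family_def
    proof (intro conjI ballI)
      show "[] \<notin> insert s (U \<union> T)" using U T s0 by (auto simp: closed_family_def)
      fix x assume "x \<in> insert s (U \<union> T)"
      then consider "x = s" | "x \<in> U" | "x \<in> T" by blast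
      then show "length x = 1 \<or> (\<exists>y\<in>insert s (U \<union> T). \<exists>z\<in>insert s (U \<union> T). x = y @ z)"
      proof cases
        case 1 then show ?thesis using uv(3) U(3) T(3) by blast
      next
        case 2 then show ?thesis using U(2) unfolding closed_family_def by blast
      next
        case 3 then show ?thesis using T(2) unfolding closed_family_def by blast
      qed
    qed
    moreover have "card (insert s (U \<union> T)) \<le> Suc (card U + card T)"
      using card_Un_le[of U T] U(4) T(4) by (simp add: card_insert_if)
    moreover have "Suc (card U + card T) \<le> 2 * length s - 1"
      using U(5) T(5) ne uv(3) by (cases u; cases v) auto
    ultimately show ?thesis using U T less.prems by (intro exI[of _ "insert s (U \<union> T)"]) auto
  qed
qed

text \<open>The longer factor of a factorization has at least half the length and is a strictly
  shorter member, so every doubling uses up a member.\<close>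

lemma closed_family_length:
  assumes "closed_family V" "finite V" "s \<in> V"
  shows "length s \<le> 2 ^ card {t \<in> V. length t < length s}"
  using assms(3)
proof (induction "length s" arbitrary: s rule: less_induct)
  case less
  show ?case
  proof (cases "length s = 1")
    case True
    then show ?thesis by simp
  next
    case False
    then obtain u v where uv: "u \<in> V" "v \<in> V" "s = u @ v"
      using less.prems assms(1) by (auto simp: closed_family_def)
    have ne: "u \<noteq> []" "v \<noteq> []" using uv assms(1) by (auto simp: closed_family_def)
    define y where "y = (if length v \<le> length u then u else v)"
    have y: "y \<in> V" "length y < length s" "length s \<le> 2 * length y" using uv ne by (auto simp: y_def)
    have "insert y {t \<in> V. length t < length y} \<subseteq> {t \<in> V. length t < length s}" using y by auto
    then have "card (insert y {t \<in> V. length t < length y}) \<le> card {t \<in> V. length t < length s}"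
      using assms(2) by (intro card_mono) auto
    then have "Suc (card {t \<in> V. length t < length y}) \<le> card {t \<in> V. length t < length s}"
      using assms(2) by simp
    then have "(2::nat) ^ Suc (card {t \<in> V. length t < length y}) \<le> 2 ^ card {t \<in> V. length t < length s}"
      by (rule power_increasing) simp
    moreover have "length y \<le> 2 ^ card {t \<in> V. length t < length y}" using less.hyps y by blast
    ultimately show ?thesis using y(3) by simp
  qed
qed

text \<open>The reason why the working space of O(log N) words of a query is linear in the size of
  the SLP.\<close>

lemma closed_family_bl:
  assumes "closed_family V" "finite V" "s \<in> V"
  shows "bl (length s) \<le> card V"
proof -
  have "card {t \<in> V. length t < length s} < card V"
    using assms(2,3) by (intro psubset_card_mono) auto
  then have "(2::nat) ^ card {t \<in> V. length t < length s} < 2 ^ card V" by simp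
  then have "length s < 2 ^ card V" using closed_family_length[OF assms] by linarith
  then show ?thesis by (simp add: bl_le_iff)
qed

lemma derive_step_context: "derive_step G x y \<Longrightarrow> derive_step G (p @ x @ q) (p @ y @ q)"
proof (induction rule: derive_step.induct)
  case (1 X rhs us vs)
  from derive_step.intros[OF this, of "p @ us" "vs @ q"] show ?case by simp
qed

lemma derive_context: "(derive_step G)\<^sup>*\<^sup>* x y \<Longrightarrow> (derive_step G)\<^sup>*\<^sup>* (p @ x @ q) (p @ y @ q)"
  by (induction rule: rtranclp_induct) (auto intro: rtranclp.rtrancl_into_rtrancl derive_step_context)

lemma derives_rule:
  assumes "derives G X s" shows "\<exists>rhs. (X, rhs) \<in> rules G"
proof -
  have "[Inl X] \<noteq> map Inr s" by auto
  then obtain y where "derive_step G [Inl X] y"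
    using assms unfolding derives_def by (meson converse_rtranclpE)
  then show ?thesis by (cases rule: derive_step.cases) (auto simp: Cons_eq_append_conv)
qed

lemma derives_append:
  assumes "(X, [Inl Y, Inl Z]) \<in> rules G" "derives G Y s" "derives G Z t"
  shows "derives G X (s @ t)"
proof -
  have "derive_step G [Inl X] [Inl Y, Inl Z]" using derive_step.intros[OF assms(1), of "[]" "[]"] by simp
  moreover have "(derive_step G)\<^sup>*\<^sup>* [Inl Y, Inl Z] (map Inr s @ [Inl Z])"
    using derive_context[of G "[Inl Y]" "map Inr s" "[]" "[Inl Z]"] assms(2) by (simp add: derives_def)
  moreover have "(derive_step G)\<^sup>*\<^sup>* (map Inr s @ [Inl Z]) (map Inr s @ map Inr t)"
    using derive_context[of G "[Inl Z]" "map Inr t" "map Inr s" "[]"] assms(3) by (simp add: derives_def)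
  ultimately show ?thesis unfolding derives_def map_append
    by (meson converse_rtranclp_into_rtranclp rtranclp_trans)
qed

lemma derives_nonempty:
  assumes "is_slp G" "derives G X s" shows "s \<noteq> []"
proof -
  have "x \<noteq> [] \<Longrightarrow> derive_step G x y \<Longrightarrow> y \<noteq> []" for x y
    using assms(1) by (auto simp: is_slp_def elim!: derive_step.cases)
  note step = this
  have "(derive_step G)\<^sup>*\<^sup>* x y \<Longrightarrow> x \<noteq> [] \<Longrightarrow> y \<noteq> []" for x y
    by (induction rule: rtranclp_induct) (auto dest: step)
  then show ?thesis using assms(2) unfolding derives_def by (metis list.map_disc_iff list.distinct(1))
qed

text \<open>Every variable derives a string and hence has a rule, so there are no more values than
  rules.\<close>

theorem slp_family:
  assumes "slp_represents G S"
  obtains V where "closed_family V" "finite V" "S \<in> V" "card V \<le> slp_size G" "card V \<le> 2 * length S"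
proof -
  have slp: "is_slp G" and S: "derives G (start G) S" using assms by (auto simp: slp_represents_def)
  define val where "val X = (THE s. derives G X s)" for X
  have uniq: "\<exists>!s. derives G X s" if "X \<in> variables G" for X using slp that by (auto simp: is_slp_def)
  have val: "derives G X (val X)" if "X \<in> variables G" for X
    using theI'[OF uniq[OF that]] by (simp add: val_def)
  have val_eq: "val X = s" if "X \<in> variables G" "derives G X s" for X s
    using uniq[OF that(1)] val[OF that(1)] that(2) by blast
  define V where "V = val ` variables G"
  have sub: "variables G \<subseteq> fst ` rules G" using val derives_rule by force
  have finr: "finite (rules G)" using slp by (simp add: is_slp_def)
  have fin: "finite (variables G)" using finite_subset[OF sub] finr by simp
  have "card V \<le> card (variables G)" unfolding V_def by (rule card_image_le[OF fin])
  also have "\<dots> \<le> card (fst ` rules G)" using sub finr by (intro card_mono) auto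
  also have "\<dots> \<le> slp_size G" unfolding slp_size_def by (rule card_image_le[OF finr])
  finally have cV: "card V \<le> slp_size G" .
  have SV: "S \<in> V" using val_eq[OF _ S] by (force simp: V_def variables_def)
  have clV: "closed_family V"
    unfolding closed_family_def
  proof (intro conjI ballI)
    show "[] \<notin> V" using derives_nonempty[OF slp val] by (force simp: V_def)
    fix s assume "s \<in> V"
    then obtain X where X: "X \<in> variables G" "s = val X" by (auto simp: V_def)
    obtain rhs where r: "(X, rhs) \<in> rules G" using derives_rule[OF val[OF X(1)]] by blast
    then consider Y Z where "rhs = [Inl Y, Inl Z]" | a where "rhs = [Inr a]"
      using slp by (fastforce simp: is_slp_def)
    then show "length s = 1 \<or> (\<exists>u\<in>V. \<exists>v\<in>V. s = u @ v)"
    proof cases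
      case 1
      have YZ: "Y \<in> variables G" "Z \<in> variables G" using r 1 unfolding variables_def by force+
      have "derives G X (val Y @ val Z)" using derives_append[OF _ val[OF YZ(1)] val[OF YZ(2)]] r 1 by simp
      then have "s = val Y @ val Z" using val_eq X by simp
      then show ?thesis using YZ by (auto simp: V_def)
    next
      case 2
      have "derive_step G [Inl X] [Inr a]" using derive_step.intros[OF r, of "[]" "[]"] 2 by simp
      then have "derives G X [a]" unfolding derives_def by auto
      then have "s = [a]" using val_eq X by simp
      then show ?thesis by simp
    qed
  qed
  obtain V' where V': "V' \<subseteq> V" "closed_family V'" "S \<in> V'" "finite V'" "card V' \<le> 2 * length S - 1"
    using closed_family_small[OF clV SV] by blast
  have "card V' \<le> card V" using V'(1) fin by (intro card_mono) (auto simp: V_def)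
  then show thesis using that[OF V'(2,4,3)] V'(5) cV by linarith
qed

section \<open>Primes and hashes\<close>

text \<open>The recurrence of Leibniz's harmonic triangle.\<close>

lemma leibniz_identity:
  assumes "0 < m" "m < n"
  shows "1 / (real m * real (n choose m)) =
    1 / (real m * real ((n - 1) choose m)) - 1 / (real (Suc m) * real (n choose Suc m))"
proof -
  obtain k where n: "n = Suc k" using assms by (cases n) auto
  have mk: "m \<le> k" using assms n by simp
  have pos: "0 < n choose m" "0 < k choose m" "0 < n choose Suc m"
    using assms n by (auto simp: zero_less_binomial_iff)
  have 1: "Suc m * (n choose Suc m) = n * (k choose m)" using Suc_times_binomial_eq[of k m] n by simp
  have 2: "(n - m) * (n choose m) = n * (k choose m)" using binomial_absorb_comp[of n m] n by simp
  have r1: "real (Suc m) * real (n choose Suc m) = real n * real (k choose m)"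
    using arg_cong[OF 1, of real] by (simp only: of_nat_mult)
  have r2: "real (n choose m) = real n * real (k choose m) / (real n - real m)"
  proof -
    have "real (n - m) * real (n choose m) = real n * real (k choose m)"
      using arg_cong[OF 2, of real] by (simp only: of_nat_mult)
    then show ?thesis using assms by (simp add: of_nat_diff field_simps)
  qed
  have nz: "real (k choose m) \<noteq> 0" "real m \<noteq> 0" "real n \<noteq> 0" "real n - real m \<noteq> 0"
    using pos assms by auto
  have "1 / (a * (b * K / (b - a))) = 1 / (a * K) - 1 / (b * K)"
    if "K \<noteq> 0" "a \<noteq> 0" "b \<noteq> 0" "b - a \<noteq> 0" for a b K :: real
    using that by (simp add: field_simps)
  from this[OF nz] have "1 / (real m * real (n choose m)) =
      1 / (real m * real (k choose m)) - 1 / (real n * real (k choose m))" unfolding r2 .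
  then show ?thesis by (simp only: r1) (simp add: n)
qed

text \<open>The boundary entries of the triangle are \<open>1 / n\<close>, and the recurrence
  expresses every other entry as a difference; multiplying by the lcm therefore makes all of them
  integers.\<close>

lemma choose_divides_Lcm_aux:
  assumes "0 < m" "m \<le> n" "n \<le> N"
  shows "\<exists>k::int. real (Lcm {1..N}) / (real m * real (n choose m)) = of_int k"
  using assms
proof (induction "n - m" arbitrary: m n)
  case 0
  then have "m dvd Lcm {1..N}" by (intro dvd_Lcm) auto
  then obtain j where "Lcm {1..N} = m * j" by blast
  then have "real (Lcm {1..N}) / (real m * real (n choose m)) = of_int (int j)" using 0 by auto
  then show ?case by blast
next
  case (Suc d)
  have mn: "m < n" using Suc by simp
  obtain k1 :: int where k1: "real (Lcm {1..N}) / (real m * real ((n - 1) choose m)) = of_int k1"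
  proof -
    have "d = n - 1 - m" "0 < m" "m \<le> n - 1" "n - 1 \<le> N" using Suc.hyps(2) Suc.prems mn by auto
    from Suc.hyps(1)[OF this] show ?thesis using that by blast
  qed
  obtain k2 :: int where k2: "real (Lcm {1..N}) / (real (Suc m) * real (n choose Suc m)) = of_int k2"
  proof -
    have "d = n - Suc m" "0 < Suc m" "Suc m \<le> n" "n \<le> N" using Suc.hyps(2) Suc.prems mn by auto
    from Suc.hyps(1)[OF this] show ?thesis using that by blast
  qed
  have "real (Lcm {1..N}) / (real m * real (n choose m)) =
      real (Lcm {1..N}) * (1 / (real m * real (n choose m)))" by simp
  also have "\<dots> = real (Lcm {1..N}) / (real m * real ((n - 1) choose m)) -
      real (Lcm {1..N}) / (real (Suc m) * real (n choose Suc m))"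
    unfolding leibniz_identity[OF Suc.prems(1) mn] by (simp add: right_diff_distrib)
  also have "\<dots> = of_int (k1 - k2)" unfolding k1 k2 by simp
  finally show ?case by blast
qed

lemma Lcm_atLeastAtMost_pos: "0 < Lcm {1..N::nat}"
  by (rule Nat.gr0I) (simp add: Lcm_0_iff_nat)

text \<open>\<open>n * (2 * n choose n)\<close> divides the lcm, and the central binomial
  coefficient is at least \<open>4 ^ n / (2 * n)\<close>.\<close>

lemma Lcm_ge:
  assumes "0 < n" shows "2 ^ (2 * n - 1) \<le> Lcm {1..2 * n::nat}"
proof -
  obtain k :: int where k: "real (Lcm {1..2 * n}) / (real n * real (2 * n choose n)) = of_int k"
    using choose_divides_Lcm_aux[of n "2 * n" "2 * n"] assms by auto
  have pos: "0 < real n * real (2 * n choose n)" using assms by (simp add: zero_less_binomial)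
  have "0 < real (Lcm {1..2 * n}) / (real n * real (2 * n choose n))"
    using pos Lcm_atLeastAtMost_pos[of "2 * n"] by (intro divide_pos_pos) auto
  then have "1 \<le> k" unfolding k by simp
  then have "1 \<le> real (Lcm {1..2 * n}) / (real n * real (2 * n choose n))" unfolding k by simp
  then have "real n * real (2 * n choose n) \<le> real (Lcm {1..2 * n})" using pos by (simp add: le_divide_eq)
  moreover have "real n * (4 ^ n / (2 * real n)) \<le> real n * real (2 * n choose n)"
    using central_binomial_lower_bound[OF assms] by (intro mult_left_mono) auto
  moreover have "real n * (4 ^ n / (2 * real n)) = real (2 ^ (2 * n - 1))"
  proof -
    have "(4::real) ^ n = 2 ^ (2 * n)" by (simp add: power_mult)
    also have "\<dots> = 2 * 2 ^ (2 * n - 1)" using assms by (simp flip: power_Suc)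
    finally show ?thesis using assms by simp
  qed
  ultimately have "real (2 ^ (2 * n - 1)) \<le> real (Lcm {1..2 * n})" by linarith
  then show ?thesis by (rule of_nat_le_iff[THEN iffD1])
qed

text \<open>The multiplicity of a prime in an lcm is a maximum, so the power divides one of the
  numbers themselves.\<close>

lemma prime_power_dvd_Lcm:
  assumes "prime p" "p ^ k dvd Lcm {1..n::nat}" "0 < k"
  shows "p ^ k \<le> n"
  using assms(2)
proof (induction n)
  case 0
  then show ?case using assms by (auto simp: prime_gt_1_nat)
next
  case (Suc n)
  have "{1..Suc n} = insert (Suc n) {1..n}" by auto
  then have l: "Lcm {1..Suc n} = lcm (Suc n) (Lcm {1..n})" by simp
  have nz: "lcm (Suc n) (Lcm {1..n}) \<noteq> 0" using Lcm_atLeastAtMost_pos[of n] by simp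
  have "k \<le> multiplicity p (lcm (Suc n) (Lcm {1..n}))"
    using Suc.prems assms nz l by (intro multiplicity_geI) auto
  also have "\<dots> = max (multiplicity p (Suc n)) (multiplicity p (Lcm {1..n}))"
    using Lcm_atLeastAtMost_pos[of n] by (intro multiplicity_lcm) (use assms in auto)
  finally have "p ^ k dvd Suc n \<or> p ^ k dvd Lcm {1..n}"
    by (auto simp: le_max_iff_disj intro: multiplicity_dvd')
  then show ?case using Suc.IH by (auto dest: dvd_imp_le)
qed

text \<open>Chebyshev's argument with y = 2^e: otherwise the lcm of 1..y^2 has only prime factors up
  to y, each contributing a power of at most y^2. It is then at most 2^(2ey), below the lower bound
  2^(y^2 - 1).\<close>

lemma exists_prime_between:
  assumes "3 \<le> e" shows "\<exists>p. prime p \<and> 2 ^ e < p \<and> p \<le> (2 ^ (2 * e) :: nat)"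
proof (rule ccontr)
  assume no: "\<not> ?thesis"
  let ?m = "2 ^ (2 * e) :: nat" and ?y = "2 ^ e :: nat"
  let ?L = "Lcm {1..?m}"
  have L0: "?L \<noteq> 0" using Lcm_atLeastAtMost_pos[of ?m] by linarith
  have pf: "p \<in> {1..?y} \<and> p ^ multiplicity p ?L \<le> ?m" if "p \<in> prime_factors ?L" for p
  proof -
    have p: "prime p" "p dvd ?L" using that by auto
    then have "0 < multiplicity p ?L" using L0 by (simp add: prime_multiplicity_gt_zero_iff)
    then have le: "p ^ multiplicity p ?L \<le> ?m"
      by (intro prime_power_dvd_Lcm[OF p(1)] multiplicity_dvd)
    have "p ^ 1 \<le> ?m" using p by (intro prime_power_dvd_Lcm[OF p(1)]) auto
    then show ?thesis using no p le prime_gt_1_nat[OF p(1)] by (auto simp: not_less)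
  qed
  have "?L = (\<Prod>p \<in> prime_factors ?L. p ^ multiplicity p ?L)"
    by (rule prime_factorization_nat[OF Lcm_atLeastAtMost_pos])
  also have "\<dots> \<le> (\<Prod>p \<in> prime_factors ?L. ?m)"
  proof (rule prod_mono)
    fix p assume "p \<in> prime_factors ?L"
    from pf[OF this] show "0 \<le> p ^ multiplicity p ?L \<and> p ^ multiplicity p ?L \<le> ?m" by (intro conjI zero_le) blast
  qed
  also have "\<dots> = ?m ^ card (prime_factors ?L)" by simp
  also have "\<dots> \<le> ?m ^ ?y"
  proof (rule power_increasing)
    have "card (prime_factors ?L) \<le> card {1..?y}" using pf by (intro card_mono subsetI) blast+
    then show "card (prime_factors ?L) \<le> ?y" by simp
  qed simp
  also have "\<dots> = 2 ^ (2 * e * ?y)" by (simp add: power_mult)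
  finally have up: "?L \<le> 2 ^ (2 * e * ?y)" .
  have m: "?m = 2 * 2 ^ (2 * e - 1)" using assms by (simp flip: power_Suc)
  have "2 ^ (?m - 1) \<le> ?L" using Lcm_ge[of "2 ^ (2 * e - 1)"] unfolding m[symmetric] by simp
  then have "(2::nat) ^ (?m - 1) \<le> 2 ^ (2 * e * ?y)" using up by linarith
  then have le: "?m - 1 \<le> 2 * e * ?y" by simp
  \<comment> \<open>The induction starts at \<open>e = 3\<close> with 7 \<le> 8.\<close>
  have e2: "2 * e + 1 \<le> ?y" using assms
  proof (induction e rule: dec_induct)
    case (step n) then show ?case by simp
  qed simp
  have "?m = ?y * ?y" by (simp add: mult_2 power_add)
  moreover have "(2 * e + 1) * ?y \<le> ?y * ?y" using e2 by (rule mult_right_mono) simp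
  moreover have "1 < ?y" using e2 assms by linarith
  ultimately have "2 * e * ?y < ?m - 1" by (simp add: algebra_simps)
  then show False using le by linarith
qed

section \<open>Polynomial hashes and a base without collisions\<close>

text \<open>Lagrange's bound: a root modulo \<open>p\<close> splits off a linear factor with a
  remainder divisible by \<open>p\<close>, and the quotient still has a coefficient not divisible by
  \<open>p\<close>.\<close>

lemma card_roots_mod_prime:
  fixes f :: "int poly" and p :: int
  assumes "prime p" "degree f \<le> n" "\<exists>i. \<not> p dvd coeff f i"
  shows "card {x \<in> {0..<p}. p dvd poly f x} \<le> n"
  using assms(2,3)
proof (induction n arbitrary: f)
  case 0
  then obtain c where f: "f = [:c:]" by (metis degree_eq_zeroE le_zero_eq)
  obtain i where "\<not> p dvd coeff f i" using 0(2) by blast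
  then have "\<not> p dvd c" unfolding f by (cases i) auto
  then have "{x \<in> {0..<p}. p dvd poly f x} = {}" by (simp add: f)
  then show ?case by (simp only: card.empty le0)
next
  case (Suc n)
  show ?case
  proof (cases "\<exists>a \<in> {0..<p}. p dvd poly f a")
    case False
    then have "{x \<in> {0..<p}. p dvd poly f x} = {}" by auto
    then show ?thesis by (simp only: card.empty le0)
  next
    case True
    then obtain a where a: "a \<in> {0..<p}" "p dvd poly f a" by blast
    define q where "q = synthetic_div f a"
    have fq: "f = [:-a, 1:] * q + [:poly f a:]"
      using synthetic_div_correct'[of a f] by (simp add: q_def)
    have dq: "degree q \<le> n" using Suc.prems(1) by (simp add: q_def degree_synthetic_div)
    have nq: "\<exists>i. \<not> p dvd coeff q i"
    proof (rule ccontr)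
      assume "\<not> ?thesis"
      then have q: "p dvd coeff q i" for i by blast
      have "p dvd coeff f i" for i
        by (subst fq) (use q a(2) in \<open>auto simp: coeff_pCons split: nat.splits\<close>)
      then show False using Suc.prems(2) by blast
    qed
    have "{x \<in> {0..<p}. p dvd poly f x} \<subseteq> insert a {x \<in> {0..<p}. p dvd poly q x}"
    proof
      fix x assume x: "x \<in> {x \<in> {0..<p}. p dvd poly f x}"
      have "poly f x = (x - a) * poly q x + poly f a" by (subst fq) (simp add: algebra_simps)
      then have "p dvd (x - a) * poly q x" using x a(2) by (simp add: dvd_add_left_iff)
      then consider "p dvd x - a" | "p dvd poly q x" using assms(1) by (auto simp: prime_dvd_mult_iff)
      then show "x \<in> insert a {x \<in> {0..<p}. p dvd poly q x}"
      proof cases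
        case 1
        then have "x mod p = a mod p" by (simp add: mod_eq_dvd_iff)
        then show ?thesis using x a by simp
      qed (use x in auto)
    qed
    then have "card {x \<in> {0..<p}. p dvd poly f x} \<le> card (insert a {x \<in> {0..<p}. p dvd poly q x})"
      by (rule card_mono[rotated]) (simp only: finite_insert, rule finite_subset[of _ "{0..<p}"], auto)
    also have "\<dots> \<le> Suc (card {x \<in> {0..<p}. p dvd poly q x})"
    proof -
      have fin: "finite {x \<in> {0..<p}. p dvd poly q x}" by (rule finite_subset[of _ "{0..<p}"]) auto
      show ?thesis unfolding card_insert_if[OF fin] by simp
    qed
    also have "\<dots> \<le> Suc n" using Suc.IH[OF dq nq] by simp
    finally show ?thesis .
  qed
qed

primrec hash :: "('a \<Rightarrow> nat) \<Rightarrow> nat \<Rightarrow> 'a list \<Rightarrow> nat" where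
  "hash c r [] = 0"
| "hash c r (x # u) = c x * r ^ length u + hash c r u"

lemma hash_append: "hash c r (u @ v) = hash c r u * r ^ length v + hash c r v"
  by (induction u) (auto simp: algebra_simps power_add)

lemma hash_poly: "int (hash c r u) = poly (Poly (rev (map (\<lambda>x. int (c x)) u))) (int r)"
  by (induction u) (auto simp: Poly_snoc poly_monom)

text \<open>A collision is a root of the difference of two polynomials of degree below
  \<open>n\<close>. At a position where the strings differ, the coefficient is a nonzero difference
  of two letter codes below \<open>p\<close>, hence nonzero modulo \<open>p\<close>.\<close>

lemma card_collisions:
  assumes p: "prime p" and uv: "length u = length v" "u \<noteq> v" "length u \<le> n"
    and c: "inj_on c (set u \<union> set v)" "\<And>x. x \<in> set u \<union> set v \<Longrightarrow> c x < p"
  shows "card {r \<in> {..<p}. hash c r u mod p = hash c r v mod p} \<le> n - 1"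
proof -
  define cu where "cu = rev (map (\<lambda>x. int (c x)) u)"
  define cv where "cv = rev (map (\<lambda>x. int (c x)) v)"
  define f where "f = Poly cu - Poly cv"
  have n0: "0 < n" using uv by (cases u) auto
  have len: "length cu = length u" "length cv = length u" by (auto simp: cu_def cv_def uv)
  have "degree f \<le> n - 1"
  proof (rule degree_le, intro allI impI)
    fix i assume "n - 1 < i"
    then have "length u \<le> i" using n0 uv(3) by linarith
    then show "coeff f i = 0" using len by (simp add: f_def nth_default_def)
  qed
  moreover have "\<exists>i. \<not> int p dvd coeff f i"
  proof -
    have "cu \<noteq> cv"
    proof
      assume "cu = cv"
      then have "map (\<lambda>x. int (c x)) u = map (\<lambda>x. int (c x)) v" by (simp add: cu_def cv_def)
      then have "map nat (map (\<lambda>x. int (c x)) u) = map nat (map (\<lambda>x. int (c x)) v)" by simp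
      then have "map c u = map c v" by (simp add: comp_def)
      then show False using c(1) uv(2) by (simp add: inj_on_map_eq_map)
    qed
    then obtain i where i: "i < length cu" "cu ! i \<noteq> cv ! i" using len by (metis nth_equalityI)
    have "cu ! i \<in> set cu" "cv ! i \<in> set cv" using i len by auto
    then have b: "0 \<le> cu ! i" "cu ! i < int p" "0 \<le> cv ! i" "cv ! i < int p"
      using c(2) by (auto simp: cu_def cv_def)
    have "coeff f i = cu ! i - cv ! i" using i len by (simp add: f_def nth_default_def)
    moreover have "\<not> int p dvd cu ! i - cv ! i"
    proof
      assume "int p dvd cu ! i - cv ! i"
      then have "cu ! i mod int p = cv ! i mod int p" by (simp add: mod_eq_dvd_iff)
      then show False using b i by simp
    qed
    ultimately show ?thesis by metis
  qed
  ultimately have 1: "card {x \<in> {0..<int p}. int p dvd poly f x} \<le> n - 1"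
    using p by (intro card_roots_mod_prime) auto
  have "int ` {r \<in> {..<p}. hash c r u mod p = hash c r v mod p} \<subseteq> {x \<in> {0..<int p}. int p dvd poly f x}"
  proof safe
    fix r assume "hash c r u mod p = hash c r v mod p"
    then have "int (hash c r u) mod int p = int (hash c r v) mod int p" by (metis zmod_int)
    then have "int p dvd int (hash c r u) - int (hash c r v)" by (simp add: mod_eq_dvd_iff)
    then show "int p dvd poly f (int r)" unfolding hash_poly by (simp add: f_def cu_def cv_def)
  qed auto
  then have "card (int ` {r \<in> {..<p}. hash c r u mod p = hash c r v mod p}) \<le>
      card {x \<in> {0..<int p}. int p dvd poly f x}"
    by (intro card_mono finite_subset[of "{x \<in> {0..<int p}. int p dvd poly f x}" "{0..<int p}"]) auto
  also have "card (int ` {r \<in> {..<p}. hash c r u mod p = hash c r v mod p}) =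
      card {r \<in> {..<p}. hash c r u mod p = hash c r v mod p}" by (rule card_image) simp
  finally show ?thesis using 1 by linarith
qed

text \<open>Union bound: each of at most \<open>N ^ 3\<close> triples \<open>(i, j, d)\<close> with
  distinct substrings excludes at most \<open>N - 1\<close> bases, fewer than the
  \<open>p - 1\<close> candidates in total.\<close>

lemma good_hash_base:
  assumes p: "prime p" and S: "length S = N" "0 < N" "N ^ 4 < p"
    and c: "inj_on c (set S)" "\<And>x. x \<in> set S \<Longrightarrow> c x < p"
  shows "\<exists>r. 0 < r \<and> r < p \<and> (\<forall>i j d. i + d \<le> N \<longrightarrow> j + d \<le> N \<longrightarrow>
    hash c r (take d (drop i S)) mod p = hash c r (take d (drop j S)) mod p \<longrightarrow>
    take d (drop i S) = take d (drop j S))"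
proof (rule ccontr)
  assume no: "\<not> ?thesis"
  let ?sub = "\<lambda>i d. take d (drop i S)"
  let ?B = "\<lambda>i j d. {r \<in> {..<p}. hash c r (?sub i d) mod p = hash c r (?sub j d) mod p}"
  let ?I = "{(i, j, d) |i j d. i \<in> {..<N} \<and> j \<in> {..<N} \<and> d \<in> {1..N} \<and> i + d \<le> N \<and> j + d \<le> N \<and> ?sub i d \<noteq> ?sub j d}"
  have IJ: "?I \<subseteq> {..<N} \<times> {..<N} \<times> {1..N}" by auto
  then have finI: "finite ?I" by (rule finite_subset) simp
  have "card ?I \<le> card ({..<N} \<times> {..<N} \<times> {1..N})" using IJ by (rule card_mono[rotated]) simp
  then have cI: "card ?I \<le> N ^ 3" by (simp add: card_cartesian_product power3_eq_cube)
  have cB: "card (?B i j d) \<le> N - 1" if "(i, j, d) \<in> ?I" for i j d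
  proof (rule card_collisions[OF p])
    have sub: "set (?sub i d) \<union> set (?sub j d) \<subseteq> set S" by (meson in_set_dropD in_set_takeD subsetI Un_iff)
    show "inj_on c (set (?sub i d) \<union> set (?sub j d))" using c(1) sub by (rule inj_on_subset)
    show "\<And>x. x \<in> set (?sub i d) \<union> set (?sub j d) \<Longrightarrow> c x < p" using c(2) sub by blast
  qed (use that S in auto)
  have "{1..<p} \<subseteq> (\<Union>(i, j, d) \<in> ?I. ?B i j d)"
  proof
    fix r assume r: "r \<in> {1..<p}"
    then obtain i j d where ijd: "i + d \<le> N" "j + d \<le> N" "hash c r (?sub i d) mod p = hash c r (?sub j d) mod p"
      "?sub i d \<noteq> ?sub j d" using no by (metis atLeastLessThan_iff less_eq_Suc_le One_nat_def)
    have "d \<noteq> 0" using ijd(4) by (intro notI) simp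
    then have "(i, j, d) \<in> ?I" using ijd by auto
    then show "r \<in> (\<Union>(i, j, d) \<in> ?I. ?B i j d)" by (rule UN_I) (use r ijd(3) in simp)
  qed
  then have "card {1..<p} \<le> card (\<Union>(i, j, d) \<in> ?I. ?B i j d)"
    using finI by (intro card_mono) auto
  also have "\<dots> \<le> (\<Sum>(i, j, d) \<in> ?I. card (?B i j d))"
    using card_UN_le[OF finI, of "\<lambda>(i, j, d). ?B i j d"] by (simp add: case_prod_unfold)
  also have "\<dots> \<le> card ?I * (N - 1)"
    using sum_bounded_above[of ?I "\<lambda>(i, j, d). card (?B i j d)" "N - 1"] cB by fastforce
  also have "\<dots> \<le> N ^ 3 * (N - 1)" using cI by (rule mult_right_mono) simp
  also have "\<dots> \<le> N ^ 4 - N ^ 3" by (simp add: power4_eq_xxxx power3_eq_cube diff_mult_distrib2)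
  finally have "p - 1 \<le> N ^ 4 - N ^ 3" by simp
  moreover have "1 \<le> N ^ 3" "N ^ 3 \<le> N ^ 4" using S(2) by (auto intro: power_increasing)
  ultimately show False using S(3) by linarith
qed

section \<open>Total correctness with time bounds\<close>

text \<open>\<open>T\<close> is an upper bound for the number of instructions.\<close>

definition tc :: "nat \<Rightarrow> prog \<Rightarrow> state \<Rightarrow> nat \<Rightarrow> (state \<Rightarrow> bool) \<Rightarrow> bool" where
  "tc w p s T Q \<longleftrightarrow> (\<exists>t s'. exec w p s t s' \<and> t \<le> T \<and> Q s')"

text \<open>Programs as lists, so that rewriting always finds the next instruction at the head. The
  closing \<open>Skip\<close> takes no time.\<close>

primrec blk :: "prog list \<Rightarrow> prog" where
  "blk [] = Skip"
| "blk (p # ps) = Seq p (blk ps)"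

declare blk.simps [simp del]

lemma tcI: "exec w p s t s' \<Longrightarrow> t \<le> T \<Longrightarrow> Q s' \<Longrightarrow> tc w p s T Q"
  unfolding tc_def by blast

lemma tcE:
  assumes "tc w p s T Q" obtains t s' where "exec w p s t s'" "t \<le> T" "Q s'"
  using assms unfolding tc_def by blast

lemma tc_mono: "tc w p s T Q \<Longrightarrow> T \<le> T' \<Longrightarrow> (\<And>s. Q s \<Longrightarrow> Q' s) \<Longrightarrow> tc w p s T' Q'"
  unfolding tc_def by (meson le_trans)

lemma tc_Seq:
  assumes "tc w p s T1 Q1" "\<And>s'. Q1 s' \<Longrightarrow> tc w q s' T2 Q" "T1 + T2 \<le> T"
  shows "tc w (Seq p q) s T Q"
proof -
  obtain t s' where 1: "exec w p s t s'" "t \<le> T1" "Q1 s'" using assms(1) by (auto simp: tc_def)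
  obtain t' s'' where 2: "exec w q s' t' s''" "t' \<le> T2" "Q s''" using assms(2)[OF 1(3)] by (auto simp: tc_def)
  have "exec w (Seq p q) s (t + t') s''" by (rule exec.Seq[OF 1(1) 2(1)])
  then show ?thesis by (rule tcI) (use 1 2 assms(3) in auto)
qed

lemma tc_Cons:
  "tc w p s T1 Q1 \<Longrightarrow> (\<And>s'. Q1 s' \<Longrightarrow> tc w (blk ps) s' T2 Q) \<Longrightarrow> T1 + T2 \<le> T \<Longrightarrow> tc w (blk (p # ps)) s T Q"
  unfolding blk.simps by (rule tc_Seq)

lemma tc_append:
  assumes "tc w (blk xs) s T1 Q1" "\<And>s'. Q1 s' \<Longrightarrow> tc w (blk ys) s' T2 Q" "T1 + T2 \<le> T"
  shows "tc w (blk (xs @ ys)) s T Q"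
  using assms
proof (induction xs arbitrary: s T1 T)
  case Nil
  then have "Q1 s" unfolding blk.simps by (auto elim: exec_elims tcE)
  from Nil.prems(2)[OF this] have "tc w (blk ys) s T Q" by (rule tc_mono) (use Nil.prems in auto)
  then show ?case by simp
next
  case (Cons x xs)
  obtain t s' where 1: "exec w (Seq x (blk xs)) s t s'" "t \<le> T1" "Q1 s'"
    using Cons.prems(1) unfolding blk.simps by (rule tcE)
  obtain t1 t2 s1 where 2: "exec w x s t1 s1" "exec w (blk xs) s1 t2 s'" "t = t1 + t2"
    using 1(1) by (auto elim: exec_elims(6))
  have "tc w (blk (xs @ ys)) s1 (t2 + T2) Q"
    by (rule Cons.IH[OF tcI[OF 2(2) order_refl] Cons.prems(2)]) (use 1 in auto)
  moreover have "tc w x s t1 (\<lambda>s'. s' = s1)" by (rule tcI[OF 2(1)]) auto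
  ultimately show ?case unfolding append_Cons using 1 2 Cons.prems(3) by (auto elim!: tc_Cons)
qed

lemma tc_Nil [simp]: "tc w (blk []) s T Q \<longleftrightarrow> Q s"
proof
  show "Q s \<Longrightarrow> tc w (blk []) s T Q" unfolding blk.simps by (rule tcI[OF exec.Skip]) auto
qed (auto simp: blk.simps elim: exec_elims tcE)

text \<open>Stated as an equivalence, which the determinism of a single instruction permits, so that
  the simplifier executes straight-line code.\<close>

lemma tc_step:
  assumes "exec w i s 1 s'" "\<And>t s''. exec w i s t s'' \<Longrightarrow> t = 1 \<and> s'' = s'"
  shows "tc w (blk (i # ps)) s T Q \<longleftrightarrow> 0 < T \<and> tc w (blk ps) s' (T - 1) Q"
proof
  assume "tc w (blk (i # ps)) s T Q"
  then obtain t u where 1: "exec w (Seq i (blk ps)) s t u" "t \<le> T" "Q u" unfolding blk.simps by (rule tcE)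
  from 1(1) obtain t1 t2 v where 2: "exec w i s t1 v" "exec w (blk ps) v t2 u" "t = t1 + t2"
    by (auto elim: exec_elims(6))
  with assms(2) have "t1 = 1" "v = s'" by auto
  then show "0 < T \<and> tc w (blk ps) s' (T - 1) Q" using 1 2 by (auto intro!: tcI[of _ _ _ t2])
next
  assume *: "0 < T \<and> tc w (blk ps) s' (T - 1) Q"
  have "tc w i s 1 (\<lambda>x. x = s')" by (rule tcI[OF assms(1)]) auto
  then show "tc w (blk (i # ps)) s T Q" by (rule tc_Cons) (use * in auto)
qed

lemma tc_Const [simp]:
  "tc w (blk (Const a k # ps)) (r, m) T Q \<longleftrightarrow> 0 < T \<and> tc w (blk ps) (r(a := k mod 2 ^ w), m) (T - 1) Q"
  by (rule tc_step, (rule exec.Const, assumption?)) (auto elim: exec_elims)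

lemma tc_Op [simp]:
  "tc w (blk (Op f a b c # ps)) (r, m) T Q \<longleftrightarrow>
    0 < T \<and> tc w (blk ps) (r(a := binop_val w f (r b) (r c)), m) (T - 1) Q"
  by (rule tc_step, (rule exec.Op, assumption?)) (auto elim: exec_elims)

lemma tc_Load:
  "r b < length m \<Longrightarrow> tc w (blk (Load a b # ps)) (r, m) T Q \<longleftrightarrow>
    0 < T \<and> tc w (blk ps) (r(a := m ! r b), m) (T - 1) Q"
  by (rule tc_step, (rule exec.Load, assumption?)) (auto elim: exec_elims)

lemma tc_Store:
  "r a < length m \<Longrightarrow> tc w (blk (Store a b # ps)) (r, m) T Q \<longleftrightarrow>
    0 < T \<and> tc w (blk ps) (r, m[r a := r b]) (T - 1) Q"
  by (rule tc_step, (rule exec.Store, assumption?)) (auto elim: exec_elims)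

lemma tc_blk: "tc w (blk (xs @ ps)) s T Q \<Longrightarrow> tc w (blk (blk xs # ps)) s T Q"
proof (induction xs arbitrary: s T)
  case Nil
  have "tc w (blk []) s 0 (\<lambda>x. x = s)" by simp
  then show ?case by (rule tc_Cons) (use Nil in auto)
next
  case (Cons x xs)
  obtain t u where 1: "exec w (Seq x (blk (xs @ ps))) s t u" "t \<le> T" "Q u"
    using Cons.prems unfolding append_Cons blk.simps by (rule tcE)
  from 1(1) obtain t1 t2 v where 2: "exec w x s t1 v" "exec w (blk (xs @ ps)) v t2 u" "t = t1 + t2"
    by (auto elim: exec_elims(6))
  have "tc w (blk (blk xs # ps)) v t2 Q" by (rule Cons.IH, rule tcI[OF 2(2)]) (use 1 in auto)
  then obtain t3 u where "exec w (Seq (blk xs) (blk ps)) v t3 u" "t3 \<le> t2" "Q u"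
    unfolding blk.simps by (rule tcE)
  then obtain t4 t5 y where 3: "exec w (blk xs) v t4 y" "exec w (blk ps) y t5 u" "t4 + t5 \<le> t2" "Q u"
    by (auto elim: exec_elims(6))
  have "exec w (blk (blk (x # xs) # ps)) s (t1 + t4 + t5) u"
    using exec.Seq[OF exec.Seq[OF 2(1) 3(1)] 3(2)] by (simp add: blk.simps)
  then show ?case by (rule tcI) (use 1 2 3 in auto)
qed

text \<open>The continuation \<open>ps\<close> is copied into both branches, so no assertion at
  their meeting point is needed; \<open>tc_blk\<close> does the flattening.\<close>

lemma tc_Cond:
  assumes "0 < T" "cmp_val c (fst s) \<Longrightarrow> tc w (blk (xs @ ps)) s (T - 1) Q"
    "\<not> cmp_val c (fst s) \<Longrightarrow> tc w (blk (ys @ ps)) s (T - 1) Q"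
  shows "tc w (blk (Cond c (blk xs) (blk ys) # ps)) s T Q"
proof -
  define zs where "zs = (if cmp_val c (fst s) then xs else ys)"
  have "tc w (blk (blk zs # ps)) s (T - 1) Q" using assms by (intro tc_blk) (auto simp: zs_def)
  then obtain t u where 1: "exec w (Seq (blk zs) (blk ps)) s t u" "t \<le> T - 1" "Q u"
    unfolding blk.simps by (rule tcE)
  from 1(1) obtain t1 t2 v where 2: "exec w (blk zs) s t1 v" "exec w (blk ps) v t2 u" "t = t1 + t2"
    by (auto elim: exec_elims(6))
  have "exec w (Cond c (blk xs) (blk ys)) s (Suc t1) v"
    using 2(1) exec.CondTrue[of c s] exec.CondFalse[of c s] by (auto simp: zs_def split: if_splits)
  from exec.Seq[OF this 2(2)] show ?thesis unfolding blk.simps by (rule tcI) (use 1 2 assms(1) in auto)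
qed

text \<open>Amortized rule: \<open>n\<close> is the time still available, of which each round may
  take a different share; the condition \<open>1 \<le> n\<close> at the end pays for the last
  test.\<close>

lemma tc_While_budget:
  assumes "I s n"
    and step: "\<And>s n. I s n \<Longrightarrow> cmp_val c (fst s) \<Longrightarrow> \<exists>T. tc w p s T (\<lambda>s'. \<exists>n'. I s' n' \<and> Suc T + n' \<le> n)"
    and stop: "\<And>s n. I s n \<Longrightarrow> \<not> cmp_val c (fst s) \<Longrightarrow> 1 \<le> n \<and> Q s"
  shows "tc w (While c p) s n Q"
  using assms(1)
proof (induction n arbitrary: s rule: less_induct)
  case (less n)
  show ?case
  proof (cases "cmp_val c (fst s)")
    case False
    then have "exec w (While c p) s 1 s" by (rule exec.WhileFalse)
    then show ?thesis using stop[OF less.prems False] unfolding tc_def by blast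
  next
    case True
    obtain T where "tc w p s T (\<lambda>s'. \<exists>n'. I s' n' \<and> Suc T + n' \<le> n)" using step[OF less.prems True] by blast
    then obtain t s' n' where 1: "exec w p s t s'" "t \<le> T" "I s' n'" "Suc T + n' \<le> n" by (auto simp: tc_def)
    have "tc w (While c p) s' n' Q" using less.IH[of n' s'] 1 by simp
    then obtain t' s'' where 2: "exec w (While c p) s' t' s''" "t' \<le> n'" "Q s''" by (auto simp: tc_def)
    have "exec w (While c p) s (Suc (t + t')) s''" by (rule exec.WhileTrue[OF True 1(1) 2(1)])
    then show ?thesis by (rule tcI) (use 1 2 in auto)
  qed
qed

lemma tc_While:
  assumes "I s n"
    and step: "\<And>s n. I s n \<Longrightarrow> cmp_val c (fst s) \<Longrightarrow> tc w p s T (\<lambda>s'. \<exists>n'. I s' n' \<and> n' < n)"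
    and stop: "\<And>s n. I s n \<Longrightarrow> \<not> cmp_val c (fst s) \<Longrightarrow> Q s"
  shows "tc w (While c p) s (Suc (n * Suc T)) Q"
proof (rule tc_While_budget[where I = "\<lambda>s b. \<exists>n. I s n \<and> b = Suc (n * Suc T)"])
  fix s b assume I: "\<exists>n. I s n \<and> b = Suc (n * Suc T)" and c: "cmp_val c (fst s)"
  then obtain n where n: "I s n" "b = Suc (n * Suc T)" by blast
  have "tc w p s T (\<lambda>s'. \<exists>n'. (\<exists>n. I s' n \<and> n' = Suc (n * Suc T)) \<and> Suc T + n' \<le> b)"
  proof (rule tc_mono[OF step[OF n(1) c] order_refl])
    fix s' assume "\<exists>n'. I s' n' \<and> n' < n"
    then obtain n' where n': "I s' n'" "n' < n" by blast
    then have "Suc n' * Suc T \<le> n * Suc T" by (intro mult_right_mono) auto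
    then show "\<exists>n'. (\<exists>n. I s' n \<and> n' = Suc (n * Suc T)) \<and> Suc T + n' \<le> b"
      using n' n by (intro exI[of _ "Suc (n' * Suc T)"]) auto
  qed
  then show "\<exists>Ta. tc w p s Ta (\<lambda>s'. \<exists>n'. (\<exists>n. I s' n \<and> n' = Suc (n * Suc T)) \<and> Suc Ta + n' \<le> b)" by blast
qed (use assms in auto)

section \<open>Numbers as lists of digits\<close>

primrec dval :: "nat \<Rightarrow> nat list \<Rightarrow> nat" where
  "dval b [] = 0"
| "dval b (d # ds) = d + b * dval b ds"

lemma dval_append: "dval b (xs @ ys) = dval b xs + b ^ length xs * dval b ys"
  by (induction xs) (auto simp: algebra_simps)

lemma dval_inj:
  assumes "length xs = length ys" "\<forall>d \<in> set xs. d < b" "\<forall>d \<in> set ys. d < b" "dval b xs = dval b ys"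
  shows "xs = ys"
  using assms
proof (induction xs ys rule: list_induct2)
  case (Cons x xs y ys)
  have e: "x + b * dval b xs = y + b * dval b ys" using Cons.prems(3) by simp
  have xy: "x < b" "y < b" using Cons.prems(1,2) by auto
  have "x = (x + b * dval b xs) mod b" using xy by simp
  also have "\<dots> = (y + b * dval b ys) mod b" unfolding e ..
  also have "\<dots> = y" using xy by simp
  finally have "x = y" .
  then have "b * dval b xs = b * dval b ys" using Cons.prems(3) by simp
  moreover have "b \<noteq> 0" using Cons.prems by auto
  ultimately show ?case using Cons \<open>x = y\<close> by simp
qed simp

definition digs :: "nat \<Rightarrow> nat \<Rightarrow> nat \<Rightarrow> nat list" where
  "digs b n x = map (\<lambda>i. x div b ^ i mod b) [0..<n]"

lemma length_digs [simp]: "length (digs b n x) = n"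
  by (simp add: digs_def)

lemma digs_less: "0 < b \<Longrightarrow> d \<in> set (digs b n x) \<Longrightarrow> d < b"
  by (auto simp: digs_def)

lemma dval_digs: "x < b ^ n \<Longrightarrow> dval b (digs b n x) = x"
proof (induction n arbitrary: x)
  case (Suc n)
  have "digs b (Suc n) x = x mod b # digs b n (x div b)"
    unfolding digs_def upt_conv_Cons[OF zero_less_Suc] map_Suc_upt[symmetric]
    by (simp add: div_mult2_eq)
  moreover have "x div b < b ^ n" using Suc.prems by (simp add: less_mult_imp_div_less mult.commute)
  ultimately show ?case using Suc.IH by simp
qed (simp add: digs_def)

definition seg :: "nat list \<Rightarrow> nat \<Rightarrow> nat \<Rightarrow> nat list" where
  "seg m a n = map (\<lambda>i. m ! (a + i)) [0..<n]"

lemma length_seg [simp]: "length (seg m a n) = n"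
  by (simp add: seg_def)

lemma seg_0 [simp]: "seg m a 0 = []"
  by (simp add: seg_def)

lemma seg_Suc: "seg m a (Suc n) = m ! a # seg m (Suc a) n"
  unfolding seg_def upt_conv_Cons[OF zero_less_Suc] map_Suc_upt[symmetric] by simp

lemma seg_cong: "(\<And>i. i < n \<Longrightarrow> m ! (a + i) = m' ! (a + i)) \<Longrightarrow> seg m a n = seg m' a n"
  by (simp add: seg_def)

text \<open>One row of schoolbook multiplication, unrolled: register 52 times the number starting at
  the address in register 51 is added to the digits in the registers \<open>ts\<close>. Register 53
  carries and register 3 holds the base.\<close>

primrec addmul :: "nat list \<Rightarrow> prog list" where
  "addmul [] = []"
| "addmul (t # ts) = [Load 50 51, Op Mult 50 50 52, Op Add 50 50 t, Op Add 50 50 53,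
     Op Mod t 50 3, Op Div 53 50 3, Op Add 51 51 2] @ addmul ts"

definition same_except :: "nat set \<Rightarrow> (nat \<Rightarrow> nat) \<Rightarrow> (nat \<Rightarrow> nat) \<Rightarrow> bool" where
  "same_except X r r' \<longleftrightarrow> (\<forall>x. x \<notin> X \<longrightarrow> r' x = r x)"

lemma same_exceptD: "same_except X r r' \<Longrightarrow> x \<notin> X \<Longrightarrow> r' x = r x"
  by (simp add: same_except_def)

text \<open>The extreme case is \<open>(b - 1) * (b - 1) + 2 * (b - 1) = b * b - 1\<close>, so
  product, digit and carry fit into one word.\<close>

lemma digit_step_bound:
  assumes "x < b" "y < b" "t < b" "c < (b::nat)" shows "x * y + t + c < b * b"
proof -
  obtain k where b: "b = Suc k" using assms by (cases b) auto
  have "x * y \<le> k * k" using assms b by (intro mult_le_mono) auto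
  moreover have "t \<le> k" "c \<le> k" using assms b by auto
  ultimately show ?thesis using b by simp
qed

lemma tc_addmul:
  assumes "r 3 = \<beta>" "r 2 = 1" "0 < \<beta>" "\<beta> * \<beta> \<le> 2 ^ w" "length m \<le> 2 ^ w" "r 51 + length ts < length m"
    "distinct ts" "\<forall>t \<in> set ts. 100 \<le> t \<and> r t < \<beta>" "r 52 < \<beta>" "r 53 < \<beta>"
    "\<forall>d \<in> set (seg m (r 51) (length ts)). d < \<beta>"
  shows "tc w (blk (addmul ts)) (r, m) (7 * length ts) (\<lambda>(r', m'). m' = m \<and>
    dval \<beta> (map r' ts) + \<beta> ^ length ts * r' 53 = dval \<beta> (map r ts) + r 52 * dval \<beta> (seg m (r 51) (length ts)) + r 53 \<and>
    (\<forall>t \<in> set ts. r' t < \<beta>) \<and> r' 53 < \<beta> \<and> same_except ({50, 51, 53} \<union> set ts) r r')"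
  using assms
proof (induction ts arbitrary: r)
  case Nil
  then show ?case by (simp add: same_except_def)
next
  case (Cons t ts)
  let ?b = "m ! r 51"
  let ?u = "?b * r 52 + r t + r 53"
  have b: "?b < \<beta>" using Cons.prems(11) by (simp add: seg_Suc)
  have t: "100 \<le> t" "r t < \<beta>" "t \<notin> set ts" using Cons.prems by auto
  have u: "?u < \<beta> * \<beta>" using b t Cons.prems by (intro digit_step_bound) auto
  then have uw: "?u < 2 ^ w" using Cons.prems(4) by linarith
  define r1 where "r1 = r(50 := ?u, t := ?u mod \<beta>, 53 := ?u div \<beta>, 51 := r 51 + 1)"
  have dv: "?u div \<beta> < \<beta>" using u Cons.prems(3) by (simp add: div_less_iff_less_mult)
  have step: "tc w (blk (addmul (t # ts))) (r, m) (7 * length (t # ts)) Q \<longleftrightarrow>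
      tc w (blk (addmul ts)) (r1, m) (7 * length ts) Q" for Q
  proof -
    have "51 \<noteq> t" "52 \<noteq> t" "53 \<noteq> t" "2 \<noteq> t" "3 \<noteq> t" "50 \<noteq> t" using t by auto
    moreover have "?b * r 52 mod 2 ^ w = ?b * r 52" "(?b * r 52 + r t) mod 2 ^ w = ?b * r 52 + r t"
      "?u mod 2 ^ w = ?u" "(r 51 + 1) mod 2 ^ w = r 51 + 1"
      using uw Cons.prems(5,6) by auto
    ultimately show ?thesis using Cons.prems(1,2,6)
      by (simp add: tc_Load r1_def fun_upd_twist fun_upd_idem)
  qed
  show ?case unfolding step
  proof (rule tc_mono[OF Cons.IH order_refl])
    have s: "seg m (r1 51) (length ts) = seg m (Suc (r 51)) (length ts)" using t by (simp add: r1_def)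
    have mp: "map r1 ts = map r ts" using Cons.prems(8) t by (auto simp: r1_def)
    have r1t: "r1 t = ?u mod \<beta>" "r1 53 = ?u div \<beta>" "r1 52 = r 52" "r1 2 = r 2" "r1 3 = r 3" "r1 51 = Suc (r 51)"
      using t by (auto simp: r1_def)
    show "r1 3 = \<beta>" "r1 2 = 1" "r1 51 + length ts < length m" "distinct ts" "r1 52 < \<beta>" "r1 53 < \<beta>"
      "\<forall>t\<in>set ts. 100 \<le> t \<and> r1 t < \<beta>" "\<forall>d \<in> set (seg m (r1 51) (length ts)). d < \<beta>"
      using Cons.prems dv mp unfolding s by (auto simp: r1t seg_Suc map_eq_conv)
    fix s' assume "case s' of (r', m') \<Rightarrow> m' = m \<and>
      dval \<beta> (map r' ts) + \<beta> ^ length ts * r' 53 = dval \<beta> (map r1 ts) + r1 52 * dval \<beta> (seg m (r1 51) (length ts)) + r1 53 \<and>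
      (\<forall>t \<in> set ts. r' t < \<beta>) \<and> r' 53 < \<beta> \<and> same_except ({50, 51, 53} \<union> set ts) r1 r'"
    then obtain r' where r': "s' = (r', m)"
      "dval \<beta> (map r' ts) + \<beta> ^ length ts * r' 53 =
        dval \<beta> (map r ts) + r 52 * dval \<beta> (seg m (Suc (r 51)) (length ts)) + ?u div \<beta>"
      "\<forall>t \<in> set ts. r' t < \<beta>" "r' 53 < \<beta>" "same_except ({50, 51, 53} \<union> set ts) r1 r'"
      unfolding mp s r1t by (cases s') auto
    have r't: "r' t = ?u mod \<beta>" using r'(5) t r1t by (auto dest: same_exceptD[of _ _ _ t])
    have "dval \<beta> (map r' (t # ts)) + \<beta> ^ length (t # ts) * r' 53 =
        ?u mod \<beta> + \<beta> * (dval \<beta> (map r' ts) + \<beta> ^ length ts * r' 53)"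
      by (simp add: r't algebra_simps)
    also have "\<dots> = (?u mod \<beta> + \<beta> * (?u div \<beta>)) +
        \<beta> * (dval \<beta> (map r ts) + r 52 * dval \<beta> (seg m (Suc (r 51)) (length ts)))"
      unfolding r'(2) by (simp add: algebra_simps)
    also have "?u mod \<beta> + \<beta> * (?u div \<beta>) = ?u" by simp
    finally have val: "dval \<beta> (map r' (t # ts)) + \<beta> ^ length (t # ts) * r' 53 =
        dval \<beta> (map r (t # ts)) + r 52 * dval \<beta> (seg m (r 51) (length (t # ts))) + r 53"
      by (simp add: seg_Suc algebra_simps)
    have "same_except ({50, 51, 53} \<union> set (t # ts)) r r'"
      using r'(5) by (auto simp: same_except_def r1_def)
    then show "case s' of (r', m') \<Rightarrow> m' = m \<and>
      dval \<beta> (map r' (t # ts)) + \<beta> ^ length (t # ts) * r' 53 =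
        dval \<beta> (map r (t # ts)) + r 52 * dval \<beta> (seg m (r 51) (length (t # ts))) + r 53 \<and>
      (\<forall>t \<in> set (t # ts). r' t < \<beta>) \<and> r' 53 < \<beta> \<and> same_except ({50, 51, 53} \<union> set (t # ts)) r r'"
      using r'(1,3,4) val r't Cons.prems(3) by simp
  qed (use Cons.prems in auto)
qed

section \<open>Arithmetic modulo a prime\<close>

text \<open>Residues modulo \<open>P\<close> are stored as \<open>cc\<close> digits in a base \<open>\<beta>\<close> of half the word length and multiplied
  by Montgomery's method, as the word RAM has no double-word product. Since \<open>P \<le> \<beta> ^ 16\<close>, 18 digits
  leave room for the carries.\<close>

definition cc :: nat where "cc = 18"

lemma cc_pos: "0 < cc" by (simp add: cc_def)

text \<open>The next window is shifted by one register. Montgomery's division by \<beta> after each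
  step is thus a renaming and takes no instruction.\<close>

definition win :: "nat \<Rightarrow> nat list" where "win i = [100 + i..<100 + i + cc]"

lemma length_win [simp]: "length (win i) = cc" and distinct_win [simp]: "distinct (win i)"
  and set_win: "set (win i) = {100 + i..<100 + i + cc}"
  by (auto simp: win_def)

lemma win_Cons: "win i = (100 + i) # [100 + Suc i..<100 + i + cc]"
  using cc_pos by (simp add: win_def upt_conv_Cons)

lemma win_snoc: "win (Suc i) = [100 + Suc i..<100 + i + cc] @ [100 + i + cc]"
proof -
  have e: "100 + Suc i + cc = Suc (100 + i + cc)" by simp
  show ?thesis unfolding win_def e by (rule upt_Suc_append) (use cc_pos in simp)
qed

definition padr :: nat where "padr = 10"
definition oadr :: nat where "oadr = padr + cc"

text \<open>One Montgomery step: the next digit of the first factor (pointer in register 54) times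
  the second factor (address in register 55) is added, then the multiple of the modulus that clears
  the lowest digit. The register cleared first is the top digit of the next window.\<close>

definition iter :: "nat \<Rightarrow> prog list" where
  "iter i = [Const (100 + i + cc) 0, Load 52 54, Op Add 54 54 2, Op Add 51 55 35, Const 53 0] @ addmul (win i) @
     [Op Mult 52 (100 + i) 4, Op Mod 52 52 3, Const 51 padr, Const 53 0] @ addmul (win i)"

primrec iters :: "nat \<Rightarrow> nat \<Rightarrow> prog list" where
  "iters i 0 = []"
| "iters i (Suc n) = iter i @ iters (Suc i) n"

primrec stores :: "nat list \<Rightarrow> prog list" where
  "stores [] = []"
| "stores (t # ts) = [Store 56 t, Op Add 56 56 2] @ stores ts"

definition zeros :: "nat list \<Rightarrow> prog list" where "zeros js = map (\<lambda>j. Const j 0) js"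

definition upd_range :: "nat \<Rightarrow> nat \<Rightarrow> nat list \<Rightarrow> nat list \<Rightarrow> bool" where
  "upd_range a n m m' \<longleftrightarrow> length m' = length m \<and> (\<forall>x. x < a \<or> a + n \<le> x \<longrightarrow> m' ! x = m ! x)"

lemma tc_zeros:
  "tc w (blk (zeros js)) (r, m) (length js)
     (\<lambda>(r', m'). m' = m \<and> (\<forall>j \<in> set js. r' j = 0) \<and> same_except (set js) r r')"
proof (induction js arbitrary: r)
  case Nil
  then show ?case by (simp add: zeros_def same_except_def)
next
  case (Cons j js)
  have "tc w (blk (zeros js)) (r(j := 0), m) (length js)
     (\<lambda>(r', m'). m' = m \<and> (\<forall>j \<in> set (j # js). r' j = 0) \<and> same_except (set (j # js)) r r')"
    by (rule tc_mono[OF Cons.IH order_refl]) (auto simp: same_except_def)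
  then show ?case by (simp add: zeros_def)
qed

lemma tc_stores:
  assumes "r 2 = 1" "r 56 + length ts < length m" "length m \<le> 2 ^ w" "56 \<notin> set ts"
  shows "tc w (blk (stores ts)) (r, m) (2 * length ts) (\<lambda>(r', m').
    upd_range (r 56) (length ts) m m' \<and> seg m' (r 56) (length ts) = map r ts \<and> same_except {56} r r')"
  using assms
proof (induction ts arbitrary: r m)
  case Nil
  then show ?case by (simp add: upd_range_def same_except_def)
next
  case (Cons t ts)
  let ?m = "m[r 56 := r t]" and ?r = "r(56 := r 56 + 1)"
  have "tc w (blk (stores ts)) (?r, ?m) (2 * length ts) (\<lambda>(r', m').
    upd_range (r 56) (length (t # ts)) m m' \<and> seg m' (r 56) (length (t # ts)) = map r (t # ts) \<and> same_except {56} r r')"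
  proof (rule tc_mono[OF Cons.IH order_refl])
    fix s' assume "case s' of (r', m') \<Rightarrow> upd_range (?r 56) (length ts) ?m m' \<and>
      seg m' (?r 56) (length ts) = map ?r ts \<and> same_except {56} ?r r'"
    moreover have "map ?r ts = map r ts" using Cons.prems by auto
    ultimately show "case s' of (r', m') \<Rightarrow> upd_range (r 56) (length (t # ts)) m m' \<and>
      seg m' (r 56) (length (t # ts)) = map r (t # ts) \<and> same_except {56} r r'"
      using Cons.prems by (auto simp: upd_range_def same_except_def seg_Suc)
  qed (use Cons.prems in auto)
  then show ?case using Cons.prems by (simp add: tc_Store)
qed

definition mulc :: "prog list" where "mulc = zeros (win 0) @ iters 0 cc"

lemma dval_zero: "\<forall>d \<in> set ds. d = 0 \<Longrightarrow> dval b ds = 0"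
  by (induction ds) auto

definition kmul :: nat where "kmul = cc + cc * (9 + 14 * cc)"

text \<open>\<open>pinv\<close> is minus the inverse of \<open>P\<close> modulo \<beta>. The bound
  on \<open>4 * P\<close> leaves a spare digit, so that sums of size at most
  \<open>4 * \<beta> * P\<close> fit into a window.\<close>

locale mont =
  fixes w \<beta> P pinv :: nat
  assumes beta: "2 \<le> \<beta>" and bw: "\<beta> * \<beta> \<le> 2 ^ w" and P1: "1 < P" and Pb: "4 * P \<le> \<beta> ^ (cc - 1)"
    and pinv: "(P * pinv + 1) mod \<beta> = 0" and pinv_less: "pinv < \<beta>"
begin

definition regs_ok :: "(nat \<Rightarrow> nat) \<Rightarrow> bool" where
  "regs_ok r \<longleftrightarrow> r 2 = 1 \<and> r 3 = \<beta> \<and> r 4 = pinv \<and> r 35 = 0"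

definition num :: "nat list \<Rightarrow> nat \<Rightarrow> bool" where
  "num m a \<longleftrightarrow> a + cc < length m \<and> (\<forall>d \<in> set (seg m a cc). d < \<beta>)"

abbreviation nval :: "nat list \<Rightarrow> nat \<Rightarrow> nat" where "nval m a \<equiv> dval \<beta> (seg m a cc)"

definition mem_ok :: "nat list \<Rightarrow> bool" where
  "mem_ok m \<longleftrightarrow> length m \<le> 2 ^ w \<and> 200 < length m \<and> num m padr \<and> nval m padr = P \<and> num m oadr \<and> nval m oadr = 1"

lemma PB: "4 * \<beta> * P \<le> \<beta> ^ cc"
proof -
  have "\<beta> * (4 * P) \<le> \<beta> * \<beta> ^ (cc - 1)" using Pb by (rule mult_left_mono) simp
  also have "\<dots> = \<beta> ^ cc" using cc_pos by (metis Suc_pred' power_Suc)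
  finally show ?thesis by (simp add: algebra_simps)
qed

lemma no_carry:
  assumes "v + \<beta> ^ cc * c = x" "x < \<beta> ^ cc" shows "c = 0" "v = x"
proof -
  show "c = 0" using assms by (cases c) auto
  then show "v = x" using assms by simp
qed

text \<open>Both added products are at most \<open>(\<beta> - 1) * P\<close>, so starting below
  \<open>2 * P\<close> the sum stays below \<open>\<beta> ^ cc\<close> and no carry leaves the
  window.\<close>

lemma tc_iter:
  assumes r: "regs_ok r" and m: "mem_ok m"
    and T: "dval \<beta> (map r (win i)) < 2 * P" "\<forall>t \<in> set (win i). r t < \<beta>"
    and x: "r 54 + 1 < length m" "m ! r 54 < \<beta>" and B: "num m (r 55)" "nval m (r 55) < P"
  shows "tc w (blk (iter i)) (r, m) (9 + 14 * cc) (\<lambda>(r', m'). m' = m \<and>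
    (\<exists>q < \<beta>. \<beta> * dval \<beta> (map r' (win (Suc i))) =
       dval \<beta> (map r (win i)) + m ! r 54 * nval m (r 55) + q * P) \<and>
    (\<forall>t \<in> set (win (Suc i)). r' t < \<beta>) \<and> r' 54 = r 54 + 1 \<and>
    same_except ({50..54} \<union> {100 + i..100 + i + cc}) r r')"
proof -
  let ?T = "dval \<beta> (map r (win i))" and ?x = "m ! r 54" and ?B = "nval m (r 55)"
  have lw: "length m \<le> 2 ^ w" "200 < length m" using m by (auto simp: mem_ok_def)
  have bpos: "0 < \<beta>" using beta by simp
  have xB: "?x * ?B \<le> (\<beta> - 1) * P" using x B by (intro mult_le_mono) auto
  have PP: "2 * P + (\<beta> - 1) * P + (\<beta> - 1) * P \<le> \<beta> ^ cc"
  proof -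
    obtain k where k: "\<beta> = Suc k" using bpos by (cases \<beta>) auto
    have "2 * P + (\<beta> - 1) * P + (\<beta> - 1) * P \<le> 4 * \<beta> * P" unfolding k by (simp add: algebra_simps)
    then show ?thesis using PB by linarith
  qed
  define r1 where "r1 = r(100 + i + cc := 0, 52 := ?x, 54 := r 54 + 1, 51 := r 55, 53 := 0)"
  have ni: "100 + i + cc \<noteq> 52" "100 + i + cc \<noteq> 54" "100 + i + cc \<noteq> 51" "100 + i + cc \<noteq> 53" "100 + i + cc \<noteq> 35"
    "100 + i + cc \<noteq> 55" "100 + i + cc \<noteq> 2" "100 + i + cc \<noteq> 3" "100 + i + cc \<noteq> 4" by auto
  have r1: "r1 51 = r 55" "r1 52 = ?x" "r1 53 = 0" "r1 2 = 1" "r1 3 = \<beta>" "r1 4 = pinv" "r1 35 = 0" "r1 55 = r 55"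
      "r1 (100 + i + cc) = 0" "r1 54 = r 54 + 1"
    using r ni by (auto simp: r1_def regs_ok_def)
  have w1: "map r1 (win i) = map r (win i)" by (auto simp: r1_def set_win)
  have blk1: "tc w (blk ([Const (100 + i + cc) 0, Load 52 54, Op Add 54 54 2, Op Add 51 55 35, Const 53 0] @ ps)) (r, m) (n + 5) Q
      \<longleftrightarrow> tc w (blk ps) (r1, m) n Q" for ps n Q
  proof -
    have "r 55 < 2 ^ w" "Suc (r 54) < 2 ^ w" using B(1) lw x by (auto simp: num_def)
    then show ?thesis using r x ni by (simp add: tc_Load r1_def regs_ok_def fun_upd_twist)
  qed
  let ?Q1 = "\<lambda>(r', m'). m' = m \<and> dval \<beta> (map r' (win i)) = ?T + ?x * ?B \<and> (\<forall>t \<in> set (win i). r' t < \<beta>) \<and>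
     same_except ({50, 51, 53} \<union> set (win i)) r1 r'"
  have a1: "tc w (blk (addmul (win i))) (r1, m) (7 * cc) ?Q1"
  proof -
    have "tc w (blk (addmul (win i))) (r1, m) (7 * length (win i)) (\<lambda>(r', m'). m' = m \<and>
      dval \<beta> (map r' (win i)) + \<beta> ^ length (win i) * r' 53 =
        dval \<beta> (map r1 (win i)) + r1 52 * dval \<beta> (seg m (r1 51) (length (win i))) + r1 53 \<and>
      (\<forall>t \<in> set (win i). r' t < \<beta>) \<and> r' 53 < \<beta> \<and> same_except ({50, 51, 53} \<union> set (win i)) r1 r')"
      by (rule tc_addmul) (use r1 bw bpos lw B x T w1 in \<open>auto simp: num_def set_win map_eq_conv\<close>)
    then show ?thesis
    proof (rule tc_mono)
      fix s' assume "case s' of (r', m') \<Rightarrow> m' = m \<and>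
        dval \<beta> (map r' (win i)) + \<beta> ^ length (win i) * r' 53 =
          dval \<beta> (map r1 (win i)) + r1 52 * dval \<beta> (seg m (r1 51) (length (win i))) + r1 53 \<and>
        (\<forall>t \<in> set (win i). r' t < \<beta>) \<and> r' 53 < \<beta> \<and> same_except ({50, 51, 53} \<union> set (win i)) r1 r'"
      then obtain r' where r': "s' = (r', m)" "dval \<beta> (map r' (win i)) + \<beta> ^ cc * r' 53 = ?T + ?x * ?B"
        "\<forall>t \<in> set (win i). r' t < \<beta>" "same_except ({50, 51, 53} \<union> set (win i)) r1 r'"
        unfolding w1 by (cases s') (auto simp: r1)
      have "?T + ?x * ?B < \<beta> ^ cc" using T(1) xB PP by linarith
      from no_carry(2)[OF r'(2) this] show "?Q1 s'" using r' by simp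
    qed simp
  qed
  have blk2: "tc w (blk ([Op Mult 52 (100 + i) 4, Op Mod 52 52 3, Const 51 padr, Const 53 0] @ ps)) (r2, m) (n + 4) Q
      \<longleftrightarrow> tc w (blk ps) (r2(52 := r2 (100 + i) * pinv mod \<beta>, 51 := padr, 53 := 0), m) n Q"
    if "r2 (100 + i) < \<beta>" "r2 4 = pinv" "r2 3 = \<beta>" for ps n Q r2
  proof -
    have "r2 (100 + i) * pinv < \<beta> * \<beta>" using that pinv_less by (intro mult_strict_mono) auto
    then have "r2 (100 + i) * pinv < 2 ^ w" using bw by linarith
    moreover have "padr < 2 ^ w" using lw by (simp add: padr_def)
    ultimately show ?thesis using that by (simp)
  qed
  have a2: "tc w (blk ([Op Mult 52 (100 + i) 4, Op Mod 52 52 3, Const 51 padr, Const 53 0] @ addmul (win i))) (r2, m) (7 * cc + 4)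
    (\<lambda>(r', m'). m' = m \<and>
    (\<exists>q < \<beta>. \<beta> * dval \<beta> (map r' (win (Suc i))) = ?T + ?x * ?B + q * P) \<and>
    (\<forall>t \<in> set (win (Suc i)). r' t < \<beta>) \<and> r' 54 = r 54 + 1 \<and>
    same_except ({50..54} \<union> {100 + i..100 + i + cc}) r r')"
    if r2: "dval \<beta> (map r2 (win i)) = ?T + ?x * ?B" "\<forall>t \<in> set (win i). r2 t < \<beta>"
      "same_except ({50, 51, 53} \<union> set (win i)) r1 r2" for r2
  proof -
    have e: "r2 k = r1 k" if "k \<notin> {50, 51, 53} \<union> set (win i)" for k using r2(3) that by (rule same_exceptD)
    have r2r: "r2 3 = \<beta>" "r2 4 = pinv" "r2 2 = 1" "r2 (100 + i + cc) = 0" "r2 54 = r 54 + 1"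
      using r1 by (auto simp: e set_win)
    have r2i: "r2 (100 + i) < \<beta>" using r2(2) cc_pos by (auto simp: set_win)
    let ?q = "r2 (100 + i) * pinv mod \<beta>"
    define r3 where "r3 = r2(52 := ?q, 51 := padr, 53 := 0)"
    have q: "?q < \<beta>" using bpos by simp
    have w3: "map r3 (win i) = map r2 (win i)" by (auto simp: r3_def set_win)
    have r3: "r3 51 = padr" "r3 52 = ?q" "r3 53 = 0" "r3 2 = 1" "r3 3 = \<beta>" "r3 54 = r 54 + 1" "r3 (100 + i + cc) = 0"
      using r2r by (auto simp: r3_def)
    have "tc w (blk (addmul (win i))) (r3, m) (7 * length (win i)) (\<lambda>(r', m'). m' = m \<and>
      dval \<beta> (map r' (win i)) + \<beta> ^ length (win i) * r' 53 =
        dval \<beta> (map r3 (win i)) + r3 52 * dval \<beta> (seg m (r3 51) (length (win i))) + r3 53 \<and>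
      (\<forall>t \<in> set (win i). r' t < \<beta>) \<and> r' 53 < \<beta> \<and> same_except ({50, 51, 53} \<union> set (win i)) r3 r')"
      by (rule tc_addmul) (use r3 bw bpos lw m q r2(2) w3 in \<open>auto simp: num_def set_win map_eq_conv mem_ok_def\<close>)
    then have "tc w (blk (addmul (win i))) (r3, m) (7 * cc) (\<lambda>(r', m'). m' = m \<and>
    (\<exists>q < \<beta>. \<beta> * dval \<beta> (map r' (win (Suc i))) = ?T + ?x * ?B + q * P) \<and>
    (\<forall>t \<in> set (win (Suc i)). r' t < \<beta>) \<and> r' 54 = r 54 + 1 \<and>
    same_except ({50..54} \<union> {100 + i..100 + i + cc}) r r')"
    proof (rule tc_mono)
      fix s' assume "case s' of (r', m') \<Rightarrow> m' = m \<and>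
        dval \<beta> (map r' (win i)) + \<beta> ^ length (win i) * r' 53 =
          dval \<beta> (map r3 (win i)) + r3 52 * dval \<beta> (seg m (r3 51) (length (win i))) + r3 53 \<and>
        (\<forall>t \<in> set (win i). r' t < \<beta>) \<and> r' 53 < \<beta> \<and> same_except ({50, 51, 53} \<union> set (win i)) r3 r'"
      then obtain r' where r': "s' = (r', m)"
        "dval \<beta> (map r' (win i)) + \<beta> ^ cc * r' 53 = ?T + ?x * ?B + ?q * P"
        "\<forall>t \<in> set (win i). r' t < \<beta>" "same_except ({50, 51, 53} \<union> set (win i)) r3 r'"
        unfolding w3 r2(1) using m by (cases s') (auto simp: r3 mem_ok_def)
      have e': "r' k = r3 k" if "k \<notin> {50, 51, 53} \<union> set (win i)" for k using r'(4) that by (rule same_exceptD)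
      have qP: "?q * P \<le> (\<beta> - 1) * P" using q by (intro mult_right_mono) auto
      have "?T + ?x * ?B + ?q * P < \<beta> ^ cc" using T(1) xB qP PP by linarith
      from no_carry(2)[OF r'(2) this]
      have v: "dval \<beta> (map r' (win i)) = ?T + ?x * ?B + ?q * P" .
      have low: "dval \<beta> (map f (win i)) = f (100 + i) + \<beta> * dval \<beta> (map f [100 + Suc i..<100 + i + cc])" for f
        by (simp add: win_Cons)
      \<comment> \<open>\<open>P * pinv\<close> is -1 modulo \<beta>, so this digit vanishes and
        dropping it divides exactly by \<beta>.\<close>
      have "r' (100 + i) = dval \<beta> (map r' (win i)) mod \<beta>"
        using r'(3) cc_pos unfolding low by (simp add: set_win)
      also have "\<dots> = (dval \<beta> (map r2 (win i)) + ?q * P) mod \<beta>" unfolding v r2(1) ..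
      also have "\<dots> = (r2 (100 + i) + ?q * P) mod \<beta>" 
      proof -
        have "(x + \<beta> * k + y) mod \<beta> = (x + y) mod \<beta>" for x k y
          using mod_mult_self2[of "x + y" \<beta> k] by (simp add: ac_simps)
        then show ?thesis unfolding low .
      qed
      also have "\<dots> = (r2 (100 + i) + r2 (100 + i) * pinv * P) mod \<beta>" by (metis mod_add_right_eq mod_mult_left_eq)
      also have "\<dots> = (r2 (100 + i) * (P * pinv + 1)) mod \<beta>" by (simp add: algebra_simps)
      also have "\<dots> = 0" using pinv by (metis mod_mult_right_eq mult_0_right mod_0)
      finally have z: "r' (100 + i) = 0" .
      have z2: "r' (100 + i + cc) = 0" using e' r3(7) by (simp add: set_win)
      have "dval \<beta> (map r' (win (Suc i))) = dval \<beta> (map r' [100 + Suc i..<100 + i + cc])"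
        using z2 by (simp add: win_snoc dval_append)
      then have "\<beta> * dval \<beta> (map r' (win (Suc i))) = ?T + ?x * ?B + ?q * P" using v z unfolding low by simp
      moreover have "\<forall>t \<in> set (win (Suc i)). r' t < \<beta>"
        using r'(3) z2 bpos by (auto simp: win_Cons[of i] win_snoc)
      moreover have "r' 54 = r 54 + 1" using e' r3(6) by (simp add: set_win)
      moreover have "same_except ({50..54} \<union> {100 + i..100 + i + cc}) r r'"
        unfolding same_except_def
      proof (intro allI impI)
        fix k assume k: "k \<notin> {50..54} \<union> {100 + i..100 + i + cc}"
        then have "r' k = r3 k" by (intro e') (auto simp: set_win)
        also have "\<dots> = r2 k" using k by (auto simp: r3_def)
        also have "\<dots> = r1 k" using k by (intro e) (auto simp: set_win)
        also have "\<dots> = r k" using k by (auto simp: r1_def)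
        finally show "r' k = r k" .
      qed
      ultimately show "case s' of (r', m') \<Rightarrow> m' = m \<and>
        (\<exists>q < \<beta>. \<beta> * dval \<beta> (map r' (win (Suc i))) = ?T + ?x * ?B + q * P) \<and>
        (\<forall>t \<in> set (win (Suc i)). r' t < \<beta>) \<and> r' 54 = r 54 + 1 \<and>
        same_except ({50..54} \<union> {100 + i..100 + i + cc}) r r'"
        using r'(1) q by auto
    qed simp
    then show ?thesis using blk2[OF r2i r2r(2,1)] unfolding r3_def by blast
  qed
  have "tc w (blk (addmul (win i) @ [Op Mult 52 (100 + i) 4, Op Mod 52 52 3, Const 51 padr, Const 53 0] @ addmul (win i)))
    (r1, m) (4 + 14 * cc) (\<lambda>(r', m'). m' = m \<and>
    (\<exists>q < \<beta>. \<beta> * dval \<beta> (map r' (win (Suc i))) = ?T + ?x * ?B + q * P) \<and>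
    (\<forall>t \<in> set (win (Suc i)). r' t < \<beta>) \<and> r' 54 = r 54 + 1 \<and>
    same_except ({50..54} \<union> {100 + i..100 + i + cc}) r r')"
  proof (rule tc_append[OF a1])
    fix s' assume "?Q1 s'"
    then obtain r2 where r2: "s' = (r2, m)" "dval \<beta> (map r2 (win i)) = ?T + ?x * ?B" "\<forall>t \<in> set (win i). r2 t < \<beta>"
      "same_except ({50, 51, 53} \<union> set (win i)) r1 r2" by (cases s') auto
    show "tc w (blk ([Op Mult 52 (100 + i) 4, Op Mod 52 52 3, Const 51 padr, Const 53 0] @ addmul (win i))) s' (7 * cc + 4)
      (\<lambda>(r', m'). m' = m \<and>
      (\<exists>q < \<beta>. \<beta> * dval \<beta> (map r' (win (Suc i))) = ?T + ?x * ?B + q * P) \<and>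
      (\<forall>t \<in> set (win (Suc i)). r' t < \<beta>) \<and> r' 54 = r 54 + 1 \<and>
      same_except ({50..54} \<union> {100 + i..100 + i + cc}) r r')" unfolding r2(1) by (rule a2[OF r2(2-4)])
  qed simp
  then show ?thesis unfolding iter_def using blk1[of _ "4 + 14 * cc"] by (simp add: add.commute)
qed

text \<open>The bound \<open>2 * P\<close> reproduces itself:
  \<open>2 * P + 2 * (\<beta> - 1) * P\<close> divided by \<beta> is again
  \<open>2 * P\<close>.\<close>

lemma tc_iters:
  assumes "regs_ok r" "mem_ok m" "dval \<beta> (map r (win i)) < 2 * P" "\<forall>t \<in> set (win i). r t < \<beta>"
    "r 54 + n < length m" "\<forall>d \<in> set (seg m (r 54) n). d < \<beta>" "num m (r 55)" "nval m (r 55) < P"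
  shows "tc w (blk (iters i n)) (r, m) (n * (9 + 14 * cc)) (\<lambda>(r', m'). m' = m \<and>
    (\<exists>q < \<beta> ^ n. \<beta> ^ n * dval \<beta> (map r' (win (i + n))) =
       dval \<beta> (map r (win i)) + dval \<beta> (seg m (r 54) n) * nval m (r 55) + q * P) \<and>
    dval \<beta> (map r' (win (i + n))) < 2 * P \<and>
    (\<forall>t \<in> set (win (i + n)). r' t < \<beta>) \<and> same_except ({50..54} \<union> {100..100 + i + n + cc}) r r')"
  using assms
proof (induction n arbitrary: i r)
  case 0
  then show ?case by (auto simp: same_except_def)
next
  case (Suc n)
  let ?x = "m ! r 54" and ?B = "nval m (r 55)"
  have bpos: "0 < \<beta>" using beta by simp
  have x: "?x < \<beta>" "\<forall>d \<in> set (seg m (Suc (r 54)) n). d < \<beta>" using Suc.prems(6) by (auto simp: seg_Suc)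
  show ?case unfolding iters.simps
  proof (rule tc_append[OF tc_iter])
    fix s' assume "case s' of (r', m') \<Rightarrow> m' = m \<and>
      (\<exists>q < \<beta>. \<beta> * dval \<beta> (map r' (win (Suc i))) = dval \<beta> (map r (win i)) + ?x * ?B + q * P) \<and>
      (\<forall>t \<in> set (win (Suc i)). r' t < \<beta>) \<and> r' 54 = r 54 + 1 \<and>
      same_except ({50..54} \<union> {100 + i..100 + i + cc}) r r'"
    then obtain r1 q1 where r1: "s' = (r1, m)" "q1 < \<beta>"
      "\<beta> * dval \<beta> (map r1 (win (Suc i))) = dval \<beta> (map r (win i)) + ?x * ?B + q1 * P"
      "\<forall>t \<in> set (win (Suc i)). r1 t < \<beta>" "r1 54 = r 54 + 1"
      "same_except ({50..54} \<union> {100 + i..100 + i + cc}) r r1" by (cases s') auto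
    have e: "r1 k = r k" if "k \<notin> {50..54} \<union> {100 + i..100 + i + cc}" for k using r1(6) that by (rule same_exceptD)
    have T1: "dval \<beta> (map r1 (win (Suc i))) < 2 * P"
    proof -
      have "?x * ?B \<le> (\<beta> - 1) * P" "q1 * P \<le> (\<beta> - 1) * P"
        using x Suc.prems(8) r1(2) by (auto intro!: mult_le_mono)
      then have "\<beta> * dval \<beta> (map r1 (win (Suc i))) < 2 * P + (\<beta> - 1) * P + (\<beta> - 1) * P"
        unfolding r1(3) using Suc.prems(3) by linarith
      also have "\<dots> = \<beta> * (2 * P)" using bpos by (cases \<beta>) (auto simp: algebra_simps)
      finally show ?thesis using bpos by simp
    qed
    have r55: "r1 55 = r 55" by (simp add: e)
    have "tc w (blk (iters (Suc i) n)) (r1, m) (n * (9 + 14 * cc)) (\<lambda>(r', m'). m' = m \<and>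
      (\<exists>q < \<beta> ^ n. \<beta> ^ n * dval \<beta> (map r' (win (Suc i + n))) =
         dval \<beta> (map r1 (win (Suc i))) + dval \<beta> (seg m (r1 54) n) * nval m (r1 55) + q * P) \<and>
      dval \<beta> (map r' (win (Suc i + n))) < 2 * P \<and>
      (\<forall>t \<in> set (win (Suc i + n)). r' t < \<beta>) \<and> same_except ({50..54} \<union> {100..100 + Suc i + n + cc}) r1 r')"
      using Suc.prems x r1 T1 by (intro Suc.IH) (auto simp: regs_ok_def e)
    then show "tc w (blk (iters (Suc i) n)) s' (n * (9 + 14 * cc)) (\<lambda>(r', m'). m' = m \<and>
      (\<exists>q < \<beta> ^ Suc n. \<beta> ^ Suc n * dval \<beta> (map r' (win (i + Suc n))) =
         dval \<beta> (map r (win i)) + dval \<beta> (seg m (r 54) (Suc n)) * ?B + q * P) \<and>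
      dval \<beta> (map r' (win (i + Suc n))) < 2 * P \<and>
      (\<forall>t \<in> set (win (i + Suc n)). r' t < \<beta>) \<and> same_except ({50..54} \<union> {100..100 + i + Suc n + cc}) r r')"
      unfolding r1(1)
    proof (rule tc_mono)
      fix s'' assume "case s'' of (r', m') \<Rightarrow> m' = m \<and>
        (\<exists>q < \<beta> ^ n. \<beta> ^ n * dval \<beta> (map r' (win (Suc i + n))) =
           dval \<beta> (map r1 (win (Suc i))) + dval \<beta> (seg m (r1 54) n) * nval m (r1 55) + q * P) \<and>
        dval \<beta> (map r' (win (Suc i + n))) < 2 * P \<and>
        (\<forall>t \<in> set (win (Suc i + n)). r' t < \<beta>) \<and> same_except ({50..54} \<union> {100..100 + Suc i + n + cc}) r1 r'"
      then obtain r' q where r': "s'' = (r', m)" "q < \<beta> ^ n"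
        "\<beta> ^ n * dval \<beta> (map r' (win (Suc i + n))) =
           dval \<beta> (map r1 (win (Suc i))) + dval \<beta> (seg m (Suc (r 54)) n) * ?B + q * P"
        "dval \<beta> (map r' (win (Suc i + n))) < 2 * P"
        "\<forall>t \<in> set (win (Suc i + n)). r' t < \<beta>" "same_except ({50..54} \<union> {100..100 + Suc i + n + cc}) r1 r'"
        unfolding r1(5) r55 by (cases s'') auto
      have "\<beta> ^ Suc n * dval \<beta> (map r' (win (Suc i + n))) =
          \<beta> * dval \<beta> (map r1 (win (Suc i))) + \<beta> * dval \<beta> (seg m (Suc (r 54)) n) * ?B + \<beta> * q * P"
        using arg_cong[OF r'(3), of "\<lambda>z. \<beta> * z"] by (simp add: algebra_simps)
      then have v: "\<beta> ^ Suc n * dval \<beta> (map r' (win (Suc i + n))) =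
          dval \<beta> (map r (win i)) + dval \<beta> (seg m (r 54) (Suc n)) * ?B + (q1 + \<beta> * q) * P"
        unfolding r1(3) by (simp add: seg_Suc algebra_simps)
      have "\<beta> * Suc q \<le> \<beta> * \<beta> ^ n" using r'(2) by (intro mult_left_mono) auto
      then have qq: "q1 + \<beta> * q < \<beta> ^ Suc n" using r1(2) by simp
      have "same_except ({50..54} \<union> {100..100 + i + Suc n + cc}) r r'"
        using r'(6) r1(6) unfolding same_except_def by auto
      then show "case s'' of (r', m') \<Rightarrow> m' = m \<and>
        (\<exists>q < \<beta> ^ Suc n. \<beta> ^ Suc n * dval \<beta> (map r' (win (i + Suc n))) =
           dval \<beta> (map r (win i)) + dval \<beta> (seg m (r 54) (Suc n)) * ?B + q * P) \<and>
        dval \<beta> (map r' (win (i + Suc n))) < 2 * P \<and>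
        (\<forall>t \<in> set (win (i + Suc n)). r' t < \<beta>) \<and> same_except ({50..54} \<union> {100..100 + i + Suc n + cc}) r r'"
        using r'(1,4,5) v qq by auto
    qed simp
  qed (use Suc.prems x in auto)
qed

lemma tc_mulc:
  assumes "regs_ok r" "mem_ok m" "num m (r 54)" "num m (r 55)" "nval m (r 55) < P"
  shows "tc w (blk mulc) (r, m) kmul (\<lambda>(r', m'). m' = m \<and>
    (\<exists>q < \<beta> ^ cc. \<beta> ^ cc * dval \<beta> (map r' (win cc)) = nval m (r 54) * nval m (r 55) + q * P) \<and>
    dval \<beta> (map r' (win cc)) < 2 * P \<and>
    (\<forall>t \<in> set (win cc). r' t < \<beta>) \<and> same_except ({50..54} \<union> {100..}) r r')"
  unfolding mulc_def
proof (rule tc_append[OF tc_zeros])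
  fix s' assume "case s' of (r', m') \<Rightarrow> m' = m \<and> (\<forall>j\<in>set (win 0). r' j = 0) \<and> same_except (set (win 0)) r r'"
  then obtain r1 where r1: "s' = (r1, m)" "\<forall>j\<in>set (win 0). r1 j = 0" "same_except (set (win 0)) r r1" by (cases s') auto
  have e: "r1 k = r k" if "k < 100" for k using r1(3) that by (intro same_exceptD[OF r1(3)]) (auto simp: set_win)
  have z: "dval \<beta> (map r1 (win 0)) = 0" using r1(2) by (intro dval_zero) auto
  have "tc w (blk (iters 0 cc)) (r1, m) (cc * (9 + 14 * cc)) (\<lambda>(r', m'). m' = m \<and>
    (\<exists>q < \<beta> ^ cc. \<beta> ^ cc * dval \<beta> (map r' (win (0 + cc))) =
       dval \<beta> (map r1 (win 0)) + dval \<beta> (seg m (r1 54) cc) * nval m (r1 55) + q * P) \<and>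
    dval \<beta> (map r' (win (0 + cc))) < 2 * P \<and>
    (\<forall>t \<in> set (win (0 + cc)). r' t < \<beta>) \<and> same_except ({50..54} \<union> {100..100 + 0 + cc + cc}) r1 r')"
    using assms P1 z r1(2) beta by (intro tc_iters) (auto simp: regs_ok_def e num_def)
  then show "tc w (blk (iters 0 cc)) s' (cc * (9 + 14 * cc)) (\<lambda>(r', m'). m' = m \<and>
    (\<exists>q < \<beta> ^ cc. \<beta> ^ cc * dval \<beta> (map r' (win cc)) = nval m (r 54) * nval m (r 55) + q * P) \<and>
    dval \<beta> (map r' (win cc)) < 2 * P \<and>
    (\<forall>t \<in> set (win cc). r' t < \<beta>) \<and> same_except ({50..54} \<union> {100..}) r r')"
    unfolding r1(1)
  proof (rule tc_mono)
    fix s'' assume "case s'' of (r', m') \<Rightarrow> m' = m \<and>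
      (\<exists>q < \<beta> ^ cc. \<beta> ^ cc * dval \<beta> (map r' (win (0 + cc))) =
         dval \<beta> (map r1 (win 0)) + dval \<beta> (seg m (r1 54) cc) * nval m (r1 55) + q * P) \<and>
      dval \<beta> (map r' (win (0 + cc))) < 2 * P \<and>
      (\<forall>t \<in> set (win (0 + cc)). r' t < \<beta>) \<and> same_except ({50..54} \<union> {100..100 + 0 + cc + cc}) r1 r'"
    moreover have "same_except ({50..54} \<union> {100..}) r r'"
      if "same_except ({50..54} \<union> {100..100 + 0 + cc + cc}) r1 r'" for r'
      using that r1(3) by (auto simp: same_except_def set_win)
    ultimately show "case s'' of (r', m') \<Rightarrow> m' = m \<and>
      (\<exists>q < \<beta> ^ cc. \<beta> ^ cc * dval \<beta> (map r' (win cc)) = nval m (r 54) * nval m (r 55) + q * P) \<and>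
      dval \<beta> (map r' (win cc)) < 2 * P \<and>
      (\<forall>t \<in> set (win cc). r' t < \<beta>) \<and> same_except ({50..54} \<union> {100..}) r r'"
      using z by (auto simp: e)
  qed simp
qed (simp add: kmul_def)

end

section \<open>Hashes of concatenations\<close>

definition hcat :: "prog list" where
  "hcat = [Op Add 54 31 35, Const 57 3, Op Add 55 32 57] @ mulc @
     [Const 57 (3 + cc), Op Add 51 32 57, Const 52 1, Const 53 0] @ addmul (win cc) @
     [Op Add 56 33 35] @ stores (win cc)"

text \<open>Montgomery multiplication by the plain number 1 is a bare reduction.\<close>

definition norm_hash :: "prog list" where
  "norm_hash = [Op Add 54 31 35, Const 55 oadr] @ mulc @ [Op Add 56 33 35] @ stores (win cc)"

primrec eqs :: "nat \<Rightarrow> prog list" where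
  "eqs 0 = []"
| "eqs (Suc n) = [Load 59 61, Load 60 62, Cond (Equal 59 60) (blk []) (blk [Const 58 0]),
     Op Add 61 61 2, Op Add 62 62 2] @ eqs n"

lemma tc_eqs:
  assumes "r 2 = 1" "length m \<le> 2 ^ w" "r 61 + n < length m" "r 62 + n < length m"
  shows "tc w (blk (eqs n)) (r, m) (6 * n) (\<lambda>(r', m'). m' = m \<and>
    r' 58 = (if seg m (r 61) n = seg m (r 62) n then r 58 else 0) \<and> same_except {58..62} r r')"
  using assms
proof (induction n arbitrary: r)
  case 0
  then show ?case by (simp add: same_except_def)
next
  case (Suc n)
  define r1 where "r1 = r(59 := m ! r 61, 60 := m ! r 62,
    58 := (if m ! r 61 = m ! r 62 then r 58 else 0), 61 := r 61 + 1, 62 := r 62 + 1)"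
  define Q where "Q = (\<lambda>(r', m'). m' = m \<and>
    r' 58 = (if seg m (r 61) (Suc n) = seg m (r 62) (Suc n) then r 58 else 0) \<and> same_except {58..62} r r')"
  have *: "tc w (blk (eqs n)) (r1, m) (6 * n) Q"
  proof (rule tc_mono[OF Suc.IH order_refl])
    fix s' assume "case s' of (r', m') \<Rightarrow> m' = m \<and>
      r' 58 = (if seg m (r1 61) n = seg m (r1 62) n then r1 58 else 0) \<and> same_except {58..62} r1 r'"
    then show "Q s'"
      by (auto simp: r1_def seg_Suc same_except_def Q_def)
  qed (use Suc.prems in \<open>auto simp: r1_def\<close>)
  have **: "tc w (blk (eqs n)) (r1, m) (Suc (6 * n)) Q" by (rule tc_mono[OF *]) auto
  have e1: "r1 = r(59 := m ! r 61, 60 := m ! r 62, 61 := Suc (r 61), 62 := Suc (r 62))"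
    if "m ! r 61 = m ! r 62" using that by (auto simp: r1_def fun_eq_iff)
  have e2: "r1 = r(59 := m ! r 61, 60 := m ! r 62, 58 := 0, 61 := Suc (r 61), 62 := Suc (r 62))"
    if "m ! r 61 \<noteq> m ! r 62" using that by (auto simp: r1_def fun_eq_iff)
  have "tc w (blk (eqs (Suc n))) (r, m) (6 * Suc n) Q"
    unfolding eqs.simps append_Cons append_Nil using Suc.prems
    apply (simp add: tc_Load)
    apply (rule tc_Cond)
      apply simp
     apply (use ** e1 in simp)
    apply (use * e2 in simp)
    done
  then show ?case unfolding Q_def .
qed

locale hashing = mont +
  fixes c :: "'a \<Rightarrow> nat" and b :: nat
  assumes cop: "coprime b P" "coprime \<beta> P"
begin

text \<open>Values kept during a computation are only reduced below \<open>3 * P\<close>, so that no comparison with \<open>P\<close> is needed.\<close>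

definition rep :: "nat list \<Rightarrow> nat \<Rightarrow> 'a list \<Rightarrow> bool" where
  "rep m a u \<longleftrightarrow> num m a \<and> 0 < nval m a \<and> nval m a < 3 * P \<and> nval m a mod P = hash c b u mod P"

text \<open>The power of the base carries the factor \<open>\<beta> ^ cc\<close> that Montgomery
  multiplication divides out again. The hash itself is only ever added and is stored without
  it.\<close>

definition nodeh :: "nat list \<Rightarrow> nat \<Rightarrow> 'a list \<Rightarrow> bool" where
  "nodeh m v s \<longleftrightarrow> num m (v + 3) \<and> nval m (v + 3) = b ^ length s * \<beta> ^ cc mod P \<and>
     num m (v + (3 + cc)) \<and> nval m (v + (3 + cc)) = hash c b s mod P"

lemma cancel_beta: "x * \<beta> ^ cc mod P = y * \<beta> ^ cc mod P \<Longrightarrow> x mod P = y mod P"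
proof -
  assume e: "x * \<beta> ^ cc mod P = y * \<beta> ^ cc mod P"
  have "coprime (\<beta> ^ cc) P" using cop(2) by simp
  have *: "x mod P = y mod P" if "x * \<beta> ^ cc mod P = y * \<beta> ^ cc mod P" "y \<le> x" for x y
  proof -
    have "P dvd x * \<beta> ^ cc - y * \<beta> ^ cc" using that by (metis mod_eq_dvd_iff_nat mult_le_mono1)
    then have "P dvd (x - y) * \<beta> ^ cc" by (simp add: diff_mult_distrib)
    then have "P dvd x - y" using \<open>coprime (\<beta> ^ cc) P\<close> by (simp add: coprime_commute coprime_dvd_mult_left_iff)
    then show ?thesis using that(2) by (simp add: mod_eq_dvd_iff_nat)
  qed
  show ?thesis using *[of x y] *[of y x] e by (cases "y \<le> x") auto
qed

definition khcat :: nat where "khcat = kmul + 9 * cc + 8"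

lemma num_upd: "num m a \<Longrightarrow> upd_range x n m m' \<Longrightarrow> a + cc \<le> x \<or> x + n \<le> a \<Longrightarrow> num m' a \<and> nval m' a = nval m a"
proof -
  assume *: "num m a" "upd_range x n m m'" "a + cc \<le> x \<or> x + n \<le> a"
  have "seg m' a cc = seg m a cc" by (rule seg_cong) (use * in \<open>auto simp: upd_range_def\<close>)
  then show ?thesis using * by (simp add: num_def upd_range_def)
qed

text \<open>The reduced product is below \<open>2 * P\<close> and the stored hash below
  \<open>P\<close>, which restores the bound \<open>3 * P\<close>. Positivity survives because
  \<open>b\<close> and \<beta> are units modulo \<open>P\<close>, so the stored power is not
  0.\<close>

lemma tc_hcat:
  assumes r: "regs_ok r" and m: "mem_ok m" and u: "rep m (r 31) u" and s: "nodeh m (r 32) s"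
    and o: "r 33 + cc < length m"
  shows "tc w (blk hcat) (r, m) khcat (\<lambda>(r', m'). rep m' (r 33) (u @ s) \<and> upd_range (r 33) cc m m' \<and>
    (\<forall>x < 50. r' x = r x))"
proof -
  have lw: "length m \<le> 2 ^ w" "200 < length m" using m by (auto simp: mem_ok_def)
  let ?A = "nval m (r 31)" and ?B = "nval m (r 32 + 3)" and ?C = "nval m (r 32 + (3 + cc))"
  have A: "num m (r 31)" "0 < ?A" "?A < 3 * P" "?A mod P = hash c b u mod P" using u by (auto simp: rep_def)
  have B: "num m (r 32 + 3)" "?B = b ^ length s * \<beta> ^ cc mod P" using s by (auto simp: nodeh_def)
  have C: "num m (r 32 + (3 + cc))" "?C = hash c b s mod P" using s by (auto simp: nodeh_def)
  have BP: "?B < P" "?C < P" using B C P1 by auto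
  have B0: "0 < ?B"
  proof -
    have "coprime (b ^ length s * \<beta> ^ cc) P" using cop by simp
    then have "\<not> P dvd b ^ length s * \<beta> ^ cc"
      using coprime_common_divisor[OF _ _ dvd_refl, of "b ^ length s * \<beta> ^ cc" P] P1 by (metis nat_dvd_1_iff_1 less_irrefl)
    then show ?thesis unfolding B(2) by (simp add: dvd_eq_mod_eq_0)
  qed
  define r1 where "r1 = r(54 := r 31, 57 := 3, 55 := r 32 + 3)"
  have 1: "tc w (blk [Op Add 54 31 35, Const 57 3, Op Add 55 32 57]) (r, m) 3 (\<lambda>s. s = (r1, m))"
  proof -
    have "r 31 < 2 ^ w" "r 32 + 3 < 2 ^ w" "3 < (2::nat) ^ w" using A(1) B(1) lw by (auto simp: num_def)
    then show ?thesis using r by (simp add: r1_def regs_ok_def)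
  qed
  have 2: "tc w (blk mulc) (r1, m) kmul (\<lambda>(r', m'). m' = m \<and>
    (\<exists>q < \<beta> ^ cc. \<beta> ^ cc * dval \<beta> (map r' (win cc)) = nval m (r1 54) * nval m (r1 55) + q * P) \<and>
    dval \<beta> (map r' (win cc)) < 2 * P \<and>
    (\<forall>t \<in> set (win cc). r' t < \<beta>) \<and> same_except ({50..54} \<union> {100..}) r1 r')"
    by (rule tc_mulc) (use r m A B BP in \<open>auto simp: r1_def regs_ok_def\<close>)
  let ?Q = "\<lambda>(r', m'). rep m' (r 33) (u @ s) \<and> upd_range (r 33) cc m m' \<and> (\<forall>x < 50. r' x = r x)"
  have 3: "tc w (blk ([Const 57 (3 + cc), Op Add 51 32 57, Const 52 1, Const 53 0] @ addmul (win cc) @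
     [Op Add 56 33 35] @ stores (win cc))) (r2, m) (9 * cc + 5) ?Q"
    if r2: "q < \<beta> ^ cc" "\<beta> ^ cc * dval \<beta> (map r2 (win cc)) = ?A * ?B + q * P"
      "dval \<beta> (map r2 (win cc)) < 2 * P" "\<forall>t \<in> set (win cc). r2 t < \<beta>"
      "same_except ({50..54} \<union> {100..}) r1 r2" for r2 q
  proof -
    let ?T = "dval \<beta> (map r2 (win cc))"
    have e: "r2 k = r1 k" if "k \<notin> {50..54} \<union> {100..}" for k using r2(5) that by (rule same_exceptD)
    have r2r: "r2 2 = 1" "r2 3 = \<beta>" "r2 35 = 0" "r2 32 = r 32" "r2 33 = r 33"
      using r by (auto simp: e r1_def regs_ok_def)
    define r3 where "r3 = r2(57 := 3 + cc, 51 := r 32 + (3 + cc), 52 := 1, 53 := 0)"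
    have 31: "tc w (blk [Const 57 (3 + cc), Op Add 51 32 57, Const 52 1, Const 53 0]) (r2, m) 4 (\<lambda>s. s = (r3, m))"
    proof -
      have "r 32 + (3 + cc) < 2 ^ w" "w \<noteq> 0" using C(1) lw by (auto simp: num_def intro: Nat.gr0I)
      then show ?thesis using r2r by (simp add: r3_def)
    qed
    have w3: "map r3 (win cc) = map r2 (win cc)" by (auto simp: r3_def set_win)
    have 32: "tc w (blk (addmul (win cc))) (r3, m) (7 * length (win cc)) (\<lambda>(r', m'). m' = m \<and>
      dval \<beta> (map r' (win cc)) + \<beta> ^ length (win cc) * r' 53 =
        dval \<beta> (map r3 (win cc)) + r3 52 * dval \<beta> (seg m (r3 51) (length (win cc))) + r3 53 \<and>
      (\<forall>t \<in> set (win cc). r' t < \<beta>) \<and> r' 53 < \<beta> \<and> same_except ({50, 51, 53} \<union> set (win cc)) r3 r')"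
      by (rule tc_addmul)
        (use r2r r2(4) beta bw lw C(1) in \<open>auto simp: r3_def num_def set_win\<close>)
    show ?thesis
    proof (rule tc_append[OF 31])
      fix s3 assume "s3 = (r3, m)"
      moreover have "tc w (blk (addmul (win cc) @ [Op Add 56 33 35] @ stores (win cc))) (r3, m) (9 * cc + 1) ?Q"
      proof (rule tc_append[OF 32])
        fix s4 assume "case s4 of (r', m') \<Rightarrow> m' = m \<and>
          dval \<beta> (map r' (win cc)) + \<beta> ^ length (win cc) * r' 53 =
            dval \<beta> (map r3 (win cc)) + r3 52 * dval \<beta> (seg m (r3 51) (length (win cc))) + r3 53 \<and>
          (\<forall>t \<in> set (win cc). r' t < \<beta>) \<and> r' 53 < \<beta> \<and> same_except ({50, 51, 53} \<union> set (win cc)) r3 r'"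
        then obtain r4 where r4: "s4 = (r4, m)" "dval \<beta> (map r4 (win cc)) + \<beta> ^ cc * r4 53 = ?T + ?C"
          "\<forall>t \<in> set (win cc). r4 t < \<beta>" "same_except ({50, 51, 53} \<union> set (win cc)) r3 r4"
          unfolding w3 by (cases s4) (auto simp: r3_def)
        have e4: "r4 k = r3 k" if "k \<notin> {50, 51, 53} \<union> set (win cc)" for k using r4(4) that by (rule same_exceptD)
        have r4r: "r4 2 = 1" "r4 33 = r 33" "r4 35 = 0" using r2r by (auto simp: e4 r3_def set_win)
        have "3 * P \<le> 4 * \<beta> * P" using beta by (intro mult_right_mono) auto
        then have "?T + ?C < \<beta> ^ cc" using r2(3) BP PB by linarith
        from no_carry(2)[OF r4(2) this] have v: "dval \<beta> (map r4 (win cc)) = ?T + ?C" .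
        let ?r5 = "r4(56 := r 33)"
        have 5: "tc w (blk [Op Add 56 33 35]) (r4, m) 1 (\<lambda>s. s = (?r5, m))" using r4r o lw by simp
        have w5: "map ?r5 (win cc) = map r4 (win cc)" by (auto simp: set_win)
        have 6: "tc w (blk (stores (win cc))) (?r5, m) (2 * length (win cc)) (\<lambda>(r', m').
          upd_range (?r5 56) (length (win cc)) m m' \<and> seg m' (?r5 56) (length (win cc)) = map ?r5 (win cc) \<and>
          same_except {56} ?r5 r')"
          by (rule tc_stores) (use r4r o lw in \<open>auto simp: set_win\<close>)
        have 7: "tc w (blk (stores (win cc))) (?r5, m) (2 * cc) ?Q"
        proof (rule tc_mono[OF 6])
          fix s6 assume "case s6 of (r', m') \<Rightarrow> upd_range (?r5 56) (length (win cc)) m m' \<and>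
            seg m' (?r5 56) (length (win cc)) = map ?r5 (win cc) \<and> same_except {56} ?r5 r'"
          then obtain r6 m6 where r6: "s6 = (r6, m6)" "upd_range (r 33) cc m m6" "seg m6 (r 33) cc = map r4 (win cc)"
            "same_except {56} ?r5 r6" unfolding w5 by (cases s6) auto
          have nv: "nval m6 (r 33) = ?T + ?C" using r6(3) v by simp
          have num6: "num m6 (r 33)" using r6(2,3) r4(3) o by (auto simp: num_def upd_range_def)
          have T0: "0 < ?T"
          proof (rule Nat.gr0I)
            assume "?T = 0"
            then have "?A * ?B = 0" using r2(2) by simp
            then show False using A(2) B0 by simp
          qed
          have "?T * \<beta> ^ cc mod P = (?A * ?B + q * P) mod P" using r2(2) by (simp add: mult.commute)
          also have "\<dots> = ?A * ?B mod P" by simp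
          also have "\<dots> = (hash c b u * (b ^ length s * \<beta> ^ cc)) mod P"
            unfolding B(2) using A(4) by (metis mod_mult_left_eq mod_mult_right_eq)
          also have "\<dots> = (hash c b u * b ^ length s) * \<beta> ^ cc mod P" by (simp add: mult.assoc)
          finally have "?T mod P = hash c b u * b ^ length s mod P" by (rule cancel_beta)
          then have "(?T + ?C) mod P = (hash c b u * b ^ length s + hash c b s) mod P"
            unfolding C(2) by (metis mod_add_eq mod_mod_trivial)
          then have "rep m6 (r 33) (u @ s)"
            unfolding rep_def nv using num6 T0 r2(3) BP by (simp add: hash_append)
          moreover have "r6 x = r x" if "x < 50" for x
          proof -
            have "r6 x = ?r5 x" using r6(4) that by (intro same_exceptD[OF r6(4)]) auto
            also have "\<dots> = r3 x" using that by (simp add: e4 set_win)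
            also have "\<dots> = r1 x" using that by (simp add: r3_def e)
            also have "\<dots> = r x" using that by (simp add: r1_def)
            finally show ?thesis .
          qed
          ultimately show "?Q s6" using r6 by simp
        qed simp
        have "tc w (blk ([Op Add 56 33 35] @ stores (win cc))) (r4, m) (2 * cc + 1) ?Q"
          by (rule tc_append[OF 5]) (use 7 in auto)
        then show "tc w (blk ([Op Add 56 33 35] @ stores (win cc))) s4 (2 * cc + 1) ?Q" using r4(1) by simp
      qed simp
      ultimately show "tc w (blk (addmul (win cc) @ [Op Add 56 33 35] @ stores (win cc))) s3 (9 * cc + 1) ?Q" by simp
    qed simp
  qed
  show ?thesis unfolding hcat_def
  proof (rule tc_append[OF 1])
    fix s1 assume s1: "s1 = (r1, m)"
    have r154: "r1 54 = r 31" "r1 55 = r 32 + 3" by (auto simp: r1_def)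
    show "tc w (blk (mulc @ [Const 57 (3 + cc), Op Add 51 32 57, Const 52 1, Const 53 0] @ addmul (win cc) @
       [Op Add 56 33 35] @ stores (win cc))) s1 (kmul + (9 * cc + 5)) ?Q"
      unfolding s1
    proof (rule tc_append[OF 2])
      fix s2 assume "case s2 of (r', m') \<Rightarrow> m' = m \<and>
        (\<exists>q < \<beta> ^ cc. \<beta> ^ cc * dval \<beta> (map r' (win cc)) = nval m (r1 54) * nval m (r1 55) + q * P) \<and>
        dval \<beta> (map r' (win cc)) < 2 * P \<and>
        (\<forall>t \<in> set (win cc). r' t < \<beta>) \<and> same_except ({50..54} \<union> {100..}) r1 r'"
      then obtain r2 q where "s2 = (r2, m)" "q < \<beta> ^ cc" "\<beta> ^ cc * dval \<beta> (map r2 (win cc)) = ?A * ?B + q * P"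
        "dval \<beta> (map r2 (win cc)) < 2 * P" "\<forall>t \<in> set (win cc). r2 t < \<beta>"
        "same_except ({50..54} \<union> {100..}) r1 r2" unfolding r154 by (cases s2) auto
      then show "tc w (blk ([Const 57 (3 + cc), Op Add 51 32 57, Const 52 1, Const 53 0] @ addmul (win cc) @
       [Op Add 56 33 35] @ stores (win cc))) s2 (9 * cc + 5) ?Q" using 3 by blast
    qed simp
  qed (simp add: khcat_def)
qed

text \<open>A positive value below \<open>3 * P\<close>, itself at most \<open>\<beta> ^ cc\<close>,
  becomes \<open>(A + q * P) / \<beta> ^ cc\<close> with \<open>q < \<beta> ^ cc\<close>. This lies
  in {1..P}, which contains each residue exactly once.\<close>

lemma tc_norm_hash:
  assumes r: "regs_ok r" and m: "mem_ok m" and u: "rep m (r 31) u" and o: "r 33 + cc < length m"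
  shows "tc w (blk norm_hash) (r, m) khcat (\<lambda>(r', m'). num m' (r 33) \<and>
    nval m' (r 33) \<in> {1..P} \<and> nval m' (r 33) * \<beta> ^ cc mod P = hash c b u mod P \<and> upd_range (r 33) cc m m' \<and>
    (\<forall>x < 50. r' x = r x))"
proof -
  have lw: "length m \<le> 2 ^ w" "200 < length m" using m by (auto simp: mem_ok_def)
  let ?A = "nval m (r 31)"
  have A: "num m (r 31)" "0 < ?A" "?A < 3 * P" "?A mod P = hash c b u mod P" using u by (auto simp: rep_def)
  have O: "num m oadr" "nval m oadr = 1" using m by (auto simp: mem_ok_def)
  define r1 where "r1 = r(54 := r 31, 55 := oadr)"
  let ?Q = "\<lambda>(r', m'). num m' (r 33) \<and> nval m' (r 33) \<in> {1..P} \<and>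
    nval m' (r 33) * \<beta> ^ cc mod P = hash c b u mod P \<and> upd_range (r 33) cc m m' \<and> (\<forall>x < 50. r' x = r x)"
  have 1: "tc w (blk [Op Add 54 31 35, Const 55 oadr]) (r, m) 2 (\<lambda>s. s = (r1, m))"
  proof -
    have "r 31 < 2 ^ w" "oadr < 2 ^ w" using A(1) O(1) lw by (auto simp: num_def)
    then show ?thesis using r by (simp add: r1_def regs_ok_def)
  qed
  have 2: "tc w (blk mulc) (r1, m) kmul (\<lambda>(r', m'). m' = m \<and>
    (\<exists>q < \<beta> ^ cc. \<beta> ^ cc * dval \<beta> (map r' (win cc)) = nval m (r1 54) * nval m (r1 55) + q * P) \<and>
    dval \<beta> (map r' (win cc)) < 2 * P \<and>
    (\<forall>t \<in> set (win cc). r' t < \<beta>) \<and> same_except ({50..54} \<union> {100..}) r1 r')"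
    by (rule tc_mulc) (use r m A O P1 in \<open>auto simp: r1_def regs_ok_def\<close>)
  have 3: "tc w (blk ([Op Add 56 33 35] @ stores (win cc))) (r2, m) (2 * cc + 1) ?Q"
    if r2: "q < \<beta> ^ cc" "\<beta> ^ cc * dval \<beta> (map r2 (win cc)) = ?A * 1 + q * P"
      "\<forall>t \<in> set (win cc). r2 t < \<beta>" "same_except ({50..54} \<union> {100..}) r1 r2" for r2 q
  proof -
    let ?T = "dval \<beta> (map r2 (win cc))"
    have e: "r2 k = r1 k" if "k \<notin> {50..54} \<union> {100..}" for k using r2(4) that by (rule same_exceptD)
    have r2r: "r2 2 = 1" "r2 35 = 0" "r2 33 = r 33" using r by (auto simp: e r1_def regs_ok_def)
    let ?r5 = "r2(56 := r 33)"
    have 5: "tc w (blk [Op Add 56 33 35]) (r2, m) 1 (\<lambda>s. s = (?r5, m))" using r2r o lw by simp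
    have w5: "map ?r5 (win cc) = map r2 (win cc)" by (auto simp: set_win)
    have 6: "tc w (blk (stores (win cc))) (?r5, m) (2 * length (win cc)) (\<lambda>(r', m').
      upd_range (?r5 56) (length (win cc)) m m' \<and> seg m' (?r5 56) (length (win cc)) = map ?r5 (win cc) \<and>
      same_except {56} ?r5 r')"
      by (rule tc_stores) (use r2r o lw in \<open>auto simp: set_win\<close>)
    have 7: "tc w (blk (stores (win cc))) (?r5, m) (2 * cc) ?Q"
    proof (rule tc_mono[OF 6])
      fix s6 assume "case s6 of (r', m') \<Rightarrow> upd_range (?r5 56) (length (win cc)) m m' \<and>
        seg m' (?r5 56) (length (win cc)) = map ?r5 (win cc) \<and> same_except {56} ?r5 r'"
      then obtain r6 m6 where r6: "s6 = (r6, m6)" "upd_range (r 33) cc m m6" "seg m6 (r 33) cc = map r2 (win cc)"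
        "same_except {56} ?r5 r6" unfolding w5 by (cases s6) auto
      have nv: "nval m6 (r 33) = ?T" using r6(3) by simp
      have num6: "num m6 (r 33)" using r6(2,3) r2(3) o by (auto simp: num_def upd_range_def)
      have T0: "0 < ?T" using r2(2) A(2) by (intro Nat.gr0I) simp
      have TP: "?T \<le> P"
      proof -
        have "3 * P \<le> \<beta> ^ cc"
        proof -
          have "3 * P \<le> 4 * \<beta> * P" using beta by (intro mult_right_mono) auto
          then show ?thesis using PB by linarith
        qed
        then have "?A < \<beta> ^ cc" using A(3) by linarith
        moreover have "(q + 1) * P \<le> \<beta> ^ cc * P" using r2(1) by (intro mult_right_mono) auto
        ultimately have "\<beta> ^ cc * ?T < \<beta> ^ cc * Suc P" using r2(2) P1 by (simp add: algebra_simps)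
        then show ?thesis using mult_less_cancel1 by (metis less_Suc_eq_le)
      qed
      have "?T * \<beta> ^ cc mod P = (?A + q * P) mod P" using r2(2) by (simp add: mult.commute)
      then have "?T * \<beta> ^ cc mod P = hash c b u mod P" using A(4) by simp
      moreover have "r6 x = r x" if "x < 50" for x
      proof -
        have "r6 x = ?r5 x" using r6(4) that by (intro same_exceptD[OF r6(4)]) auto
        also have "\<dots> = r1 x" using that by (simp add: e)
        also have "\<dots> = r x" using that by (simp add: r1_def)
        finally show ?thesis .
      qed
      ultimately show "?Q s6" using r6 nv num6 T0 TP by simp
    qed simp
    show ?thesis by (rule tc_append[OF 5]) (use 7 in auto)
  qed
  show ?thesis unfolding norm_hash_def
  proof (rule tc_append[OF 1])
    fix s1 assume s1: "s1 = (r1, m)"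
    have r154: "r1 54 = r 31" "r1 55 = oadr" by (auto simp: r1_def)
    show "tc w (blk (mulc @ [Op Add 56 33 35] @ stores (win cc))) s1 (kmul + (2 * cc + 1)) ?Q"
      unfolding s1
    proof (rule tc_append[OF 2])
      fix s2 assume "case s2 of (r', m') \<Rightarrow> m' = m \<and>
        (\<exists>q < \<beta> ^ cc. \<beta> ^ cc * dval \<beta> (map r' (win cc)) = nval m (r1 54) * nval m (r1 55) + q * P) \<and>
        dval \<beta> (map r' (win cc)) < 2 * P \<and>
        (\<forall>t \<in> set (win cc). r' t < \<beta>) \<and> same_except ({50..54} \<union> {100..}) r1 r'"
      then obtain r2 q where "s2 = (r2, m)" "q < \<beta> ^ cc" "\<beta> ^ cc * dval \<beta> (map r2 (win cc)) = ?A * 1 + q * P"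
        "\<forall>t \<in> set (win cc). r2 t < \<beta>"
        "same_except ({50..54} \<union> {100..}) r1 r2" unfolding r154 O(2) by (cases s2) auto
      then show "tc w (blk ([Op Add 56 33 35] @ stores (win cc))) s2 (2 * cc + 1) ?Q" using 3 by blast
    qed simp
  qed (simp add: khcat_def)
qed

end

section \<open>Collecting the items of a window\<close>

primrec copyd :: "nat \<Rightarrow> prog list" where
  "copyd 0 = []"
| "copyd (Suc n) = [Load 59 61, Store 62 59, Op Add 61 61 2, Op Add 62 62 2] @ copyd n"

lemma tc_copyd:
  assumes "r 2 = 1" "length m \<le> 2 ^ w" "r 61 + n < length m" "r 62 + n < length m"
    "r 61 + n \<le> r 62 \<or> r 62 + n \<le> r 61"
  shows "tc w (blk (copyd n)) (r, m) (4 * n) (\<lambda>(r', m'). upd_range (r 62) n m m' \<and>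
    seg m' (r 62) n = seg m (r 61) n \<and> (\<forall>x < 50. r' x = r x))"
  using assms
proof (induction n arbitrary: r m)
  case 0
  then show ?case by (simp add: upd_range_def)
next
  case (Suc n)
  let ?m = "m[r 62 := m ! r 61]"
  define r1 where "r1 = r(59 := m ! r 61, 61 := Suc (r 61), 62 := Suc (r 62))"
  define Q where "Q = (\<lambda>(r', m'). upd_range (r 62) (Suc n) m m' \<and>
    seg m' (r 62) (Suc n) = seg m (r 61) (Suc n) \<and> (\<forall>x < (50::nat). r' x = r x))"
  have "tc w (blk (copyd n)) (r1, ?m) (4 * n) Q"
  proof (rule tc_mono[OF Suc.IH order_refl])
    fix s' assume "case s' of (r', m') \<Rightarrow> upd_range (r1 62) n ?m m' \<and>
      seg m' (r1 62) n = seg ?m (r1 61) n \<and> (\<forall>x<50. r' x = r1 x)"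
    then obtain r' m' where s': "s' = (r', m')" "upd_range (Suc (r 62)) n ?m m'"
      "seg m' (Suc (r 62)) n = seg ?m (Suc (r 61)) n" "\<forall>x<50. r' x = r1 x"
      by (cases s') (auto simp: r1_def)
    have sg: "seg ?m (Suc (r 61)) n = seg m (Suc (r 61)) n"
      by (rule seg_cong) (use Suc.prems in \<open>auto simp: nth_list_update\<close>)
    have "m' ! r 62 = m ! r 61" using s'(2) Suc.prems by (simp add: upd_range_def)
    then have "seg m' (r 62) (Suc n) = seg m (r 61) (Suc n)" by (simp add: seg_Suc s'(3) sg)
    moreover have "upd_range (r 62) (Suc n) m m'" using s'(2) by (auto simp: upd_range_def)
    ultimately show "Q s'" using s' by (simp add: Q_def r1_def)
  qed (use Suc.prems in \<open>auto simp: r1_def\<close>)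
  then have "tc w (blk (copyd (Suc n))) (r, m) (4 * Suc n) Q"
    using Suc.prems by (simp add: tc_Load tc_Store r1_def)
  then show ?case unfolding Q_def .
qed

definition rs :: nat where "rs = cc + 2"

text \<open>The right child is pushed first, so the left one is on top.\<close>

definition expand :: "prog list" where
  "expand = [Op Add 26 22 2, Load 26 26, Const 27 2, Op Add 27 22 27, Load 27 27,
     Store 21 27, Op Add 21 21 2, Store 21 26, Op Add 21 21 2]"

definition item :: "prog list" where
  "item = [Op Add 26 24 2, Store 26 22, Op Add 31 26 2, Op Add 32 22 35, Op Add 33 31 36] @ hcat @
     [Op Add 25 25 23, Op Add 24 24 36, Store 24 25, Op Sub 20 20 23, Op Add 16 16 2]"

definition pop :: "prog list" where "pop = [Op Sub 21 21 2, Load 22 21, Load 23 22]"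

definition skip_body :: "prog list" where
  "skip_body = pop @ [Cond (LessEq 23 19) (blk [Op Sub 19 19 23]) (blk expand)]"

definition take_body :: "prog list" where
  "take_body = pop @ [Cond (LessEq 23 20) (blk item) (blk expand)]"

text \<open>The hash of the empty prefix is a copy of \<open>P\<close> from \<open>padr\<close>: the
  residue 0 in the positive representation.\<close>

definition build :: "prog list" where
  "build = [Op Add 21 37 35, Store 21 5, Op Add 21 21 2, Op Add 24 15 35, Const 25 0, Const 16 0, Store 24 25,
     Const 61 padr, Op Add 62 24 2, Op Add 62 62 2] @ copyd cc @
     [While (Less 35 19) (blk skip_body), While (Less 35 20) (blk take_body)]"

text \<open>
  The memory starts with the constant part \<open>M0\<close>: ten header words, \<open>P\<close> and 1 as numbers, and for every
  \<open>s \<in> F\<close> at \<open>addr s\<close> its length, the addresses of its two children and its hash data. Then follow a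
  stack at \<open>stk\<close>, the two lists of items at \<open>iA\<close> and \<open>iB\<close> and two accumulators at \<open>aA\<close> and \<open>aB\<close>.

  Registers 2 to 8 and 35 to 43 are constant during a query. Registers from 50 on are scratch space of the
  arithmetic. Register 15 holds the base of the current list of items, 16 its length, 19 and 20 the
  positions that remain to be skipped and covered, 21 the stack pointer and 22 the current node.
\<close>

locale lce_structure = hashing w \<beta> P pinv c b for w \<beta> P pinv :: nat and c :: "'a \<Rightarrow> nat" and b :: nat +
  fixes F :: "'a list set" and S :: "'a list" and addr ht :: "'a list \<Rightarrow> nat"
    and M0 :: "nat list" and stk iA iB aA aB cap L D0 sN :: nat
  assumes SF: "S \<in> F"
    and F_len: "s \<in> F \<Longrightarrow> s \<noteq> []"
    and node: "s \<in> F \<Longrightarrow> addr s + (3 + cc) + cc < length M0 \<and> M0 ! addr s = length s \<and> nodeh M0 (addr s) s"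
    and children: "s \<in> F \<Longrightarrow> 2 \<le> length s \<Longrightarrow> \<exists>u v. u \<in> F \<and> v \<in> F \<and> s = u @ v \<and>
      M0 ! (addr s + 1) = addr u \<and> M0 ! (addr s + 2) = addr v \<and> ht u < ht s \<and> ht v < ht s"
    and header: "M0 ! 0 = addr S" "M0 ! 1 = \<beta>" "M0 ! 2 = pinv" "M0 ! 3 = D0" "M0 ! 4 = sN" "M0 ! 5 = stk"
      "M0 ! 6 = iA" "M0 ! 7 = iB" "M0 ! 8 = aA" "M0 ! 9 = aB"
    and mem0: "mem_ok M0"
    and layout: "length M0 \<le> stk" "stk + cap + 1 \<le> iA" "iA + (cap + 2) * rs \<le> iB" "iB + (cap + 2) * rs \<le> aA"
      "aA + cc + 1 \<le> aB" "aB + cc + 1 < L" "L \<le> 2 ^ w"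
    and capS: "1 + 4 * ht S \<le> cap"
    and Nw: "2 * length S + 2 < 2 ^ w" "sN * sN \<le> length S" "D0 < 2 ^ w"
begin

definition good :: "nat list \<Rightarrow> bool" where
  "good m \<longleftrightarrow> length m = L \<and> (\<forall>x < length M0. m ! x = M0 ! x) \<and> (\<forall>x < L. m ! x < 2 ^ w)"

definition regs :: "(nat \<Rightarrow> nat) \<Rightarrow> bool" where
  "regs r \<longleftrightarrow> regs_ok r \<and> r 5 = addr S \<and> r 36 = rs \<and> r 37 = stk \<and> r 38 = iA \<and> r 39 = iB \<and> r 40 = aA \<and> r 41 = aB"

lemma LM0: "length M0 < L"
  using layout by linarith

lemma M0_200: "200 < length M0"
  using mem0 by (simp add: mem_ok_def)

lemma num_M0: "num M0 a \<Longrightarrow> good m \<Longrightarrow> num m a \<and> nval m a = nval M0 a"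
proof -
  assume *: "num M0 a" "good m"
  have "seg m a cc = seg M0 a cc" by (rule seg_cong) (use * in \<open>auto simp: good_def num_def\<close>)
  then show ?thesis using * LM0 by (simp add: num_def good_def)
qed

lemma good_mem_ok: "good m \<Longrightarrow> mem_ok m"
  using mem0 num_M0[of padr m] num_M0[of oadr m] layout(7) LM0 by (auto simp: mem_ok_def good_def)

lemma node_good:
  assumes "good m" "s \<in> F"
  shows "m ! addr s = length s" "nodeh m (addr s) s" "addr s + (3 + cc) + cc < L" "addr s + 3 < 2 ^ w"
proof -
  show "m ! addr s = length s" using node[OF assms(2)] assms(1) by (simp add: good_def)
  show "nodeh m (addr s) s" using node[OF assms(2)] num_M0[OF _ assms(1)] by (auto simp: nodeh_def)
  show "addr s + (3 + cc) + cc < L" using node[OF assms(2)] LM0 by linarith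
  then show "addr s + 3 < 2 ^ w" using layout(7) by linarith
qed

lemma children_good:
  assumes "good m" "s \<in> F" "2 \<le> length s"
  obtains u v where "u \<in> F" "v \<in> F" "s = u @ v" "m ! (addr s + 1) = addr u" "m ! (addr s + 2) = addr v"
    "ht u < ht s" "ht v < ht s"
proof -
  have "addr s + 2 < length M0" using node[OF assms(2)] by simp
  then have "m ! (addr s + 1) = M0 ! (addr s + 1)" "m ! (addr s + 2) = M0 ! (addr s + 2)"
    using assms(1) by (auto simp: good_def)
  then show thesis using children[OF assms(2,3)] that by force
qed

section \<open>The traversal stack and the items of a window\<close>

definition stack :: "nat list \<Rightarrow> 'a list list \<Rightarrow> bool" where
  "stack m st \<longleftrightarrow> set st \<subseteq> F \<and> (\<forall>i < length st. m ! (stk + i) = addr (rev st ! i))"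

lemma stack_top: "stack m (v # st) \<Longrightarrow> m ! (stk + length st) = addr v \<and> v \<in> F \<and> stack m st"
  by (auto simp: stack_def nth_append dest: spec[of _ "length st"])

lemma stack_push:
  assumes "stack m st" "v \<in> F" "stk + length st < length m" 
  shows "stack (m[stk + length st := addr v]) (v # st)"
  using assms by (auto simp: stack_def nth_append nth_list_update)

text \<open>Bounds the number of stack operations until the position \<open>x\<close> is reached: only the node that
  contains \<open>x\<close> in its interior is expanded.\<close>

fun bpot :: "nat \<Rightarrow> 'a list list \<Rightarrow> nat" where
  "bpot x [] = 0"
| "bpot x (v # st) = (if x = 0 then 0 else if x < length v then 2 * ht v else bpot (x - length v) st)"

lemma bpot_0 [simp]: "bpot 0 st = 0"
  by (cases st) auto

text \<open>An expansion lengthens the stack by one, so a drop of two is a net gain; it comes from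
  the smaller heights of the children.\<close>

lemma bpot_expand:
  assumes "s = u @ v" "ht u < ht s" "ht v < ht s"
  shows "bpot x (u # v # st) \<le> bpot x (s # st)"
    "0 < x \<Longrightarrow> x < length s \<Longrightarrow> bpot x (u # v # st) + 2 \<le> bpot x (s # st)"
  using assms by auto

text \<open>\<open>y\<close> is the right end of the window. Counting it already during the skipping
  keeps enough capacity for the later covering.\<close>

definition pot :: "nat \<Rightarrow> nat \<Rightarrow> 'a list list \<Rightarrow> nat" where
  "pot x y st = length st + bpot x st + bpot y st"

lemma good_update: "good m \<Longrightarrow> length M0 \<le> a \<Longrightarrow> v < 2 ^ w \<Longrightarrow> good (m[a := v])"
  by (cases "a < length m") (auto simp: good_def nth_list_update)

lemma addr_w: "s \<in> F \<Longrightarrow> addr s < 2 ^ w"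
  using node[of s] LM0 layout(7) by linarith

lemma sub_w: "y \<le> x \<Longrightarrow> x < 2 ^ w \<Longrightarrow> (x + (2 ^ w - y)) mod 2 ^ w = (x - y :: nat)"
proof -
  assume *: "y \<le> x" "x < 2 ^ w"
  then have e: "x + (2 ^ w - y) = (x - y) + 2 ^ w" by simp
  have "(x + (2 ^ w - y)) mod 2 ^ w = (x - y) mod 2 ^ w" unfolding e by (rule mod_add_self2)
  then show ?thesis using * by simp
qed

definition frame :: "nat set \<Rightarrow> (nat \<Rightarrow> nat) \<Rightarrow> (nat \<Rightarrow> nat) \<Rightarrow> bool" where
  "frame X r r' \<longleftrightarrow> (\<forall>x < 50. x \<notin> X \<longrightarrow> r' x = r x)"

lemma frameD: "frame X r r' \<Longrightarrow> x < 50 \<Longrightarrow> x \<notin> X \<Longrightarrow> r' x = r x"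
  by (simp add: frame_def)

lemma frame_refl [simp]: "frame X r r"
  by (simp add: frame_def)

lemma regs_frame: "regs r \<Longrightarrow> frame X r r' \<Longrightarrow> X \<inter> {2, 3, 4, 5, 35, 36, 37, 38, 39, 40, 41} = {} \<Longrightarrow> regs r'"
  unfolding regs_def regs_ok_def frame_def by auto

lemma tc_expand:
  assumes g: "good m" and R: "regs r" and st: "stack m st" and s: "s \<in> F" "2 \<le> length s" "r 22 = addr s"
    and sp: "r 21 = stk + length st" and cap: "length st + 2 \<le> cap"
    and Q: "\<And>u v r' m'. u \<in> F \<Longrightarrow> v \<in> F \<Longrightarrow> s = u @ v \<Longrightarrow> ht u < ht s \<Longrightarrow> ht v < ht s \<Longrightarrow> good m' \<Longrightarrow>
      stack m' (u # v # st) \<Longrightarrow> r' 21 = stk + length st + 2 \<Longrightarrow> frame {21, 26, 27} r r' \<Longrightarrow>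
      (\<forall>x. x < stk \<or> stk + cap \<le> x \<longrightarrow> m' ! x = m ! x) \<Longrightarrow> Q (r', m')"
    and T: "9 \<le> T"
  shows "tc w (blk expand) (r, m) T Q"
proof -
  obtain u v where uv: "u \<in> F" "v \<in> F" "s = u @ v" "m ! (addr s + 1) = addr u" "m ! (addr s + 2) = addr v"
    "ht u < ht s" "ht v < ht s" using children_good[OF g s(1,2)] by blast
  note nd = node_good[OF g s(1)]
  have len: "length m = L" using g by (simp add: good_def)
  have b: "addr s + 2 < L" "stk + length st + 2 < L" using nd layout cap by auto
  have wb: "x mod 2 ^ w = x" if "x < L" for x using that layout(7) by simp
  have w2: "(2::nat) mod 2 ^ w = 2" using nd(4) by simp
  have r2: "r 2 = 1" using R by (simp add: regs_def regs_ok_def)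
  let ?m1 = "m[stk + length st := addr v]"
  let ?m2 = "?m1[stk + length (v # st) := addr u]"
  have st1: "stack ?m1 (v # st)" using stack_push[OF st uv(2)] b len by simp
  have st2: "stack ?m2 (u # v # st)" using stack_push[OF st1 uv(1)] b len by simp
  have g2: "good ?m2" using g layout addr_w uv by (intro good_update) auto
  have "Q (r(26 := addr u, 27 := addr v, 21 := stk + length st + 2), ?m2)"
    using b cap by (intro Q[OF uv(1,2,3,6,7) g2 st2]) (auto simp: frame_def nth_list_update)
  moreover have "r(26 := addr u, 27 := addr v, 21 := stk + length st + 2) =
    r(26 := addr u, 27 := addr v, 21 := Suc (Suc (stk + length st)))" by simp
  ultimately show ?thesis unfolding expand_def using b len r2 s(3) sp uv(4,5) w2 T wb[of "Suc (addr s)"] wb[of "addr s + 2"]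
      wb[of "Suc (stk + length st)"] wb[of "Suc (Suc (stk + length st))"]
    by (simp add: tc_Load tc_Store fun_upd_twist)
qed

lemma tc_pop:
  assumes g: "good m" and R: "regs r" and st: "stack m (v # st)" and sp: "r 21 = stk + length (v # st)"
    and cap: "length st \<le> cap"
    and Q: "tc w (blk ps) (r(21 := stk + length st, 22 := addr v, 23 := length v), m) T Q"
    and T': "T + 3 \<le> T'"
  shows "tc w (blk (pop @ ps)) (r, m) T' Q"
proof -
  have v: "m ! (stk + length st) = addr v" "v \<in> F" using stack_top[OF st] by auto
  note nd = node_good[OF g v(2)]
  have len: "length m = L" using g by (simp add: good_def)
  have b: "Suc (stk + length st) < L" "addr v < L" using nd layout cap by auto
  have r2: "r 2 = 1" using R by (simp add: regs_def regs_ok_def)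
  have "Suc (stk + length st) < 2 ^ w" using b layout(7) by linarith
  then have s: "(Suc (stk + length st) + (2 ^ w - Suc 0)) mod 2 ^ w = stk + length st" using sub_w[of 1 "Suc (stk + length st)"] by simp
  have "tc w (blk (pop @ ps)) (r, m) (T + 3) Q"
    unfolding pop_def using Q b len r2 sp v(1) nd(1) s by (simp add: tc_Load)
  then show ?thesis by (rule tc_mono) (use T' in auto)
qed

text \<open>Only the node containing the left end of the window in its interior is expanded, so
  \<open>pot\<close> decreases in every round. The potential of the right end is left over and
  bounds the covering loop.\<close>

lemma tc_skip_loop:
  assumes "good m" "regs r" "stack m st" "r 21 = stk + length st" "r 19 + d \<le> length (concat st)"
    "length (concat st) < 2 ^ w" "pot (r 19) (r 19 + d) st \<le> cap"
  shows "tc w (While (Less 35 19) (blk skip_body)) (r, m) (Suc (pot (r 19) (r 19 + d) st * 14)) (\<lambda>(r', m').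
    good m' \<and> frame {19, 21, 22, 23, 26, 27} r r' \<and> (\<forall>x. x < stk \<or> stk + cap \<le> x \<longrightarrow> m' ! x = m ! x) \<and>
    (\<exists>st'. stack m' st' \<and> r' 21 = stk + length st' \<and> drop (r 19) (concat st) = concat st' \<and>
      length st' + bpot d st' \<le> cap))"
proof -
  let ?X = "{19, 21, 22, 23, 26, 27}"
  define I where "I = (\<lambda>(r', m') n. good m' \<and> frame ?X r r' \<and> (\<forall>x. x < stk \<or> stk + cap \<le> x \<longrightarrow> m' ! x = m ! x) \<and>
    (\<exists>st'. stack m' st' \<and> r' 21 = stk + length st' \<and> drop (r 19) (concat st) = drop (r' 19) (concat st') \<and>
      r' 19 + d \<le> length (concat st') \<and> length (concat st') < 2 ^ w \<and> n = pot (r' 19) (r' 19 + d) st' \<and> n \<le> cap))"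
  have II: "I (r', m') n" if "good m'" "frame ?X r r'" "\<forall>x. x < stk \<or> stk + cap \<le> x \<longrightarrow> m' ! x = m ! x"
    "stack m' st'" "r' 21 = stk + length st'" "drop (r 19) (concat st) = drop (r' 19) (concat st')"
    "r' 19 + d \<le> length (concat st')" "length (concat st') < 2 ^ w" "n = pot (r' 19) (r' 19 + d) st'" "n \<le> cap"
    for r' m' n st' unfolding I_def using that by blast
  have "tc w (While (Less 35 19) (blk skip_body)) (r, m) (Suc (pot (r 19) (r 19 + d) st * Suc 13)) (\<lambda>(r', m').
    good m' \<and> frame ?X r r' \<and> (\<forall>x. x < stk \<or> stk + cap \<le> x \<longrightarrow> m' ! x = m ! x) \<and>
    (\<exists>st'. stack m' st' \<and> r' 21 = stk + length st' \<and> drop (r 19) (concat st) = concat st' \<and>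
      length st' + bpot d st' \<le> cap))"
  proof (rule tc_While[where I = I])
    show "I (r, m) (pot (r 19) (r 19 + d) st)" using assms by (auto simp: I_def)
  next
    fix s n assume I: "I s n" and c: "cmp_val (Less 35 19) (fst s)"
    obtain r1 m1 where s: "s = (r1, m1)" by (cases s)
    obtain st' where st': "stack m1 st'" "r1 21 = stk + length st'" "drop (r 19) (concat st) = drop (r1 19) (concat st')"
      "r1 19 + d \<le> length (concat st')" "length (concat st') < 2 ^ w" "n = pot (r1 19) (r1 19 + d) st'" "n \<le> cap"
      and g: "good m1" and fr: "frame ?X r r1" and out: "\<forall>x. x < stk \<or> stk + cap \<le> x \<longrightarrow> m1 ! x = m ! x"
      using I unfolding I_def s by auto
    have R1: "regs r1" using regs_frame[OF assms(2) fr] by simp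
    then have "r1 35 = 0" by (simp add: regs_def regs_ok_def)
    then have k0: "0 < r1 19" using c by (simp add: s)
    then obtain v q where vq: "st' = v # q" using st'(4) by (cases st') auto
    have vF: "v \<in> F" using stack_top[of m1 v q] st' vq by simp
    have sq: "stack m1 q" using stack_top[of m1 v q] st' vq by simp
    let ?r2 = "r1(21 := stk + length q, 22 := addr v, 23 := length v)"
    have R2: "regs ?r2" using R1 by (auto simp: regs_def regs_ok_def)
    show "tc w (blk skip_body) s 13 (\<lambda>s'. \<exists>n'. I s' n' \<and> n' < n)"
      unfolding s skip_body_def
    proof (rule tc_pop[OF g R1, where T = 10])
      show "stack m1 (v # q)" "r1 21 = stk + length (v # q)" "length q \<le> cap"
        using st' vq by (auto simp: pot_def)
      show "tc w (blk [Cond (LessEq 23 19) (blk [Op Sub 19 19 23]) (blk expand)]) (?r2, m1) 10 (\<lambda>s'. \<exists>n'. I s' n' \<and> n' < n)"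
      proof (rule tc_Cond)
        assume "cmp_val (LessEq 23 19) (fst (?r2, m1))"
        then have le: "length v \<le> r1 19" by simp
        have "r1 19 < 2 ^ w" using st'(4,5) by linarith
        then have sb: "(r1 19 + (2 ^ w - length v)) mod 2 ^ w = r1 19 - length v" using sub_w[OF le] by simp
        let ?r3 = "?r2(19 := r1 19 - length v)"
        have len0: "0 < length v" using F_len[OF vF] by simp
        have lt: "pot (r1 19 - length v) (r1 19 - length v + d) q < n"
          using le len0 k0 unfolding st'(6) vq pot_def by auto
        have "I (?r3, m1) (pot (r1 19 - length v) (r1 19 - length v + d) q)"
        proof (rule II[OF g _ out sq])
          show "frame ?X r ?r3" using fr by (auto simp: frame_def)
        qed (use st' vq le lt in auto)
        then show "tc w (blk ([Op Sub 19 19 23] @ [])) (?r2, m1) (10 - 1) (\<lambda>s'. \<exists>n'. I s' n' \<and> n' < n)"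
          using sb lt by auto
      next
        assume "\<not> cmp_val (LessEq 23 19) (fst (?r2, m1))"
        then have lt: "r1 19 < length v" by simp
        have "tc w (blk expand) (?r2, m1) 9 (\<lambda>s'. \<exists>n'. I s' n' \<and> n' < n)"
        proof (rule tc_expand[OF g R2 sq vF])
          show "2 \<le> length v" using lt k0 by linarith
          show "?r2 22 = addr v" "?r2 21 = stk + length q" by auto
          have "2 * ht v \<le> n" using lt k0 unfolding st'(6) vq pot_def by auto
          moreover obtain u z where "ht u < ht v" using children[OF vF \<open>2 \<le> length v\<close>] by blast
          ultimately show "length q + 2 \<le> cap" using st'(7) lt k0 unfolding st'(6) vq pot_def by auto
        next
          fix u z r' m' assume uz: "u \<in> F" "z \<in> F" "v = u @ z" "ht u < ht v" "ht z < ht v" "good m'" "stack m' (u # z # q)"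
            "r' 21 = stk + length q + 2" "frame {21, 26, 27} ?r2 r'" "\<forall>x. x < stk \<or> stk + cap \<le> x \<longrightarrow> m' ! x = m1 ! x"
          have r19: "r' 19 = r1 19" using frameD[OF uz(9), of 19] by simp
          have fr': "frame ?X r r'" using fr uz(9) by (auto simp: frame_def)
          have lt': "pot (r1 19) (r1 19 + d) (u # z # q) < n"
            using bpot_expand(1)[OF uz(3-5), of "r1 19 + d" q] bpot_expand(2)[OF uz(3-5) k0 lt, of q]
            unfolding st'(6) vq pot_def by (simp del: bpot.simps)
          have "I (r', m') (pot (r1 19) (r1 19 + d) (u # z # q))"
            by (rule II[OF uz(6) fr' _ uz(7)]) (use uz out st' lt' r19 vq in auto)
          then show "\<exists>n'. I (r', m') n' \<and> n' < n" using lt' by blast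
        qed simp
        then show "tc w (blk (expand @ [])) (?r2, m1) (10 - 1) (\<lambda>s'. \<exists>n'. I s' n' \<and> n' < n)" by simp
      qed simp
    qed simp
  next
    fix s n assume I: "I s n" and c: "\<not> cmp_val (Less 35 19) (fst s)"
    obtain r1 m1 where s: "s = (r1, m1)" by (cases s)
    have "regs r1" using regs_frame[OF assms(2)] I unfolding I_def s by auto
    then have "r1 35 = 0" by (simp add: regs_def regs_ok_def)
    then have "r1 19 = 0" using c by (simp add: s)
    then show "case s of (r', m') \<Rightarrow> good m' \<and> frame ?X r r' \<and> (\<forall>x. x < stk \<or> stk + cap \<le> x \<longrightarrow> m' ! x = m ! x) \<and>
      (\<exists>st'. stack m' st' \<and> r' 21 = stk + length st' \<and> drop (r 19) (concat st) = concat st' \<and>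
        length st' + bpot d st' \<le> cap)"
      using I unfolding I_def s by (auto simp: pot_def)
  qed
  then show ?thesis by simp
qed

text \<open>The record of item \<open>i\<close> holds the total length and the hash of the items before it, hence one more
  record than items.\<close>

definition items :: "nat list \<Rightarrow> nat \<Rightarrow> 'a list list \<Rightarrow> bool" where
  "items m base its \<longleftrightarrow> set its \<subseteq> F \<and>
     (\<forall>i \<le> length its. m ! (base + i * rs) = length (concat (take i its)) \<and> rep m (base + i * rs + 2) (concat (take i its))) \<and>
     (\<forall>i < length its. m ! (base + i * rs + 1) = addr (its ! i))"

definition ok_base :: "nat \<Rightarrow> bool" where
  "ok_base base \<longleftrightarrow> stk + cap + 1 \<le> base \<and> base + (cap + 2) * rs \<le> aA"

lemma rs_cc: "rs = cc + 2"
  by (simp add: rs_def)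

lemma rep_cong: "rep m a u \<Longrightarrow> length m' = length m \<Longrightarrow> (\<And>i. i < cc \<Longrightarrow> m' ! (a + i) = m ! (a + i)) \<Longrightarrow> rep m' a u"
proof -
  assume *: "rep m a u" "length m' = length m" "\<And>i. i < cc \<Longrightarrow> m' ! (a + i) = m ! (a + i)"
  have "seg m' a cc = seg m a cc" by (rule seg_cong) (use * in auto)
  then show ?thesis using * by (simp add: rep_def num_def)
qed

lemma items_cong:
  assumes "items m base its" "length m' = length m"
    "\<And>x. base \<le> x \<Longrightarrow> x < base + Suc (length its) * rs \<Longrightarrow> m' ! x = m ! x"
  shows "items m' base its"
proof -
  have le: "i * rs + rs \<le> Suc (length its) * rs" if "i \<le> length its" for i
    using mult_le_mono1[of "Suc i" "Suc (length its)" rs] that by simp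
  show ?thesis unfolding items_def
  proof (intro conjI allI impI)
    show "set its \<subseteq> F" using assms(1) by (simp add: items_def)
    fix i assume i: "i \<le> length its"
    have "m' ! (base + i * rs) = m ! (base + i * rs)" by (rule assms(3)) (use le[OF i] rs_cc in linarith)+
    then show "m' ! (base + i * rs) = length (concat (take i its))" using assms(1) i by (simp add: items_def)
    have "rep m (base + i * rs + 2) (concat (take i its))" using assms(1) i by (simp add: items_def)
    then show "rep m' (base + i * rs + 2) (concat (take i its))"
    proof (rule rep_cong[OF _ assms(2)])
      fix j assume "j < cc"
      then show "m' ! (base + i * rs + 2 + j) = m ! (base + i * rs + 2 + j)"
        by (intro assms(3)) (use le[OF i] rs_cc in linarith)+
    qed
  next
    fix i assume i: "i < length its"
    have "m' ! (base + i * rs + 1) = m ! (base + i * rs + 1)"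
      by (rule assms(3)) (use le[of i] i rs_cc in linarith)+
    then show "m' ! (base + i * rs + 1) = addr (its ! i)" using assms(1) i by (simp add: items_def)
  qed
qed

lemma beta_w: "\<beta> \<le> 2 ^ w"
proof -
  have "\<beta> * 1 \<le> \<beta> * \<beta>" using beta by (intro mult_left_mono) auto
  then show ?thesis using bw by linarith
qed

lemma good_upd_num:
  assumes "good m" "upd_range a cc m m'" "num m' a" "length M0 \<le> a"
  shows "good m'"
proof -
  have "m' ! x < 2 ^ w" if x: "x < L" for x
  proof (cases "a \<le> x \<and> x < a + cc")
    case True
    then have "m' ! x \<in> set (seg m' a cc)" by (auto simp: seg_def intro!: image_eqI[of _ _ "x - a"])
    then show ?thesis using assms(3) beta_w by (auto simp: num_def)
  next
    case False
    then have "m' ! x = m ! x" using assms(2) by (auto simp: upd_range_def)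
    then show ?thesis using assms(1) x by (simp add: good_def)
  qed
  then show ?thesis using assms by (auto simp: good_def upd_range_def)
qed

definition kitem :: nat where "kitem = khcat + 10"

lemma tc_item:
  assumes g: "good m" and R: "regs r" and base: "ok_base base" and it: "items m base its" and v: "v \<in> F"
    and r: "r 22 = addr v" "r 23 = length v" "r 24 = base + length its * rs" "r 25 = length (concat its)"
      "r 16 = length its" "length v \<le> r 20" "r 20 < 2 ^ w" "length its < cap" "length (concat its) + length v < 2 ^ w"
    and Q: "\<And>r' m'. good m' \<Longrightarrow> items m' base (its @ [v]) \<Longrightarrow> r' 24 = base + Suc (length its) * rs \<Longrightarrow>
      r' 25 = length (concat its) + length v \<Longrightarrow> r' 16 = Suc (length its) \<Longrightarrow> r' 20 = r 20 - length v \<Longrightarrow>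
      frame {16, 20, 24, 25, 26, 31, 32, 33} r r' \<Longrightarrow>
      (\<forall>x. x < base \<or> base + (cap + 2) * rs \<le> x \<longrightarrow> m' ! x = m ! x) \<Longrightarrow> Q (r', m')"
  shows "tc w (blk item) (r, m) kitem Q"
proof -
  define cur where "cur = base + length its * rs"
  have len: "length m = L" using g by (simp add: good_def)
  note rr = R[unfolded regs_def regs_ok_def]
  have cb: "cur + 3 * rs \<le> base + (cap + 2) * rs"
    using mult_le_mono1[of "length its + 3" "cap + 2" rs] r(8) by (simp add: cur_def algebra_simps)
  have cL: "cur + 3 * rs < L" using cb base layout by (simp add: ok_base_def)
  have bM: "length M0 \<le> base" using base layout by (simp add: ok_base_def)
  have cM: "length M0 \<le> cur" using bM by (simp add: cur_def)
  have wb: "x mod 2 ^ w = x" if "x < L" for x using that layout(7) by simp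
  let ?m1 = "m[Suc cur := addr v]"
  define r1 where "r1 = r(26 := Suc cur, 31 := cur + 2, 32 := addr v, 33 := cur + 2 + rs)"
  have av: "addr v < L" using node_good(3)[OF g v] by simp
  have 1: "tc w (blk [Op Add 26 24 2, Store 26 22, Op Add 31 26 2, Op Add 32 22 35, Op Add 33 31 36]) (r, m) 5 (\<lambda>s. s = (r1, ?m1))"
    using rr r(1,3) cL len av wb[of "Suc cur"] wb[of "Suc (Suc cur)"] wb[of "addr v"] wb[of "Suc (Suc (cur + rs))"] rs_cc
    by (simp add: tc_Store r1_def cur_def[symmetric])
  have g1: "good ?m1" using good_update[OF g] cM addr_w[OF v] by simp
  have R1: "regs r1" using R by (auto simp: regs_def regs_ok_def r1_def)
  have rp: "rep ?m1 (cur + 2) (concat its)"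
  proof -
    have "rep m (cur + 2) (concat its)" using it unfolding items_def cur_def by (metis order_refl take_all)
    then show ?thesis by (rule rep_cong) auto
  qed
  have 2: "tc w (blk hcat) (r1, ?m1) khcat (\<lambda>(r', m'). rep m' (r1 33) (concat its @ v) \<and> upd_range (r1 33) cc ?m1 m' \<and> (\<forall>x < 50. r' x = r1 x))"
  proof (rule tc_hcat)
    show "regs_ok r1" using R1 by (simp add: regs_def)
    show "mem_ok ?m1" by (rule good_mem_ok[OF g1])
    show "rep ?m1 (r1 31) (concat its)" using rp by (simp add: r1_def)
    show "nodeh ?m1 (r1 32) v" using node_good(2)[OF g1 v] by (simp add: r1_def)
    show "r1 33 + cc < length ?m1" using cL len rs_cc by (simp add: r1_def)
  qed
  have 3: "tc w (blk [Op Add 25 25 23, Op Add 24 24 36, Store 24 25, Op Sub 20 20 23, Op Add 16 16 2]) (r2, m2) 5 Q"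
    if r2: "rep m2 (cur + 2 + rs) (concat its @ v)" "upd_range (cur + 2 + rs) cc ?m1 m2" "\<forall>x < 50. r2 x = r1 x" for r2 m2
  proof -
    let ?m3 = "m2[cur + rs := length (concat its) + length v]"
    define r3 where "r3 = r2(25 := length (concat its) + length v, 24 := cur + rs, 20 := r 20 - length v, 16 := Suc (length its))"
    have e: "r2 x = r1 x" if "x < 50" for x using r2(3) that by simp
    have len2: "length m2 = L" using r2(2) len by (simp add: upd_range_def)
    have g2: "good m2" using good_upd_num[OF g1 r2(2)] r2(1) cM by (simp add: rep_def)
    have g3: "good ?m3" using good_update[OF g2] cM r(9) by simp
    have ag: "?m3 ! x = m ! x" if "x \<noteq> Suc cur" "x \<noteq> cur + rs" "x < cur + 2 + rs \<or> cur + 2 + rs + cc \<le> x" for x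
    proof -
      have "?m3 ! x = m2 ! x" using that by simp
      also have "\<dots> = ?m1 ! x" using r2(2) that by (auto simp: upd_range_def)
      also have "\<dots> = m ! x" using that by simp
      finally show ?thesis .
    qed
    have it3: "items ?m3 base (its @ [v])" unfolding items_def
    proof (intro conjI allI impI)
      show "set (its @ [v]) \<subseteq> F" using it v by (auto simp: items_def)
    next
      fix i assume i: "i \<le> length (its @ [v])"
      consider "i \<le> length its" | "i = Suc (length its)" using i by fastforce
      then have "?m3 ! (base + i * rs) = length (concat (take i (its @ [v]))) \<and>
        rep ?m3 (base + i * rs + 2) (concat (take i (its @ [v])))"
      proof cases
        case 1
        have le: "base + i * rs \<le> cur" using mult_le_mono1[OF 1, of rs] by (simp add: cur_def)
        have far: "base + i * rs + rs \<le> cur \<or> base + i * rs = cur"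
        proof (cases "i = length its")
          case False
          then show ?thesis using 1 mult_le_mono1[of "Suc i" "length its" rs] by (simp add: cur_def)
        qed (simp add: cur_def)
        have "?m3 ! (base + i * rs) = m ! (base + i * rs)"
          by (rule ag) (use le rs_cc in linarith, use le rs_cc in linarith, rule disjI1, use le rs_cc in linarith)
        moreover have "rep m (base + i * rs + 2) (concat (take i its))" using it 1 by (simp add: items_def)
        then have "rep ?m3 (base + i * rs + 2) (concat (take i its))"
        proof (rule rep_cong)
          show "length ?m3 = length m" using len len2 by simp
          fix j assume j: "j < cc"
          have lt: "base + i * rs + 2 + j < cur + rs" "base + i * rs + 2 + j \<noteq> Suc cur" using far rs_cc j by linarith+
          show "?m3 ! (base + i * rs + 2 + j) = m ! (base + i * rs + 2 + j)"
            by (rule ag) (use lt in linarith, use lt in linarith, rule disjI1, use lt in linarith)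
        qed
        ultimately show ?thesis using it 1 by (simp add: items_def)
      next
        case 2
        have a: "base + i * rs = cur + rs" by (simp add: 2 cur_def)
        have "?m3 ! (cur + rs) = length (concat its) + length v" using cL len2 by simp
        moreover have "rep ?m3 (cur + rs + 2) (concat its @ v)"
        proof -
          have "cur + 2 + rs = cur + rs + 2" by simp
          from r2(1)[unfolded this] show ?thesis by (rule rep_cong) auto
        qed
        ultimately show ?thesis unfolding a by (simp add: 2)
      qed
      then show "?m3 ! (base + i * rs) = length (concat (take i (its @ [v])))"
        "rep ?m3 (base + i * rs + 2) (concat (take i (its @ [v])))" by auto
    next
      fix i assume i: "i < length (its @ [v])"
      show "?m3 ! (base + i * rs + 1) = addr ((its @ [v]) ! i)"
      proof (cases "i = length its")
        case True
        have "?m3 ! Suc cur = m2 ! Suc cur" using rs_cc by simp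
        also have "\<dots> = ?m1 ! Suc cur" using r2(2) by (auto simp: upd_range_def)
        also have "\<dots> = addr v" using cL len rs_cc by simp
        finally show ?thesis using True by (simp add: cur_def)
      next
        case False
        then have il: "i < length its" using i by simp
        have "base + i * rs + rs \<le> cur" using mult_le_mono1[of "Suc i" "length its" rs] il by (simp add: cur_def)
        then have lt: "base + i * rs + 1 < cur" using rs_cc by linarith
        have "?m3 ! (base + i * rs + 1) = m ! (base + i * rs + 1)"
          by (rule ag) (use lt in linarith, use lt in linarith, rule disjI1, use lt in linarith)
        then show ?thesis using it il by (simp add: items_def nth_append)
      qed
    qed
    have "Q (r3, ?m3)"
    proof (rule Q[OF g3 it3])
      show "r3 24 = base + Suc (length its) * rs" by (simp add: r3_def cur_def)
      show "frame {16, 20, 24, 25, 26, 31, 32, 33} r r3" by (auto simp: frame_def r3_def e r1_def)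
      show "\<forall>x. x < base \<or> base + (cap + 2) * rs \<le> x \<longrightarrow> ?m3 ! x = m ! x"
      proof (intro allI impI)
        fix x assume x: "x < base \<or> base + (cap + 2) * rs \<le> x"
        have "base \<le> cur" by (simp add: cur_def)
        then show "?m3 ! x = m ! x"
          by (intro ag) (use x cb rs_cc in linarith)+
      qed
    qed (simp_all add: r3_def)
    moreover have "length (concat its) + length v < 2 ^ w" using r by simp
    moreover have "Suc (length its) < 2 ^ w" using r(8) layout by simp
    moreover have "(r 20 + (2 ^ w - length v)) mod 2 ^ w = r 20 - length v" using sub_w[OF r(6,7)] .
    ultimately show ?thesis using rr r cL len2 wb[of "cur + rs"] e
      by (simp add: tc_Store r3_def e r1_def cur_def[symmetric])
  qed
  show ?thesis unfolding item_def
  proof (rule tc_append[OF 1])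
    fix s1 assume s1: "s1 = (r1, ?m1)"
    show "tc w (blk (hcat @ [Op Add 25 25 23, Op Add 24 24 36, Store 24 25, Op Sub 20 20 23, Op Add 16 16 2])) s1 (khcat + 5) Q"
      unfolding s1
    proof (rule tc_append[OF 2])
      fix s2 assume "case s2 of (r', m') \<Rightarrow> rep m' (r1 33) (concat its @ v) \<and> upd_range (r1 33) cc ?m1 m' \<and> (\<forall>x < 50. r' x = r1 x)"
      moreover have "r1 33 = cur + 2 + rs" by (simp add: r1_def)
      ultimately show "tc w (blk [Op Add 25 25 23, Op Add 24 24 36, Store 24 25, Op Sub 20 20 23, Op Add 16 16 2]) s2 5 Q"
        using 3 by (cases s2) auto
    qed simp
  qed (simp add: kitem_def)
qed

lemma stack_cong: "stack m st \<Longrightarrow> length st \<le> cap \<Longrightarrow> (\<And>x. stk \<le> x \<Longrightarrow> x < stk + cap \<Longrightarrow> m' ! x = m ! x) \<Longrightarrow> stack m' st"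
  by (auto simp: stack_def)

lemma tc_take_loop:
  assumes "good m" "regs r" "stack m st" "r 21 = stk + length st" "r 20 \<le> length (concat st)"
    "length (concat st) < 2 ^ w" "length st + bpot (r 20) st \<le> cap"
    and base: "ok_base base" and it: "items m base []" "r 24 = base" "r 25 = 0" "r 16 = 0"
  shows "tc w (While (Less 35 20) (blk take_body)) (r, m) (Suc (cap * (kitem + 15))) (\<lambda>(r', m').
    good m' \<and> frame {16, 20, 21, 22, 23, 24, 25, 26, 27, 31, 32, 33} r r' \<and>
    (\<forall>x. (x < stk \<or> stk + cap \<le> x) \<longrightarrow> (x < base \<or> base + (cap + 2) * rs \<le> x) \<longrightarrow> m' ! x = m ! x) \<and>
    (\<exists>its. items m' base its \<and> concat its = take (r 20) (concat st) \<and> r' 16 = length its \<and> length its \<le> cap))"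
proof -
  let ?X = "{16, 20, 21, 22, 23, 24, 25, 26, 27, 31, 32, 33}"
  let ?T = "take (r 20) (concat st)"
  let ?out = "\<lambda>m'. \<forall>x. (x < stk \<or> stk + cap \<le> x) \<longrightarrow> (x < base \<or> base + (cap + 2) * rs \<le> x) \<longrightarrow> m' ! x = m ! x"
  define I where "I = (\<lambda>(r', m') n. good m' \<and> frame ?X r r' \<and> ?out m' \<and>
    (\<exists>st' its. stack m' st' \<and> r' 21 = stk + length st' \<and> items m' base its \<and> concat its @ take (r' 20) (concat st') = ?T \<and>
      r' 20 \<le> length (concat st') \<and> length (concat its) + length (concat st') < 2 ^ w \<and>
      r' 24 = base + length its * rs \<and> r' 25 = length (concat its) \<and> r' 16 = length its \<and>
      n = length st' + bpot (r' 20) st' \<and> length its + n \<le> cap))"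
  have II: "I (r', m') n" if "good m'" "frame ?X r r'" "?out m'" "stack m' st'" "r' 21 = stk + length st'"
      "items m' base its" "concat its @ take (r' 20) (concat st') = ?T" "r' 20 \<le> length (concat st')"
      "length (concat its) + length (concat st') < 2 ^ w" "r' 24 = base + length its * rs"
      "r' 25 = length (concat its)" "r' 16 = length its" "n = length st' + bpot (r' 20) st'" "length its + n \<le> cap"
    for r' m' n st' its unfolding I_def using that by blast
  have "tc w (While (Less 35 20) (blk take_body)) (r, m) (Suc ((length st + bpot (r 20) st) * Suc (kitem + 14))) (\<lambda>(r', m').
    good m' \<and> frame ?X r r' \<and> ?out m' \<and>
    (\<exists>its. items m' base its \<and> concat its = ?T \<and> r' 16 = length its \<and> length its \<le> cap))"
  proof (rule tc_While[where I = I])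
    show "I (r, m) (length st + bpot (r 20) st)" by (rule II[of _ _ st "[]"]) (use assms in auto)
  next
    fix s n assume I: "I s n" and c: "cmp_val (Less 35 20) (fst s)"
    obtain r1 m1 where s: "s = (r1, m1)" by (cases s)
    obtain st' its where st': "stack m1 st'" "r1 21 = stk + length st'" "items m1 base its"
      "concat its @ take (r1 20) (concat st') = ?T" "r1 20 \<le> length (concat st')"
      "length (concat its) + length (concat st') < 2 ^ w" "r1 24 = base + length its * rs"
      "r1 25 = length (concat its)" "r1 16 = length its" "n = length st' + bpot (r1 20) st'" "length its + n \<le> cap"
      and g: "good m1" and fr: "frame ?X r r1" and out: "?out m1"
      using I unfolding I_def s by auto
    have R1: "regs r1" using regs_frame[OF assms(2) fr] by simp
    then have "r1 35 = 0" by (simp add: regs_def regs_ok_def)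
    then have k0: "0 < r1 20" using c by (simp add: s)
    then obtain v q where vq: "st' = v # q" using st'(5) by (cases st') auto
    have vF: "v \<in> F" and sq: "stack m1 q" using stack_top[of m1 v q] st' vq by auto
    let ?r2 = "r1(21 := stk + length q, 22 := addr v, 23 := length v)"
    have R2: "regs ?r2" using R1 by (auto simp: regs_def regs_ok_def)
    show "tc w (blk take_body) s (kitem + 14) (\<lambda>s'. \<exists>n'. I s' n' \<and> n' < n)"
      unfolding s take_body_def
    proof (rule tc_pop[OF g R1, where T = "kitem + 11"])
      show "stack m1 (v # q)" "r1 21 = stk + length (v # q)" "length q \<le> cap" using st' vq by auto
      show "tc w (blk [Cond (LessEq 23 20) (blk item) (blk expand)]) (?r2, m1) (kitem + 11) (\<lambda>s'. \<exists>n'. I s' n' \<and> n' < n)"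
      proof (rule tc_Cond)
        assume "cmp_val (LessEq 23 20) (fst (?r2, m1))"
        then have le: "length v \<le> r1 20" by simp
        have nq: "length q + bpot (r1 20 - length v) q < n" using le k0 unfolding st'(10) vq by auto
        have "tc w (blk item) (?r2, m1) kitem (\<lambda>s'. \<exists>n'. I s' n' \<and> n' < n)"
        proof (rule tc_item[OF g R2 base st'(3) vF])
          show "?r2 20 < 2 ^ w" using st'(5,6) by simp
          show "length (concat its) + length v < 2 ^ w" using st'(6) vq by simp
          show "length its < cap" using st'(11) nq by linarith
          fix r' m' assume a: "good m'" "items m' base (its @ [v])" "r' 24 = base + Suc (length its) * rs"
            "r' 25 = length (concat its) + length v" "r' 16 = Suc (length its)" "r' 20 = ?r2 20 - length v"
            "frame {16, 20, 24, 25, 26, 31, 32, 33} ?r2 r'"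
            "\<forall>x. x < base \<or> base + (cap + 2) * rs \<le> x \<longrightarrow> m' ! x = m1 ! x"
          have r20: "r' 20 = r1 20 - length v" using a(6) by simp
          have "I (r', m') (length q + bpot (r' 20) q)"
          proof (rule II[OF a(1) _ _ _ _ a(2)])
            show "frame ?X r r'" using fr a(7) by (auto simp: frame_def)
            show "?out m'" using out a(8) by simp
            show "stack m' q"
              by (rule stack_cong[OF sq]) (use st'(11) nq a(8) base in \<open>auto simp: ok_base_def\<close>)
            show "r' 21 = stk + length q" using frameD[OF a(7), of 21] by simp
            show "concat (its @ [v]) @ take (r' 20) (concat q) = ?T"
              using st'(4) le by (simp add: vq r20)
          qed (use a r20 st' vq le nq in auto)
          then show "\<exists>n'. I (r', m') n' \<and> n' < n" using nq r20 by auto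
        qed (use st' le in auto)
        then show "tc w (blk (item @ [])) (?r2, m1) (kitem + 11 - 1) (\<lambda>s'. \<exists>n'. I s' n' \<and> n' < n)"
          by (auto intro: tc_mono)
      next
        assume "\<not> cmp_val (LessEq 23 20) (fst (?r2, m1))"
        then have lt: "r1 20 < length v" by simp
        have "tc w (blk expand) (?r2, m1) (kitem + 10) (\<lambda>s'. \<exists>n'. I s' n' \<and> n' < n)"
        proof (rule tc_expand[OF g R2 sq vF])
          show l2: "2 \<le> length v" using lt k0 by linarith
          show "?r2 22 = addr v" "?r2 21 = stk + length q" by auto
          have "2 * ht v \<le> bpot (r1 20) st'" using lt k0 unfolding vq by auto
          moreover obtain u z where "ht u < ht v" using children[OF vF l2] by blast
          ultimately show "length q + 2 \<le> cap" using st'(11) unfolding st'(10) vq by (simp del: bpot.simps)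
        next
          fix u z r' m' assume uz: "u \<in> F" "z \<in> F" "v = u @ z" "ht u < ht v" "ht z < ht v" "good m'" "stack m' (u # z # q)"
            "r' 21 = stk + length q + 2" "frame {21, 26, 27} ?r2 r'" "\<forall>x. x < stk \<or> stk + cap \<le> x \<longrightarrow> m' ! x = m1 ! x"
          have rf: "r' 20 = r1 20" "r' 24 = r1 24" "r' 25 = r1 25" "r' 16 = r1 16"
            using frameD[OF uz(9), of 20] frameD[OF uz(9), of 24] frameD[OF uz(9), of 25] frameD[OF uz(9), of 16] by auto
          have lt': "length (u # z # q) + bpot (r1 20) (u # z # q) < n"
            using bpot_expand(2)[OF uz(3-5) k0 lt, of q] unfolding st'(10) vq by (simp del: bpot.simps)
          have le: "Suc (length its) * rs \<le> (cap + 2) * rs" using st'(11) by (intro mult_le_mono1) simp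
          have ge: "stk + cap \<le> base" using base by (simp add: ok_base_def)
          have "I (r', m') (length (u # z # q) + bpot (r' 20) (u # z # q))"
          proof (rule II[OF uz(6) _ _ uz(7)])
            show "frame ?X r r'" using fr uz(9) by (auto simp: frame_def)
            show "?out m'" using out uz(10) by simp
            have "length m' = length m1" using uz(6) g by (simp add: good_def)
            then show "items m' base its" by (rule items_cong[OF st'(3)]) (use uz(10) ge in auto)
          qed (use st' vq rf uz lt' in \<open>auto simp del: bpot.simps\<close>)
          then show "\<exists>n'. I (r', m') n' \<and> n' < n" using lt' rf by auto
        qed simp
        then show "tc w (blk (expand @ [])) (?r2, m1) (kitem + 11 - 1) (\<lambda>s'. \<exists>n'. I s' n' \<and> n' < n)"
          by (simp add: add.commute)
      qed simp
    qed simp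
  next
    fix s n assume I: "I s n" and c: "\<not> cmp_val (Less 35 20) (fst s)"
    obtain r1 m1 where s: "s = (r1, m1)" by (cases s)
    have "regs r1" using regs_frame[OF assms(2)] I unfolding I_def s by auto
    then have "r1 35 = 0" by (simp add: regs_def regs_ok_def)
    then have "r1 20 = 0" using c by (simp add: s)
    then show "case s of (r', m') \<Rightarrow> good m' \<and> frame ?X r r' \<and> ?out m' \<and>
      (\<exists>its. items m' base its \<and> concat its = ?T \<and> r' 16 = length its \<and> length its \<le> cap)"
      using I unfolding I_def s by auto
  qed
  then show ?thesis
  proof (rule tc_mono)
    show "Suc ((length st + bpot (r 20) st) * Suc (kitem + 14)) \<le> Suc (cap * (kitem + 15))"
      using mult_le_mono1[OF assms(7), of "kitem + 15"] by (simp add: add.commute)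
  qed
qed

definition kbuild :: nat where "kbuild = 4 * cc + 30 + kitem"

text \<open>\<open>cap\<close> is at least the initial potential: one stack entry and
  \<open>2 * ht S\<close> for each of the two ends of the window.\<close>

lemma tc_build:
  assumes g: "good m" and R: "regs r" and base: "ok_base base" "r 15 = base" and d: "r 19 + r 20 \<le> length S"
  shows "tc w (blk build) (r, m) (kbuild * (cap + 1)) (\<lambda>(r', m').
    good m' \<and> frame {16, 19, 20, 21, 22, 23, 24, 25, 26, 27, 31, 32, 33} r r' \<and>
    (\<forall>x. (x < stk \<or> stk + cap \<le> x) \<longrightarrow> (x < base \<or> base + (cap + 2) * rs \<le> x) \<longrightarrow> m' ! x = m ! x) \<and>
    (\<exists>its. items m' base its \<and> concat its = take (r 20) (drop (r 19) S) \<and> r' 16 = length its \<and> length its \<le> cap))"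
    (is "tc _ _ _ _ ?Q")
proof -
  have len: "length m = L" using g by (simp add: good_def)
  note rr = R[unfolded regs_def regs_ok_def]
  have wb: "x mod 2 ^ w = x" if "x < L" for x using that layout(7) by simp
  have bb: "base + 2 * rs < L" "stk + cap + 1 \<le> base" "length M0 \<le> stk" "stk + 1 < L"
    using base layout mult_le_mono1[of 2 "cap + 2" rs] by (auto simp: ok_base_def)
  have padL: "padr < L" using LM0 M0_200 by (simp add: padr_def)
  let ?m1 = "m[stk := addr S, base := 0]"
  define r1 where "r1 = r(21 := stk + 1, 24 := base, 25 := 0, 16 := 0, 61 := padr, 62 := base + 2)"
  have 1: "tc w (blk [Op Add 21 37 35, Store 21 5, Op Add 21 21 2, Op Add 24 15 35, Const 25 0, Const 16 0, Store 24 25,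
     Const 61 padr, Op Add 62 24 2, Op Add 62 62 2]) (r, m) 10 (\<lambda>s. s = (r1, ?m1))"
    using rr base(2) bb len wb[of stk] wb[of "Suc stk"] wb[of base] wb[of "Suc base"] wb[of "Suc (Suc base)"] wb[OF padL] rs_cc
    by (simp add: tc_Store r1_def fun_upd_twist)
  have g1: "good ?m1" using g addr_w[OF SF] bb by (intro good_update) auto
  have st1: "stack ?m1 [S]" using bb len SF by (auto simp: stack_def)
  have pad: "rep ?m1 padr []"
    using good_mem_ok[OF g1] P1 by (auto simp: rep_def mem_ok_def)
  have 2: "tc w (blk (copyd cc)) (r1, ?m1) (4 * cc) (\<lambda>(r', m'). upd_range (r1 62) cc ?m1 m' \<and>
    seg m' (r1 62) cc = seg ?m1 (r1 61) cc \<and> (\<forall>x < 50. r' x = r1 x))"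
    using rr bb len rs_cc padL pad M0_200 layout(7) LM0
    by (intro tc_copyd) (auto simp: r1_def padr_def rep_def num_def cc_def)
  have 3: "tc w (blk [While (Less 35 19) (blk skip_body), While (Less 35 20) (blk take_body)]) (r2, m2)
      (Suc (cap * 14) + (Suc (cap * (kitem + 15)))) ?Q"
    if u: "upd_range (base + 2) cc ?m1 m2" "seg m2 (base + 2) cc = seg ?m1 padr cc" "\<forall>x < 50. r2 x = r1 x" for r2 m2
  proof -
    have e: "r2 x = r1 x" if "x < 50" for x using u(3) that by simp
    have len2: "length m2 = L" using u(1) len by (simp add: upd_range_def)
    have n2: "num m2 (base + 2)" using pad u(2) bb len2 rs_cc by (simp add: rep_def num_def)
    have g2: "good m2" using good_upd_num[OF g1 u(1) n2] bb by simp
    have R2: "regs r2" using R by (auto simp: regs_def regs_ok_def e r1_def)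
    have "stack m2 [S]" by (rule stack_cong[OF st1]) (use capS bb u(1) in \<open>auto simp: upd_range_def\<close>)
    have it2: "items m2 base []"
    proof -
      have "rep m2 (base + 2) []" using pad u(2) n2 by (simp add: rep_def)
      moreover have "m2 ! base = 0" using u(1) bb len by (simp add: upd_range_def)
      ultimately show ?thesis by (simp add: items_def)
    qed
    have p: "pot (r 19) (r 19 + r 20) [S] \<le> cap" using capS by (auto simp: pot_def)
    have r2v: "r2 19 = r 19" "r2 20 = r 20" "r2 21 = stk + 1" "r2 24 = base" "r2 25 = 0" "r2 16 = 0" by (auto simp: e r1_def)
    have Sw: "length S < 2 ^ w" using Nw by linarith
    have A: "tc w (While (Less 35 19) (blk skip_body)) (r2, m2) (Suc (pot (r2 19) (r2 19 + r 20) [S] * 14)) (\<lambda>(r', m').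
      good m' \<and> frame {19, 21, 22, 23, 26, 27} r2 r' \<and> (\<forall>x. x < stk \<or> stk + cap \<le> x \<longrightarrow> m' ! x = m2 ! x) \<and>
      (\<exists>st'. stack m' st' \<and> r' 21 = stk + length st' \<and> drop (r2 19) (concat [S]) = concat st' \<and>
        length st' + bpot (r 20) st' \<le> cap))"
      by (rule tc_skip_loop[OF g2 R2 \<open>stack m2 [S]\<close>]) (use r2v d p Sw in auto)
    show ?thesis
    proof (rule tc_Cons[OF A])
      fix s' assume "case s' of (r', m') \<Rightarrow>
        good m' \<and> frame {19, 21, 22, 23, 26, 27} r2 r' \<and> (\<forall>x. x < stk \<or> stk + cap \<le> x \<longrightarrow> m' ! x = m2 ! x) \<and>
        (\<exists>st'. stack m' st' \<and> r' 21 = stk + length st' \<and> drop (r2 19) (concat [S]) = concat st' \<and>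
          length st' + bpot (r 20) st' \<le> cap)"
      then obtain r3 m3 st' where s3: "s' = (r3, m3)" "good m3" "frame {19, 21, 22, 23, 26, 27} r2 r3"
        "\<forall>x. x < stk \<or> stk + cap \<le> x \<longrightarrow> m3 ! x = m2 ! x" "stack m3 st'" "r3 21 = stk + length st'"
        "drop (r 19) S = concat st'" "length st' + bpot (r 20) st' \<le> cap" using r2v(1) by (cases s') auto
      have R3: "regs r3" using regs_frame[OF R2 s3(3)] by simp
      have r3v: "r3 20 = r 20" "r3 24 = base" "r3 25 = 0" "r3 16 = 0"
        using frameD[OF s3(3), of 20] frameD[OF s3(3), of 24] frameD[OF s3(3), of 25] frameD[OF s3(3), of 16] r2v by auto
      have "length m3 = length m2" using s3(2) g2 by (simp add: good_def)
      then have it3: "items m3 base []" by (rule items_cong[OF it2]) (use s3(4) bb in auto)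
      have lc: "length (concat st') = length S - r 19" using arg_cong[OF s3(7), of length] by simp
      have B: "tc w (While (Less 35 20) (blk take_body)) (r3, m3) (Suc (cap * (kitem + 15))) (\<lambda>(r', m').
        good m' \<and> frame {16, 20, 21, 22, 23, 24, 25, 26, 27, 31, 32, 33} r3 r' \<and>
        (\<forall>x. (x < stk \<or> stk + cap \<le> x) \<longrightarrow> (x < base \<or> base + (cap + 2) * rs \<le> x) \<longrightarrow> m' ! x = m3 ! x) \<and>
        (\<exists>its. items m' base its \<and> concat its = take (r3 20) (concat st') \<and> r' 16 = length its \<and> length its \<le> cap))"
        by (rule tc_take_loop[OF s3(2) R3 s3(5,6) _ _ _ base(1) it3]) (use r3v s3(8) lc d Sw in auto)
      show "tc w (blk [While (Less 35 20) (blk take_body)]) s' (Suc (cap * (kitem + 15))) ?Q"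
        unfolding s3(1)
      proof (rule tc_Cons[OF B, where ?T2.0 = 0])
        fix s4 assume "case s4 of (r', m') \<Rightarrow>
          good m' \<and> frame {16, 20, 21, 22, 23, 24, 25, 26, 27, 31, 32, 33} r3 r' \<and>
          (\<forall>x. (x < stk \<or> stk + cap \<le> x) \<longrightarrow> (x < base \<or> base + (cap + 2) * rs \<le> x) \<longrightarrow> m' ! x = m3 ! x) \<and>
          (\<exists>its. items m' base its \<and> concat its = take (r3 20) (concat st') \<and> r' 16 = length its \<and> length its \<le> cap)"
        then obtain r4 m4 its where s4: "s4 = (r4, m4)" "good m4" "frame {16, 20, 21, 22, 23, 24, 25, 26, 27, 31, 32, 33} r3 r4"
          "\<forall>x. (x < stk \<or> stk + cap \<le> x) \<longrightarrow> (x < base \<or> base + (cap + 2) * rs \<le> x) \<longrightarrow> m4 ! x = m3 ! x"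
          "items m4 base its" "concat its = take (r3 20) (concat st')" "r4 16 = length its" "length its \<le> cap"
          by (cases s4) auto
        have "frame {16, 19, 20, 21, 22, 23, 24, 25, 26, 27, 31, 32, 33} r r4"
          unfolding frame_def
        proof (intro allI impI)
          fix x assume x: "x < (50::nat)" "x \<notin> {16, 19, 20, 21, 22, 23, 24, 25, 26, 27, 31, 32, 33}"
          have "r4 x = r3 x" using x by (intro frameD[OF s4(3)]) auto
          also have "\<dots> = r2 x" using x by (intro frameD[OF s3(3)]) auto
          also have "\<dots> = r x" using x by (auto simp: e r1_def)
          finally show "r4 x = r x" .
        qed
        moreover have "m4 ! x = m ! x" if x: "x < stk \<or> stk + cap \<le> x" "x < base \<or> base + (cap + 2) * rs \<le> x" for x
        proof -
          have "m4 ! x = m3 ! x" using s4(4) x by blast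
          also have "\<dots> = m2 ! x" using s3(4) x by blast
          also have "\<dots> = ?m1 ! x"
          proof -
            have "x < base + 2 \<or> base + 2 + cc \<le> x" using x(2) mult_le_mono1[of 2 "cap + 2" rs] rs_cc by auto
            then show ?thesis using u(1) by (auto simp: upd_range_def)
          qed
          also have "\<dots> = m ! x"
          proof -
            have "0 < (cap + 2) * rs" using rs_cc by simp
            then have "x \<noteq> stk" "x \<noteq> base" using x capS by linarith+
            then show ?thesis by simp
          qed
          finally show ?thesis .
        qed
        ultimately show "tc w (blk []) s4 0 ?Q" using s4 r3v(1) s3(7) by auto
      qed simp
    qed (use p r2v in simp)
  qed
  show ?thesis unfolding build_def
  proof (rule tc_append[OF 1])
    fix s1 assume s1: "s1 = (r1, ?m1)"
    show "tc w (blk (copyd cc @ [While (Less 35 19) (blk skip_body), While (Less 35 20) (blk take_body)])) s1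
      (4 * cc + (Suc (cap * 14) + (Suc (cap * (kitem + 15))))) ?Q" unfolding s1
    proof (rule tc_append[OF 2])
      fix s2 assume "case s2 of (r', m') \<Rightarrow> upd_range (r1 62) cc ?m1 m' \<and>
        seg m' (r1 62) cc = seg ?m1 (r1 61) cc \<and> (\<forall>x < 50. r' x = r1 x)"
      moreover have "r1 62 = base + 2" "r1 61 = padr" by (auto simp: r1_def)
      ultimately show "tc w (blk [While (Less 35 19) (blk skip_body), While (Less 35 20) (blk take_body)]) s2
        (Suc (cap * 14) + (Suc (cap * (kitem + 15)))) ?Q" using 3 by (cases s2) auto
    qed simp
  qed (simp add: kbuild_def algebra_simps)
qed

end

section \<open>Comparing prefixes of the windows\<close>

definition loc_body :: "prog list" where
  "loc_body = [Op Add 30 28 29, Const 26 2, Op Div 30 30 26, Op Mult 31 30 36, Op Add 31 31 15, Load 31 31,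
     Cond (LessEq 31 19) (blk [Op Add 28 30 35]) (blk [Op Add 29 30 35]), Op Add 27 28 2]"

definition locate :: "prog list" where
  "locate = [Const 28 0, Op Add 29 16 35, Op Add 27 28 2, While (Less 27 29) (blk loc_body)]"

definition desc_body :: "prog list" where
  "desc_body = [Load 23 22, Cond (LessEq 23 20)
     (blk ([Op Add 31 34 35, Op Add 32 22 35, Op Add 33 34 35] @ hcat @ [Op Sub 20 20 23]))
     (blk [Op Add 26 22 2, Load 26 26, Load 27 26, Cond (LessEq 27 20)
       (blk ([Op Add 31 34 35, Op Add 32 26 35, Op Add 33 34 35] @ hcat @
          [Op Sub 20 20 27, Const 26 2, Op Add 26 22 26, Load 22 26]))
       (blk [Op Add 22 26 35])])]"

definition desc :: "prog list" where
  "desc = [Op Mult 26 28 36, Op Add 26 26 15, Load 27 26, Op Sub 20 19 27, Op Add 26 26 2, Load 22 26,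
     Op Add 61 26 2, Op Add 62 34 35] @ copyd cc @ [While (Less 35 20) (blk desc_body)]"

context lce_structure begin

lemma two_w: "(2::nat) mod 2 ^ w = 2"
proof -
  have "2 < (2::nat) ^ w" using M0_200 LM0 layout(7) by linarith
  then show ?thesis by simp
qed

lemma one_w: "(1::nat) mod 2 ^ w = 1"
proof -
  have "1 < (2::nat) ^ w" using M0_200 LM0 layout(7) by linarith
  then show ?thesis by (rule mod_less)
qed

lemma item_addr: "ok_base base \<Longrightarrow> i \<le> cap \<Longrightarrow> base + i * rs + 2 * rs \<le> aA"
proof -
  assume *: "ok_base base" "i \<le> cap"
  have "(i + 2) * rs \<le> (cap + 2) * rs" using *(2) by (intro mult_le_mono1) simp
  moreover have "(i + 2) * rs = i * rs + 2 * rs" by (rule add_mult_distrib)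
  ultimately show ?thesis using *(1) unfolding ok_base_def by linarith
qed

lemma aA_L: "aA + 2 * cc + 2 < L"
  using layout by linarith

text \<open>The upper inequality is not strict, so that the full length of the window is located in
  its last item.\<close>

lemma tc_locate:
  assumes g: "good m" and R: "regs r" and base: "ok_base base" "r 15 = base" and it: "items m base its"
    and n: "r 16 = length its" "0 < length its" "length its \<le> cap" and x: "r 19 \<le> length (concat its)"
  shows "tc w (blk locate) (r, m) (10 * bl cap + 4) (\<lambda>(r', m'). m' = m \<and> frame {26, 27, 28, 29, 30, 31} r r' \<and>
    r' 28 < length its \<and> length (concat (take (r' 28) its)) \<le> r 19 \<and> r 19 \<le> length (concat (take (Suc (r' 28)) its)))"
proof -
  let ?X = "{26, 27, 28, 29, 30, 31}" and ?E = "\<lambda>i. length (concat (take i its))" and ?x = "r 19"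
  have len: "length m = L" using g by (simp add: good_def)
  note rr = R[unfolded regs_def regs_ok_def]
  have wb: "y mod 2 ^ w = y" if "y < L" for y using that layout(7) by simp
  have capL: "2 * cap + 2 < L"
  proof -
    have "(cap + 2) * 2 \<le> (cap + 2) * rs" using rs_cc by (intro mult_le_mono2) simp
    moreover have "(cap + 2) * 2 = 2 * cap + 4" by simp
    moreover have "(cap + 2) * rs \<le> aA" using base(1) by (simp add: ok_base_def)
    ultimately show ?thesis using aA_L by linarith
  qed
  define I where "I = (\<lambda>(r', m') k. m' = m \<and> frame ?X r r' \<and> r' 27 = Suc (r' 28) \<and> r' 28 < r' 29 \<and> r' 29 \<le> length its \<and>
    ?E (r' 28) \<le> ?x \<and> (r' 29 = length its \<or> ?x < ?E (r' 29)) \<and> r' 29 - r' 28 \<le> 2 ^ k)"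
  let ?Q = "\<lambda>(r', m'). m' = m \<and> frame ?X r r' \<and> r' 28 < length its \<and> ?E (r' 28) \<le> ?x \<and> ?x \<le> ?E (Suc (r' 28))"
  let ?r1 = "r(28 := 0, 29 := length its, 27 := Suc 0)"
  have loop: "tc w (While (Less 27 29) (blk loc_body)) (?r1, m) (Suc (bl cap * Suc 9)) ?Q"
  proof (rule tc_While[where I = I])
    have "length its < 2 ^ bl cap" using n(3) bl_bound[of cap] by linarith
    then show "I (?r1, m) (bl cap)" using n by (auto simp: I_def frame_def)
  next
    fix s k assume I: "I s k" and c: "cmp_val (Less 27 29) (fst s)"
    obtain r1 m1 where s: "s = (r1, m1)" by (cases s)
    let ?lo = "r1 28" and ?hi = "r1 29"
    have i: "m1 = m" "frame ?X r r1" "r1 27 = Suc ?lo" "?lo < ?hi" "?hi \<le> length its" "?E ?lo \<le> ?x"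
      "?hi = length its \<or> ?x < ?E ?hi" "?hi - ?lo \<le> 2 ^ k" "Suc ?lo < ?hi"
      using I c unfolding I_def s by auto
    have rf: "r1 15 = base" "r1 19 = ?x" "r1 35 = 0" "r1 36 = rs" "r1 2 = 1"
      using frameD[OF i(2), of 15] frameD[OF i(2), of 19] frameD[OF i(2), of 35] frameD[OF i(2), of 36] frameD[OF i(2), of 2] rr base by auto
    have k: "k \<noteq> 0" using i(8,9) by (intro notI) simp
    then obtain j where j: "k = Suc j" by (cases k) auto
    define mid where "mid = (?lo + ?hi) div 2"
    have mid: "?lo < mid" "mid < ?hi" "?hi - mid \<le> 2 ^ j" "mid - ?lo \<le> 2 ^ j" "mid \<le> cap"
      using i n j unfolding mid_def by auto
    let ?a = "base + mid * rs"
    have aL: "?a < L" using item_addr[OF base(1) mid(5)] aA_L by linarith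
    have E: "m ! ?a = ?E mid" using it mid i(5) by (simp add: items_def)
    have lh: "?lo + ?hi < L" using i n capL by linarith
    let ?r2 = "r1(30 := mid, 26 := 2, 31 := ?E mid)"
    have fin: "\<exists>n'. I (r', m) n' \<and> n' < k" if r': "frame ?X r r'" "r' 27 = Suc (r' 28)"
        "(?E mid \<le> ?x \<and> r' 28 = mid \<and> r' 29 = ?hi) \<or> (?x < ?E mid \<and> r' 28 = ?lo \<and> r' 29 = mid)" for r'
    proof -
      have "I (r', m) j" using r' mid i unfolding I_def by auto
      then show ?thesis using j by blast
    qed
    have step: "tc w (blk loc_body) (r1, m) 9 Q" if
      "?E mid \<le> ?x \<Longrightarrow> Q (?r2(28 := mid, 27 := Suc mid), m)"
      "\<not> ?E mid \<le> ?x \<Longrightarrow> Q (?r2(29 := mid, 27 := Suc ?lo), m)" for Q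
    proof -
      have c: "tc w (blk (Cond (LessEq 31 19) (blk [Op Add 28 30 35]) (blk [Op Add 29 30 35]) # [Op Add 27 28 2])) (?r2, m) 3 Q"
      proof (rule tc_Cond)
        have "Suc mid < L" "mid < L" "Suc ?lo < L" using mid lh by linarith+
        note w3 = this[THEN wb]
        show "cmp_val (LessEq 31 19) (fst (?r2, m)) \<Longrightarrow> tc w (blk ([Op Add 28 30 35] @ [Op Add 27 28 2])) (?r2, m) (3 - 1) Q"
          using that(1) rf w3 by simp
        show "\<not> cmp_val (LessEq 31 19) (fst (?r2, m)) \<Longrightarrow> tc w (blk ([Op Add 29 30 35] @ [Op Add 27 28 2])) (?r2, m) (3 - 1) Q"
          using that(2) rf w3 by simp
      qed simp
      have "(?lo + ?hi) mod 2 ^ w = ?lo + ?hi" "mid * rs mod 2 ^ w = mid * rs" "(mid * rs + base) mod 2 ^ w = ?a"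
        using wb[OF lh] wb[OF aL] wb[of "mid * rs"] aL by (auto simp: add.commute)
      then show ?thesis unfolding loc_body_def using c rf aL len E two_w
        by (simp add: tc_Load mid_def[symmetric] fun_upd_twist)
    qed
    show "tc w (blk loc_body) s 9 (\<lambda>s'. \<exists>n'. I s' n' \<and> n' < k)"
      unfolding s i(1)
    proof (rule step)
      assume "?E mid \<le> ?x"
      then show "\<exists>n'. I (?r2(28 := mid, 27 := Suc mid), m) n' \<and> n' < k"
        by (intro fin) (use i(2) in \<open>auto simp: frame_def\<close>)
    next
      assume "\<not> ?E mid \<le> ?x"
      then show "\<exists>n'. I (?r2(29 := mid, 27 := Suc ?lo), m) n' \<and> n' < k"
        by (intro fin) (use i(2) in \<open>auto simp: frame_def\<close>)
    qed
  next
    fix s k assume I: "I s k" and c: "\<not> cmp_val (Less 27 29) (fst s)"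
    obtain r1 m1 where s: "s = (r1, m1)" by (cases s)
    have i: "m1 = m" "frame ?X r r1" "r1 28 < r1 29" "r1 29 \<le> length its" "?E (r1 28) \<le> ?x"
      "r1 29 = length its \<or> ?x < ?E (r1 29)" "r1 29 = Suc (r1 28)"
      using I c unfolding I_def s by auto
    have "?x \<le> ?E (Suc (r1 28))" using i(6,7) x by auto
    then show "?Q s" using i by (simp add: s)
  qed
  have "length its < L" using n capL by linarith
  note wl = wb[OF this]
  have "tc w (blk [While (Less 27 29) (blk loc_body)]) (?r1, m) (Suc (bl cap * Suc 9)) ?Q"
    by (rule tc_Cons[OF loop, where ?T2.0 = 0]) auto
  then have "tc w (blk locate) (r, m) (Suc (bl cap * Suc 9) + 3) ?Q"
    unfolding locate_def using rr n(1) wl one_w by simp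
  then show ?thesis by (rule tc_mono) auto
qed

lemma upd_range_trans: "upd_range a n m m' \<Longrightarrow> upd_range a n m' m'' \<Longrightarrow> upd_range a n m m''"
  by (simp add: upd_range_def)

lemma upd_range_refl [simp]: "upd_range a n m m"
  by (simp add: upd_range_def)

definition kdesc :: nat where "kdesc = khcat + 15"

lemma tc_hcat_acc:
  assumes g: "good m" and R: "regs r" and acc: "aA \<le> acc" "acc + cc < L" "r 34 = acc" and u: "rep m acc u"
    and v: "v \<in> F" "r 22 = addr v \<and> k = 22 \<or> r 26 = addr v \<and> k = 26"
    and Q: "\<And>r' m'. good m' \<Longrightarrow> upd_range acc cc m m' \<Longrightarrow> rep m' acc (u @ v) \<Longrightarrow> frame {31, 32, 33} r r' \<Longrightarrow>
      tc w (blk ps) (r', m') T Q"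
  shows "tc w (blk ([Op Add 31 34 35, Op Add 32 k 35, Op Add 33 34 35] @ hcat @ ps)) (r, m) (T + khcat + 3) Q"
proof -
  have len: "length m = L" using g by (simp add: good_def)
  note rr = R[unfolded regs_def regs_ok_def]
  have wb: "y mod 2 ^ w = y" if "y < L" for y using that layout(7) by simp
  have aL: "acc < L" "addr v < L" using acc node_good(3)[OF g v(1)] by auto
  define r1 where "r1 = r(31 := acc, 32 := addr v, 33 := acc)"
  have R1: "regs r1" using R by (auto simp: regs_def regs_ok_def r1_def)
  have 1: "tc w (blk [Op Add 31 34 35, Op Add 32 k 35, Op Add 33 34 35]) (r, m) 3 (\<lambda>s. s = (r1, m))"
    using rr v(2) acc(3) wb[OF aL(1)] wb[OF aL(2)] by (auto simp: r1_def)
  have 2: "tc w (blk hcat) (r1, m) khcat (\<lambda>(r', m'). rep m' (r1 33) (u @ v) \<and> upd_range (r1 33) cc m m' \<and> (\<forall>x < 50. r' x = r1 x))"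
  proof (rule tc_hcat)
    show "regs_ok r1" using R1 by (simp add: regs_def)
    show "mem_ok m" by (rule good_mem_ok[OF g])
    show "rep m (r1 31) u" using u by (simp add: r1_def)
    show "nodeh m (r1 32) v" using node_good(2)[OF g v(1)] by (simp add: r1_def)
    show "r1 33 + cc < length m" using acc len by (simp add: r1_def)
  qed
  show ?thesis
  proof (rule tc_append[OF 1])
    fix s1 assume s1: "s1 = (r1, m)"
    show "tc w (blk (hcat @ ps)) s1 (khcat + T) Q" unfolding s1
    proof (rule tc_append[OF 2])
      fix s2 assume "case s2 of (r', m') \<Rightarrow> rep m' (r1 33) (u @ v) \<and> upd_range (r1 33) cc m m' \<and> (\<forall>x < 50. r' x = r1 x)"
      then obtain r2 m2 where s2: "s2 = (r2, m2)" "rep m2 acc (u @ v)" "upd_range acc cc m m2" "\<forall>x < 50. r2 x = r1 x"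
        by (cases s2) (auto simp: r1_def)
      have "good m2" using good_upd_num[OF g s2(3)] s2(2) acc layout by (simp add: rep_def)
      moreover have "frame {31, 32, 33} r r2" using s2(4) by (auto simp: frame_def r1_def)
      ultimately show "tc w (blk ps) s2 T Q" unfolding s2(1) using s2 by (intro Q)
    qed simp
  qed simp
qed

text \<open>Each round appends the whole node and stops, or moves to a child of smaller height,
  appending the left child first if it moves to the right. The measure is 0 exactly when nothing
  remains to be appended.\<close>

lemma tc_desc_loop:
  assumes "good m" "regs r" and acc: "aA \<le> acc" "acc + cc < L" "r 34 = acc" and "rep m acc u"
    and "v \<in> F" "r 22 = addr v" "r 20 \<le> length v" "length v < 2 ^ w"
  shows "tc w (While (Less 35 20) (blk desc_body)) (r, m) (Suc (Suc (ht v) * Suc kdesc)) (\<lambda>(r', m').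
    good m' \<and> upd_range acc cc m m' \<and> rep m' acc (u @ take (r 20) v) \<and> frame {20, 22, 23, 26, 27, 31, 32, 33} r r')"
proof -
  let ?X = "{20, 22, 23, 26, 27, 31, 32, 33}" and ?T = "u @ take (r 20) v"
  define I where "I = (\<lambda>(r', m') n. good m' \<and> upd_range acc cc m m' \<and> frame ?X r r' \<and>
    (\<exists>v' u'. r' 22 = addr v' \<and> v' \<in> F \<and> r' 20 \<le> length v' \<and> length v' < 2 ^ w \<and> rep m' acc u' \<and> u' @ take (r' 20) v' = ?T \<and>
      (n::nat) = (if r' 20 = 0 then 0 else Suc (ht v'))))"
  have II: "I (r', m') n" if "good m'" "upd_range acc cc m m'" "frame ?X r r'" "r' 22 = addr v'" "v' \<in> F" "r' 20 \<le> length v'"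
    "length v' < 2 ^ w" "rep m' acc u'" "u' @ take (r' 20) v' = ?T" "n = (if r' 20 = 0 then 0 else Suc (ht v'))" for r' m' n v' u'
    unfolding I_def using that by blast
  let ?n0 = "if r 20 = 0 then 0 else Suc (ht v)"
  have "tc w (While (Less 35 20) (blk desc_body)) (r, m) (Suc (?n0 * Suc kdesc)) (\<lambda>(r', m').
    good m' \<and> upd_range acc cc m m' \<and> rep m' acc ?T \<and> frame ?X r r')"
  proof (rule tc_While[where I = I])
    show "I (r, m) ?n0" by (rule II[of _ _ v u]) (use assms in auto)
  next
    fix s n assume I: "I s n" and c: "cmp_val (Less 35 20) (fst s)"
    obtain r1 m1 where s: "s = (r1, m1)" by (cases s)
    obtain v' u' where i: "r1 22 = addr v'" "v' \<in> F" "r1 20 \<le> length v'" "length v' < 2 ^ w" "rep m1 acc u'"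
      "u' @ take (r1 20) v' = ?T" "n = (if r1 20 = 0 then 0 else Suc (ht v'))"
      and g: "good m1" and up: "upd_range acc cc m m1" and fr: "frame ?X r r1"
      using I unfolding I_def s by auto
    have R1: "regs r1" using regs_frame[OF assms(2) fr] by simp
    note rr = R1[unfolded regs_def regs_ok_def]
    have k0: "0 < r1 20" using c rr by (simp add: s)
    have n: "n = Suc (ht v')" using i(7) k0 by simp
    have len: "length m1 = L" using g by (simp add: good_def)
    have wb: "y mod 2 ^ w = y" if "y < L" for y using that layout(7) by simp
    note nd = node_good[OF g i(2)]
    let ?r2 = "r1(23 := length v')"
    have R2: "regs ?r2" using R1 by (auto simp: regs_def regs_ok_def)
    have a34: "r1 34 = acc" using frameD[OF fr, of 34] acc(3) by simp
    show "tc w (blk desc_body) s kdesc (\<lambda>s'. \<exists>n'. I s' n' \<and> n' < n)"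
    proof -
      have "tc w (blk [Cond (LessEq 23 20)
       (blk ([Op Add 31 34 35, Op Add 32 22 35, Op Add 33 34 35] @ hcat @ [Op Sub 20 20 23]))
       (blk [Op Add 26 22 2, Load 26 26, Load 27 26, Cond (LessEq 27 20)
         (blk ([Op Add 31 34 35, Op Add 32 26 35, Op Add 33 34 35] @ hcat @
            [Op Sub 20 20 27, Const 26 2, Op Add 26 22 26, Load 22 26]))
         (blk [Op Add 22 26 35])])]) (?r2, m1) (khcat + 13) (\<lambda>s'. \<exists>n'. I s' n' \<and> n' < n)"
      proof (rule tc_Cond)
        assume "cmp_val (LessEq 23 20) (fst (?r2, m1))"
        then have eq: "r1 20 = length v'" using i(3) by simp
        have "tc w (blk ([Op Add 31 34 35, Op Add 32 22 35, Op Add 33 34 35] @ hcat @ [Op Sub 20 20 23])) (?r2, m1) (1 + khcat + 3)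
          (\<lambda>s'. \<exists>n'. I s' n' \<and> n' < n)"
        proof (rule tc_hcat_acc[OF g R2 acc(1,2) _ i(5) i(2)])
          show "?r2 34 = acc" using a34 by simp
          show "?r2 22 = addr v' \<and> 22 = 22 \<or> ?r2 26 = addr v' \<and> 22 = 26" using i(1) by simp
          fix r' m' assume a: "good m'" "upd_range acc cc m1 m'" "rep m' acc (u' @ v')" "frame {31, 32, 33} ?r2 r'"
          have rv: "r' 20 = length v'" "r' 23 = length v'" "r' 22 = addr v'"
            using frameD[OF a(4), of 20] frameD[OF a(4), of 23] frameD[OF a(4), of 22] eq i(1) by auto
          have sb: "(length v' + (2 ^ w - length v')) mod 2 ^ w = 0" using sub_w[of "length v'" "length v'"] i(4) by simp
          have "I (r'(20 := 0), m') 0"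
          proof (rule II[OF a(1) upd_range_trans[OF up a(2)] _ _ i(2) _ i(4) a(3)])
            show "frame ?X r (r'(20 := 0))" using fr a(4) by (auto simp: frame_def)
            show "(u' @ v') @ take ((r'(20 := 0)) 20) v' = ?T" using i(6) eq by simp
          qed (use rv in auto)
          then show "tc w (blk [Op Sub 20 20 23]) (r', m') 1 (\<lambda>s'. \<exists>n'. I s' n' \<and> n' < n)"
            using rv sb n by auto
        qed
        then show "tc w (blk (([Op Add 31 34 35, Op Add 32 22 35, Op Add 33 34 35] @ hcat @ [Op Sub 20 20 23]) @ [])) (?r2, m1)
          (khcat + 13 - 1) (\<lambda>s'. \<exists>n'. I s' n' \<and> n' < n)" by (auto intro: tc_mono)
      next
        assume "\<not> cmp_val (LessEq 23 20) (fst (?r2, m1))"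
        then have lt: "r1 20 < length v'" by simp
        then have l2: "2 \<le> length v'" using k0 by linarith
        obtain x y where xy: "x \<in> F" "y \<in> F" "v' = x @ y" "m1 ! (addr v' + 1) = addr x" "m1 ! (addr v' + 2) = addr y"
          "ht x < ht v'" "ht y < ht v'" using children_good[OF g i(2) l2] by blast
        note ndx = node_good[OF g xy(1)]
        let ?r3 = "r1(23 := length v', 26 := addr x, 27 := length x)"
        have R3: "regs ?r3" using R1 by (auto simp: regs_def regs_ok_def)
        have lw: "length x < 2 ^ w" "length y < 2 ^ w" using i(4) xy(3) by auto
        have c2: "tc w (blk [Cond (LessEq 27 20)
           (blk ([Op Add 31 34 35, Op Add 32 26 35, Op Add 33 34 35] @ hcat @
              [Op Sub 20 20 27, Const 26 2, Op Add 26 22 26, Load 22 26]))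
           (blk [Op Add 22 26 35])]) (?r3, m1) (khcat + 9) (\<lambda>s'. \<exists>n'. I s' n' \<and> n' < n)"
        proof (rule tc_Cond)
          assume "cmp_val (LessEq 27 20) (fst (?r3, m1))"
          then have le: "length x \<le> r1 20" by simp
          have "tc w (blk ([Op Add 31 34 35, Op Add 32 26 35, Op Add 33 34 35] @ hcat @
              [Op Sub 20 20 27, Const 26 2, Op Add 26 22 26, Load 22 26])) (?r3, m1) (4 + khcat + 3)
            (\<lambda>s'. \<exists>n'. I s' n' \<and> n' < n)"
          proof (rule tc_hcat_acc[OF g R3 acc(1,2) _ i(5) xy(1)])
            show "?r3 34 = acc" using a34 by simp
            show "?r3 22 = addr x \<and> 26 = 22 \<or> ?r3 26 = addr x \<and> 26 = 26" by simp
            fix r' m' assume a: "good m'" "upd_range acc cc m1 m'" "rep m' acc (u' @ x)" "frame {31, 32, 33} ?r3 r'"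
            have rv: "r' 20 = r1 20" "r' 27 = length x" "r' 22 = addr v'"
              using frameD[OF a(4), of 20] frameD[OF a(4), of 27] frameD[OF a(4), of 22] i(1) by auto
            have "r1 20 < 2 ^ w" using i(3,4) by linarith
            then have sb: "(r1 20 + (2 ^ w - length x)) mod 2 ^ w = r1 20 - length x" using sub_w[OF le] by simp
            have vM: "addr v' + 2 < length M0" using node[OF i(2)] by simp
            have my: "m' ! (addr v' + 2) = addr y"
              using a(1) g vM xy(5) by (simp add: good_def)
            have len': "length m' = L" using a(1) by (simp add: good_def)
            let ?r4 = "r'(20 := r1 20 - length x, 26 := addr v' + 2, 22 := addr y)"
            have "I (?r4, m') (if r1 20 - length x = 0 then 0 else Suc (ht y))"
            proof (rule II[OF a(1) upd_range_trans[OF up a(2)] _ _ xy(2) _ lw(2) a(3)])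
              show "frame ?X r ?r4" using fr a(4) by (auto simp: frame_def)
              show "(u' @ x) @ take (?r4 20) y = ?T" using i(6) le xy(3) by simp
            qed (use lt xy(3) in auto)
            moreover have "(if r1 20 - length x = 0 then 0 else Suc (ht y)) < n" using n xy(7) by auto
            ultimately have "\<exists>n'. I (?r4, m') n' \<and> n' < n" by blast
            then show "tc w (blk [Op Sub 20 20 27, Const 26 2, Op Add 26 22 26, Load 22 26]) (r', m') 4 (\<lambda>s'. \<exists>n'. I s' n' \<and> n' < n)"
              using rv sb my len' vM LM0 two_w wb[of "addr v' + 2"] by (simp add: tc_Load fun_upd_twist)
          qed
          then show "tc w (blk (([Op Add 31 34 35, Op Add 32 26 35, Op Add 33 34 35] @ hcat @
              [Op Sub 20 20 27, Const 26 2, Op Add 26 22 26, Load 22 26]) @ [])) (?r3, m1) (khcat + 9 - 1)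
            (\<lambda>s'. \<exists>n'. I s' n' \<and> n' < n)" by (auto intro: tc_mono)
        next
          assume "\<not> cmp_val (LessEq 27 20) (fst (?r3, m1))"
          then have lx: "r1 20 < length x" by simp
          let ?r4 = "?r3(22 := addr x)"
          have "I (?r4, m1) (Suc (ht x))"
          proof (rule II[OF g up _ _ xy(1) _ lw(1) i(5)])
            show "frame ?X r ?r4" using fr by (auto simp: frame_def)
            show "u' @ take (?r4 20) x = ?T" using i(6) lx xy(3) by simp
          qed (use lx k0 in auto)
          then have "\<exists>n'. I (?r4, m1) n' \<and> n' < n" using n xy(6) by auto
          then show "tc w (blk ([Op Add 22 26 35] @ [])) (?r3, m1) (khcat + 9 - 1) (\<lambda>s'. \<exists>n'. I s' n' \<and> n' < n)"
            using rr wb[of "addr x"] ndx(3) by simp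
        qed simp
        have "Suc (addr v') < L" "addr x < L" using nd(3) ndx(3) by auto
        then show "tc w (blk ([Op Add 26 22 2, Load 26 26, Load 27 26, Cond (LessEq 27 20)
           (blk ([Op Add 31 34 35, Op Add 32 26 35, Op Add 33 34 35] @ hcat @
              [Op Sub 20 20 27, Const 26 2, Op Add 26 22 26, Load 22 26]))
           (blk [Op Add 22 26 35])] @ [])) (?r2, m1) (khcat + 13 - 1) (\<lambda>s'. \<exists>n'. I s' n' \<and> n' < n)"
          using c2 rr i(1) len xy(4) ndx(1) wb[of "Suc (addr v')"] by (simp add: tc_Load add.commute)
      qed simp
      then show ?thesis unfolding s desc_body_def kdesc_def
        using i(1) nd(1,3) len by (simp add: tc_Load add.commute) (auto elim: tc_mono)
    qed
  next
    fix s n assume I: "I s n" and c: "\<not> cmp_val (Less 35 20) (fst s)"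
    obtain r1 m1 where s: "s = (r1, m1)" by (cases s)
    have "regs r1" using regs_frame[OF assms(2)] I unfolding I_def s by auto
    then have "r1 35 = 0" by (simp add: regs_def regs_ok_def)
    then have "r1 20 = 0" using c by (simp add: s)
    then show "case s of (r', m') \<Rightarrow> good m' \<and> upd_range acc cc m m' \<and> rep m' acc ?T \<and> frame ?X r r'"
      using I unfolding I_def s by auto
  qed
  then show ?thesis by (rule tc_mono) auto
qed

definition ktest :: nat where "ktest = kdesc + 4 * cc + 30"

text \<open>\<open>bl cap\<close> accounts for the binary search among the items and
  \<open>h\<close> for the descent in one of them; prefixes ending at item boundaries have their
  hashes stored.\<close>

lemma tc_test:
  assumes g: "good m" and R: "regs r" and base: "ok_base base" "r 15 = base" and it: "items m base its"
    and n: "r 16 = length its" "0 < length its" "length its \<le> cap" and x: "r 19 \<le> length (concat its)"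
    and acc: "aA \<le> acc" "acc + cc < L" "r 34 = acc" and h: "\<And>v. v \<in> set its \<Longrightarrow> ht v \<le> h"
    and lw: "length (concat its) < 2 ^ w"
  shows "tc w (blk (locate @ desc)) (r, m) (ktest * (bl cap + h + 2)) (\<lambda>(r', m').
    good m' \<and> upd_range acc cc m m' \<and> rep m' acc (take (r 19) (concat its)) \<and>
    frame {20, 22, 23, 26, 27, 28, 29, 30, 31, 32, 33} r r')"
proof -
  let ?X = "{20, 22, 23, 26, 27, 28, 29, 30, 31, 32, 33}"
  let ?Q = "\<lambda>(r', m'). good m' \<and> upd_range acc cc m m' \<and> rep m' acc (take (r 19) (concat its)) \<and> frame ?X r r'"
  have len: "length m = L" using g by (simp add: good_def)
  note rr = R[unfolded regs_def regs_ok_def]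
  have wb: "y mod 2 ^ w = y" if "y < L" for y using that layout(7) by simp
  have D: "tc w (blk desc) (r1, m) (8 + 4 * cc + Suc (Suc h * Suc kdesc)) ?Q"
    if r1: "frame {26, 27, 28, 29, 30, 31} r r1" "r1 28 < length its" "length (concat (take (r1 28) its)) \<le> r 19"
      "r 19 \<le> length (concat (take (Suc (r1 28)) its))" for r1
  proof -
    define i where "i = r1 28"
    have i: "i < length its" "length (concat (take i its)) \<le> r 19" "r 19 \<le> length (concat (take (Suc i) its))"
      using r1 by (auto simp: i_def)
    define e where "e = length (concat (take i its))"
    define v where "v = its ! i"
    define a where "a = base + i * rs"
    have vi: "v \<in> set its" using i by (simp add: v_def)
    have vF: "v \<in> F" using vi it by (auto simp: items_def)
    have ts: "concat (take (Suc i) its) = concat (take i its) @ v" using i by (simp add: v_def take_Suc_conv_app_nth)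
    have rem: "r 19 - e \<le> length v" "e \<le> r 19" using i ts by (auto simp: e_def)
    have aL: "a + 2 * rs \<le> aA" using item_addr[OF base(1), of i] i n by (simp add: a_def)
    have ma: "m ! a = e" "m ! Suc a = addr v" "rep m (Suc (Suc a)) (concat (take i its))"
      using it i unfolding items_def a_def e_def v_def by auto
    have rf: "r1 15 = base" "r1 19 = r 19" "r1 34 = acc" "r1 2 = 1" "r1 35 = 0" "r1 36 = rs"
      using frameD[OF r1(1), of 15] frameD[OF r1(1), of 19] frameD[OF r1(1), of 34] frameD[OF r1(1), of 2]
        frameD[OF r1(1), of 35] frameD[OF r1(1), of 36] rr base acc by auto
    let ?r2 = "r1(26 := Suc a, 27 := e, 20 := r 19 - e, 22 := addr v, 61 := Suc (Suc a), 62 := acc)"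
    have 1: "tc w (blk [Op Mult 26 28 36, Op Add 26 26 15, Load 27 26, Op Sub 20 19 27, Op Add 26 26 2, Load 22 26,
       Op Add 61 26 2, Op Add 62 34 35]) (r1, m) 8 (\<lambda>s. s = (?r2, m))"
    proof -
      have "i * rs \<le> a" by (simp add: a_def)
      then have "i * rs mod 2 ^ w = i * rs" "(i * rs + base) mod 2 ^ w = a" "Suc a mod 2 ^ w = Suc a"
        "Suc (Suc a) mod 2 ^ w = Suc (Suc a)" "acc mod 2 ^ w = acc"
        using wb[of "i * rs"] wb[of a] wb[of "Suc a"] wb[of "Suc (Suc a)"] wb[of acc] aL aA_L acc rs_cc
        by (auto simp: a_def add.commute)
      moreover have "(r 19 + (2 ^ w - e)) mod 2 ^ w = r 19 - e" using sub_w[OF rem(2)] x lw by simp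
      moreover have "Suc a < L" "a < L" using aL aA_L rs_cc by auto
      ultimately show ?thesis using rf ma len by (simp add: tc_Load i_def[symmetric] fun_upd_twist)
    qed
    have 2: "tc w (blk (copyd cc)) (?r2, m) (4 * cc) (\<lambda>(r', m'). upd_range (?r2 62) cc m m' \<and>
      seg m' (?r2 62) cc = seg m (?r2 61) cc \<and> (\<forall>x < 50. r' x = ?r2 x))"
      using rf aL aA_L acc len layout(7) rs_cc by (intro tc_copyd) auto
    show ?thesis unfolding desc_def
    proof (rule tc_append[OF 1])
      fix s1 assume s1: "s1 = (?r2, m)"
      show "tc w (blk (copyd cc @ [While (Less 35 20) (blk desc_body)])) s1 (4 * cc + Suc (Suc h * Suc kdesc)) ?Q" unfolding s1
      proof (rule tc_append[OF 2])
        fix s2 assume "case s2 of (r', m') \<Rightarrow> upd_range (?r2 62) cc m m' \<and>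
          seg m' (?r2 62) cc = seg m (?r2 61) cc \<and> (\<forall>x < 50. r' x = ?r2 x)"
        then obtain r3 m3 where s2: "s2 = (r3, m3)" "upd_range acc cc m m3" "seg m3 acc cc = seg m (Suc (Suc a)) cc"
          "\<forall>x < 50. r3 x = ?r2 x" by (cases s2) auto
        have rp: "rep m3 acc (concat (take i its))"
          using ma(3) s2(2,3) acc len by (auto simp: rep_def num_def upd_range_def)
        have g3: "good m3" using good_upd_num[OF g s2(2)] rp acc layout by (simp add: rep_def)
        have e3: "r3 x = ?r2 x" if "x < 50" for x using s2(4) that by simp
        have f3: "frame ?X r r3" using r1(1) by (auto simp: frame_def e3)
        have R3: "regs r3" using regs_frame[OF R f3] by simp
        have "length v \<le> length (concat its)" using vi by (simp add: length_concat member_le_sum_list)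
        then have vw: "length v < 2 ^ w" using lw by linarith
        have 3: "tc w (While (Less 35 20) (blk desc_body)) (r3, m3) (Suc (Suc (ht v) * Suc kdesc)) (\<lambda>(r', m').
          good m' \<and> upd_range acc cc m3 m' \<and> rep m' acc (concat (take i its) @ take (r3 20) v) \<and>
          frame {20, 22, 23, 26, 27, 31, 32, 33} r3 r')"
          by (rule tc_desc_loop[OF g3 R3 acc(1,2) _ rp vF]) (use rem vw rf in \<open>auto simp: e3\<close>)
        have tk: "concat (take i its) @ take (r 19 - e) v = take (r 19) (concat its)"
        proof -
          have "concat its = concat (take (Suc i) its) @ concat (drop (Suc i) its)"
            by (metis append_take_drop_id concat_append)
          then show ?thesis using ts rem by (simp add: e_def)
        qed
        have "tc w (blk [While (Less 35 20) (blk desc_body)]) (r3, m3) (Suc (Suc (ht v) * Suc kdesc)) ?Q"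
        proof (rule tc_Cons[OF 3, where ?T2.0 = 0])
          fix s4 assume "case s4 of (r', m') \<Rightarrow>
            good m' \<and> upd_range acc cc m3 m' \<and> rep m' acc (concat (take i its) @ take (r3 20) v) \<and>
            frame {20, 22, 23, 26, 27, 31, 32, 33} r3 r'"
          moreover have "r3 20 = r 19 - e" by (simp add: e3)
          ultimately obtain r4 m4 where s4: "s4 = (r4, m4)" "good m4" "upd_range acc cc m3 m4"
            "rep m4 acc (take (r 19) (concat its))" "frame {20, 22, 23, 26, 27, 31, 32, 33} r3 r4"
            using tk by (cases s4) auto
          have "frame ?X r r4" using f3 s4(5) by (auto simp: frame_def)
          then show "tc w (blk []) s4 0 ?Q" using s4 upd_range_trans[OF s2(2) s4(3)] by simp
        qed simp
        moreover have "Suc (Suc (ht v) * Suc kdesc) \<le> Suc (Suc h * Suc kdesc)" using h[OF vi] mult_le_mono1[of "Suc (ht v)" "Suc h" "Suc kdesc"] by (simp only: Suc_le_mono)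
        ultimately show "tc w (blk [While (Less 35 20) (blk desc_body)]) s2 (Suc (Suc h * Suc kdesc)) ?Q"
          unfolding s2(1) by (rule tc_mono)
      qed simp
    qed simp
  qed
  show ?thesis
  proof (rule tc_append[OF tc_locate[OF g R base it n x]])
    fix s' assume "case s' of (r', m') \<Rightarrow> m' = m \<and> frame {26, 27, 28, 29, 30, 31} r r' \<and>
      r' 28 < length its \<and> length (concat (take (r' 28) its)) \<le> r 19 \<and> r 19 \<le> length (concat (take (Suc (r' 28)) its))"
    then show "tc w (blk desc) s' (8 + 4 * cc + Suc (Suc h * Suc kdesc)) ?Q" using D by (cases s') auto
  next
    have k: "kdesc + 4 * cc + 30 = ktest" by (simp add: ktest_def)
    have "10 * bl cap \<le> ktest * bl cap" "Suc h * Suc kdesc \<le> Suc h * ktest"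
      by (intro mult_le_mono1 mult_le_mono2, simp add: ktest_def)+
    moreover have "13 + 4 * cc \<le> ktest" by (simp add: ktest_def)
    moreover have "ktest * (bl cap + h + 2) = ktest * bl cap + Suc h * ktest + ktest" by (simp add: algebra_simps)
    ultimately show "10 * bl cap + 4 + (8 + 4 * cc + Suc (Suc h * Suc kdesc)) \<le> ktest * (bl cap + h + 2)" by linarith
  qed
qed

end

definition eqt :: "prog list" where
  "eqt = [Op Add 15 38 35, Op Add 16 17 35, Op Add 34 40 35] @ (locate @ desc) @
     [Op Add 15 39 35, Op Add 16 18 35, Op Add 34 41 35] @ (locate @ desc) @
     [Op Add 31 40 35, Op Add 33 40 35] @ norm_hash @ [Op Add 31 41 35, Op Add 33 41 35] @ norm_hash @
     [Const 58 1, Op Add 61 40 35, Op Add 62 41 35] @ eqs cc @ [Op Add 10 58 35]"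

context lce_structure begin

definition keqt :: nat where "keqt = 2 * ktest + 2 * khcat + 6 * cc + 20"

lemma items_upd: "items m base its \<Longrightarrow> ok_base base \<Longrightarrow> length its \<le> cap \<Longrightarrow> upd_range a n m m' \<Longrightarrow> aA \<le> a \<Longrightarrow> items m' base its"
proof -
  assume *: "items m base its" "ok_base base" "length its \<le> cap" "upd_range a n m m'" "aA \<le> a"
  have le: "Suc (length its) * rs \<le> (cap + 2) * rs" using *(3) by (intro mult_le_mono1) simp
  show ?thesis
  proof (rule items_cong[OF *(1)])
    show "length m' = length m" using *(4) by (simp add: upd_range_def)
    fix x assume "base \<le> x" "x < base + Suc (length its) * rs"
    then have "x < a" using le *(2,5) unfolding ok_base_def by linarith
    then show "m' ! x = m ! x" using *(4) by (simp add: upd_range_def)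
  qed
qed

lemma ok_iA: "ok_base iA" and ok_iB: "ok_base iB"
  using layout by (auto simp: ok_base_def)

text \<open>Since {1..P} is a complete system of residues, congruent normalized values are equal
  numbers and hence have equal digits.\<close>

lemma norm_eq:
  assumes "num m a" "num m a'" "nval m a \<in> {1..P}" "nval m a' \<in> {1..P}"
    "nval m a * \<beta> ^ cc mod P = x mod P" "nval m a' * \<beta> ^ cc mod P = y mod P"
  shows "seg m a cc = seg m a' cc \<longleftrightarrow> x mod P = y mod P"
proof
  assume "seg m a cc = seg m a' cc"
  then show "x mod P = y mod P" using assms(5,6) by simp
next
  assume "x mod P = y mod P"
  then have "nval m a * \<beta> ^ cc mod P = nval m a' * \<beta> ^ cc mod P" using assms(5,6) by (simp only:)
  from cancel_beta[OF this] have "nval m a mod P = nval m a' mod P" .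
  then have "nval m a = nval m a'" using assms(3,4) P1 by (cases "nval m a = P"; cases "nval m a' = P") auto
  then show "seg m a cc = seg m a' cc" using assms(1,2) by (intro dval_inj) (auto simp: num_def)
qed

lemma tc_norm:
  assumes g: "good m" and R: "regs r" and acc: "acc = aA \<and> k = 40 \<or> acc = aB \<and> k = 41" and u: "rep m acc u"
    and Q: "\<And>r' m'. good m' \<Longrightarrow> upd_range acc cc m m' \<Longrightarrow> num m' acc \<Longrightarrow> nval m' acc \<in> {1..P} \<Longrightarrow>
      nval m' acc * \<beta> ^ cc mod P = hash c b u mod P \<Longrightarrow> frame {31, 33} r r' \<Longrightarrow> tc w (blk ps) (r', m') T Q"
  shows "tc w (blk ([Op Add 31 k 35, Op Add 33 k 35] @ norm_hash @ ps)) (r, m) (T + khcat + 2) Q"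
proof -
  have len: "length m = L" using g by (simp add: good_def)
  note rr = R[unfolded regs_def regs_ok_def]
  have wb: "y mod 2 ^ w = y" if "y < L" for y using that layout(7) by simp
  have ac: "aA \<le> acc" "acc + cc < L" using acc layout by auto
  let ?r1 = "r(31 := acc, 33 := acc)"
  have R1: "regs ?r1" using R by (auto simp: regs_def regs_ok_def)
  have 1: "tc w (blk [Op Add 31 k 35, Op Add 33 k 35]) (r, m) 2 (\<lambda>s. s = (?r1, m))"
    using rr acc wb[of acc] ac(2) by auto
  have 2: "tc w (blk norm_hash) (?r1, m) khcat (\<lambda>(r', m'). num m' (?r1 33) \<and>
    nval m' (?r1 33) \<in> {1..P} \<and> nval m' (?r1 33) * \<beta> ^ cc mod P = hash c b u mod P \<and> upd_range (?r1 33) cc m m' \<and>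
    (\<forall>x < 50. r' x = ?r1 x))"
    by (rule tc_norm_hash) (use R1 good_mem_ok[OF g] u ac len in \<open>auto simp: regs_def\<close>)
  show ?thesis
  proof (rule tc_append[OF 1])
    fix s1 assume s1: "s1 = (?r1, m)"
    show "tc w (blk (norm_hash @ ps)) s1 (khcat + T) Q" unfolding s1
    proof (rule tc_append[OF 2])
      fix s2 assume "case s2 of (r', m') \<Rightarrow> num m' (?r1 33) \<and>
        nval m' (?r1 33) \<in> {1..P} \<and> nval m' (?r1 33) * \<beta> ^ cc mod P = hash c b u mod P \<and> upd_range (?r1 33) cc m m' \<and>
        (\<forall>x < 50. r' x = ?r1 x)"
      then obtain r2 m2 where s2: "s2 = (r2, m2)" "num m2 acc" "nval m2 acc \<in> {1..P}"
        "nval m2 acc * \<beta> ^ cc mod P = hash c b u mod P" "upd_range acc cc m m2" "\<forall>x < 50. r2 x = ?r1 x" by (cases s2) auto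
      have "good m2" using good_upd_num[OF g s2(5,2)] ac layout by simp
      moreover have "frame {31, 33} r r2" using s2(6) by (auto simp: frame_def)
      ultimately show "tc w (blk ps) s2 T Q" unfolding s2(1) using s2 by (intro Q)
    qed simp
  qed simp
qed

lemma tc_eqt:
  assumes g: "good m" and R: "regs r" and it: "items m iA as" "items m iB bs"
    and n: "r 17 = length as" "0 < length as" "length as \<le> cap" "r 18 = length bs" "0 < length bs" "length bs \<le> cap"
    and x: "r 19 \<le> length (concat as)" "r 19 \<le> length (concat bs)"
    and h: "\<And>v. v \<in> set as \<union> set bs \<Longrightarrow> ht v \<le> h"
    and lw: "length (concat as) < 2 ^ w" "length (concat bs) < 2 ^ w"
  shows "tc w (blk eqt) (r, m) (keqt * (bl cap + h + 2)) (\<lambda>(r', m').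
    good m' \<and> items m' iA as \<and> items m' iB bs \<and>
    r' 10 = (if hash c b (take (r 19) (concat as)) mod P = hash c b (take (r 19) (concat bs)) mod P then 1 else 0) \<and>
    frame {10, 15, 16, 20, 22, 23, 26, 27, 28, 29, 30, 31, 32, 33, 34} r r')"
proof -
  let ?X = "{10, 15, 16, 20, 22, 23, 26, 27, 28, 29, 30, 31, 32, 33, 34}"
  let ?Y = "{20, 22, 23, 26, 27, 28, 29, 30, 31, 32, 33}"
  let ?u = "take (r 19) (concat as)" and ?v = "take (r 19) (concat bs)"
  let ?Q = "\<lambda>(r', m'). good m' \<and> items m' iA as \<and> items m' iB bs \<and>
    r' 10 = (if hash c b ?u mod P = hash c b ?v mod P then 1 else 0) \<and> frame ?X r r'"
  let ?K = "bl cap + h + 2"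
  have wb: "y mod 2 ^ w = y" if "y < L" for y using that layout(7) by simp
  have capL: "cap < L" "iA < L" "iB < L" "aA + cc < L" "aB + cc < L" "aA + cc < aB" using layout by auto
  have fin: "tc w (blk ([Const 58 1, Op Add 61 40 35, Op Add 62 41 35] @ eqs cc @ [Op Add 10 58 35])) (r5, m5) (6 * cc + 4) ?Q"
    if "good m5" "items m5 iA as" "items m5 iB bs" "frame ?X r r5" "num m5 aA" "num m5 aB" "nval m5 aA \<in> {1..P}" "nval m5 aB \<in> {1..P}"
      "nval m5 aA * \<beta> ^ cc mod P = hash c b ?u mod P" "nval m5 aB * \<beta> ^ cc mod P = hash c b ?v mod P" for r5 m5
  proof -
    have R5: "regs r5" using regs_frame[OF R that(4)] by simp
    note rr = R5[unfolded regs_def regs_ok_def]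
    have len: "length m5 = L" using that(1) by (simp add: good_def)
    let ?r6 = "r5(58 := 1, 61 := aA, 62 := aB)"
    have 1: "tc w (blk [Const 58 1, Op Add 61 40 35, Op Add 62 41 35]) (r5, m5) 3 (\<lambda>s. s = (?r6, m5))"
      using rr wb[of aA] wb[of aB] capL one_w by simp
    have 2: "tc w (blk (eqs cc)) (?r6, m5) (6 * cc) (\<lambda>(r', m'). m' = m5 \<and>
      r' 58 = (if seg m5 (?r6 61) cc = seg m5 (?r6 62) cc then ?r6 58 else 0) \<and> same_except {58..62} ?r6 r')"
      by (rule tc_eqs) (use rr len capL layout(7) in auto)
    show ?thesis
    proof (rule tc_append[OF 1])
      fix s1 assume s1: "s1 = (?r6, m5)"
      show "tc w (blk (eqs cc @ [Op Add 10 58 35])) s1 (6 * cc + 1) ?Q" unfolding s1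
      proof (rule tc_append[OF 2])
        fix s2 assume "case s2 of (r', m') \<Rightarrow> m' = m5 \<and>
          r' 58 = (if seg m5 (?r6 61) cc = seg m5 (?r6 62) cc then ?r6 58 else 0) \<and> same_except {58..62} ?r6 r'"
        then obtain r7 where r7: "s2 = (r7, m5)" "r7 58 = (if seg m5 aA cc = seg m5 aB cc then 1 else 0)"
          "same_except {58..62} ?r6 r7" by (cases s2) auto
        have e7: "r7 x = r5 x" if "x < 50" for x using same_exceptD[OF r7(3), of x] that by simp
        have v: "r7 58 = (if hash c b ?u mod P = hash c b ?v mod P then 1 else 0)"
          unfolding r7(2) using norm_eq[OF that(5-10)] by simp
        have "r7 58 mod 2 ^ w = r7 58" unfolding r7(2) using one_w by simp
        moreover have "frame ?X r (r7(10 := r7 58))" using that(4) by (auto simp: frame_def e7)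
        ultimately show "tc w (blk [Op Add 10 58 35]) s2 1 ?Q"
          unfolding r7(1) using rr v that(1-3) by (simp add: e7)
      qed simp
    qed simp
  qed
  let ?p4 = "[Const 58 1, Op Add 61 40 35, Op Add 62 41 35] @ eqs cc @ [Op Add 10 58 35]"
  let ?p3 = "[Op Add 31 40 35, Op Add 33 40 35] @ norm_hash @ [Op Add 31 41 35, Op Add 33 41 35] @ norm_hash @ ?p4"
  have norms: "tc w (blk ?p3) (r3, m3) (6 * cc + 4 + khcat + 2 + khcat + 2) ?Q"
    if a: "good m3" "items m3 iA as" "items m3 iB bs" "frame ?X r r3" "rep m3 aA ?u" "rep m3 aB ?v" for r3 m3
  proof (rule tc_norm[where acc = aA])
    show "good m3" "rep m3 aA ?u" "aA = aA \<and> (40::nat) = 40 \<or> aA = aB \<and> (40::nat) = 41" using a by auto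
    show "regs r3" using regs_frame[OF R a(4)] by simp
    fix r4 m4 assume b1: "good m4" "upd_range aA cc m3 m4" "num m4 aA" "nval m4 aA \<in> {1..P}"
      "nval m4 aA * \<beta> ^ cc mod P = hash c b ?u mod P" "frame {31, 33} r3 r4"
    have f4: "frame ?X r r4" using a(4) b1(6) by (auto simp: frame_def)
    show "tc w (blk ([Op Add 31 41 35, Op Add 33 41 35] @ norm_hash @ ?p4)) (r4, m4) (6 * cc + 4 + khcat + 2) ?Q"
    proof (rule tc_norm[where acc = aB])
      show "good m4" "aB = aA \<and> (41::nat) = 40 \<or> aB = aB \<and> (41::nat) = 41" using b1 by auto
      show "regs r4" using regs_frame[OF R f4] by simp
      show "rep m4 aB ?v" by (rule rep_cong[OF a(6)]) (use b1(2) capL in \<open>auto simp: upd_range_def\<close>)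
      fix r5 m5 assume b2: "good m5" "upd_range aB cc m4 m5" "num m5 aB" "nval m5 aB \<in> {1..P}"
        "nval m5 aB * \<beta> ^ cc mod P = hash c b ?v mod P" "frame {31, 33} r4 r5"
      have f5: "frame ?X r r5" using f4 b2(6) by (auto simp: frame_def)
      have nA: "num m5 aA" "nval m5 aA = nval m4 aA" using num_upd[OF b1(3) b2(2)] capL by auto
      have "items m4 iA as" "items m4 iB bs"
        using items_upd[OF a(2) ok_iA n(3) b1(2)] items_upd[OF a(3) ok_iB n(6) b1(2)] by auto
      then have "items m5 iA as" "items m5 iB bs"
        using items_upd[OF _ ok_iA n(3) b2(2)] items_upd[OF _ ok_iB n(6) b2(2)] capL by auto
      then show "tc w (blk ?p4) (r5, m5) (6 * cc + 4) ?Q"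
        using fin[OF b2(1) _ _ f5 nA(1) b2(3) _ b2(4)] nA(2) b1(4,5) b2(5) by simp
    qed
  qed
  let ?p2 = "[Op Add 15 39 35, Op Add 16 18 35, Op Add 34 41 35] @ (locate @ desc) @ ?p3"
  have second: "tc w (blk ?p2) (r2, m2) (3 + (ktest * ?K + (6 * cc + 4 + khcat + 2 + khcat + 2))) ?Q"
    if a: "good m2" "items m2 iA as" "items m2 iB bs" "frame ?X r r2" "rep m2 aA ?u" for r2 m2
  proof -
    have R2: "regs r2" using regs_frame[OF R a(4)] by simp
    note rr = R2[unfolded regs_def regs_ok_def]
    have rv: "r2 18 = length bs" "r2 19 = r 19" using frameD[OF a(4), of 18] frameD[OF a(4), of 19] n by auto
    let ?r3 = "r2(15 := iB, 16 := length bs, 34 := aB)"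
    have R3: "regs ?r3" using R2 by (auto simp: regs_def regs_ok_def)
    have 1: "tc w (blk [Op Add 15 39 35, Op Add 16 18 35, Op Add 34 41 35]) (r2, m2) 3 (\<lambda>s. s = (?r3, m2))"
      using rr rv wb[of iB] wb[of aB] wb[of "length bs"] capL n by simp
    have 2: "tc w (blk (locate @ desc)) (?r3, m2) (ktest * ?K) (\<lambda>(r', m').
      good m' \<and> upd_range aB cc m2 m' \<and> rep m' aB (take (?r3 19) (concat bs)) \<and> frame ?Y ?r3 r')"
      by (rule tc_test[OF a(1) R3 ok_iB _ a(3)]) (use n x h lw capL rv layout in auto)
    show ?thesis
    proof (rule tc_append[OF 1])
      fix s1 assume s1: "s1 = (?r3, m2)"
      show "tc w (blk ((locate @ desc) @ ?p3)) s1 (ktest * ?K + (6 * cc + 4 + khcat + 2 + khcat + 2)) ?Q" unfolding s1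
      proof (rule tc_append[OF 2])
        fix s2 assume "case s2 of (r', m') \<Rightarrow> good m' \<and> upd_range aB cc m2 m' \<and> rep m' aB (take (?r3 19) (concat bs)) \<and> frame ?Y ?r3 r'"
        then obtain r4 m4 where s2: "s2 = (r4, m4)" "good m4" "upd_range aB cc m2 m4" "rep m4 aB ?v" "frame ?Y ?r3 r4"
          using rv by (cases s2) auto
        have f: "frame ?X r r4" using a(4) s2(5) by (auto simp: frame_def)
        have "rep m4 aA ?u" by (rule rep_cong[OF a(5)]) (use s2(3) capL in \<open>auto simp: upd_range_def\<close>)
        moreover have "items m4 iA as" "items m4 iB bs"
          using items_upd[OF a(2) ok_iA n(3) s2(3)] items_upd[OF a(3) ok_iB n(6) s2(3)] capL by auto
        ultimately show "tc w (blk ?p3) s2 (6 * cc + 4 + khcat + 2 + khcat + 2) ?Q"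
          unfolding s2(1) using norms[OF s2(2) _ _ f _ s2(4)] by blast
      qed simp
    qed simp
  qed
  note rr = R[unfolded regs_def regs_ok_def]
  let ?r1 = "r(15 := iA, 16 := length as, 34 := aA)"
  have R1: "regs ?r1" using R by (auto simp: regs_def regs_ok_def)
  have 1: "tc w (blk [Op Add 15 38 35, Op Add 16 17 35, Op Add 34 40 35]) (r, m) 3 (\<lambda>s. s = (?r1, m))"
    using rr wb[of iA] wb[of aA] wb[of "length as"] capL n by simp
  have 2: "tc w (blk (locate @ desc)) (?r1, m) (ktest * ?K) (\<lambda>(r', m').
    good m' \<and> upd_range aA cc m m' \<and> rep m' aA (take (?r1 19) (concat as)) \<and> frame ?Y ?r1 r')"
    by (rule tc_test[OF g R1 ok_iA _ it(1)]) (use n x h lw capL in auto)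
  show ?thesis unfolding eqt_def
  proof (rule tc_append[OF 1])
    fix s1 assume s1: "s1 = (?r1, m)"
    show "tc w (blk ((locate @ desc) @ ?p2)) s1 (ktest * ?K + (3 + (ktest * ?K + (6 * cc + 4 + khcat + 2 + khcat + 2)))) ?Q" unfolding s1
    proof (rule tc_append[OF 2])
      fix s2 assume "case s2 of (r', m') \<Rightarrow> good m' \<and> upd_range aA cc m m' \<and> rep m' aA (take (?r1 19) (concat as)) \<and> frame ?Y ?r1 r'"
      then obtain r4 m4 where s2: "s2 = (r4, m4)" "good m4" "upd_range aA cc m m4" "rep m4 aA ?u" "frame ?Y ?r1 r4"
        by (cases s2) auto
      have f: "frame ?X r r4" using s2(5) by (auto simp: frame_def)
      have "items m4 iA as" "items m4 iB bs"
        using items_upd[OF it(1) ok_iA n(3) s2(3)] items_upd[OF it(2) ok_iB n(6) s2(3)] by auto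
      then show "tc w (blk ?p2) s2 (3 + (ktest * ?K + (6 * cc + 4 + khcat + 2 + khcat + 2))) ?Q"
        unfolding s2(1) using second[OF s2(2) _ _ f s2(4)] by blast
    qed simp
  next
    have "2 * khcat + 6 * cc + 20 \<le> (2 * khcat + 6 * cc + 20) * ?K" by simp
    moreover have "keqt * ?K = ktest * ?K + ktest * ?K + (2 * khcat + 6 * cc + 20) * ?K"
      by (simp add: keqt_def algebra_simps)
    ultimately show "3 + (ktest * ?K + (3 + (ktest * ?K + (6 * cc + 4 + khcat + 2 + khcat + 2)))) \<le> keqt * ?K" by linarith
  qed
qed

end

section \<open>The query\<close>

lemma take_eq_iff_lcp:
  assumes "d \<le> length xs" "d \<le> length ys"
  shows "take d xs = take d ys \<longleftrightarrow> d \<le> length (longest_common_prefix xs ys)"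
proof
  assume eq: "take d xs = take d ys"
  have "prefix (take d xs) xs" "prefix (take d xs) ys" by (rule take_is_prefix, subst eq, rule take_is_prefix)
  then have "prefix (take d xs) (longest_common_prefix xs ys)" by (rule longest_common_prefix_max_prefix)
  then show "d \<le> length (longest_common_prefix xs ys)" using assms prefix_length_le by fastforce
next
  assume d: "d \<le> length (longest_common_prefix xs ys)"
  obtain u v where "xs = longest_common_prefix xs ys @ u" "ys = longest_common_prefix xs ys @ v"
    using longest_common_prefix_prefix1[of xs ys] longest_common_prefix_prefix2[of xs ys] unfolding prefix_def by blast
  then have "take d xs = take d (longest_common_prefix xs ys)" "take d ys = take d (longest_common_prefix xs ys)"
    using d by (metis append_Nil2 diff_is_0_eq take0 take_append)+
  then show "take d xs = take d ys" by simp
qed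

lemma bl_mult: "bl (x * y) \<le> bl x + bl y"
proof -
  have "x * y < 2 ^ bl x * 2 ^ bl y" by (rule mult_strict_mono) (use bl_bound in auto)
  then show ?thesis by (simp add: bl_le_iff power_add)
qed

lemma bl_self: "bl n \<le> n"
  by (simp add: bl_le_iff)

lemma bl_power2 [simp]: "bl (2 ^ e) = Suc e"
  using bl_le_iff[of "2 ^ e" "Suc e"] bl_less_iff[of e "2 ^ e"] by simp

definition collect :: "prog list" where
  "collect = [Op Add 19 6 35, Op Add 20 11 35, Op Add 15 38 35] @ build @
     [Op Add 17 16 35, Op Add 19 7 35, Op Add 20 11 35, Op Add 15 39 35] @ build @ [Op Add 18 16 35]"

definition bisect_body :: "prog list" where
  "bisect_body = [Op Add 14 12 13, Const 26 2, Op Div 14 14 26, Op Add 19 14 35] @ eqt @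
     [Cond (Equal 10 2) (blk [Op Add 12 14 35]) (blk [Op Add 13 14 35]), Op Add 45 12 2]"

definition bisect :: "prog list" where
  "bisect = [Op Add 12 35 35, Op Add 13 11 35, Op Add 45 12 2, While (Less 45 13) (blk bisect_body),
     Op Add 0 12 35, Op Add 44 2 35]"

text \<open>Register 42 holds the integer square root of \<open>N\<close>: squaring a larger \<open>D\<close> might overflow.\<close>

definition grow :: "prog list" where
  "grow = [Cond (Less 9 8) (blk [Cond (LessEq 9 42) (blk [Op Mult 9 9 9]) (blk [Op Add 9 43 35])])
     (blk [Op Add 0 8 35, Op Add 44 2 35])]"

definition phase :: "prog list" where
  "phase = Cond (Less 9 8) (blk [Op Add 11 9 35]) (blk [Op Add 11 8 35]) # (collect @ [Op Add 19 11 35] @ eqt @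
     [Cond (Equal 10 2) (blk grow) (blk bisect)])"

locale lce_query = lce_structure w \<beta> P pinv c b F S addr ht M0 stk iA iB aA aB cap L D0 sN
  for w \<beta> P pinv :: nat and c :: "'a \<Rightarrow> nat" and b :: nat and F :: "'a list set" and S :: "'a list"
    and addr ht :: "'a list \<Rightarrow> nat" and M0 :: "nat list" and stk iA iB aA aB cap L D0 sN :: nat +
  fixes e0 :: nat
  assumes hash_inj: "i + d \<le> length S \<Longrightarrow> j + d \<le> length S \<Longrightarrow>
      hash c b (take d (drop i S)) mod P = hash c b (take d (drop j S)) mod P \<Longrightarrow> take d (drop i S) = take d (drop j S)"
    and ht_bl: "s \<in> F \<Longrightarrow> ht s \<le> 22 * bl (length s)"
    and D0: "D0 = 2 ^ e0" "1 \<le> e0" "bl (length S) \<le> (Suc e0)\<^sup>2" "(Suc e0)\<^sup>2 \<le> 9 * bl (length S)"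
    and cap_le: "cap \<le> 89 * bl (length S)"
    and sN_lt: "length S < Suc sN * Suc sN"
begin

text \<open>The zero-based form of \<open>lce\<close>; the program first subtracts 1 from both
  positions.\<close>

definition ext :: "nat \<Rightarrow> nat \<Rightarrow> nat" where
  "ext i j = length (longest_common_prefix (drop i S) (drop j S))"

definition room :: "nat \<Rightarrow> nat \<Rightarrow> nat" where "room i j = length S - max i j"

lemma ext_le_lim: "ext i j \<le> room i j"
  using prefix_length_le[OF longest_common_prefix_prefix1[of "drop i S" "drop j S"]]
    prefix_length_le[OF longest_common_prefix_prefix2[of "drop i S" "drop j S"]]
  by (auto simp: ext_def room_def)

text \<open>Here the absence of collisions turns a comparison of hashes into an exact test against
  the answer.\<close>

lemma hash_eq_iff:
  assumes "d \<le> room i j" "i < length S" "j < length S"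
  shows "hash c b (take d (drop i S)) mod P = hash c b (take d (drop j S)) mod P \<longleftrightarrow> d \<le> ext i j"
proof -
  have "i + d \<le> length S" "j + d \<le> length S" using assms by (auto simp: room_def)
  moreover have "take d (drop i S) = take d (drop j S) \<longleftrightarrow> d \<le> ext i j"
    unfolding ext_def by (rule take_eq_iff_lcp) (use assms in \<open>auto simp: room_def\<close>)
  ultimately show ?thesis using hash_inj[of i d j] by auto
qed

section \<open>One phase of a query\<close>

definition env :: "nat \<Rightarrow> nat \<Rightarrow> (nat \<Rightarrow> nat) \<Rightarrow> bool" where
  "env i j r \<longleftrightarrow> regs r \<and> r 6 = i \<and> r 7 = j \<and> r 8 = room i j \<and> r 42 = sN \<and> r 43 = length S"

lemma env_frame: "env i j r \<Longrightarrow> frame X r r' \<Longrightarrow>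
    X \<inter> {2, 3, 4, 5, 6, 7, 8, 35, 36, 37, 38, 39, 40, 41, 42, 43} = {} \<Longrightarrow> env i j r'"
  unfolding env_def regs_def regs_ok_def frame_def by auto

definition collected :: "nat \<Rightarrow> nat \<Rightarrow> nat \<Rightarrow> state \<Rightarrow> bool" where
  "collected i j d = (\<lambda>(r, m). good m \<and> env i j r \<and> r 11 = d \<and> (\<exists>as bs. items m iA as \<and> items m iB bs \<and>
     r 17 = length as \<and> r 18 = length bs \<and> length as \<le> cap \<and> length bs \<le> cap \<and>
     concat as = take d (drop i S) \<and> concat bs = take d (drop j S)))"

lemma collected_cong:
  assumes "collected i j d (r, m)" "frame X r r'"
    "X \<inter> {2, 3, 4, 5, 6, 7, 8, 35, 36, 37, 38, 39, 40, 41, 42, 43} = {}" "X \<inter> {11, 17, 18} = {}"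
  shows "collected i j d (r', m)"
proof -
  have "env i j r'" using assms env_frame[OF _ assms(2,3)] by (simp add: collected_def)
  moreover have "r' 11 = r 11" "r' 17 = r 17" "r' 18 = r 18" using assms(2,4) by (auto simp: frame_def)
  ultimately show ?thesis using assms(1) by (simp add: collected_def)
qed

lemma small_w: "x \<le> 2 * length S + 2 \<Longrightarrow> x mod 2 ^ w = x"
  using Nw(1) by simp

lemma L_w: "x < L \<Longrightarrow> x mod 2 ^ w = x"
  using layout(7) by simp

lemma tc_collect:
  assumes g: "good m" and E: "env i j r" and d: "r 11 = d" "d \<le> room i j" and ij: "i < length S" "j < length S"
  shows "tc w (blk collect) (r, m) (2 * (kbuild * (cap + 1)) + 8) (\<lambda>s. collected i j d s \<and> (fst s) 9 = r 9 \<and> (fst s) 44 = r 44)"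
proof -
  let ?X = "{16, 19, 20, 21, 22, 23, 24, 25, 26, 27, 31, 32, 33}"
  let ?X' = "{15, 16, 17, 19, 20, 21, 22, 23, 24, 25, 26, 27, 31, 32, 33}"
  let ?Q = "\<lambda>s. collected i j d s \<and> (fst s) 9 = r 9 \<and> (fst s) 44 = r 44"
  let ?K = "kbuild * (cap + 1)"
  note ee = E[unfolded env_def regs_def regs_ok_def]
  have dl: "i + d \<le> length S" "j + d \<le> length S" using d ij by (auto simp: room_def)
  have capL: "cap < L" "iA < L" "iB < L" using layout by auto
  have wd: "d mod 2 ^ w = d" "i mod 2 ^ w = i" "j mod 2 ^ w = j" by (rule small_w, use dl in simp)+
  let ?r1 = "r(19 := i, 20 := d, 15 := iA)"
  have f1: "frame ?X' r ?r1" by (auto simp: frame_def)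
  have R1: "regs ?r1" using env_frame[OF E f1] by (simp add: env_def)
  have 1: "tc w (blk [Op Add 19 6 35, Op Add 20 11 35, Op Add 15 38 35]) (r, m) 3 (\<lambda>s. s = (?r1, m))"
    using ee d wd L_w[OF capL(2)] by simp
  have 2: "tc w (blk build) (?r1, m) ?K (\<lambda>(r', m').
    good m' \<and> frame ?X ?r1 r' \<and>
    (\<forall>x. (x < stk \<or> stk + cap \<le> x) \<longrightarrow> (x < iA \<or> iA + (cap + 2) * rs \<le> x) \<longrightarrow> m' ! x = m ! x) \<and>
    (\<exists>its. items m' iA its \<and> concat its = take (?r1 20) (drop (?r1 19) S) \<and> r' 16 = length its \<and> length its \<le> cap))"
    by (rule tc_build[OF g R1 ok_iA]) (use dl in auto)
  show ?thesis unfolding collect_def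
  proof (rule tc_append[OF 1])
    fix s1 assume s1: "s1 = (?r1, m)"
    show "tc w (blk (build @ [Op Add 17 16 35, Op Add 19 7 35, Op Add 20 11 35, Op Add 15 39 35] @ build @ [Op Add 18 16 35]))
      s1 (?K + (4 + (?K + 1))) ?Q" unfolding s1
    proof (rule tc_append[OF 2])
      fix s2 assume "case s2 of (r', m') \<Rightarrow> good m' \<and> frame ?X ?r1 r' \<and>
        (\<forall>x. (x < stk \<or> stk + cap \<le> x) \<longrightarrow> (x < iA \<or> iA + (cap + 2) * rs \<le> x) \<longrightarrow> m' ! x = m ! x) \<and>
        (\<exists>its. items m' iA its \<and> concat its = take (?r1 20) (drop (?r1 19) S) \<and> r' 16 = length its \<and> length its \<le> cap)"
      then obtain r2 m2 as where s2: "s2 = (r2, m2)" "good m2" "frame ?X ?r1 r2" "items m2 iA as"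
        "concat as = take d (drop i S)" "r2 16 = length as" "length as \<le> cap" by (cases s2) auto
      have f2: "frame ?X' r r2" using s2(3) by (auto simp: frame_def)
      have E2: "env i j r2" using env_frame[OF E f2] by simp
      note ee2 = E2[unfolded env_def regs_def regs_ok_def]
      have r11: "r2 11 = d" using frameD[OF f2, of 11] d by simp
      let ?r3 = "r2(17 := length as, 19 := j, 20 := d, 15 := iB)"
      have f3: "frame ?X' r ?r3" using f2 by (auto simp: frame_def)
      have R3: "regs ?r3" using env_frame[OF E f3] by (simp add: env_def)
      have 3: "tc w (blk [Op Add 17 16 35, Op Add 19 7 35, Op Add 20 11 35, Op Add 15 39 35]) (r2, m2) 4 (\<lambda>s. s = (?r3, m2))"
        using ee2 r11 wd s2(6,7) L_w[OF capL(3)] L_w[of "length as"] capL(1) by simp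
      have 4: "tc w (blk build) (?r3, m2) ?K (\<lambda>(r', m').
        good m' \<and> frame ?X ?r3 r' \<and>
        (\<forall>x. (x < stk \<or> stk + cap \<le> x) \<longrightarrow> (x < iB \<or> iB + (cap + 2) * rs \<le> x) \<longrightarrow> m' ! x = m2 ! x) \<and>
        (\<exists>its. items m' iB its \<and> concat its = take (?r3 20) (drop (?r3 19) S) \<and> r' 16 = length its \<and> length its \<le> cap))"
        by (rule tc_build[OF s2(2) R3 ok_iB]) (use dl in auto)
      show "tc w (blk ([Op Add 17 16 35, Op Add 19 7 35, Op Add 20 11 35, Op Add 15 39 35] @ build @ [Op Add 18 16 35]))
        s2 (4 + (?K + 1)) ?Q" unfolding s2(1)
      proof (rule tc_append[OF 3])
        fix s3 assume s3: "s3 = (?r3, m2)"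
        show "tc w (blk (build @ [Op Add 18 16 35])) s3 (?K + 1) ?Q" unfolding s3
        proof (rule tc_append[OF 4])
          fix s4 assume "case s4 of (r', m') \<Rightarrow> good m' \<and> frame ?X ?r3 r' \<and>
            (\<forall>x. (x < stk \<or> stk + cap \<le> x) \<longrightarrow> (x < iB \<or> iB + (cap + 2) * rs \<le> x) \<longrightarrow> m' ! x = m2 ! x) \<and>
            (\<exists>its. items m' iB its \<and> concat its = take (?r3 20) (drop (?r3 19) S) \<and> r' 16 = length its \<and> length its \<le> cap)"
          then obtain r4 m4 bs where s4: "s4 = (r4, m4)" "good m4" "frame ?X ?r3 r4"
            "\<forall>x. (x < stk \<or> stk + cap \<le> x) \<longrightarrow> (x < iB \<or> iB + (cap + 2) * rs \<le> x) \<longrightarrow> m4 ! x = m2 ! x"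
            "items m4 iB bs" "concat bs = take d (drop j S)" "r4 16 = length bs" "length bs \<le> cap" by (cases s4) auto
          have f4: "frame ?X' r r4" using f3 s4(3) by (auto simp: frame_def)
          have E4: "env i j r4" using env_frame[OF E f4] by simp
          have r17: "r4 17 = length as" using frameD[OF s4(3), of 17] by simp
          have "items m4 iA as"
          proof (rule items_cong[OF s2(4)])
            show "length m4 = length m2" using s4(2) s2(2) by (simp add: good_def)
            fix x assume x: "iA \<le> x" "x < iA + Suc (length as) * rs"
            have "Suc (length as) * rs \<le> (cap + 2) * rs" using s2(7) by (intro mult_le_mono1) simp
            then have "x < iB" "stk + cap \<le> x" using x layout by auto
            then show "m4 ! x = m2 ! x" using s4(4) by blast
          qed
          moreover have "env i j (r4(18 := length bs))"
            by (rule env_frame[OF E4, of "{18}"]) (auto simp: frame_def)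
          moreover have "r4 11 = d" "r4 9 = r 9" "r4 44 = r 44"
            using frameD[OF f4, of 11] frameD[OF f4, of 9] frameD[OF f4, of 44] d by auto
          ultimately have "?Q (r4(18 := length bs), m4)"
            unfolding collected_def using s4 s2 r17 by auto
          moreover have "r4 35 = 0" using E4 by (simp add: env_def regs_def regs_ok_def)
          moreover have "length bs mod 2 ^ w = length bs" using L_w s4(8) capL(1) by simp
          ultimately show "tc w (blk [Op Add 18 16 35]) s4 1 ?Q" unfolding s4(1) using s4(7) by simp
        qed simp
      qed simp
    qed simp
  qed simp
qed

text \<open>The items concatenate to a window of length \<open>d\<close>, so none is longer, and
  local balance bounds their heights by \<open>22 * bl d\<close>. This makes the time depend on the
  guess and not on \<open>N\<close>, apart from \<open>bl cap\<close>.\<close>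

lemma tc_compare:
  assumes C: "collected i j d (r, m)" and x: "r 19 = x" "x \<le> d" and d: "0 < d" "d \<le> room i j"
    and ij: "i < length S" "j < length S"
  shows "tc w (blk eqt) (r, m) (keqt * (bl cap + 22 * bl d + 2)) (\<lambda>(r', m'). collected i j d (r', m') \<and>
    r' 10 = (if x \<le> ext i j then 1 else 0) \<and> frame {10, 15, 16, 20, 22, 23, 26, 27, 28, 29, 30, 31, 32, 33, 34} r r')"
proof -
  let ?X = "{10, 15, 16, 20, 22, 23, 26, 27, 28, 29, 30, 31, 32, 33, 34}"
  obtain as bs where a: "good m" "env i j r" "r 11 = d" "items m iA as" "items m iB bs" "r 17 = length as"
    "r 18 = length bs" "length as \<le> cap" "length bs \<le> cap" "concat as = take d (drop i S)" "concat bs = take d (drop j S)"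
    using C unfolding collected_def by auto
  have dl: "i + d \<le> length S" "j + d \<le> length S" using d ij by (auto simp: room_def)
  have len: "length (concat as) = d" "length (concat bs) = d" using a(10,11) dl by auto
  have h: "ht v \<le> 22 * bl d" if "v \<in> set as \<union> set bs" for v
  proof -
    have "v \<in> F" using that a(4,5) by (auto simp: items_def)
    moreover have "length v \<le> length (concat zs)" if "v \<in> set zs" for zs :: "'a list list"
      using that by (auto simp: in_set_conv_decomp)
    from this[of as] this[of bs] have "length v \<le> d" using that len by (elim UnE) simp_all
    ultimately show ?thesis using ht_bl[of v] bl_mono[of "length v" d] by linarith
  qed
  have pos: "0 < length as" "0 < length bs" using len d by (cases as; cases bs; auto)+
  have "tc w (blk eqt) (r, m) (keqt * (bl cap + 22 * bl d + 2)) (\<lambda>(r', m').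
    good m' \<and> items m' iA as \<and> items m' iB bs \<and>
    r' 10 = (if hash c b (take (r 19) (concat as)) mod P = hash c b (take (r 19) (concat bs)) mod P then 1 else 0) \<and>
    frame ?X r r')"
  proof (rule tc_eqt[OF a(1) _ a(4,5,6) pos(1) a(8) a(7) pos(2) a(9) _ _ h])
    show "regs r" using a(2) by (simp add: env_def)
    have "d < 2 ^ w" using dl Nw by linarith
    then show "length (concat as) < 2 ^ w" "length (concat bs) < 2 ^ w" using len by auto
  qed (use x len in auto)
  then show ?thesis
  proof (rule tc_mono[OF _ order_refl])
    fix s assume "case s of (r', m') \<Rightarrow> good m' \<and> items m' iA as \<and> items m' iB bs \<and>
      r' 10 = (if hash c b (take (r 19) (concat as)) mod P = hash c b (take (r 19) (concat bs)) mod P then 1 else 0) \<and>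
      frame ?X r r'"
    then obtain r' m' where s: "s = (r', m')" "good m'" "items m' iA as" "items m' iB bs" "frame ?X r r'"
      "r' 10 = (if hash c b (take (r 19) (concat as)) mod P = hash c b (take (r 19) (concat bs)) mod P then 1 else 0)"
      by (cases s) auto
    have t: "take (r 19) (concat as) = take x (drop i S)" "take (r 19) (concat bs) = take x (drop j S)"
      using a(10,11) x by (simp_all add: min_absorb1)
    have "r' 10 = (if x \<le> ext i j then 1 else 0)"
      unfolding s(6) t using hash_eq_iff[of x i j] x d ij by simp
    moreover have "env i j r'" using env_frame[OF a(2) s(5)] by simp
    moreover have "r' 11 = d" "r' 17 = length as" "r' 18 = length bs"
      using frameD[OF s(5), of 11] frameD[OF s(5), of 17] frameD[OF s(5), of 18] a by auto
    ultimately show "case s of (r', m') \<Rightarrow> collected i j d (r', m') \<and>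
      r' 10 = (if x \<le> ext i j then 1 else 0) \<and> frame ?X r r'"
      unfolding collected_def using s a by auto
  qed
qed

text \<open>The search keeps \<open>ext i j\<close> in a half-open interval; its initial upper end
  \<open>d\<close> is excluded by the failed comparison of the windows.\<close>

lemma tc_bisect:
  assumes C: "collected i j d (r, m)" and d: "0 < d" "d \<le> room i j" and ij: "i < length S" "j < length S"
    and ne: "ext i j < d" and K: "K = keqt * (bl cap + 22 * bl d + 2)"
  shows "tc w (blk bisect) (r, m) (Suc (bl d * (K + 8)) + 5) (\<lambda>(r', m'). good m' \<and> env i j r' \<and> r' 0 = ext i j \<and> r' 44 = 1)"
proof -
  let ?X = "{10, 12, 13, 14, 15, 16, 19, 20, 22, 23, 26, 27, 28, 29, 30, 31, 32, 33, 34, 45}"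
  let ?Y = "{10, 15, 16, 20, 22, 23, 26, 27, 28, 29, 30, 31, 32, 33, 34}"
  have dl: "i + d \<le> length S" using d ij by (auto simp: room_def)
  have E: "env i j r" and r11: "r 11 = d" using C by (auto simp: collected_def)
  note ee = E[unfolded env_def regs_def regs_ok_def]
  define I where "I = (\<lambda>(r', m') k. collected i j d (r', m') \<and> r' 12 < r' 13 \<and> r' 13 \<le> d \<and> r' 12 \<le> ext i j \<and>
    ext i j < r' 13 \<and> r' 45 = Suc (r' 12) \<and> r' 13 - r' 12 \<le> 2 ^ k)"
  let ?Q = "\<lambda>(r', m'). good m' \<and> env i j r' \<and> r' 12 = ext i j"
  let ?r1 = "r(12 := 0, 13 := d, 45 := Suc 0)"
  have loop: "tc w (While (Less 45 13) (blk bisect_body)) (?r1, m) (Suc (bl d * Suc (K + 7))) ?Q"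
  proof (rule tc_While[where I = I])
    have "collected i j d (?r1, m)" by (rule collected_cong[OF C, of "{12, 13, 45}"]) (auto simp: frame_def)
    then show "I (?r1, m) (bl d)" using d ne bl_bound[of d] by (simp add: I_def)
  next
    fix s k assume I: "I s k" and c: "cmp_val (Less 45 13) (fst s)"
    obtain r1 m1 where s: "s = (r1, m1)" by (cases s)
    let ?lo = "r1 12" and ?hi = "r1 13"
    have a: "collected i j d (r1, m1)" "?lo < ?hi" "?hi \<le> d" "?lo \<le> ext i j" "ext i j < ?hi" "?hi - ?lo \<le> 2 ^ k" "Suc ?lo < ?hi"
      using I c unfolding I_def s by auto
    have "k \<noteq> 0" using a(6,7) by (intro notI) simp
    then obtain l where l: "k = Suc l" by (cases k) auto
    define mid where "mid = (?lo + ?hi) div 2"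
    have mid: "?lo < mid" "mid < ?hi" "?hi - mid \<le> 2 ^ l" "mid - ?lo \<le> 2 ^ l" "mid \<le> d"
      using a l unfolding mid_def by auto
    have E1: "env i j r1" using a(1) by (simp add: collected_def)
    note ee1 = E1[unfolded env_def regs_def regs_ok_def]
    let ?r2 = "r1(14 := mid, 26 := 2, 19 := mid)"
    have wm: "(?lo + ?hi) mod 2 ^ w = ?lo + ?hi" "mid mod 2 ^ w = mid" by (rule small_w, use a mid dl in linarith)+
    have 1: "tc w (blk [Op Add 14 12 13, Const 26 2, Op Div 14 14 26, Op Add 19 14 35]) (r1, m1) 4 (\<lambda>s. s = (?r2, m1))"
      using ee1 wm two_w by (simp add: mid_def[symmetric] fun_upd_twist)
    have C2: "collected i j d (?r2, m1)" by (rule collected_cong[OF a(1), of "{14, 19, 26}"]) (auto simp: frame_def)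
    have 2: "tc w (blk eqt) (?r2, m1) K (\<lambda>(r', m'). collected i j d (r', m') \<and>
      r' 10 = (if mid \<le> ext i j then 1 else 0) \<and> frame ?Y ?r2 r')"
      unfolding K by (rule tc_compare[OF C2 _ mid(5) d ij]) simp
    show "tc w (blk bisect_body) s (K + 7) (\<lambda>s'. \<exists>n'. I s' n' \<and> n' < k)" unfolding s bisect_body_def
    proof (rule tc_append[OF 1])
      fix s1 assume s1: "s1 = (?r2, m1)"
      show "tc w (blk (eqt @ [Cond (Equal 10 2) (blk [Op Add 12 14 35]) (blk [Op Add 13 14 35]), Op Add 45 12 2]))
        s1 (K + 3) (\<lambda>s'. \<exists>n'. I s' n' \<and> n' < k)" unfolding s1
      proof (rule tc_append[OF 2])
        fix s2 assume "case s2 of (r', m') \<Rightarrow> collected i j d (r', m') \<and>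
          r' 10 = (if mid \<le> ext i j then 1 else 0) \<and> frame ?Y ?r2 r'"
        then obtain r3 m3 where s2: "s2 = (r3, m3)" "collected i j d (r3, m3)" "r3 10 = (if mid \<le> ext i j then 1 else 0)"
          "frame ?Y ?r2 r3" by (cases s2) auto
        have E3: "env i j r3" using s2(2) by (simp add: collected_def)
        have ee3: "r3 2 = 1" "r3 35 = 0" using E3 by (auto simp: env_def regs_def regs_ok_def)
        have rv: "r3 12 = ?lo" "r3 13 = ?hi" "r3 14 = mid"
          using frameD[OF s2(4), of 12] frameD[OF s2(4), of 13] frameD[OF s2(4), of 14] by auto
        have w3: "Suc mid mod 2 ^ w = Suc mid" "Suc ?lo mod 2 ^ w = Suc ?lo" by (rule small_w, use a mid dl in linarith)+
        have fin: "\<exists>n'. I (r', m3) n' \<and> n' < k" if "frame {12, 13, 45} r3 r'" "r' 45 = Suc (r' 12)"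
          "(mid \<le> ext i j \<and> r' 12 = mid \<and> r' 13 = ?hi) \<or> (ext i j < mid \<and> r' 12 = ?lo \<and> r' 13 = mid)" for r'
        proof -
          have "collected i j d (r', m3)" by (rule collected_cong[OF s2(2) that(1)]) auto
          then have "I (r', m3) l" using that a mid unfolding I_def by auto
          then show ?thesis using l by blast
        qed
        show "tc w (blk [Cond (Equal 10 2) (blk [Op Add 12 14 35]) (blk [Op Add 13 14 35]), Op Add 45 12 2])
          s2 3 (\<lambda>s'. \<exists>n'. I s' n' \<and> n' < k)" unfolding s2(1)
        proof (rule tc_Cond)
          assume "cmp_val (Equal 10 2) (fst (r3, m3))"
          then have le: "mid \<le> ext i j" using s2(3) ee3 by (cases "mid \<le> ext i j") auto
          have "\<exists>n'. I (r3(12 := mid, 45 := Suc mid), m3) n' \<and> n' < k"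
            by (rule fin) (use le rv in \<open>auto simp: frame_def\<close>)
          then show "tc w (blk ([Op Add 12 14 35] @ [Op Add 45 12 2])) (r3, m3) (3 - 1) (\<lambda>s'. \<exists>n'. I s' n' \<and> n' < k)"
            using ee3 rv w3 wm by simp
        next
          assume "\<not> cmp_val (Equal 10 2) (fst (r3, m3))"
          then have le: "ext i j < mid" using s2(3) ee3 by (cases "mid \<le> ext i j") auto
          have "\<exists>n'. I (r3(13 := mid, 45 := Suc ?lo), m3) n' \<and> n' < k"
            by (rule fin) (use le rv in \<open>auto simp: frame_def\<close>)
          then show "tc w (blk ([Op Add 13 14 35] @ [Op Add 45 12 2])) (r3, m3) (3 - 1) (\<lambda>s'. \<exists>n'. I s' n' \<and> n' < k)"
            using ee3 rv w3 wm by simp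
        qed simp
      qed simp
    qed simp
  next
    fix s k assume I: "I s k" and c: "\<not> cmp_val (Less 45 13) (fst s)"
    obtain r1 m1 where s: "s = (r1, m1)" by (cases s)
    show "?Q s" using I c unfolding I_def s by (auto simp: collected_def)
  qed
  have wd: "d mod 2 ^ w = d" by (rule small_w) (use dl in simp)
  have "tc w (blk [While (Less 45 13) (blk bisect_body), Op Add 0 12 35, Op Add 44 2 35]) (?r1, m) (3 + bl d * (K + 8))
    (\<lambda>(r', m'). good m' \<and> env i j r' \<and> r' 0 = ext i j \<and> r' 44 = 1)"
  proof (rule tc_Cons[OF loop])
    fix s assume "?Q s"
    then obtain r1 m1 where s: "s = (r1, m1)" "good m1" "env i j r1" "r1 12 = ext i j" by (cases s) auto
    note ee1 = s(3)[unfolded env_def regs_def regs_ok_def]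
    have "ext i j mod 2 ^ w = ext i j" by (rule small_w) (use ne dl in linarith)
    moreover have "env i j (r1(0 := ext i j, 44 := 1))" by (rule env_frame[OF s(3), of "{0, 44}"]) (auto simp: frame_def)
    ultimately show "tc w (blk [Op Add 0 12 35, Op Add 44 2 35]) s 2 (\<lambda>(r', m'). good m' \<and> env i j r' \<and> r' 0 = ext i j \<and> r' 44 = 1)"
      unfolding s(1) using s ee1 one_w by simp
  qed simp
  then show ?thesis unfolding bisect_def using ee r11 wd one_w by simp
qed

end

definition setup_query :: "prog list" where
  "setup_query = [Const 2 1, Op Sub 6 0 2, Op Sub 7 1 2, Load 5 35, Load 3 2, Const 26 2, Load 4 26, Const 26 3, Load 9 26,
     Const 26 4, Load 42 26, Const 26 5, Load 37 26, Const 26 6, Load 38 26, Const 26 7, Load 39 26, Const 26 8, Load 40 26,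
     Const 26 9, Load 41 26, Const 36 rs, Load 43 5, Cond (Less 6 7) (blk [Op Sub 8 43 7]) (blk [Op Sub 8 43 6])]"

definition query :: prog where "query = blk (setup_query @ [While (Equal 44 35) (blk phase)])"

context lce_query begin

section \<open>Time of a phase and of the whole query\<close>

definition kphase :: nat where "kphase = 180 * kbuild + 66 * keqt + 30"

text \<open>\<open>q\<close> stands for the bit length of the guess. Collecting takes O(cap), which
  is O(q^2) since log N is at most q^2. For the same reason \<open>bl cap\<close> is at most
  \<open>7 + 2 * q\<close>, so one comparison costs O(q), and at most \<open>q\<close> of them occur
  in the bisection.\<close>

lemma phase_time:
  assumes "1 \<le> q" "bl (length S) \<le> q\<^sup>2" "bl d \<le> q"
  shows "2 * (kbuild * (cap + 1)) + keqt * (bl cap + 22 * bl d + 2) + bl d * (keqt * (bl cap + 22 * bl d + 2) + 8) + 22 \<le> kphase * q\<^sup>2"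
proof -
  have "S \<noteq> []" using F_len[OF SF] .
  then have N: "1 \<le> bl (length S)" using bl_pos[of "length S"] by simp
  have qq: "q \<le> q\<^sup>2" "1 \<le> q\<^sup>2" using assms(1) by (auto simp: power2_eq_square)
  have cap1: "cap + 1 \<le> 90 * q\<^sup>2" using cap_le N assms(2) by linarith
  have "bl cap \<le> bl (89 * q\<^sup>2)" by (rule bl_mono) (use cap_le assms(2) in linarith)
  also have "\<dots> \<le> bl 89 + bl (q\<^sup>2)" by (rule bl_mult)
  also have "bl 89 \<le> 7" by (simp add: bl_le_iff)
  also have "bl (q\<^sup>2) \<le> bl q + bl q" unfolding power2_eq_square by (rule bl_mult)
  also have "bl q \<le> q" by (rule bl_self)
  finally have "bl cap + 22 * bl d + 2 \<le> 33 * q" using assms by linarith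
  then have K: "keqt * (bl cap + 22 * bl d + 2) \<le> keqt * (33 * q)" by (rule mult_le_mono2)
  also have "keqt * (33 * q) \<le> keqt * (33 * q\<^sup>2)" using qq by simp
  finally have 1: "keqt * (bl cap + 22 * bl d + 2) \<le> 33 * (keqt * q\<^sup>2)" by simp
  have "bl d * (keqt * (bl cap + 22 * bl d + 2) + 8) \<le> q * (keqt * (33 * q) + 8)"
    using K assms(3) by (intro mult_le_mono) auto
  also have "\<dots> = 33 * (keqt * q\<^sup>2) + 8 * q" by (simp add: power2_eq_square algebra_simps)
  finally have 2: "bl d * (keqt * (bl cap + 22 * bl d + 2) + 8) \<le> 33 * (keqt * q\<^sup>2) + 8 * q\<^sup>2" using qq by linarith
  have "kbuild * (cap + 1) \<le> kbuild * (90 * q\<^sup>2)" using cap1 by (rule mult_le_mono2)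
  then have 3: "2 * (kbuild * (cap + 1)) \<le> 180 * (kbuild * q\<^sup>2)" by simp
  have "kphase * q\<^sup>2 = 180 * (kbuild * q\<^sup>2) + 66 * (keqt * q\<^sup>2) + 30 * q\<^sup>2"
    by (simp add: kphase_def algebra_simps)
  then show ?thesis using 1 2 3 qq by linarith
qed

text \<open>A guess that reaches \<open>room i j\<close> decides the query: a match then means that
  the answer is \<open>room i j\<close>, and a mismatch leads to the bisection.\<close>

lemma tc_phase:
  assumes g: "good m" and E: "env i j r" and D: "r 9 = D" "1 \<le> D" "D < 2 ^ w" "bl (length S) \<le> (bl D)\<^sup>2"
    and ij: "i < length S" "j < length S" and f: "r 44 = 0"
  shows "tc w (blk phase) (r, m) (kphase * (bl D)\<^sup>2) (\<lambda>(r', m'). good m' \<and> env i j r' \<and>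
    (r' 44 = 1 \<and> r' 0 = ext i j \<or>
     r' 44 = 0 \<and> D \<le> ext i j \<and> D < room i j \<and> r' 9 = (if D \<le> sN then D * D else length S)))"
    (is "tc _ _ _ _ ?Q")
proof -
  define d where "d = min D (room i j)"
  let ?Y = "{10, 15, 16, 20, 22, 23, 26, 27, 28, 29, 30, 31, 32, 33, 34}"
  define KC where "KC = 2 * (kbuild * (cap + 1)) + 8"
  define KE where "KE = keqt * (bl cap + 22 * bl d + 2)"
  have room0: "0 < room i j" "room i j \<le> length S" using ij by (auto simp: room_def)
  have d: "0 < d" "d \<le> room i j" "d \<le> D" using room0 D by (auto simp: d_def)
  have wd: "d mod 2 ^ w = d" "room i j mod 2 ^ w = room i j" "length S mod 2 ^ w = length S" by (rule small_w, use d room0 in linarith)+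
  note ee = E[unfolded env_def regs_def regs_ok_def]
  have last: "tc w (blk [Cond (Equal 10 2) (blk grow) (blk bisect)]) (r3, m3) (bl d * (KE + 8) + 7) ?Q"
    if C: "collected i j d (r3, m3)" "r3 10 = (if d \<le> ext i j then 1 else 0)" "r3 9 = D" "r3 44 = 0" for r3 m3
  proof (rule tc_Cond)
    have E3: "env i j r3" and g3: "good m3" using C by (auto simp: collected_def)
    have rv: "r3 2 = 1" "r3 35 = 0" "r3 8 = room i j" "r3 42 = sN" "r3 43 = length S"
      using E3 by (auto simp: env_def regs_def regs_ok_def)
    {
      assume "cmp_val (Equal 10 2) (fst (r3, m3))"
      then have le: "d \<le> ext i j" using C(2) rv by (cases "d \<le> ext i j") auto
      have e9: "env i j (r3(9 := x))" for x by (rule env_frame[OF E3, of "{9}"]) (auto simp: frame_def)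
      have e0: "env i j (r3(0 := x, 44 := y))" for x y by (rule env_frame[OF E3, of "{0, 44}"]) (auto simp: frame_def)
      have "tc w (blk grow) (r3, m3) 3 ?Q" unfolding grow_def
      proof (rule tc_Cond)
        assume "cmp_val (Less 9 8) (fst (r3, m3))"
        then have lt: "D < room i j" using C(3) rv by simp
        then have dD: "d = D" by (simp add: d_def)
        have "tc w (blk [Cond (LessEq 9 42) (blk [Op Mult 9 9 9]) (blk [Op Add 9 43 35])]) (r3, m3) 2 ?Q"
        proof (rule tc_Cond)
          assume "cmp_val (LessEq 9 42) (fst (r3, m3))"
          then have s: "D \<le> sN" using C(3) rv by simp
          have "D * D \<le> sN * sN" using s by (intro mult_le_mono)
          then have "D * D mod 2 ^ w = D * D" using Nw(2) by (intro small_w) linarith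
          then show "tc w (blk ([Op Mult 9 9 9] @ [])) (r3, m3) (2 - 1) ?Q"
            using C(3,4) rv e9 g3 le lt dD s by simp
        next
          assume "\<not> cmp_val (LessEq 9 42) (fst (r3, m3))"
          then have s: "\<not> D \<le> sN" using C(3) rv by simp
          show "tc w (blk ([Op Add 9 43 35] @ [])) (r3, m3) (2 - 1) ?Q"
            using C(3,4) rv e9 g3 le lt dD s wd by simp
        qed simp
        then show "tc w (blk ([Cond (LessEq 9 42) (blk [Op Mult 9 9 9]) (blk [Op Add 9 43 35])] @ [])) (r3, m3) (3 - 1) ?Q" by simp
      next
        assume "\<not> cmp_val (Less 9 8) (fst (r3, m3))"
        then have "d = room i j" using C(3) rv by (simp add: d_def)
        then have "ext i j = room i j" using le ext_le_lim[of i j] by simp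
        then show "tc w (blk ([Op Add 0 8 35, Op Add 44 2 35] @ [])) (r3, m3) (3 - 1) ?Q"
          using rv e0 g3 wd one_w by simp
      qed simp
      then show "tc w (blk (grow @ [])) (r3, m3) (bl d * (KE + 8) + 7 - 1) ?Q"
        unfolding append_Nil2 by (rule tc_mono) auto
    }
    {
      assume "\<not> cmp_val (Equal 10 2) (fst (r3, m3))"
      then have "ext i j < d" using C(2) rv by (cases "d \<le> ext i j") auto
      from tc_bisect[OF C(1) d(1,2) ij this KE_def]
      show "tc w (blk (bisect @ [])) (r3, m3) (bl d * (KE + 8) + 7 - 1) ?Q"
        unfolding append_Nil2 by (rule tc_mono) auto
    }
  qed simp
  let ?p3 = "[Cond (Equal 10 2) (blk grow) (blk bisect)]"
  have rest: "tc w (blk (collect @ [Op Add 19 11 35] @ eqt @ ?p3)) (r1, m) (KC + (1 + (KE + (bl d * (KE + 8) + 7)))) ?Q"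
    if r1: "r1 = r(11 := d)" for r1
  proof -
    have E1: "env i j r1" unfolding r1 by (rule env_frame[OF E, of "{11}"]) (auto simp: frame_def)
    have 1: "tc w (blk collect) (r1, m) KC (\<lambda>s. collected i j d s \<and> (fst s) 9 = r1 9 \<and> (fst s) 44 = r1 44)"
      unfolding KC_def by (rule tc_collect[OF g E1 _ d(2) ij]) (simp add: r1)
    show ?thesis
    proof (rule tc_append[OF 1])
      fix s2 assume "collected i j d s2 \<and> (fst s2) 9 = r1 9 \<and> (fst s2) 44 = r1 44"
      then obtain r2 m2 where s2: "s2 = (r2, m2)" "collected i j d (r2, m2)" "r2 9 = D" "r2 44 = 0"
        using D f r1 by (cases s2) auto
      have r35: "r2 35 = 0" "r2 11 = d" using s2(2) by (auto simp: collected_def env_def regs_def regs_ok_def)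
      let ?r3 = "r2(19 := d)"
      have op: "tc w (blk ps) (?r3, m2) T R \<Longrightarrow> tc w (blk ([Op Add 19 11 35] @ ps)) (r2, m2) (1 + T) R" for ps T R
        using r35 wd by simp
      have C3: "collected i j d (?r3, m2)" by (rule collected_cong[OF s2(2), of "{19}"]) (auto simp: frame_def)
      have 2: "tc w (blk eqt) (?r3, m2) KE (\<lambda>(r', m'). collected i j d (r', m') \<and>
        r' 10 = (if d \<le> ext i j then 1 else 0) \<and> frame ?Y ?r3 r')"
        unfolding KE_def by (rule tc_compare[OF C3 _ order_refl d(1,2) ij]) simp
      have "tc w (blk (eqt @ ?p3)) (?r3, m2) (KE + (bl d * (KE + 8) + 7)) ?Q"
      proof (rule tc_append[OF 2])
        fix s4 assume "case s4 of (r', m') \<Rightarrow> collected i j d (r', m') \<and>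
          r' 10 = (if d \<le> ext i j then 1 else 0) \<and> frame ?Y ?r3 r'"
        then obtain r4 m4 where s4: "s4 = (r4, m4)" "collected i j d (r4, m4)"
          "r4 10 = (if d \<le> ext i j then 1 else 0)" "frame ?Y ?r3 r4" by (cases s4) auto
        show "tc w (blk ?p3) s4 (bl d * (KE + 8) + 7) ?Q" unfolding s4(1)
          by (rule last[OF s4(2,3)]) (use frameD[OF s4(4), of 9] frameD[OF s4(4), of 44] s2 in auto)
      qed simp
      then show "tc w (blk ([Op Add 19 11 35] @ eqt @ ?p3)) s2 (1 + (KE + (bl d * (KE + 8) + 7))) ?Q"
        unfolding s2(1) by (rule op)
    qed simp
  qed
  have op: "tc w (blk ps) (r(11 := d), m) T R \<Longrightarrow> tc w (blk ([Op Add 11 x 35] @ ps)) (r, m) (Suc (Suc T) - 1) R"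
    if "r x mod 2 ^ w = d" for ps T R x using that ee by simp
  have "tc w (blk phase) (r, m) (Suc (Suc (KC + (1 + (KE + (bl d * (KE + 8) + 7)))))) ?Q" unfolding phase_def
  proof (rule tc_Cond)
    assume "cmp_val (Less 9 8) (fst (r, m))"
    then have "r 9 mod 2 ^ w = d" using ee D by (simp add: d_def)
    then show "tc w (blk ([Op Add 11 9 35] @ collect @ [Op Add 19 11 35] @ eqt @ ?p3)) (r, m)
      (Suc (Suc (KC + (1 + (KE + (bl d * (KE + 8) + 7))))) - 1) ?Q" using rest[OF refl] by (rule op)
  next
    assume "\<not> cmp_val (Less 9 8) (fst (r, m))"
    then have "r 8 mod 2 ^ w = d" using ee D wd by (simp add: d_def)
    then show "tc w (blk ([Op Add 11 8 35] @ collect @ [Op Add 19 11 35] @ eqt @ ?p3)) (r, m)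
      (Suc (Suc (KC + (1 + (KE + (bl d * (KE + 8) + 7))))) - 1) ?Q" using rest[OF refl] by (rule op)
  qed simp
  moreover have "Suc (Suc (KC + (1 + (KE + (bl d * (KE + 8) + 7))))) \<le> kphase * (bl D)\<^sup>2"
    using phase_time[of "bl D" d] bl_mono[OF d(3)] bl_pos[of D] D unfolding KC_def KE_def by simp
  ultimately show ?thesis by (rule tc_mono)
qed

lemma regs_query:
  assumes g: "good m" and ij: "i < length S" "j < length S"
    and Q: "\<And>r. env i j r \<Longrightarrow> r 9 = D0 \<Longrightarrow> r 44 = 0 \<Longrightarrow> tc w (blk ps) (r, m) T Q"
  shows "tc w (blk (setup_query @ ps)) (query_regs (Suc i) (Suc j), m) (T + 25) Q"
proof -
  have len: "length m = L" "200 < L" using g LM0 M0_200 by (auto simp: good_def)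
  have m: "m ! x = M0 ! x" if "x < 200" for x using g that M0_200 by (auto simp: good_def)
  have mN: "m ! addr S = length S" "addr S < L" using node_good[OF g SF] by auto
  have wk: "x mod 2 ^ w = x" if "x \<le> 200" for x :: nat using that len(2) layout(7) by simp
  have rs200: "rs \<le> 200" by (simp add: rs_def cc_def)
  have sub: "(length S + (2 ^ w - x)) mod 2 ^ w = length S - x" if "x \<le> length S" for x
    using sub_w[OF that] Nw(1) by simp
  have s1: "(Suc x + (2 ^ w - Suc 0)) mod 2 ^ w = x" if "x < length S" for x
    using sub_w[of 1 "Suc x"] that Nw(1) by simp
  define r where "r = (query_regs (Suc i) (Suc j))(2 := 1, 6 := i, 7 := j, 5 := addr S, 3 := \<beta>, 4 := pinv, 9 := D0,
    42 := sN, 37 := stk, 38 := iA, 39 := iB, 40 := aA, 41 := aB, 26 := 9, 36 := rs, 43 := length S)"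
  have E: "env i j (r(8 := room i j))"
    by (simp add: env_def regs_def regs_ok_def r_def query_regs_def)
  have last: "tc w (blk (Cond (Less 6 7) (blk [Op Sub 8 43 7]) (blk [Op Sub 8 43 6]) # ps)) (r, m) (T + 2) Q"
  proof (rule tc_Cond)
    have rv: "r 6 = i" "r 7 = j" "r 43 = length S" by (auto simp: r_def)
    have q: "tc w (blk ps) (r(8 := room i j), m) T Q" by (rule Q[OF E]) (auto simp: r_def query_regs_def)
    show "cmp_val (Less 6 7) (fst (r, m)) \<Longrightarrow> tc w (blk ([Op Sub 8 43 7] @ ps)) (r, m) (T + 2 - 1) Q"
      using rv q sub[of j] ij by (simp add: room_def max_def split: if_splits)
    show "\<not> cmp_val (Less 6 7) (fst (r, m)) \<Longrightarrow> tc w (blk ([Op Sub 8 43 6] @ ps)) (r, m) (T + 2 - 1) Q"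
      using rv q sub[of i] ij by (simp add: room_def max_def split: if_splits)
  qed simp
  show ?thesis unfolding setup_query_def using last ij s1[OF ij(1)] s1[OF ij(2)] one_w len m mN rs200
    by (simp add: tc_Load wk header header[unfolded One_nat_def] r_def query_regs_def fun_upd_twist)
qed

definition kk :: nat where "kk = kphase + 2"

text \<open>If the phase with guess \<open>D\<close> is not the last one, \<open>D \<le> ext i j\<close>. As \<open>(bl D)\<^sup>2\<close> at least doubles with each
  squaring and at most quadruples, the later phases are paid by the difference in the second summand.\<close>

definition budget :: "nat \<Rightarrow> nat \<Rightarrow> nat \<Rightarrow> nat" where
  "budget i j D = kk * (bl D)\<^sup>2 +
     (if D \<le> ext i j \<and> D < room i j then 8 * (kk * (bl (ext i j))\<^sup>2) - 4 * (kk * (bl D)\<^sup>2) else 0)"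

text \<open>Let \<open>a\<close>, \<open>a'\<close> be the costs of this phase and the next, and
  \<open>x\<close> that of the answer's bit length. If the next phase may continue,
  \<open>a' \<ge> 2 * a\<close> gives \<open>4 * a \<le> 3 * a'\<close>, which is what the
  difference of the budgets requires. If it is the last, \<open>a' \<le> 4 * a\<close> and
  \<open>a \<le> x\<close> give \<open>a + a' \<le> 8 * x - 3 * a\<close>.\<close>

lemma budget_next:
  assumes D: "D = 2 ^ e" "1 \<le> e" "D \<le> ext i j" "D < room i j" and ij: "i < length S"
    and D': "D' = (if D \<le> sN then D * D else length S)"
  shows "kphase * (bl D)\<^sup>2 + 1 + budget i j D' \<le> budget i j D"
proof -
  define a a' x where "a = kk * (bl D)\<^sup>2" and "a' = kk * (bl D')\<^sup>2" and "x = kk * (bl (ext i j))\<^sup>2"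
  have q: "bl D = Suc e" using D(1) by simp
  have "bl D' \<le> 2 * bl D"
  proof (cases "D \<le> sN")
    case True
    then show ?thesis using bl_mult[of D D] D' by simp
  next
    case False
    \<comment> \<open>Beyond the integer square root, \<open>D * D\<close> is already at least
      \<open>N\<close>, so replacing the guess by \<open>N\<close> grows it no more than squaring
      would.\<close>
    then have "Suc sN * Suc sN \<le> D * D" by (intro mult_le_mono) auto
    then have "length S \<le> D * D" using sN_lt by linarith
    then show ?thesis using False D' bl_mono[of "length S" "D * D"] bl_mult[of D D] by simp
  qed
  then have "(bl D')\<^sup>2 \<le> (2 * bl D)\<^sup>2" by (rule power_mono) simp
  then have "a' \<le> kk * (2 * bl D)\<^sup>2" unfolding a'_def by (rule mult_le_mono2)
  then have a4: "a' \<le> 4 * a" by (simp add: a_def power_mult_distrib)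
  have "(bl D)\<^sup>2 \<le> (bl (ext i j))\<^sup>2" using bl_mono[OF D(3)] by (rule power_mono) simp
  then have ax: "a \<le> x" unfolding a_def x_def by (rule mult_le_mono2)
  have "1 * 1 \<le> (bl D)\<^sup>2" using q by (simp add: power2_eq_square)
  then have k: "kphase * (bl D)\<^sup>2 + 1 \<le> a" by (simp add: a_def kk_def algebra_simps)
  have bD: "budget i j D = a + (8 * x - 4 * a)" using D by (simp add: budget_def a_def x_def)
  show ?thesis
  proof (cases "D' \<le> ext i j \<and> D' < room i j")
    case True
    then have "D' \<noteq> length S" by (auto simp: room_def)
    then have "D' = 2 ^ (e + e)" using D' D(1) by (auto simp: power_add split: if_splits)
    then have q': "bl D' = Suc (e + e)" by simp
    obtain f where "e = Suc f" using D(2) by (cases e) auto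
    \<comment> \<open>This is \<open>2 * (e + 1)^2 \<le> (2 * e + 1)^2\<close>, which needs
      \<open>e \<ge> 1\<close>.\<close>
    then have "2 * (bl D)\<^sup>2 \<le> (bl D')\<^sup>2" unfolding q q' by (simp add: power2_eq_square algebra_simps)
    from mult_le_mono2[OF this, of kk] have a2: "2 * a \<le> a'" by (simp add: a_def a'_def)
    have "(bl D')\<^sup>2 \<le> (bl (ext i j))\<^sup>2" using bl_mono[of D' "ext i j"] True by (intro power_mono) auto
    then have "a' \<le> x" unfolding a'_def x_def by (rule mult_le_mono2)
    moreover have "budget i j D' = a' + (8 * x - 4 * a')" using True by (simp add: budget_def a'_def x_def)
    ultimately show ?thesis using k a2 ax bD by linarith
  next
    case False
    then have "budget i j D' = a'" by (auto simp: budget_def a'_def)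
    then show ?thesis using k a4 ax bD by linarith
  qed
qed

lemma tc_query:
  assumes g: "good m" and ij: "i < length S" "j < length S"
  shows "tc w query (query_regs (Suc i) (Suc j), m) (budget i j D0 + 25) (\<lambda>(r', m'). good m' \<and> r' 0 = ext i j)"
proof -
  \<comment> \<open>Every guess is a power of two except possibly \<open>length S\<close>; the
    latter cannot be below \<open>room i j\<close>, so it ends the query.\<close>
  define ok where "ok D \<longleftrightarrow> 1 \<le> D \<and> D < 2 ^ w \<and> bl (length S) \<le> (bl D)\<^sup>2 \<and> ((\<exists>e \<ge> 1. D = 2 ^ e) \<or> D = length S)" for D
  define I where "I = (\<lambda>(r, m) n. good m \<and> env i j r \<and>
    (r 44 = 1 \<and> r 0 = ext i j \<and> 1 \<le> n \<or> r 44 = 0 \<and> ok (r 9) \<and> budget i j (r 9) \<le> n))"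
  have loop: "tc w (While (Equal 44 35) (blk phase)) (r, m) (budget i j D0) (\<lambda>(r', m'). good m' \<and> r' 0 = ext i j)"
    if r: "env i j r" "r 9 = D0" "r 44 = 0" for r
  proof (rule tc_While_budget[where I = I])
    have "ok D0" unfolding ok_def using D0 Nw(3) by auto
    then show "I (r, m) (budget i j D0)" using r g by (simp add: I_def)
  next
    fix s n assume I: "I s n" and c: "cmp_val (Equal 44 35) (fst s)"
    obtain r1 m1 where s: "s = (r1, m1)" by (cases s)
    define D where "D = r1 9"
    have E: "env i j r1" and g1: "good m1" using I by (auto simp: I_def s)
    have "r1 35 = 0" using E by (simp add: env_def regs_def regs_ok_def)
    then have f: "r1 44 = 0" using c s by simp
    have okD: "ok D" and n: "budget i j D \<le> n" using I f by (auto simp: I_def s D_def)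
    have o: "1 \<le> D" "D < 2 ^ w" "bl (length S) \<le> (bl D)\<^sup>2" "(\<exists>e \<ge> 1. D = 2 ^ e) \<or> D = length S"
      using okD by (auto simp: ok_def)
    have "tc w (blk phase) s (kphase * (bl D)\<^sup>2) (\<lambda>s'. \<exists>n'. I s' n' \<and> Suc (kphase * (bl D)\<^sup>2) + n' \<le> n)" unfolding s
    proof (rule tc_mono[OF tc_phase[OF g1 E D_def[symmetric] o(1-3) ij f] order_refl])
      fix s' assume "case s' of (r', m') \<Rightarrow> good m' \<and> env i j r' \<and>
        (r' 44 = 1 \<and> r' 0 = ext i j \<or>
         r' 44 = 0 \<and> D \<le> ext i j \<and> D < room i j \<and> r' 9 = (if D \<le> sN then D * D else length S))"
      then obtain r2 m2 where s': "s' = (r2, m2)" "good m2" "env i j r2" and cs: "(r2 44 = 1 \<and> r2 0 = ext i j) \<or>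
        (r2 44 = 0 \<and> D \<le> ext i j \<and> D < room i j \<and> r2 9 = (if D \<le> sN then D * D else length S))" by (cases s') auto
      from cs show "\<exists>n'. I s' n' \<and> Suc (kphase * (bl D)\<^sup>2) + n' \<le> n"
      proof
        assume a: "r2 44 = 1 \<and> r2 0 = ext i j"
        have "1 \<le> (bl D)\<^sup>2" using bl_pos[of D] o(1) by (simp add: Suc_le_eq)
        then have "kphase * (bl D)\<^sup>2 + 2 \<le> kk * (bl D)\<^sup>2" by (simp add: kk_def algebra_simps)
        also have "\<dots> \<le> n" using n by (simp add: budget_def)
        finally have "Suc (kphase * (bl D)\<^sup>2) + 1 \<le> n" by simp
        moreover have "I s' 1" using a s' by (simp add: I_def)
        ultimately show ?thesis by blast
      next
        assume a: "r2 44 = 0 \<and> D \<le> ext i j \<and> D < room i j \<and> r2 9 = (if D \<le> sN then D * D else length S)"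
        define D' where "D' = (if D \<le> sN then D * D else length S)"
        have "D \<noteq> length S" using a by (auto simp: room_def)
        then obtain e where e: "D = 2 ^ e" "1 \<le> e" using o(4) by blast
        have st: "kphase * (bl D)\<^sup>2 + 1 + budget i j D' \<le> budget i j D"
          by (rule budget_next[OF e _ _ ij(1) D'_def]) (use a in auto)
        have DN: "D \<le> length S" using a by (auto simp: room_def)
        have "D * 1 \<le> D * D" using o(1) by (intro mult_le_mono2)
        then have le: "D \<le> D'" using DN by (simp add: D'_def)
        have "D' \<le> length S"
        proof (cases "D \<le> sN")
          case True
          then have "D * D \<le> sN * sN" by (intro mult_le_mono)
          then show ?thesis using True Nw(2) by (simp add: D'_def)
        qed (simp add: D'_def)
        then have "D' < 2 ^ w" using Nw(1) by linarith
        moreover have "(bl D)\<^sup>2 \<le> (bl D')\<^sup>2" using bl_mono[OF le] by (rule power_mono) simp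
        moreover have pw: "(\<exists>e \<ge> 1. D' = 2 ^ e) \<or> D' = length S"
        proof (cases "D \<le> sN")
          case True
          then have "D' = 2 ^ (e + e)" using e by (simp add: D'_def power_add)
          then show ?thesis using e(2) by (intro disjI1 exI[of _ "e + e"]) simp
        qed (simp add: D'_def)
        ultimately have "ok D'" unfolding ok_def using o(1,3) le by (intro conjI pw) linarith+
        then have "I s' (budget i j D')" using a s' by (simp add: I_def D'_def)
        then show ?thesis using st n by (intro exI[of _ "budget i j D'"]) simp
      qed
    qed
    then show "\<exists>T. tc w (blk phase) s T (\<lambda>s'. \<exists>n'. I s' n' \<and> Suc T + n' \<le> n)" by blast
  next
    fix s n assume I: "I s n" and c: "\<not> cmp_val (Equal 44 35) (fst s)"
    obtain r1 m1 where s: "s = (r1, m1)" by (cases s)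
    have "r1 35 = 0" using I by (simp add: I_def s env_def regs_def regs_ok_def)
    then show "1 \<le> n \<and> (case s of (r', m') \<Rightarrow> good m' \<and> r' 0 = ext i j)" using I c by (auto simp: I_def s)
  qed
  show ?thesis unfolding query_def
  proof (rule regs_query[OF g ij])
    fix r assume "env i j r" "r 9 = D0" "r 44 = 0"
    from loop[OF this] show "tc w (blk [While (Equal 44 35) (blk phase)]) (r, m) (budget i j D0) (\<lambda>(r', m'). good m' \<and> r' 0 = ext i j)"
      by (rule tc_Cons[where ?T2.0 = 0]) auto
  qed
qed

lemma budget_le: "budget i j D0 \<le> 9 * (kk * bl (length S)) + 8 * (kk * (bl (ext i j))\<^sup>2)"
proof -
  have "kk * (bl D0)\<^sup>2 \<le> kk * (9 * bl (length S))" using D0(1,4) by (intro mult_le_mono2) simp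
  then have "kk * (bl D0)\<^sup>2 \<le> 9 * (kk * bl (length S))" by (simp only: mult.left_commute)
  moreover have "(if D0 \<le> ext i j \<and> D0 < room i j then 8 * (kk * (bl (ext i j))\<^sup>2) - 4 * (kk * (bl D0)\<^sup>2) else 0)
    \<le> 8 * (kk * (bl (ext i j))\<^sup>2)" by simp
  ultimately show ?thesis unfolding budget_def by linarith
qed

end

section \<open>The memory image\<close>

lemma seg_eqI: "length ds = n \<Longrightarrow> (\<And>i. i < n \<Longrightarrow> m ! (a + i) = ds ! i) \<Longrightarrow> seg m a n = ds"
  by (rule nth_equalityI) (auto simp: seg_def)

lemma bt_restrict_length: "bt F g u h \<Longrightarrow> length u \<le> n \<Longrightarrow> bt {s \<in> F. length s \<le> n} g u h"
  by (induction rule: bt.induct) (auto intro: bt.intros)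

locale grammar_memory = hashing w \<beta> P pinv c b for w \<beta> P pinv :: nat and c :: "'a \<Rightarrow> nat" and b :: nat +
  fixes F :: "'a list set" and S :: "'a list" and e0 sN :: nat
  assumes finF: "finite F" and SF: "S \<in> F" and F_le: "s \<in> F \<Longrightarrow> length s \<le> length S"
    and F_bt: "s \<in> F \<Longrightarrow> bt F (\<lambda>_. 0) s (22 * bl (length s))"
    and hash_inj: "i + d \<le> length S \<Longrightarrow> j + d \<le> length S \<Longrightarrow>
      hash c b (take d (drop i S)) mod P = hash c b (take d (drop j S)) mod P \<Longrightarrow> take d (drop i S) = take d (drop j S)"
    and e0: "1 \<le> e0" "bl (length S) \<le> (Suc e0)\<^sup>2" "(Suc e0)\<^sup>2 \<le> 9 * bl (length S)" "2 ^ e0 < (2::nat) ^ w"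
    and sN: "sN * sN \<le> length S" "length S < Suc sN * Suc sN"
    and words: "366 + 39 * card F + 41 * (89 * bl (length S)) \<le> 2 ^ w" "2 * length S + 2 < 2 ^ w"
begin

text \<open>With minimal heights, the two factors at the root of an optimal tree are strictly lower
  than the string, so one fixed factorization per string suffices.\<close>

definition ht :: "'a list \<Rightarrow> nat" where "ht s = (LEAST h. bt F (\<lambda>_. 0) s h)"

lemma bt_ht: "s \<in> F \<Longrightarrow> bt F (\<lambda>_. 0) s (ht s)"
  unfolding ht_def using F_bt by (rule LeastI)

lemma ht_le: "bt F (\<lambda>_. 0) s h \<Longrightarrow> ht s \<le> h"
  unfolding ht_def by (rule Least_le)

lemma ex_children:
  assumes "s \<in> F" "2 \<le> length s"
  shows "\<exists>u v. u \<in> F \<and> v \<in> F \<and> s = u @ v \<and> ht u < ht s \<and> ht v < ht s"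
  using bt_ht[OF assms(1)]
proof cases
  case (leaf x)
  then show ?thesis using assms by simp
next
  case (node u h v)
  then have "ht u < ht s" "ht v < ht s" using ht_le[of u h] ht_le[of v h] by auto
  then show ?thesis using node bt_in by blast
qed

definition left :: "'a list \<Rightarrow> 'a list" where
  "left s = (SOME u. \<exists>v. u \<in> F \<and> v \<in> F \<and> s = u @ v \<and> ht u < ht s \<and> ht v < ht s)"

definition right :: "'a list \<Rightarrow> 'a list" where "right s = drop (length (left s)) s"

lemma left_right:
  assumes "s \<in> F" "2 \<le> length s"
  shows "left s \<in> F" "right s \<in> F" "s = left s @ right s" "ht (left s) < ht s" "ht (right s) < ht s"
proof -
  obtain v where v: "left s \<in> F" "v \<in> F" "s = left s @ v" "ht (left s) < ht s" "ht v < ht s"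
    using someI_ex[OF ex_children[OF assms]] unfolding left_def[symmetric] by blast
  moreover have "right s = v" unfolding right_def by (subst v(3)) simp
  ultimately show "left s \<in> F" "right s \<in> F" "s = left s @ right s" "ht (left s) < ht s" "ht (right s) < ht s" by auto
qed

definition nodes :: "'a list list" where "nodes = (SOME xs. set xs = F \<and> distinct xs)"

lemma nodes: "set nodes = F" "length nodes = card F"
proof -
  have "set nodes = F \<and> distinct nodes" unfolding nodes_def by (rule someI_ex[OF finite_distinct_list[OF finF]])
  then show "set nodes = F" "length nodes = card F" using distinct_card[of nodes] by auto
qed

definition idx :: "'a list \<Rightarrow> nat" where "idx s = (SOME k. k < card F \<and> nodes ! k = s)"

lemma idx: "s \<in> F \<Longrightarrow> idx s < card F \<and> nodes ! idx s = s"
  unfolding idx_def by (rule someI_ex) (use nodes in \<open>metis in_set_conv_nth\<close>)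

text \<open>46 = 10 + 18 + 18 counts the header and the numbers \<open>P\<close> and 1; a node takes
  39 = 3 + 18 + 18 words.\<close>

definition addr :: "'a list \<Rightarrow> nat" where "addr s = 46 + idx s * 39"

definition cells :: "'a list \<Rightarrow> nat list" where
  "cells s = [length s, if length s = 1 then 0 else addr (left s), if length s = 1 then 0 else addr (right s)] @
     digs \<beta> cc (b ^ length s * \<beta> ^ cc mod P) @ digs \<beta> cc (hash c b s mod P)"

definition cap :: nat where "cap = 1 + 4 * ht S"
text \<open>The padding of 200 words guarantees the lower bound on the length in
  \<open>mem_ok\<close>, whatever the size of \<open>F\<close>.\<close>

definition stk :: nat where "stk = 46 + 39 * card F + 200"
definition iA :: nat where "iA = stk + cap + 1"
definition iB :: nat where "iB = iA + (cap + 2) * rs"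
definition aA :: nat where "aA = iB + (cap + 2) * rs"
definition aB :: nat where "aB = aA + cc + 1"
definition L :: nat where "L = aB + cc + 2"

definition M0 :: "nat list" where
  "M0 = map (\<lambda>x. if x < 10 then [addr S, \<beta>, pinv, 2 ^ e0, sN, stk, iA, iB, aA, aB] ! x
     else if x < 28 then digs \<beta> cc P ! (x - 10) else if x < 46 then digs \<beta> cc 1 ! (x - 28)
     else if x < 46 + 39 * card F then cells (nodes ! ((x - 46) div 39)) ! ((x - 46) mod 39) else 0) [0..<stk]"

lemma S_pos: "1 \<le> length S" "1 \<le> bl (length S)"
proof -
  show 1: "1 \<le> length S" using bt_nonempty[OF bt_ht[OF SF]] by (cases S) auto
  show "1 \<le> bl (length S)" using bl_pos[of "length S"] 1 by (cases S) auto
qed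

lemma cap_le: "cap \<le> 89 * bl (length S)"
  using ht_le[OF F_bt[OF SF]] S_pos by (simp add: cap_def)

lemma L_eq: "L = 366 + 39 * card F + 41 * cap"
  by (simp add: L_def aB_def aA_def iB_def iA_def stk_def rs_def cc_def)

lemma L_words: "L \<le> 2 ^ w"
  using words cap_le L_eq by linarith

lemma length_M0 [simp]: "length M0 = stk"
  by (simp add: M0_def)

lemma length_cells [simp]: "length (cells s) = 39"
  by (simp add: cells_def cc_def)

lemma M0_node:
  assumes "s \<in> F" "k < 39"
  shows "M0 ! (addr s + k) = cells s ! k"
proof -
  have i: "idx s < card F" "nodes ! idx s = s" using idx[OF assms(1)] by auto
  then have "Suc (idx s) * 39 \<le> card F * 39" by (intro mult_le_mono1) simp
  then have lt: "addr s + k < 46 + 39 * card F" using assms(2) by (simp add: addr_def)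
  have "(addr s + k - 46) div 39 = idx s" "(addr s + k - 46) mod 39 = k"
    using assms(2) by (simp_all add: addr_def)
  then show ?thesis using lt i by (simp add: M0_def stk_def addr_def)
qed

lemma addr_less: "s \<in> F \<Longrightarrow> addr s + 39 < stk"
proof -
  assume "s \<in> F"
  then have "Suc (idx s) * 39 \<le> card F * 39" using idx[of s] by (intro mult_le_mono1) simp
  then show ?thesis by (simp add: addr_def stk_def)
qed

lemma P_less: "P < \<beta> ^ cc"
proof -
  have "1 * P < 4 * P" using P1 by simp
  also have "4 * P \<le> \<beta> ^ (cc - 1)" by (rule Pb)
  also have "\<dots> \<le> \<beta> ^ cc" using beta by (intro power_increasing) auto
  finally show ?thesis by simp
qed

lemma num_digs: "seg m a cc = digs \<beta> cc x \<Longrightarrow> x \<le> P \<Longrightarrow> a + cc < length m \<Longrightarrow> num m a \<and> nval m a = x"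
  using P_less beta by (auto simp: num_def dval_digs digs_less)

lemma node_cells:
  assumes "s \<in> F"
  shows "M0 ! addr s = length s" "nodeh M0 (addr s) s"
    "2 \<le> length s \<Longrightarrow> M0 ! (addr s + 1) = addr (left s) \<and> M0 ! (addr s + 2) = addr (right s)"
proof -
  show "M0 ! addr s = length s" using M0_node[OF assms, of 0] by (simp add: cells_def)
  show "2 \<le> length s \<Longrightarrow> M0 ! (addr s + 1) = addr (left s) \<and> M0 ! (addr s + 2) = addr (right s)"
    using M0_node[OF assms, of 1] M0_node[OF assms, of 2] by (simp add: cells_def)
  have al: "addr s + 39 < length M0" using addr_less[OF assms] by simp
  have cc39: "3 + cc + cc = 39" by (simp add: cc_def)
  have "seg M0 (addr s + 3) cc = digs \<beta> cc (b ^ length s * \<beta> ^ cc mod P)"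
  proof (rule seg_eqI)
    fix k assume "k < cc"
    then show "M0 ! (addr s + 3 + k) = digs \<beta> cc (b ^ length s * \<beta> ^ cc mod P) ! k"
      using M0_node[OF assms, of "3 + k"] cc39 by (simp add: cells_def nth_append add.assoc)
  qed simp
  from num_digs[OF this] have 1: "num M0 (addr s + 3) \<and> nval M0 (addr s + 3) = b ^ length s * \<beta> ^ cc mod P"
    using al cc39 P1 by simp
  have "seg M0 (addr s + (3 + cc)) cc = digs \<beta> cc (hash c b s mod P)"
  proof (rule seg_eqI)
    fix k assume "k < cc"
    then show "M0 ! (addr s + (3 + cc) + k) = digs \<beta> cc (hash c b s mod P) ! k"
      using M0_node[OF assms, of "3 + cc + k"] cc39 by (simp add: cells_def nth_append add.assoc)
  qed simp
  from num_digs[OF this] have "num M0 (addr s + (3 + cc)) \<and> nval M0 (addr s + (3 + cc)) = hash c b s mod P"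
    using al cc39 P1 by simp
  then show "nodeh M0 (addr s) s" using 1 by (simp add: nodeh_def)
qed

lemma mem_ok_M0: "mem_ok M0"
proof -
  have p: "seg M0 padr cc = digs \<beta> cc P" by (rule seg_eqI) (auto simp: padr_def cc_def M0_def stk_def)
  have o: "seg M0 oadr cc = digs \<beta> cc 1" by (rule seg_eqI) (auto simp: oadr_def padr_def cc_def M0_def stk_def)
  have "stk < L" by (simp add: L_def aB_def aA_def iB_def iA_def)
  moreover have "200 < stk" "oadr + cc < stk" "padr + cc < stk" by (auto simp: oadr_def padr_def cc_def stk_def)
  ultimately show ?thesis unfolding mem_ok_def using num_digs[OF p] num_digs[OF o] L_words P1 by simp
qed

lemma is_lce_query: "lce_query w \<beta> P pinv c b F S addr ht M0 stk iA iB aA aB cap L (2 ^ e0) sN e0"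
proof unfold_locales
  fix s assume s: "s \<in> F"
  show "s \<noteq> []" using bt_nonempty[OF bt_ht[OF s]] .
  show "addr s + (3 + cc) + cc < length M0 \<and> M0 ! addr s = length s \<and> nodeh M0 (addr s) s"
    using node_cells[OF s] addr_less[OF s] by (simp add: cc_def)
  show "ht s \<le> 22 * bl (length s)" by (rule ht_le[OF F_bt[OF s]])
  assume l: "2 \<le> length s"
  show "\<exists>u v. u \<in> F \<and> v \<in> F \<and> s = u @ v \<and> M0 ! (addr s + 1) = addr u \<and> M0 ! (addr s + 2) = addr v \<and> ht u < ht s \<and> ht v < ht s"
    using left_right[OF s l] node_cells(3)[OF s l] by blast
next
  show "length M0 \<le> stk" "stk + cap + 1 \<le> iA" "iA + (cap + 2) * rs \<le> iB" "iB + (cap + 2) * rs \<le> aA"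
      "aA + cc + 1 \<le> aB" "aB + cc + 1 < L"
    by (simp_all add: L_def aB_def aA_def iB_def iA_def)
  show "M0 ! 0 = addr S" "M0 ! 1 = \<beta>" "M0 ! 2 = pinv" "M0 ! 3 = 2 ^ e0" "M0 ! 4 = sN" "M0 ! 5 = stk"
      "M0 ! 6 = iA" "M0 ! 7 = iB" "M0 ! 8 = aA" "M0 ! 9 = aB"
    by (simp_all add: M0_def stk_def)
  show "1 + 4 * ht S \<le> cap" by (simp add: cap_def)
qed (use SF mem_ok_M0 L_words words e0 sN cap_le hash_inj in blast)+

interpretation lce_query w \<beta> P pinv c b F S addr ht M0 stk iA iB aA aB cap L "2 ^ e0" sN e0
  by (rule is_lce_query)

lemma M0_w: "x < stk \<Longrightarrow> M0 ! x < 2 ^ w"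
proof -
  assume x: "x < stk"
  have "\<beta> * 2 \<le> \<beta> * \<beta>" using beta by (intro mult_le_mono2)
  then have bw: "\<beta> < 2 ^ w" using bw beta by linarith
  have dw: "digs \<beta> cc y ! k < 2 ^ w" if "k < cc" for y k
    using digs_less[of \<beta> "digs \<beta> cc y ! k" cc y] nth_mem[of k "digs \<beta> cc y"] that bw beta by simp
  have lay: "stk < L" "iA < L" "iB < L" "aA < L" "aB < L" by (simp_all add: L_def aB_def aA_def iB_def iA_def)
  have aw: "addr s < 2 ^ w" if "s \<in> F" for s using addr_less[OF that] lay(1) L_words by linarith
  have "sN * 1 \<le> sN * sN" by (cases sN) auto
  then have sw: "sN < 2 ^ w" using sN(1) words(2) by linarith
  have hw: "\<forall>y \<in> set [addr S, \<beta>, pinv, 2 ^ e0, sN, stk, iA, iB, aA, aB]. y < 2 ^ w"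
    using aw[OF SF] bw pinv_less e0(4) sw lay L_words by auto
  have rw: "cells s ! k < 2 ^ w" if s: "s \<in> F" and k: "k < 39" for s k
  proof -
    have "y < 2 ^ w" if "y \<in> set (digs \<beta> cc z)" for y z using digs_less[OF _ that] beta bw by simp
    moreover have "length s < 2 ^ w" using F_le[OF s] words(2) by linarith
    moreover have "addr (left s) < 2 ^ w" "addr (right s) < 2 ^ w" if "length s \<noteq> 1"
    proof -
      have "2 \<le> length s" using bt_nonempty[OF bt_ht[OF s]] that by (cases s) (auto simp: Suc_le_eq)
      then show "addr (left s) < 2 ^ w" "addr (right s) < 2 ^ w" using left_right[OF s] aw by auto
    qed
    ultimately have "\<forall>y \<in> set (cells s). y < 2 ^ w" unfolding cells_def set_append by (auto split: if_splits)
    then show ?thesis using nth_mem[of k "cells s"] k by simp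
  qed
  show ?thesis
  proof (cases "x < 10")
    case True
    then have "M0 ! x = [addr S, \<beta>, pinv, 2 ^ e0, sN, stk, iA, iB, aA, aB] ! x" using x by (simp add: M0_def)
    moreover have "[addr S, \<beta>, pinv, 2 ^ e0, sN, stk, iA, iB, aA, aB] ! x \<in> set [addr S, \<beta>, pinv, 2 ^ e0, sN, stk, iA, iB, aA, aB]"
      by (rule nth_mem) (use True in simp)
    ultimately show ?thesis using hw by metis
  next
    case False
    show ?thesis
    proof (cases "x < 46")
      case True
      then show ?thesis using False x dw[of "x - 10" P] dw[of "x - 28" 1] by (auto simp: M0_def cc_def)
    next
      case ge: False
      show ?thesis
      proof (cases "x < 46 + 39 * card F")
        case True
        then have "(x - 46) div 39 < card F" using ge by (intro less_mult_imp_div_less) simp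
        then have "nodes ! ((x - 46) div 39) \<in> F" using nodes nth_mem by metis
        then show ?thesis using rw[of "nodes ! ((x - 46) div 39)" "(x - 46) mod 39"] x ge True by (simp add: M0_def)
      next
        case False
        then show ?thesis using x ge by (simp add: M0_def)
      qed
    qed
  qed
qed

lemma ex_good: "good (M0 @ replicate (L - stk) 0)"
proof -
  have "stk \<le> L" by (simp add: L_def aB_def aA_def iB_def iA_def)
  then show ?thesis using M0_w by (auto simp: good_def nth_append)
qed

text \<open>\<open>bl n\<close> exceeds the logarithm by at most 1, and
  \<open>(1 + y)^2 \<le> 2 + 2 * y^2\<close>; the coefficients 9 and 8 of \<open>budget_le\<close>
  then give the constant 25 = 9 + 2 * 8. All \<open>good\<close> memories form the set of admissible
  contents, as a query leaves such a memory behind.\<close>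

lemma solves:
  assumes space: "real L \<le> sp" and C: "25 * real kk + 25 \<le> C"
  shows "solves_lce w query S sp (\<lambda>l. C * (1 + log 2 (real (length S)) + (log 2 (real (max 1 l)))\<^sup>2))"
  unfolding solves_lce_def
proof (intro exI[of _ "{m. good m}"] conjI ballI)
  show "{m. good m} \<noteq> {}" using ex_good by blast
next
  fix m assume m: "m \<in> {m. good m}"
  then show "real (length m) \<le> sp" using space by (simp add: good_def)
  fix x assume "x \<in> set m"
  then show "x < 2 ^ w" using m by (auto simp: good_def in_set_conv_nth)
next
  fix m i j assume m: "m \<in> {m. good m}" and i: "i \<in> {1..length S}" and j: "j \<in> {1..length S}"
  let ?l = "lce S i j"
  have ij: "i - 1 < length S" "j - 1 < length S" "Suc (i - 1) = i" "Suc (j - 1) = j" using i j by auto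
  have l: "ext (i - 1) (j - 1) = ?l" by (simp add: ext_def lce_def)
  have g: "good m" using m by simp
  have "tc w query (query_regs i j, m) (budget (i - 1) (j - 1) (2 ^ e0) + 25) (\<lambda>(r', m'). good m' \<and> r' 0 = ?l)"
    using tc_query[OF g ij(1,2)] unfolding ij(3,4) l .
  then obtain t s' where t: "exec w query (query_regs i j, m) t s'" "t \<le> budget (i - 1) (j - 1) (2 ^ e0) + 25"
    "case s' of (r', m') \<Rightarrow> good m' \<and> r' 0 = ?l" by (rule tcE)
  obtain r' m' where s': "s' = (r', m')" by (cases s')
  have "t \<le> 9 * (kk * bl (length S)) + 8 * (kk * (bl ?l)\<^sup>2) + 25"
    using t(2) budget_le[of "i - 1" "j - 1"] unfolding l by linarith
  then have "real t \<le> real (9 * (kk * bl (length S)) + 8 * (kk * (bl ?l)\<^sup>2) + 25)" by (rule of_nat_mono)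
  then have tr: "real t \<le> 9 * (real kk * real (bl (length S))) + 8 * (real kk * (real (bl ?l))\<^sup>2) + 25" by simp
  have lg: "real (bl n) \<le> 1 + log 2 (real (max 1 n))" for n
  proof (cases "n = 0")
    case False
    then have "bl n - 1 < bl n" using bl_pos[of n] by simp
    then have "2 ^ (bl n - 1) \<le> n" by (simp add: bl_less_iff)
    then have "real (2 ^ (bl n - 1)) \<le> real n" by (rule of_nat_mono)
    then have "real (bl n - 1) \<le> log 2 (real n)" by (intro le_log_of_power) simp_all
    then show ?thesis using False bl_pos[of n] by simp
  qed simp
  define y where "y = log 2 (real (max 1 ?l))"
  define z where "z = log 2 (real (length S))"
  have "1 \<le> real (length S)" using S_pos(1) by linarith
  then have z0: "0 \<le> z" unfolding z_def by (intro zero_le_log_cancel_iff[THEN iffD2]) linarith+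
  have "real (bl (length S)) \<le> 1 + z" using lg[of "length S"] S_pos(1) by (simp add: z_def max_def)
  then have 1: "real kk * real (bl (length S)) \<le> real kk * (1 + z)" by (intro mult_left_mono) auto
  have "(real (bl ?l))\<^sup>2 \<le> (1 + y)\<^sup>2" using lg[of ?l] by (intro power_mono) (auto simp: y_def)
  also have "\<dots> \<le> 2 + 2 * y\<^sup>2" using sum_squares_bound[of 1 y] by (simp add: power2_sum)
  finally have 2: "real kk * (real (bl ?l))\<^sup>2 \<le> real kk * (2 + 2 * y\<^sup>2)" by (intro mult_left_mono) auto
  have "real t \<le> 9 * (real kk * (1 + z)) + 8 * (real kk * (2 + 2 * y\<^sup>2)) + 25" using tr 1 2 by linarith
  also have "\<dots> \<le> (25 * real kk + 25) * (1 + z + y\<^sup>2)"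
  proof -
    have "0 \<le> real kk * z" "0 \<le> real kk * y\<^sup>2" "0 \<le> y\<^sup>2" using z0 by auto
    then show ?thesis using z0 by (simp add: algebra_simps)
  qed
  also have "\<dots> \<le> C * (1 + z + y\<^sup>2)" using C z0 by (intro mult_right_mono) auto
  finally have "real t \<le> C * (1 + z + y\<^sup>2)" .
  then show "\<exists>t r m'. exec w query (query_regs i j, m) t (r, m') \<and> r 0 = ?l \<and> m' \<in> {m. good m} \<and>
    real t \<le> C * (1 + log 2 (real (length S)) + (log 2 (real (max 1 ?l)))\<^sup>2)"
    using t s' unfolding y_def z_def by auto
qed

end

section \<open>Choice of the parameters\<close>

lemma ex_neg_inverse:
  fixes p q :: nat
  assumes "coprime p q" "0 < q"
  shows "\<exists>x < q. (p * x + 1) mod q = 0"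
proof -
  obtain u v where uv: "u * int p + v * int q = gcd (int p) (int q)" using bezout_int by blast
  have "gcd (int p) (int q) = 1" using assms(1) by (simp add: coprime_iff_gcd_eq_1)
  then have 1: "u * int p + v * int q = 1" using uv by simp
  define x where "x = nat ((- u) mod int q)"
  have x: "int x = (- u) mod int q" "x < q" using assms(2) by (auto simp: x_def nat_less_iff)
  have "int ((p * x + 1) mod q) = (int p * ((- u) mod int q) + 1) mod int q" by (simp add: zmod_int x(1) add.commute)
  also have "\<dots> = (int p * (- u) + 1) mod int q"
    by (rule mod_add_cong[OF mod_mult_right_eq refl])
  also have "int p * (- u) + 1 = v * int q" using 1 by (simp add: algebra_simps)
  also have "v * int q mod int q = int 0" by simp
  finally have "(p * x + 1) mod q = 0" by (simp only: of_nat_eq_iff)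
  with x(2) show ?thesis by (intro exI[of _ x] conjI)
qed

text \<open>The least \<open>e\<close> with \<open>x \<le> (Suc e)^2\<close> satisfies
  \<open>e^2 < x\<close> unless it is 1, and \<open>Suc e \<le> 2 * e\<close>, so the square
  overshoots by a constant factor only. The last clause keeps the first guess at most twice the
  length of the string.\<close>

lemma ex_first_exponent:
  assumes "1 \<le> x"
  obtains e :: nat where "1 \<le> e" "x \<le> (Suc e)\<^sup>2" "(Suc e)\<^sup>2 \<le> 9 * x" "e = 1 \<or> e < x"
proof -
  let ?P = "\<lambda>e. 1 \<le> e \<and> x \<le> (Suc e)\<^sup>2"
  define e where "e = (LEAST e. ?P e)"
  have ex: "?P x" using assms by (simp add: power2_eq_square)
  have e: "?P e" unfolding e_def by (rule LeastI[of ?P, OF ex])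
  show thesis
  proof (cases "e = 1")
    case True
    then show thesis using that[of e] e assms by (simp add: power2_eq_square)
  next
    case False
    then obtain f where f: "e = Suc f" "1 \<le> f" using e by (cases e) auto
    have "\<not> ?P f" using not_less_Least[of f ?P] f unfolding e_def[symmetric] by simp
    then have lt: "e\<^sup>2 < x" using f by simp
    have "Suc e \<le> 2 * e" using e by simp
    then have "(Suc e)\<^sup>2 \<le> (2 * e)\<^sup>2" by (rule power_mono) simp
    then have "(Suc e)\<^sup>2 \<le> 9 * x" using lt by (simp add: power_mult_distrib)
    moreover have "e \<le> e\<^sup>2" using e by (simp add: power2_eq_square)
    ultimately show thesis using that[of e] e lt by simp
  qed
qed

lemma ex_floor_sqrt: "\<exists>k. k * k \<le> n \<and> n < Suc k * Suc k" for n :: nat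
proof -
  define k where "k = (LEAST k. n < Suc k * Suc k)"
  have k: "n < Suc k * Suc k" unfolding k_def by (rule LeastI[of _ n]) simp
  moreover have "k * k \<le> n"
  proof (cases k)
    case (Suc f)
    then show ?thesis using not_less_Least[of f "\<lambda>k. n < Suc k * Suc k"] unfolding k_def[symmetric] by simp
  qed simp
  ultimately show ?thesis by blast
qed

text \<open>The memory has at most \<open>9100 * card V\<close> words, from 366 + 39 * 130 + 41 * 89
  = 9085, hence at most \<open>18200 * length S\<close>, within the assumed
  \<open>20000 * length S\<close>. Neither \<open>query\<close> nor \<open>lce_query.kk\<close>
  refers to parameters of the locale, so program and constant are uniform in the SLP and the word
  length.\<close>

theorem slp_lce:
  fixes G :: "('v, 'a) cfg" and S :: "'a list"
  assumes slp: "slp_represents G S" and wl: "20000 * length S \<le> 2 ^ w" and C: "25 * real lce_query.kk + 9125 \<le> C"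
  shows "solves_lce w query S (C * real (slp_size G))
    (\<lambda>l. C * (1 + log 2 (real (length S)) + (log 2 (real (max 1 l)))\<^sup>2))"
proof -
  obtain V where V: "closed_family V" "finite V" "S \<in> V" "card V \<le> slp_size G" "card V \<le> 2 * length S"
    using slp_family[OF slp] .
  obtain F0 where F0: "finite F0" "V \<subseteq> F0" "card F0 \<le> 130 * card V" "\<And>s. s \<in> F0 \<Longrightarrow> bt F0 (\<lambda>_. 0) s (22 * bl (length s))"
    using balanced_family[OF V(2,1)] V(3) by blast
  \<comment> \<open>Without longer strings all stored lengths fit into words; the trees survive
    because their nodes are no longer than the root.\<close>
  define F where "F = {s \<in> F0. length s \<le> length S}"
  have F: "finite F" "S \<in> F" "card F \<le> 130 * card V"
    using F0 V(3) card_mono[OF F0(1), of F] by (auto simp: F_def)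
  define N where "N = length S"
  have N0: "0 < N" using V(1,3) by (auto simp: closed_family_def N_def)
  have V1: "1 \<le> card V" using V(2,3) by (simp add: Suc_le_eq card_gt_0_iff) blast
  have blV: "bl N \<le> card V" unfolding N_def by (rule closed_family_bl[OF V(1-3)])
  have bN: "0 < bl N" using bl_pos[OF N0] .
  have pN: "2 ^ (bl N - 1) \<le> N" using bl_less_iff[of "bl N - 1" N] bN by simp
  \<comment> \<open>With this \<open>t\<close>, \<open>N \<le> \<beta>^2 \<le> 32 * N\<close>:
    products of digits fit into a word, and numbers polynomial in \<open>N\<close> have a constant
    number of digits.\<close>
  define t where "t = bl N div 2 + 2"
  define \<beta> :: nat where "\<beta> = 2 ^ t"
  have "2 * t \<le> (bl N - 1) + 5" using bN by (simp add: t_def)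
  then have "(2::nat) ^ (2 * t) \<le> 2 ^ ((bl N - 1) + 5)" by (intro power_increasing) auto
  also have "\<dots> \<le> 32 * N" using pN by (simp add: power_add)
  finally have b2: "\<beta> * \<beta> \<le> 32 * N" by (simp add: \<beta>_def mult_2 power_add)
  have "(2::nat) ^ bl N \<le> 2 ^ (2 * t)" by (rule power_increasing) (auto simp: t_def)
  then have "N \<le> 2 ^ (2 * t)" using bl_bound[of N] by linarith
  then have Nb: "N \<le> \<beta>\<^sup>2" by (simp add: \<beta>_def mult_2 power_add power2_eq_square)
  have b4: "4 \<le> \<beta>" using power_increasing[of 2 t "2::nat"] by (simp add: \<beta>_def t_def)
  \<comment> \<open>The exponent 8 makes \<open>P\<close> exceed \<open>\<beta>^8\<close>, hence
    \<open>N^4\<close>, as \<open>good_hash_base\<close> demands. The upper bound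
    \<open>\<beta>^16\<close> together with \<open>4 \<le> \<beta>\<close> gives
    \<open>4 * P \<le> \<beta>^17\<close>, which fits \<open>cc = 18\<close>.\<close>
  obtain P :: nat where P: "prime P" "2 ^ (8 * t) < P" "P \<le> 2 ^ (2 * (8 * t))"
    using exists_prime_between[of "8 * t"] by (auto simp: t_def)
  have P8: "\<beta> ^ 8 < P" "P \<le> \<beta> ^ 16" using P(2,3) by (simp_all add: \<beta>_def mult.commute flip: power_mult)
  have "N ^ 4 \<le> (\<beta>\<^sup>2) ^ 4" using Nb by (rule power_mono) simp
  then have N4: "N ^ 4 < P" using P8(1) by (simp flip: power_mult)
  have NP: "N < P"
  proof -
    have "N ^ 1 \<le> N ^ 4" using N0 by (intro power_increasing) auto
    then show ?thesis using N4 by simp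
  qed
  have "odd P"
  proof
    assume "even P"
    then have "P = 2" using P(1) primes_dvd_imp_eq[of 2 P] by simp
    moreover have "2 ^ 1 \<le> (2::nat) ^ (8 * t)" by (rule power_increasing) (auto simp: t_def)
    ultimately show False using P(2) by simp
  qed
  then have cop: "coprime \<beta> P" by (simp add: \<beta>_def)
  obtain pinv where pinv: "pinv < \<beta>" "(P * pinv + 1) mod \<beta> = 0"
    using ex_neg_inverse[of P \<beta>] cop b4 by (auto simp: coprime_commute)
  obtain c :: "'a \<Rightarrow> nat" where "bij_betw c (set S) {0..<card (set S)}" using ex_bij_betw_finite_nat[of "set S"] by auto
  then have c: "inj_on c (set S)" "c ` set S = {0..<card (set S)}" by (auto simp: bij_betw_def)
  have cP: "c x < P" if "x \<in> set S" for x
  proof -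
    have "c x < card (set S)" using c(2) that by auto
    then show ?thesis using card_length[of S] NP by (simp add: N_def)
  qed
  obtain b where b: "0 < b" "b < P" "\<And>i j d. i + d \<le> N \<Longrightarrow> j + d \<le> N \<Longrightarrow>
    hash c b (take d (drop i S)) mod P = hash c b (take d (drop j S)) mod P \<Longrightarrow> take d (drop i S) = take d (drop j S)"
    using good_hash_base[OF P(1) N_def[symmetric] N0 N4 c(1) cP] by blast
  \<comment> \<open>As \<open>0 < b < P\<close>, the base is a unit modulo \<open>P\<close>, which
    keeps the stored powers nonzero.\<close>
  have "\<not> P dvd b" using b(1,2) by (auto dest: dvd_imp_le)
  then have "coprime P b" by (rule prime_imp_coprime[OF P(1)])
  then have copb: "coprime b P" by (subst coprime_commute)
  obtain e0 where e0: "1 \<le> e0" "bl N \<le> (Suc e0)\<^sup>2" "(Suc e0)\<^sup>2 \<le> 9 * bl N" "e0 = 1 \<or> e0 < bl N"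
    using ex_first_exponent[of "bl N"] bN by auto
  have "2 ^ e0 \<le> 2 * N" using e0(4) N0 by (auto simp: bl_less_iff)
  then have e0w: "2 ^ e0 < (2::nat) ^ w" using wl N0 unfolding N_def[symmetric] by linarith
  obtain sN where sN: "sN * sN \<le> N" "N < Suc sN * Suc sN" using ex_floor_sqrt[of N] by blast
  have sz: "366 + 39 * card F + 41 * (89 * bl N) \<le> 9100 * card V" using F(3) blV V1 by linarith
  interpret M: grammar_memory w \<beta> P pinv c b F S e0 sN
  proof
    show "2 \<le> \<beta>" "1 < P" "(P * pinv + 1) mod \<beta> = 0" "pinv < \<beta>" "coprime b P" "coprime \<beta> P"
      using b4 P(1) pinv copb cop prime_gt_1_nat by auto
    show "\<beta> * \<beta> \<le> 2 ^ w" using b2 wl N0 unfolding N_def[symmetric] by linarith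
    have "4 * P \<le> \<beta> * \<beta> ^ 16" by (rule mult_le_mono[OF b4 P8(2)])
    also have "\<dots> = \<beta> ^ (cc - 1)" by (simp add: cc_def flip: power_Suc)
    finally show "4 * P \<le> \<beta> ^ (cc - 1)" .
    show "s \<in> F \<Longrightarrow> bt F (\<lambda>_. 0) s (22 * bl (length s))" for s
      unfolding F_def using bt_restrict_length[OF F0(4)] by simp
    show "366 + 39 * card F + 41 * (89 * bl (length S)) \<le> 2 ^ w"
      using sz V(5) wl unfolding N_def[symmetric] by linarith
    show "2 * length S + 2 < 2 ^ w" using wl N0 unfolding N_def[symmetric] by linarith
    show "finite F" "S \<in> F" "\<And>s. s \<in> F \<Longrightarrow> length s \<le> length S" using F by (auto simp: F_def)
    show "\<And>i d j. i + d \<le> length S \<Longrightarrow> j + d \<le> length S \<Longrightarrow>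
      hash c b (take d (drop i S)) mod P = hash c b (take d (drop j S)) mod P \<Longrightarrow> take d (drop i S) = take d (drop j S)"
      using b(3) unfolding N_def .
  qed (use e0 e0w sN in \<open>auto simp: N_def\<close>)
  have "M.L \<le> 9100 * slp_size G"
    using M.L_eq M.cap_le sz V(4) unfolding N_def by linarith
  then have "real M.L \<le> real (9100 * slp_size G)" by (rule of_nat_mono)
  also have "\<dots> = 9100 * real (slp_size G)" by simp
  also have "\<dots> \<le> C * real (slp_size G)" using C by (intro mult_right_mono) auto
  finally have "real M.L \<le> C * real (slp_size G)" .
  then show ?thesis by (rule M.solves) (use C in simp)
qed

text \<open>The hypothesis on \<open>w\<close> is the usual one of the word RAM, log N + O(1) bits
  per word. The summand 1 and \<open>max 1 l\<close> cover strings of length 1 and empty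
  extensions.\<close>

theorem theorem2:
  shows "\<exists>(p :: prog) (k :: nat) (C :: real). \<forall>(G :: (nat, nat) cfg) (S :: nat list) (w :: nat).
    slp_represents G S \<longrightarrow> k * length S \<le> 2 ^ w \<longrightarrow>
    solves_lce w p S
      (C * real (slp_size G))
      (\<lambda>l. C * (1 + log 2 (real (length S)) + (log 2 (real (max 1 l)))\<^sup>2))"
  using slp_lce by blast

end
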